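(* Let $(M,\omega_g)$ be a compact Kähler manifold of complex dimension $n$, write $\omega=\omega_g$, and let $f\in C^\infty(M,\mathbb{R})$ be a smooth function satisfying $\Delta_{\bar\partial}f=\lambda f$ for some $\lambda\in\mathbb{R}$. Let $E=T^{*1,0}M$, let $\phi=\partial f$, let $V$ be the $(1,0)$-vector field dual to $\bar\phi$ with respect to the Kähler metric, and let $\omega_1=\{\partial_E\phi,\phi\}$. Then $$2\lambda\int_M|\phi|^4\,\frac{\omega^n}{n!}=\int_M\left(R(V,\bar V,V,\bar V)+|\phi|^2|\partial\bar\partial f|^2\right)\frac{\omega^n}{n!}+\left\|\omega_1-\lambda f\phi\right\|^2+\|\omega_1\|^2.$$ In particular, $$2\lambda\int_M|V|^4\,\frac{\omega^n}{n!}\geq\int_M R(V,\bar V,V,\bar V)\,\frac{\omega^n}{n!}.$$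
   Context: In local holomorphic coordinates $\omega_g=\sqrt{-1}\,g_{i\bar j}\,dz^i\wedge d\bar z^j$, and $(g^{i\bar j})$ is the inverse matrix, with $g^{i\bar k}g_{j\bar k}=\delta^i_j$. The curvature is $R_{i\bar jk\bar\ell}=-\frac{\partial^2 g_{k\bar\ell}}{\partial z^i\partial\bar z^j}+g^{p\bar q}\frac{\partial g_{k\bar q}}{\partial z^i}\frac{\partial g_{p\bar\ell}}{\partial\bar z^j}$ and $R(V,\bar V,V,\bar V)=R_{i\bar jk\bar\ell}V^i\bar V^jV^k\bar V^\ell$. On functions, $\Delta_{\bar\partial}f=\bar\partial^*\bar\partial f=-g^{i\bar j}\frac{\partial^2f}{\partial z^i\partial\bar z^j}$. $E=T^{*1,0}M$ is the holomorphic cotangent bundle with the Hermitian metric induced by $g$, and $\partial_E,\bar\partial_E$ are the $(1,0)$ and $(0,1)$ parts of its Chern connection. For $E$-valued forms, $\{\alpha\otimes s,\beta\otimes t\}=\langle s,t\rangle_E\,\alpha\wedge\bar\beta$. The form $\phi=\partial f=\phi_i\,dz^i$ (with $\phi_i=\partial f/\partial z^i$) is regarded as a section ($0$-form) of $E$. The vector field $V$ is $V=g^{i\bar k}\bar\phi_k\frac{\partial}{\partial z^i}$, i.e. $\phi_i=g_{i\bar j}\bar V^j$, so that $|V|=|\phi|$. Explicitly, with $t_{ij}=\frac{\partial^2f}{\partial z^i\partial z^j}-\Gamma_{ij}^k\frac{\partial f}{\partial z^k}$ and $\Gamma_{ij}^k=g^{k\bar\ell}\frac{\partial g_{j\bar\ell}}{\partial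 z^i}$, one has $\omega_1=g^{i\bar k}t_{ij}\bar\phi_k\,dz^j$. Norms: $|\phi|^2=g^{i\bar j}\phi_i\bar\phi_j$; $|V|^2=g_{i\bar j}V^i\bar V^j$; for $\partial\bar\partial f=f_{i\bar j}\,dz^i\wedge d\bar z^j$, $|\partial\bar\partial f|^2=g^{i\bar k}g^{\ell\bar j}f_{i\bar j}\overline{f_{k\bar\ell}}$; and for a $1$-form $\eta$, $\|\eta\|^2=\int_M|\eta|^2\,\frac{\omega^n}{n!}$. *)

theory Defs
  imports "HOL-Analysis.Analysis"
begin

section \<open>Calculus on open subsets of complex coordinate space\<close>

text \<open>\<open>C\<^sup>k\<close> in the real sense, meant for open \<open>S\<close>.\<close>

primrec Ck_on :: "nat \<Rightarrow> ('v::real_normed_vector \<Rightarrow> 'w::real_normed_vector) \<Rightarrow> 'v set \<Rightarrow> bool" where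
  "Ck_on 0 F S = continuous_on S F"
| "Ck_on (Suc k) F S = ((\<forall>x\<in>S. F differentiable at x) \<and>
     (\<forall>v. Ck_on k (\<lambda>x. frechet_derivative F (at x) v) S))"

definition smooth_on :: "('v::real_normed_vector \<Rightarrow> 'w::real_normed_vector) \<Rightarrow> 'v set \<Rightarrow> bool" where
  "smooth_on F S \<longleftrightarrow> (\<forall>k. Ck_on k F S)"

definition holomorphic_map_on :: "(complex^'n \<Rightarrow> complex^'m) \<Rightarrow> (complex^'n) set \<Rightarrow> bool" where
  "holomorphic_map_on F S \<longleftrightarrow>
     (\<forall>x\<in>S. \<exists>F'. (F has_derivative F') (at x) \<and> (\<forall>a v. F' (a *s v) = a *s F' v))"

text \<open>Wirtinger derivatives \<open>\<partial>/\<partial>z\<^sup>i = (\<partial>/\<partial>x\<^sup>i - \<i> \<partial>/\<partial>y\<^sup>i)/2\<close> and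
  \<open>\<partial>/\<partial>\<bar>z\<^sup>i = (\<partial>/\<partial>x\<^sup>i + \<i> \<partial>/\<partial>y\<^sup>i)/2\<close>.\<close>

definition wirt :: "'n \<Rightarrow> (complex^'n \<Rightarrow> complex) \<Rightarrow> complex^'n \<Rightarrow> complex" where
  "wirt i F x = (frechet_derivative F (at x) (axis i 1)
                 - \<i> * frechet_derivative F (at x) (axis i \<i>)) / 2"

definition wirt_bar :: "'n \<Rightarrow> (complex^'n \<Rightarrow> complex) \<Rightarrow> complex^'n \<Rightarrow> complex" where
  "wirt_bar i F x = (frechet_derivative F (at x) (axis i 1)
                     + \<i> * frechet_derivative F (at x) (axis i \<i>)) / 2"

text \<open>Exterior derivative of a 2-form, evaluated on three constant vector fields.\<close>

definition ext_deriv2 ::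
  "('v::real_normed_vector \<Rightarrow> 'v \<Rightarrow> 'v \<Rightarrow> 'w::real_normed_vector) \<Rightarrow> 'v \<Rightarrow> 'v \<Rightarrow> 'v \<Rightarrow> 'v \<Rightarrow> 'w" where
  "ext_deriv2 \<alpha> x u v w =
     frechet_derivative (\<lambda>y. \<alpha> y v w) (at x) u
   - frechet_derivative (\<lambda>y. \<alpha> y u w) (at x) v
   + frechet_derivative (\<lambda>y. \<alpha> y u v) (at x) w"


section \<open>Complex manifolds\<close>

text \<open>A chart is a pair (domain, coordinate map). An atlas is any set of holomorphically compatible
  charts covering the manifold; it need not be maximal, and the manifold need not be connected.\<close>

type_synonym ('a, 'n) chart = "'a set \<times> ('a \<Rightarrow> complex^'n)"

definition chart_inv :: "('a, 'n) chart \<Rightarrow> complex^'n \<Rightarrow> 'a" where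
  "chart_inv c = inv_into (fst c) (snd c)"

definition compact_complex_manifold :: "'a topology \<Rightarrow> ('a, 'n::finite) chart set \<Rightarrow> bool" where
  "compact_complex_manifold M A \<longleftrightarrow>
     compact_space M \<and> Hausdorff_space M \<and>
     (\<forall>c\<in>A. openin M (fst c) \<and> open (snd c ` fst c) \<and>
        homeomorphic_map (subtopology M (fst c)) (top_of_set (snd c ` fst c)) (snd c)) \<and>
     (\<Union>c\<in>A. fst c) = topspace M \<and>
     (\<forall>c\<in>A. \<forall>d\<in>A. holomorphic_map_on (snd d \<circ> chart_inv c) (snd c ` (fst c \<inter> fst d)))"

definition smooth_function ::
  "('a, 'n::finite) chart set \<Rightarrow> ('a \<Rightarrow> 'w::real_normed_vector) \<Rightarrow> bool" where
  "smooth_function A h \<longleftrightarrow> (\<forall>c\<in>A. smooth_on (h \<circ> chart_inv c) (snd c ` fst c))"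

text \<open>\<open>pd c i h\<close> and \<open>pd_bar c i h\<close> are \<open>\<partial>h/\<partial>z\<^sup>i\<close> and \<open>\<partial>h/\<partial>\<bar>z\<^sup>i\<close> in the chart \<open>c\<close>, as functions on (the
  domain of \<open>c\<close> in) the manifold.\<close>

definition pd :: "('a, 'n::finite) chart \<Rightarrow> 'n \<Rightarrow> ('a \<Rightarrow> complex) \<Rightarrow> 'a \<Rightarrow> complex" where
  "pd c i h p = wirt i (h \<circ> chart_inv c) (snd c p)"

definition pd_bar :: "('a, 'n::finite) chart \<Rightarrow> 'n \<Rightarrow> ('a \<Rightarrow> complex) \<Rightarrow> 'a \<Rightarrow> complex" where
  "pd_bar c i h p = wirt_bar i (h \<circ> chart_inv c) (snd c p)"

text \<open>A tensor field is given by its components in each chart. A tensor contraction with no free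
  index has the same value in all charts around \<open>p\<close>; \<open>scalar\<close> is the resulting function on the
  manifold.\<close>

definition scalar :: "('a, 'n) chart set \<Rightarrow> (('a, 'n) chart \<Rightarrow> 'a \<Rightarrow> 'b) \<Rightarrow> 'a \<Rightarrow> 'b" where
  "scalar A h p = (THE v. \<forall>c\<in>A. p \<in> fst c \<longrightarrow> h c p = v)"


section \<open>Kaehler metrics\<close>

text \<open>\<open>g c p $ i $ j\<close> is \<open>g\<^bsub>i\<bar>j\<^esub>\<close> at \<open>p\<close> in the chart \<open>c\<close>.\<close>

type_synonym ('a, 'n) metric = "('a, 'n) chart \<Rightarrow> 'a \<Rightarrow> complex^'n^'n"

text \<open>The 2-form \<open>\<omega> = \<i> g\<^bsub>i\<bar>j\<^esub> dz\<^sup>i \<and> d\<bar>z\<^sup>j\<close> on a pair of tangent vectors, for the coefficient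
  matrix \<open>G\<close>.\<close>

definition kaehler_form :: "complex^'n^'n \<Rightarrow> complex^'n::finite \<Rightarrow> complex^'n \<Rightarrow> complex" where
  "kaehler_form G u v = \<i> * (\<Sum>i\<in>UNIV. \<Sum>j\<in>UNIV. G $ i $ j * (u $ i * cnj (v $ j) - v $ i * cnj (u $ j)))"

definition hermitian_metric :: "('a, 'n::finite) chart set \<Rightarrow> ('a, 'n) metric \<Rightarrow> bool" where
  "hermitian_metric A g \<longleftrightarrow>
     (\<forall>c\<in>A. smooth_on (g c \<circ> chart_inv c) (snd c ` fst c) \<and>
        (\<forall>p\<in>fst c. (\<forall>i j. g c p $ i $ j = cnj (g c p $ j $ i)) \<and>
           (\<forall>v. v \<noteq> 0 \<longrightarrow> Re (\<Sum>i\<in>UNIV. \<Sum>j\<in>UNIV. g c p $ i $ j * v $ i * cnj (v $ j)) > 0))) \<and>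
     (\<forall>c\<in>A. \<forall>d\<in>A. \<forall>p\<in>fst c \<inter> fst d. \<forall>i j. g c p $ i $ j =
        (\<Sum>k\<in>UNIV. \<Sum>l\<in>UNIV. pd c i (\<lambda>q. snd d q $ k) p * cnj (pd c j (\<lambda>q. snd d q $ l) p)
           * g d p $ k $ l))"

definition compact_kaehler_manifold ::
  "'a topology \<Rightarrow> ('a, 'n::finite) chart set \<Rightarrow> ('a, 'n) metric \<Rightarrow> bool" where
  "compact_kaehler_manifold M A g \<longleftrightarrow>
     compact_complex_manifold M A \<and> hermitian_metric A g \<and>
     (\<forall>c\<in>A. \<forall>x\<in>snd c ` fst c. \<forall>u v w.
        ext_deriv2 (\<lambda>y. kaehler_form (g c (chart_inv c y))) x u v w = 0)"

text \<open>\<open>ginv g c i j p\<close> is \<open>g\<^sup>i\<^sup>\<bar>\<^sup>j\<close>, normalised by \<open>g\<^sup>i\<^sup>\<bar>\<^sup>k g\<^bsub>j\<bar>k\<^esub> = \<delta>\<^sup>i\<^sub>j\<close>, so it is the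
  \<open>(j, i)\<close> entry of the inverse of the matrix \<open>(g\<^bsub>i\<bar>j\<^esub>)\<close>.\<close>

definition ginv :: "('a, 'n::finite) metric \<Rightarrow> ('a, 'n) chart \<Rightarrow> 'n \<Rightarrow> 'n \<Rightarrow> 'a \<Rightarrow> complex" where
  "ginv g c i j p = matrix_inv (g c p) $ j $ i"


section \<open>Integration against \<open>\<omega>\<^sup>n / n!\<close>\<close>

text \<open>The real coordinate frame \<open>\<partial>/\<partial>x\<^sup>i\<close> (\<open>False\<close>), \<open>\<partial>/\<partial>y\<^sup>i\<close> (\<open>True\<close>). The order of the pairs
  \<open>(x\<^sup>i, y\<^sup>i)\<close> is irrelevant for the complex orientation, so the index set \<open>'n\<close> needs no enumeration.\<close>

definition real_frame :: "'n \<times> bool \<Rightarrow> complex^'n" where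
  "real_frame k = axis (fst k) (if snd k then \<i> else 1)"

text \<open>The top form \<open>\<omega>\<^sup>n / n!\<close> on the positively oriented real coordinate frame, by
  \<open>(\<alpha>\<^sub>1 \<and> \<dots> \<and> \<alpha>\<^sub>n) (v\<^sub>1, \<dots>, v\<^sub>2\<^sub>n) = 2\<^sup>-\<^sup>n \<Sum>\<^sub>\<sigma> sgn \<sigma> \<Prod>\<^sub>i \<alpha>\<^sub>i (v\<^bsub>\<sigma>(2i-1)\<^esub>, v\<^bsub>\<sigma>(2i)\<^esub>)\<close> for 2-forms. The value is real
  for Hermitian \<open>G\<close> and equals \<open>2\<^sup>n det G\<close>.\<close>

definition volume_density :: "complex^'n::finite^'n \<Rightarrow> real" where
  "volume_density (G :: complex^'n^'n) =
     Re (\<Sum>\<sigma> | \<sigma> permutes (UNIV :: ('n \<times> bool) set). of_int (sign \<sigma>) *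
           (\<Prod>i\<in>UNIV. kaehler_form G (real_frame (\<sigma> (i, False))) (real_frame (\<sigma> (i, True)))))
     / (2 ^ CARD('n) * fact CARD('n))"

definition active_charts ::
  "'a topology \<Rightarrow> ('a, 'n) chart set \<Rightarrow> (('a, 'n) chart \<Rightarrow> 'a \<Rightarrow> real) \<Rightarrow> ('a, 'n) chart set" where
  "active_charts M A \<rho> = {c\<in>A. \<exists>p\<in>topspace M. \<rho> c p \<noteq> 0}"

definition partition_of_unity ::
  "'a topology \<Rightarrow> ('a, 'n::finite) chart set \<Rightarrow> (('a, 'n) chart \<Rightarrow> 'a \<Rightarrow> real) \<Rightarrow> bool" where
  "partition_of_unity M A \<rho> \<longleftrightarrow>
     finite (active_charts M A \<rho>) \<and>
     (\<forall>c\<in>A. smooth_function A (\<rho> c) \<and> (\<forall>p\<in>topspace M. 0 \<le> \<rho> c p) \<and>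
        M closure_of {p\<in>topspace M. \<rho> c p \<noteq> 0} \<subseteq> fst c) \<and>
     (\<forall>p\<in>topspace M. (\<Sum>c\<in>active_charts M A \<rho>. \<rho> c p) = 1)"

text \<open>\<open>\<integral>\<^sub>M h \<omega>\<^sup>n / n!\<close>, computed with some partition of unity subordinate to the atlas; as usual the
  value does not depend on which one is chosen.\<close>

definition integral_M ::
  "'a topology \<Rightarrow> ('a, 'n::finite) chart set \<Rightarrow> ('a, 'n) metric \<Rightarrow>
   ('a \<Rightarrow> 'w::{banach, second_countable_topology}) \<Rightarrow> 'w" where
  "integral_M M A g h =
     (let \<rho> = (SOME \<rho>. partition_of_unity M A \<rho>) in
      \<Sum>c\<in>active_charts M A \<rho>.
        set_lebesgue_integral lborel (snd c ` fst c)
          (\<lambda>x. let p = chart_inv c x in (\<rho> c p * volume_density (g c p)) *\<^sub>R h p))"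


section \<open>Tensor calculus of the metric\<close>

text \<open>Forms of type (1,0), sections of \<open>E = T\<^sup>*\<^sup>1\<^sup>,\<^sup>0M\<close> and (1,0)-vector fields are all given by their
  component vectors in each chart.\<close>

type_synonym ('a, 'n) field10 = "('a, 'n) chart \<Rightarrow> 'a \<Rightarrow> complex^'n"

definition del :: "('a \<Rightarrow> complex) \<Rightarrow> ('a, 'n::finite) field10" where
  "del f c p = (\<chi> i. pd c i f p)"

text \<open>\<open>\<Delta>\<^bsub>\<bar>\<partial>\<^esub> f = \<bar>\<partial>\<^sup>* \<bar>\<partial> f\<close> on functions.\<close>

definition dbar_laplacian ::
  "('a, 'n::finite) chart set \<Rightarrow> ('a, 'n) metric \<Rightarrow> ('a \<Rightarrow> complex) \<Rightarrow> 'a \<Rightarrow> complex" where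
  "dbar_laplacian A g f = scalar A (\<lambda>c p.
     - (\<Sum>i\<in>UNIV. \<Sum>j\<in>UNIV. ginv g c i j p * pd c i (pd_bar c j f) p))"

definition cov_inner ::
  "('a, 'n::finite) metric \<Rightarrow> ('a, 'n) chart \<Rightarrow> 'a \<Rightarrow> complex^'n \<Rightarrow> complex^'n \<Rightarrow> complex" where
  "cov_inner g c p s t = (\<Sum>i\<in>UNIV. \<Sum>j\<in>UNIV. ginv g c i j p * s $ i * cnj (t $ j))"

text \<open>The pointwise norms. \<open>Re\<close> only turns the type into \<^typ>\<open>real\<close>: for a Hermitian metric the sums are
  real.\<close>

definition form_norm2 ::
  "('a, 'n::finite) chart set \<Rightarrow> ('a, 'n) metric \<Rightarrow> ('a, 'n) field10 \<Rightarrow> 'a \<Rightarrow> real" where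
  "form_norm2 A g \<eta> = scalar A (\<lambda>c p. Re (cov_inner g c p (\<eta> c p) (\<eta> c p)))"

definition vec_norm2 ::
  "('a, 'n::finite) chart set \<Rightarrow> ('a, 'n) metric \<Rightarrow> ('a, 'n) field10 \<Rightarrow> 'a \<Rightarrow> real" where
  "vec_norm2 A g V = scalar A (\<lambda>c p.
     Re (\<Sum>i\<in>UNIV. \<Sum>j\<in>UNIV. g c p $ i $ j * V c p $ i * cnj (V c p $ j)))"

definition del_delbar_norm2 ::
  "('a, 'n::finite) chart set \<Rightarrow> ('a, 'n) metric \<Rightarrow> ('a \<Rightarrow> complex) \<Rightarrow> 'a \<Rightarrow> real" where
  "del_delbar_norm2 A g f = scalar A (\<lambda>c p.
     Re (\<Sum>i\<in>UNIV. \<Sum>j\<in>UNIV. \<Sum>k\<in>UNIV. \<Sum>l\<in>UNIV. ginv g c i k p * ginv g c l j p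
           * pd c i (pd_bar c j f) p * cnj (pd c k (pd_bar c l f) p)))"

definition L2_norm2 ::
  "'a topology \<Rightarrow> ('a, 'n::finite) chart set \<Rightarrow> ('a, 'n) metric \<Rightarrow> ('a, 'n) field10 \<Rightarrow> real" where
  "L2_norm2 M A g \<eta> = integral_M M A g (form_norm2 A g \<eta>)"

text \<open>The vector field dual to the conjugate of a (1,0)-form: \<open>V\<^sup>i = g\<^sup>i\<^sup>\<bar>\<^sup>k \<bar>\<phi>\<^sub>k\<close>.\<close>

definition dual_vec :: "('a, 'n::finite) metric \<Rightarrow> ('a, 'n) field10 \<Rightarrow> ('a, 'n) field10" where
  "dual_vec g \<phi> c p = (\<chi> i. \<Sum>k\<in>UNIV. ginv g c i k p * cnj (\<phi> c p $ k))"

text \<open>\<open>R\<^bsub>i\<bar>jk\<bar>l\<^esub>\<close>.\<close>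

definition curv ::
  "('a, 'n::finite) metric \<Rightarrow> ('a, 'n) chart \<Rightarrow> 'n \<Rightarrow> 'n \<Rightarrow> 'n \<Rightarrow> 'n \<Rightarrow> 'a \<Rightarrow> complex" where
  "curv g c i j k l p =
     - pd c i (pd_bar c j (\<lambda>q. g c q $ k $ l)) p
     + (\<Sum>r\<in>UNIV. \<Sum>s\<in>UNIV. ginv g c r s p
          * pd c i (\<lambda>q. g c q $ k $ s) p * pd_bar c j (\<lambda>q. g c q $ r $ l) p)"

text \<open>\<open>R(V, \<bar>V, V, \<bar>V)\<close>.\<close>

definition curv_along ::
  "('a, 'n::finite) chart set \<Rightarrow> ('a, 'n) metric \<Rightarrow> ('a, 'n) field10 \<Rightarrow> 'a \<Rightarrow> complex" where
  "curv_along A g V = scalar A (\<lambda>c p.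
     \<Sum>i\<in>UNIV. \<Sum>j\<in>UNIV. \<Sum>k\<in>UNIV. \<Sum>l\<in>UNIV.
       curv g c i j k l p * V c p $ i * cnj (V c p $ j) * V c p $ k * cnj (V c p $ l))"

text \<open>The connection form of the Chern connection of \<open>E\<close> in the holomorphic frame \<open>(dz\<^sup>k)\<close> is
  \<open>\<theta> = \<partial>H H\<^sup>-\<^sup>1\<close> with \<open>H\<^bsub>kl\<^esub> = \<langle>dz\<^sup>k, dz\<^sup>l\<rangle> = g\<^sup>k\<^sup>\<bar>\<^sup>l\<close>, where \<open>\<nabla> dz\<^sup>k = \<theta>\<^sub>k\<^sup>m \<otimes> dz\<^sup>m\<close>. Here \<open>chern_form g c j p\<close>
  is the matrix of \<open>dz\<^sup>j\<close>-coefficients of \<open>\<theta>\<close>.\<close>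

definition chern_form ::
  "('a, 'n::finite) metric \<Rightarrow> ('a, 'n) chart \<Rightarrow> 'n \<Rightarrow> 'a \<Rightarrow> complex^'n^'n" where
  "chern_form g c j p =
     (\<chi> k l. pd c j (ginv g c k l) p) ** matrix_inv (\<chi> k l. ginv g c k l p)"

text \<open>\<open>\<partial>\<^sub>E s\<close> for a section \<open>s\<close> of \<open>E\<close>: an \<open>E\<close>-valued (1,0)-form \<open>\<Sum>\<^sub>j dz\<^sup>j \<otimes> \<sigma>\<^sub>j\<close>, represented by the
  sections \<open>\<sigma>\<^sub>j\<close>, where \<open>\<sigma>\<^sub>j = \<Sum>\<^sub>i (\<partial>\<^sub>j s\<^sub>i + s\<^sub>k \<theta>\<^sub>j\<^sub>k\<^sup>i) dz\<^sup>i\<close>.\<close>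

definition del_E ::
  "('a, 'n::finite) metric \<Rightarrow> ('a, 'n) field10 \<Rightarrow> 'n \<Rightarrow> ('a, 'n) field10" where
  "del_E g s j c p =
     (\<chi> i. pd c j (\<lambda>q. s c q $ i) p + (\<Sum>k\<in>UNIV. s c p $ k * chern_form g c j p $ k $ i))"

text \<open>\<open>{\<Sum>\<^sub>j dz\<^sup>j \<otimes> \<sigma>\<^sub>j, t} = \<Sum>\<^sub>j \<langle>\<sigma>\<^sub>j, t\<rangle>\<^sub>E dz\<^sup>j\<close>, the pairing of an \<open>E\<close>-valued (1,0)-form with an \<open>E\<close>-valued
  0-form.\<close>

definition E_pairing ::
  "('a, 'n::finite) metric \<Rightarrow> ('n \<Rightarrow> ('a, 'n) field10) \<Rightarrow> ('a, 'n) field10 \<Rightarrow> ('a, 'n) field10" where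
  "E_pairing g \<sigma> t c p = (\<chi> j. cov_inner g c p (\<sigma> j c p) (t c p))"

end

theory Submission
  imports Defs "HOL-Complex_Analysis.Cauchy_Integral_Formula"
begin

text \<open>
The formula is one pointwise identity, integrated. Let \<open>U = |\<phi>|\<^sup>2\<close>. Since the Chern connection is metric,
\<open>\<partial>U = \<omega>1 + \<omega>2\<close>, where \<open>\<omega>1\<close> is the pairing \<open>{\<partial>\<^sub>E \<phi>, \<phi>}\<close> and \<open>\<omega>2\<close> has the components
\<open>f\<^bsub>j\<bar>k\<^esub> V\<^bsup>\<bar>k\<^esup>\<close>, the complex Hessian of \<open>f\<close> contracted with the conjugate of \<open>V\<close>. Put \<open>a = \<omega>1(V)\<close> and
\<open>b = \<omega>2(V)\<close>, and let \<open>W\<close> be the vector field dual to the conjugate of \<open>\<omega>2\<close>. Curvature is the obstruction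
to commuting a holomorphic covariant derivative with an antiholomorphic one; commuting them on third derivatives of \<open>f\<close> and contracting with
\<open>V\<close>, its conjugate, and \<open>V\<close> gives

  \<open>R(V, \<bar>V, V, \<bar>V) = \<bar>V a - V b - 2 |\<omega>1|\<^sup>2 + W U\<close>

(lemma \<open>Bochner_identity\<close>, with \<open>\<bar>V\<close> read as the conjugate field). For a Kaehler metric the trace of the Christoffel symbols is the logarithmic
derivative of the volume density. Hence \<open>div V\<close> is the trace \<open>-\<lambda> f\<close> of the complex Hessian, and
differentiating this relation once more yields \<open>div W = -\<lambda> U + |\<partial>\<bar>\<partial> f|\<^sup>2\<close>. Therefore the functions
\<open>\<bar>V a - \<lambda> f a\<close>, \<open>V b - \<lambda> f b\<close>, \<open>W U + U (|\<partial>\<bar>\<partial> f|\<^sup>2 - \<lambda> U)\<close> and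
\<open>U\<^sup>2 + f (a + b) - \<lambda> f\<^sup>2 U\<close> are, up to conjugation, the divergences of the four global vector fields
\<open>conj(a) V\<close>, \<open>b V\<close>, \<open>U W\<close> and \<open>f U V\<close>. Adding the first and the third, subtracting the second and subtracting
\<open>\<lambda>\<close> times the conjugate of the fourth produces exactly the difference of the two integrands
in the formula (\<open>weighted_bochner_formula\<close>). The inequality drops the three nonnegative terms; that
\<open>|\<partial>\<bar>\<partial> f|\<^sup>2\<close> is one of them is \<open>hess_norm2_real\<close>.

What has to be built for this is the statement that divergences integrate to zero
(\<open>divergence_theorem\<close>) for an integral defined by charts and a partition of unity \<open>\<rho>\<close>. Integrating by parts
in every chart leaves terms \<open>X \<rho>\<^sub>c\<close>, which cancel because \<open>\<Sum>\<^sub>c \<rho>\<^sub>c = 1\<close>, as soon as each of them may be integrated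
in whatever chart is convenient (\<open>chart_integral_independent\<close>). That is the change of variables formula,
together with the fact that the density of \<open>\<omega>\<^sup>n/n!\<close> is multiplied by the real Jacobian determinant. This density is
a sum over permutations, that is, a Pfaffian; its transformation rule (\<open>volume_density_congruence\<close>), its positivity and its
derivative all follow from the rule \<open>Pf(L\<^sup>T W L) = det L Pf W\<close>.
\<close>

section \<open>Smooth maps\<close>

lemma has_frechet_derivative:
  "F differentiable at x \<Longrightarrow> (F has_derivative frechet_derivative F (at x)) (at x)"
  by (simp add: frechet_derivative_works)

lemma Ck_on_subset: "Ck_on k F S \<Longrightarrow> T \<subseteq> S \<Longrightarrow> Ck_on k F T"
  by (induction k arbitrary: F) (auto intro: continuous_on_subset)

lemma Ck_on_cong:
  assumes "open S" "\<And>x. x \<in> S \<Longrightarrow> F x = G x" "Ck_on k F S"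
  shows "Ck_on k G S"
  using assms(2,3)
proof (induction k arbitrary: F G)
  case 0
  then show ?case by (metis Ck_on.simps(1) continuous_on_cong)
next
  case (Suc k)
  have dF: "F differentiable at x" if "x \<in> S" for x using Suc.prems that by auto
  have eq: "frechet_derivative F (at x) = frechet_derivative G (at x)" if "x \<in> S" for x
    by (rule frechet_derivative_transform_within_open[OF dF[OF that] assms(1) that Suc.prems(1)])
  have "G differentiable at x" if "x \<in> S" for x
    using dF[OF that] unfolding differentiable_def
    by (metis has_derivative_transform_within_open assms(1) that Suc.prems(1))
  moreover have "Ck_on k (\<lambda>x. frechet_derivative G (at x) v) S" for v
    by (rule Suc.IH[of "\<lambda>x. frechet_derivative F (at x) v"]) (use Suc.prems eq in auto)
  ultimately show ?case by simp
qed

text \<open>Later inductions on the order of differentiability use this form: it suffices to exhibit some derivative whose directional values are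
one order less smooth, so that \<open>frechet_derivative\<close> never has to be computed.\<close>

lemma Ck_on_SucI:
  assumes "open S" "\<And>x. x \<in> S \<Longrightarrow> (F has_derivative F' x) (at x)"
    "\<And>v. Ck_on k (\<lambda>x. F' x v) S"
  shows "Ck_on (Suc k) F S"
proof -
  have "frechet_derivative F (at x) = F' x" if "x \<in> S" for x
    using assms(2)[OF that] frechet_derivative_at by metis
  then have "Ck_on k (\<lambda>x. frechet_derivative F (at x) v) S" for v
    by (intro Ck_on_cong[OF assms(1) _ assms(3)]) auto
  then show ?thesis using assms(2) by (auto simp: differentiable_def)
qed

lemma Ck_on_mono_Suc: "Ck_on (Suc k) F S \<Longrightarrow> Ck_on k F S"
proof (induction k arbitrary: F)
  case 0
  then show ?case
    by (auto simp: continuous_on_eq_continuous_within intro!: differentiable_imp_continuous_within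
        intro: differentiable_at_imp_differentiable_on differentiable_at_withinI)
next
  case (Suc k)
  then show ?case by (metis Ck_on.simps(2))
qed

lemma Ck_on_const: "Ck_on k (\<lambda>x. c) S"
  by (induction k arbitrary: c) auto

lemma Ck_on_bounded_linear:
  assumes "open S" "bounded_linear L" shows "Ck_on k L S"
proof (cases k)
  case 0
  then show ?thesis using assms by (simp add: linear_continuous_on)
next
  case (Suc j)
  show ?thesis unfolding Suc
    by (rule Ck_on_SucI[where F'="\<lambda>x. L"])
      (auto simp: assms Ck_on_const intro: bounded_linear.has_derivative[OF assms(2), of "\<lambda>x. x" "\<lambda>x. x"])
qed

lemma Ck_on_linear_compose:
  assumes "open S" "bounded_linear L" "Ck_on k F S"
  shows "Ck_on k (\<lambda>x. L (F x)) S"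
  using assms(3)
proof (induction k arbitrary: F)
  case 0
  then show ?case using assms(2) by (simp add: bounded_linear.continuous_on)
next
  case (Suc k)
  show ?case
    by (rule Ck_on_SucI[where F'="\<lambda>x v. L (frechet_derivative F (at x) v)"])
      (use Suc assms in \<open>auto intro!: bounded_linear.has_derivative[OF assms(2)] simp: has_frechet_derivative\<close>)
qed

lemma Ck_on_add:
  assumes "open S" "Ck_on k F S" "Ck_on k G S"
  shows "Ck_on k (\<lambda>x. F x + G x) S"
  using assms(2,3)
proof (induction k arbitrary: F G)
  case 0
  then show ?case by (simp add: continuous_on_add)
next
  case (Suc k)
  show ?case
    by (rule Ck_on_SucI[where F'="\<lambda>x v. frechet_derivative F (at x) v + frechet_derivative G (at x) v"])
      (use Suc assms in \<open>auto intro!: has_derivative_add simp: has_frechet_derivative\<close>)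
qed

lemma Ck_on_bilinear:
  assumes "open S" "bounded_bilinear B" "Ck_on k F S" "Ck_on k G S"
  shows "Ck_on k (\<lambda>x. B (F x) (G x)) S"
  using assms(3,4)
proof (induction k arbitrary: F G)
  case 0
  then show ?case using assms(2) by (simp add: bounded_bilinear.continuous_on)
next
  case (Suc k)
  show ?case
  proof (rule Ck_on_SucI[where F'="\<lambda>x v. B (F x) (frechet_derivative G (at x) v) +
        B (frechet_derivative F (at x) v) (G x)"])
    show "((\<lambda>x. B (F x) (G x)) has_derivative (\<lambda>v. B (F x) (frechet_derivative G (at x) v) +
        B (frechet_derivative F (at x) v) (G x))) (at x)" if "x \<in> S" for x
      by (rule bounded_bilinear.FDERIV[OF assms(2)]) (use Suc that in \<open>auto simp: has_frechet_derivative\<close>)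
    show "Ck_on k (\<lambda>x. B (F x) (frechet_derivative G (at x) v) +
        B (frechet_derivative F (at x) v) (G x)) S" for v
      by (intro Ck_on_add Suc.IH assms(1) Ck_on_mono_Suc[OF Suc.prems(1)] Ck_on_mono_Suc[OF Suc.prems(2)])
        (use Suc.prems in auto)
  qed (fact assms)
qed

lemma Ck_on_inverse:
  fixes F :: "'v::real_normed_vector \<Rightarrow> 'a::real_normed_field"
  assumes "open S" "Ck_on k F S" "\<And>x. x \<in> S \<Longrightarrow> F x \<noteq> 0"
  shows "Ck_on k (\<lambda>x. inverse (F x)) S"
  using assms(2)
proof (induction k)
  case 0
  then show ?case using assms by (auto intro: continuous_on_inverse)
next
  case (Suc k)
  have IH: "Ck_on k (\<lambda>x. inverse (F x)) S" using Suc Ck_on_mono_Suc by blast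
  show ?case
  proof (rule Ck_on_SucI[where F'="\<lambda>x v. - (inverse (F x) * frechet_derivative F (at x) v * inverse (F x))"])
    show "((\<lambda>x. inverse (F x)) has_derivative (\<lambda>v. - (inverse (F x) * frechet_derivative F (at x) v * inverse (F x)))) (at x)"
      if "x \<in> S" for x
      by (rule Deriv.has_derivative_inverse) (use assms Suc that in \<open>auto simp: has_frechet_derivative\<close>)
    show "Ck_on k (\<lambda>x. - (inverse (F x) * frechet_derivative F (at x) v * inverse (F x))) S" for v
      by (rule Ck_on_linear_compose[OF assms(1) bounded_linear_minus[OF bounded_linear_ident]],
          intro Ck_on_bilinear[OF assms(1) bounded_bilinear_mult] IH)
        (use Suc in auto)
  qed (fact assms)
qed

lemma Ck_on_sum:
  assumes "open S" "finite I" "\<And>i. i \<in> I \<Longrightarrow> Ck_on k (F i) S"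
  shows "Ck_on k (\<lambda>x. \<Sum>i\<in>I. F i x) S"
  using assms(2,3) by (induction I rule: finite_induct) (auto simp: Ck_on_const intro!: Ck_on_add assms(1))

text \<open>The derivative of \<open>G \<circ> F\<close> evaluates \<open>DG\<close> at a vector that varies with the point, whereas smoothness of \<open>DG\<close>
is known for constant vectors only. Expanding that vector in a basis separates the two dependences.\<close>

lemma Ck_on_compose:
  fixes G :: "'u::euclidean_space \<Rightarrow> 'w::real_normed_vector"
  assumes "open S" "open T" "Ck_on k F S" "Ck_on k G T" "\<And>x. x \<in> S \<Longrightarrow> F x \<in> T"
  shows "Ck_on k (\<lambda>x. G (F x)) S"
  using assms(3,4)
proof (induction k arbitrary: G)
  case 0
  then show ?case using assms by (auto intro: continuous_on_compose2)
next
  case (Suc k)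
  have dG: "(G has_derivative frechet_derivative G (at (F x))) (at (F x))" if "x \<in> S" for x
    using Suc.prems(2) assms(5)[OF that] by (simp add: has_frechet_derivative)
  have dF: "(F has_derivative frechet_derivative F (at x)) (at x)" if "x \<in> S" for x
    using Suc.prems(1) that by (simp add: has_frechet_derivative)
  show ?case
  proof (rule Ck_on_SucI[where F'="\<lambda>x v. \<Sum>b\<in>Basis. (frechet_derivative F (at x) v \<bullet> b) *\<^sub>R frechet_derivative G (at (F x)) b"])
    fix x assume x: "x \<in> S"
    have lin: "linear (frechet_derivative G (at (F x)))" using dG[OF x] by (rule has_derivative_linear)
    have expand: "frechet_derivative G (at (F x)) w = (\<Sum>b\<in>Basis. (w \<bullet> b) *\<^sub>R frechet_derivative G (at (F x)) b)" for w
      using arg_cong[OF euclidean_representation[of w], of "frechet_derivative G (at (F x))"]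
      by (simp add: linear_sum[OF lin] linear_scale[OF lin])
    have eq: "(\<lambda>v. frechet_derivative G (at (F x)) (frechet_derivative F (at x) v)) =
      (\<lambda>v. \<Sum>b\<in>Basis. (frechet_derivative F (at x) v \<bullet> b) *\<^sub>R frechet_derivative G (at (F x)) b)"
      by (rule ext, rule expand)
    have "((\<lambda>x. G (F x)) has_derivative (\<lambda>v. frechet_derivative G (at (F x)) (frechet_derivative F (at x) v))) (at x)"
      using diff_chain_at[OF dF[OF x] dG[OF x]] by (simp add: o_def)
    then show "((\<lambda>x. G (F x)) has_derivative (\<lambda>v. \<Sum>b\<in>Basis. (frechet_derivative F (at x) v \<bullet> b) *\<^sub>R frechet_derivative G (at (F x)) b)) (at x)"
      unfolding eq .
  next
    fix v
    show "Ck_on k (\<lambda>x. \<Sum>b\<in>Basis. (frechet_derivative F (at x) v \<bullet> b) *\<^sub>R frechet_derivative G (at (F x)) b) S"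
    proof (intro Ck_on_sum Ck_on_bilinear[OF _ bounded_bilinear_scaleR] assms Suc.IH Ck_on_mono_Suc[OF Suc.prems(1)])
      fix b :: 'u
      show "Ck_on k (\<lambda>x. frechet_derivative F (at x) v \<bullet> b) S"
        by (rule Ck_on_linear_compose[OF assms(1) bounded_linear_inner_left]) (use Suc.prems in auto)
    qed (use Suc.prems in auto)
  qed (fact assms)
qed

text \<open>Smoothness is a local property. This glues a compactly supported function in a chart to its extension by zero.\<close>

lemma Ck_on_Un:
  assumes "open S" "open T" "Ck_on k F S" "Ck_on k F T"
  shows "Ck_on k F (S \<union> T)"
  using assms(3,4) by (induction k arbitrary: F) (auto intro: continuous_on_open_Un assms)

lemma smooth_on_subset: "smooth_on F S \<Longrightarrow> T \<subseteq> S \<Longrightarrow> smooth_on F T"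
  unfolding smooth_on_def using Ck_on_subset by blast

lemma smooth_on_cong: "open S \<Longrightarrow> (\<And>x. x \<in> S \<Longrightarrow> F x = G x) \<Longrightarrow> smooth_on F S \<Longrightarrow> smooth_on G S"
  unfolding smooth_on_def using Ck_on_cong by blast

lemma smooth_on_const: "smooth_on (\<lambda>x. c) S"
  unfolding smooth_on_def using Ck_on_const by blast

lemma smooth_on_bounded_linear: "open S \<Longrightarrow> bounded_linear L \<Longrightarrow> smooth_on L S"
  unfolding smooth_on_def using Ck_on_bounded_linear by blast

lemma smooth_on_linear_compose:
  "open S \<Longrightarrow> bounded_linear L \<Longrightarrow> smooth_on F S \<Longrightarrow> smooth_on (\<lambda>x. L (F x)) S"
  unfolding smooth_on_def using Ck_on_linear_compose by blast

lemma smooth_on_add: "open S \<Longrightarrow> smooth_on F S \<Longrightarrow> smooth_on G S \<Longrightarrow> smooth_on (\<lambda>x. F x + G x) S"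
  unfolding smooth_on_def using Ck_on_add by blast

lemma smooth_on_bilinear:
  "open S \<Longrightarrow> bounded_bilinear B \<Longrightarrow> smooth_on F S \<Longrightarrow> smooth_on G S \<Longrightarrow> smooth_on (\<lambda>x. B (F x) (G x)) S"
  unfolding smooth_on_def using Ck_on_bilinear by blast

lemmas smooth_on_mult = smooth_on_bilinear[OF _ bounded_bilinear_mult]
lemmas smooth_on_minus = smooth_on_linear_compose[OF _ bounded_linear_minus[OF bounded_linear_ident]]

lemma smooth_on_diff:
  "open S \<Longrightarrow> smooth_on F S \<Longrightarrow> smooth_on G S \<Longrightarrow> smooth_on (\<lambda>x. F x - G x) S"
  using smooth_on_add[of S F "\<lambda>x. - G x"] smooth_on_minus[of S G] by simp

lemma smooth_on_inverse:
  fixes F :: "'v::real_normed_vector \<Rightarrow> 'a::real_normed_field"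
  shows "open S \<Longrightarrow> smooth_on F S \<Longrightarrow> (\<And>x. x \<in> S \<Longrightarrow> F x \<noteq> 0) \<Longrightarrow> smooth_on (\<lambda>x. inverse (F x)) S"
  unfolding smooth_on_def using Ck_on_inverse by blast

lemma smooth_on_sum:
  "open S \<Longrightarrow> (\<And>i. i \<in> I \<Longrightarrow> smooth_on (F i) S) \<Longrightarrow> smooth_on (\<lambda>x. \<Sum>i\<in>I. F i x) S"
  by (induction I rule: infinite_finite_induct) (auto simp: smooth_on_const intro!: smooth_on_add)

lemma smooth_on_prod:
  fixes F :: "'i \<Rightarrow> 'v::real_normed_vector \<Rightarrow> 'a::real_normed_field"
  shows "open S \<Longrightarrow> (\<And>i. i \<in> I \<Longrightarrow> smooth_on (F i) S) \<Longrightarrow> smooth_on (\<lambda>x. \<Prod>i\<in>I. F i x) S"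
  by (induction I rule: infinite_finite_induct) (auto simp: smooth_on_const intro!: smooth_on_mult)

lemma smooth_on_compose:
  fixes G :: "'u::euclidean_space \<Rightarrow> 'w::real_normed_vector"
  shows "open S \<Longrightarrow> open T \<Longrightarrow> smooth_on F S \<Longrightarrow> smooth_on G T \<Longrightarrow> (\<And>x. x \<in> S \<Longrightarrow> F x \<in> T) \<Longrightarrow>
    smooth_on (\<lambda>x. G (F x)) S"
  unfolding smooth_on_def using Ck_on_compose by blast

lemma smooth_on_Un:
  "open S \<Longrightarrow> open T \<Longrightarrow> smooth_on F S \<Longrightarrow> smooth_on F T \<Longrightarrow> smooth_on F (S \<union> T)"
  unfolding smooth_on_def using Ck_on_Un by blast

lemma smooth_on_frechet_derivative:
  "smooth_on F S \<Longrightarrow> smooth_on (\<lambda>x. frechet_derivative F (at x) v) S"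
  unfolding smooth_on_def by (metis Ck_on.simps(2))

lemma smooth_on_imp_differentiable: "smooth_on F S \<Longrightarrow> x \<in> S \<Longrightarrow> F differentiable at x"
  unfolding smooth_on_def by (metis Ck_on.simps(2))

lemma smooth_on_has_derivative:
  "smooth_on F S \<Longrightarrow> x \<in> S \<Longrightarrow> (F has_derivative frechet_derivative F (at x)) (at x)"
  by (simp add: has_frechet_derivative smooth_on_imp_differentiable)

lemma smooth_on_imp_continuous_on: "smooth_on F S \<Longrightarrow> continuous_on S F"
  unfolding smooth_on_def by (metis Ck_on.simps(1))

lemma smooth_on_vec_nth:
  fixes F :: "'v::real_normed_vector \<Rightarrow> 'w::real_normed_vector ^ 'n::finite"
  shows "open S \<Longrightarrow> smooth_on F S \<Longrightarrow> smooth_on (\<lambda>x. F x $ i) S"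
  by (rule smooth_on_linear_compose[OF _ bounded_linear_vec_nth])

text \<open>A vector is the sum of its components times coordinate vectors, so this reduces to sums and linear maps.\<close>

lemma smooth_on_vec:
  fixes F :: "'v::real_normed_vector \<Rightarrow> 'w::euclidean_space ^ 'n::finite"
  assumes "open S" "\<And>i. smooth_on (\<lambda>x. F x $ i) S"
  shows "smooth_on F S"
proof -
  have ax: "bounded_linear (axis i :: 'w \<Rightarrow> 'w ^ 'n)" for i
    by (simp add: linear_conv_bounded_linear[symmetric])
      (auto intro!: linearI simp: axis_def vec_eq_iff)
  have "smooth_on (\<lambda>x. \<Sum>i\<in>UNIV. axis i (F x $ i)) S"
    by (intro smooth_on_sum[OF assms(1)] smooth_on_linear_compose[OF assms(1) ax] assms(2))
  moreover have "(\<Sum>i\<in>UNIV. axis i (w $ i)) = w" for w :: "'w ^ 'n"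
    by (simp add: vec_eq_iff axis_def if_distrib sum.delta cong: if_cong)
  ultimately show ?thesis by simp
qed

lemma smooth_on_of_real:
  fixes F :: "'v::real_normed_vector \<Rightarrow> real"
  shows "open S \<Longrightarrow> smooth_on F S \<Longrightarrow> smooth_on (\<lambda>x. complex_of_real (F x)) S"
  by (rule smooth_on_linear_compose[OF _ bounded_linear_of_real])

lemma smooth_on_cnj: "open S \<Longrightarrow> smooth_on F S \<Longrightarrow> smooth_on (\<lambda>x. cnj (F x)) S"
  by (rule smooth_on_linear_compose[OF _ bounded_linear_cnj])

lemma smooth_on_Re: "open S \<Longrightarrow> smooth_on F S \<Longrightarrow> smooth_on (\<lambda>x. Re (F x)) S"
  by (rule smooth_on_linear_compose[OF _ bounded_linear_Re])

lemma smooth_on_Im: "open S \<Longrightarrow> smooth_on F S \<Longrightarrow> smooth_on (\<lambda>x. Im (F x)) S"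
  by (rule smooth_on_linear_compose[OF _ bounded_linear_Im])

section \<open>Symmetry of second derivatives\<close>

text \<open>The classical route to the symmetry of second derivatives: the mean value theorem, applied first in direction \<open>u\<close> and then in
direction \<open>v\<close>, evaluates the second difference quotient, an expression symmetric in \<open>u\<close> and \<open>v\<close>, by a second derivative at a nearby point.\<close>

lemma double_difference_mean_value:
  fixes f :: "'v::real_normed_vector \<Rightarrow> real"
  assumes sm: "smooth_on f (ball x r)" and s: "0 < s" "s * (norm u + norm v) < r"
  obtains a b where "0 < a" "a < s" "0 < b" "b < s"
    "f (x + s *\<^sub>R u + s *\<^sub>R v) - f (x + s *\<^sub>R u) - f (x + s *\<^sub>R v) + f x =
       s * s * frechet_derivative (\<lambda>y. frechet_derivative f (at y) u) (at (x + a *\<^sub>R u + b *\<^sub>R v)) v"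
proof -
  let ?D = "\<lambda>y. frechet_derivative f (at y)"
  let ?D2 = "\<lambda>y. frechet_derivative (\<lambda>y. ?D y u) (at y)"
  have inb: "x + a *\<^sub>R u + b *\<^sub>R v \<in> ball x r" if "0 \<le> a" "a \<le> s" "0 \<le> b" "b \<le> s" for a b
  proof -
    have "norm (a *\<^sub>R u + b *\<^sub>R v) \<le> a * norm u + b * norm v"
      using norm_triangle_ineq[of "a *\<^sub>R u" "b *\<^sub>R v"] that by simp
    also have "\<dots> \<le> s * norm u + s * norm v"
      by (intro add_mono mult_right_mono) (use that in auto)
    also have "\<dots> < r" using s by (simp add: algebra_simps)
    finally show ?thesis using norm_minus_cancel[of "a *\<^sub>R u + b *\<^sub>R v"]
      by (simp add: dist_norm add.assoc del: norm_minus_cancel)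
  qed
  have der: "((\<lambda>a. f (x + a *\<^sub>R u + b *\<^sub>R v)) has_real_derivative ?D (x + a *\<^sub>R u + b *\<^sub>R v) u) (at a)"
    if "0 \<le> a" "a \<le> s" "0 \<le> b" "b \<le> s" for a b
  proof -
    have d: "(f has_derivative ?D (x + a *\<^sub>R u + b *\<^sub>R v)) (at (x + a *\<^sub>R u + b *\<^sub>R v))"
      using smooth_on_has_derivative[OF sm inb[OF that]] .
    have "((\<lambda>a. f (x + a *\<^sub>R u + b *\<^sub>R v)) has_derivative (\<lambda>h. ?D (x + a *\<^sub>R u + b *\<^sub>R v) (h *\<^sub>R u))) (at a)"
      by (rule has_derivative_compose[of "\<lambda>a. x + a *\<^sub>R u + b *\<^sub>R v" "\<lambda>h. h *\<^sub>R u", OF _ d]) (auto intro!: derivative_eq_intros)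
    then show ?thesis
      by (simp add: has_field_derivative_def linear_scale[OF has_derivative_linear[OF d]] mult_commute_abs)
  qed
  have der2: "((\<lambda>b. ?D (x + a *\<^sub>R u + b *\<^sub>R v) u) has_real_derivative ?D2 (x + a *\<^sub>R u + b *\<^sub>R v) v) (at b)"
    if "0 \<le> a" "a \<le> s" "0 \<le> b" "b \<le> s" for a b
  proof -
    have d: "((\<lambda>y. ?D y u) has_derivative ?D2 (x + a *\<^sub>R u + b *\<^sub>R v)) (at (x + a *\<^sub>R u + b *\<^sub>R v))"
      using smooth_on_has_derivative[OF smooth_on_frechet_derivative[OF sm] inb[OF that]] .
    have "((\<lambda>b. ?D (x + a *\<^sub>R u + b *\<^sub>R v) u) has_derivative (\<lambda>h. ?D2 (x + a *\<^sub>R u + b *\<^sub>R v) (h *\<^sub>R v))) (at b)"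
      by (rule has_derivative_compose[of "\<lambda>b. x + a *\<^sub>R u + b *\<^sub>R v" "\<lambda>h. h *\<^sub>R v", OF _ d]) (auto intro!: derivative_eq_intros)
    then show ?thesis
      by (simp add: has_field_derivative_def linear_scale[OF has_derivative_linear[OF d]] mult_commute_abs)
  qed
  let ?h = "\<lambda>a. f (x + a *\<^sub>R u + s *\<^sub>R v) - f (x + a *\<^sub>R u + 0 *\<^sub>R v)"
  obtain a where a: "0 < a" "a < s"
    "?h s - ?h 0 = (s - 0) * (?D (x + a *\<^sub>R u + s *\<^sub>R v) u - ?D (x + a *\<^sub>R u + 0 *\<^sub>R v) u)"
  proof (rule exE[OF MVT2[OF s(1), of ?h "\<lambda>a. ?D (x + a *\<^sub>R u + s *\<^sub>R v) u - ?D (x + a *\<^sub>R u + 0 *\<^sub>R v) u"]])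
    show "(?h has_real_derivative ?D (x + a *\<^sub>R u + s *\<^sub>R v) u - ?D (x + a *\<^sub>R u + 0 *\<^sub>R v) u) (at a)"
      if "0 \<le> a" "a \<le> s" for a
      by (rule DERIV_diff; rule der) (use that s(1) in auto)
  qed auto
  obtain b where b: "0 < b" "b < s"
    "?D (x + a *\<^sub>R u + s *\<^sub>R v) u - ?D (x + a *\<^sub>R u + 0 *\<^sub>R v) u = (s - 0) * ?D2 (x + a *\<^sub>R u + b *\<^sub>R v) v"
  proof (rule exE[OF MVT2[OF s(1), of "\<lambda>b. ?D (x + a *\<^sub>R u + b *\<^sub>R v) u" "\<lambda>b. ?D2 (x + a *\<^sub>R u + b *\<^sub>R v) v"]])
    show "((\<lambda>b. ?D (x + a *\<^sub>R u + b *\<^sub>R v) u) has_real_derivative ?D2 (x + a *\<^sub>R u + b *\<^sub>R v) v) (at b)"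
      if "0 \<le> b" "b \<le> s" for b
      by (rule der2) (use that a in auto)
  qed auto
  show ?thesis
    by (rule that[of a b]) (use a b in \<open>auto simp: algebra_simps\<close>)
qed

text \<open>The second difference of size \<open>s\<close> can be evaluated in both orders; as \<open>s\<close> tends to \<open>0\<close> both
evaluation points converge to \<open>x\<close>, where the second derivatives are continuous.\<close>

lemma frechet_derivative_commute_real:
  fixes f :: "'v::real_normed_vector \<Rightarrow> real"
  assumes sm: "smooth_on f S" and S: "open S" "x \<in> S"
  shows "frechet_derivative (\<lambda>y. frechet_derivative f (at y) u) (at x) v =
         frechet_derivative (\<lambda>y. frechet_derivative f (at y) v) (at x) u"
proof -
  let ?D2 = "\<lambda>u y. frechet_derivative (\<lambda>y. frechet_derivative f (at y) u) (at y)"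
  obtain r where r: "0 < r" "ball x r \<subseteq> S" using S by (meson open_contains_ball)
  have smr: "smooth_on f (ball x r)" using smooth_on_subset[OF sm r(2)] .
  \<comment> \<open>The extra \<open>1\<close> keeps the denominator positive when \<open>u\<close> and \<open>v\<close> vanish.\<close>
  define s where "s n = inverse (real (Suc n)) * (r / (norm u + norm v + 1))" for n
  have s0: "0 < s n" for n using r(1) by (auto simp: s_def intro!: mult_pos_pos divide_pos_pos add_nonneg_pos)
  have sr: "s n * (norm u + norm v) < r" for n
  proof -
    have "s n * (norm u + norm v) < s n * (norm u + norm v + 1)" using s0[of n] by simp
    also have "\<dots> = inverse (real (Suc n)) * r"
    proof -
      have "norm u + norm v + 1 \<noteq> 0" using norm_ge_zero[of u] norm_ge_zero[of v] by linarith
      then show ?thesis by (simp add: s_def)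
    qed
    also have "\<dots> \<le> r" using r(1) by (simp add: divide_simps)
    finally show ?thesis .
  qed
  have slim: "s \<longlonglongrightarrow> 0"
    unfolding s_def by (rule tendsto_mult_left_zero[OF LIMSEQ_inverse_real_of_nat])
  have cont: "isCont (\<lambda>y. ?D2 u y v) x" for u v
    using smooth_on_imp_continuous_on[OF smooth_on_frechet_derivative[OF smooth_on_frechet_derivative[OF sm]]] S
    by (simp add: continuous_on_eq_continuous_at)
  have lim: "\<exists>p. p \<longlonglongrightarrow> x \<and> (\<forall>n. f (x + s n *\<^sub>R u + s n *\<^sub>R v) - f (x + s n *\<^sub>R u) - f (x + s n *\<^sub>R v) + f x
        = s n * s n * ?D2 u (p n) v)" if sr: "\<And>n. s n * (norm u + norm v) < r" for u v
  proof -
    have "\<exists>a b. 0 < a \<and> a < s n \<and> 0 < b \<and> b < s n \<and> f (x + s n *\<^sub>R u + s n *\<^sub>R v) - f (x + s n *\<^sub>R u) - f (x + s n *\<^sub>R v) + f x =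
       s n * s n * ?D2 u (x + a *\<^sub>R u + b *\<^sub>R v) v" for n
      using double_difference_mean_value[OF smr s0[of n] sr[of n]] by metis
    then obtain a b where ab: "\<And>n. 0 < a n" "\<And>n. a n < s n" "\<And>n. 0 < b n" "\<And>n. b n < s n"
      "\<And>n. f (x + s n *\<^sub>R u + s n *\<^sub>R v) - f (x + s n *\<^sub>R u) - f (x + s n *\<^sub>R v) + f x =
       s n * s n * ?D2 u (x + a n *\<^sub>R u + b n *\<^sub>R v) v" by metis
    have "a \<longlonglongrightarrow> 0" "b \<longlonglongrightarrow> 0"
      by (rule tendsto_sandwich[OF _ _ tendsto_const slim], auto intro!: always_eventually less_imp_le ab)+
    then have "(\<lambda>n. x + a n *\<^sub>R u + b n *\<^sub>R v) \<longlonglongrightarrow> x + 0 *\<^sub>R u + 0 *\<^sub>R v"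
      by (intro tendsto_intros)
    then show ?thesis using ab(5) by (intro exI[of _ "\<lambda>n. x + a n *\<^sub>R u + b n *\<^sub>R v"]) simp
  qed
  obtain p where p: "p \<longlonglongrightarrow> x" "\<And>n. f (x + s n *\<^sub>R u + s n *\<^sub>R v) - f (x + s n *\<^sub>R u) - f (x + s n *\<^sub>R v) + f x
        = s n * s n * ?D2 u (p n) v" using lim[OF sr] by blast
  obtain q where q: "q \<longlonglongrightarrow> x" "\<And>n. f (x + s n *\<^sub>R v + s n *\<^sub>R u) - f (x + s n *\<^sub>R v) - f (x + s n *\<^sub>R u) + f x
        = s n * s n * ?D2 v (q n) u" using lim[of v u] sr by (auto simp: add.commute)
  have "?D2 u (p n) v = ?D2 v (q n) u" for n
    using p(2)[of n] q(2)[of n] s0[of n] by (simp add: algebra_simps)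
  moreover have "(\<lambda>n. ?D2 u (p n) v) \<longlonglongrightarrow> ?D2 u x v" "(\<lambda>n. ?D2 v (q n) u) \<longlonglongrightarrow> ?D2 v x u"
    using isCont_tendsto_compose[OF cont] p(1) q(1) by blast+
  ultimately show ?thesis by (metis (no_types, lifting) LIMSEQ_unique ext)
qed

lemma frechet_derivative_linear_compose:
  assumes "bounded_linear L" "F differentiable at x"
  shows "frechet_derivative (\<lambda>y. L (F y)) (at x) v = L (frechet_derivative F (at x) v)"
  using bounded_linear.has_derivative[OF assms(1) has_frechet_derivative[OF assms(2)]]
    frechet_derivative_at by metis

text \<open>Real and imaginary parts reduce this to the real case, where the mean value theorem is available.\<close>

lemma frechet_derivative_commute:
  fixes F :: "'v::real_normed_vector \<Rightarrow> complex"
  assumes sm: "smooth_on F S" and S: "open S" "x \<in> S"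
  shows "frechet_derivative (\<lambda>y. frechet_derivative F (at y) u) (at x) v =
         frechet_derivative (\<lambda>y. frechet_derivative F (at y) v) (at x) u"
proof -
  have key: "L (frechet_derivative (\<lambda>y. frechet_derivative F (at y) u) (at x) v) =
    frechet_derivative (\<lambda>y. frechet_derivative (\<lambda>y. L (F y)) (at y) u) (at x) v"
    if L: "bounded_linear L" for L :: "complex \<Rightarrow> real" and u v
  proof -
    have d: "(\<lambda>y. frechet_derivative F (at y) u) differentiable at x"
      using smooth_on_imp_differentiable[OF smooth_on_frechet_derivative[OF sm] S(2)] .
    have "frechet_derivative (\<lambda>y. L (frechet_derivative F (at y) u)) (at x) v =
        frechet_derivative (\<lambda>y. frechet_derivative (\<lambda>y. L (F y)) (at y) u) (at x) v"
      by (rule fun_cong[OF frechet_derivative_transform_within_open[OF _ S]])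
        (auto simp: frechet_derivative_linear_compose[OF L] smooth_on_imp_differentiable[OF sm]
          intro!: differentiableI[OF bounded_linear.has_derivative[OF L has_frechet_derivative[OF d]]])
    then show ?thesis by (simp add: frechet_derivative_linear_compose[OF L d])
  qed
  show ?thesis
    using frechet_derivative_commute_real[OF smooth_on_Re[OF S(1) sm] S, of u v]
      frechet_derivative_commute_real[OF smooth_on_Im[OF S(1) sm] S, of u v]
    by (intro complex_eqI) (simp_all only: key[OF bounded_linear_Re] key[OF bounded_linear_Im])
qed

section \<open>Holomorphic maps of several variables are smooth\<close>

lemma norm_vector_scalar_mult: "norm (c *s v) = cmod c * norm (v :: complex^'n::finite)"
  by (simp add: norm_vec_def norm_mult L2_set_right_distrib)

lemma bounded_linear_vector_scalar_mult_left: "bounded_linear (\<lambda>c. c *s (v :: complex^'n::finite))"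
  by (auto intro!: linearI simp: linear_conv_bounded_linear[symmetric] vec_eq_iff algebra_simps)

definition several_holomorphic_on :: "(complex^'n::finite \<Rightarrow> complex) \<Rightarrow> (complex^'n) set \<Rightarrow> bool" where
  "several_holomorphic_on f S \<longleftrightarrow>
     (\<forall>x\<in>S. f differentiable at x \<and>
        (\<forall>a v. frechet_derivative f (at x) (a *s v) = a * frechet_derivative f (at x) v))"

lemma holomorphic_map_on_component:
  fixes F :: "complex^'n::finite \<Rightarrow> complex^'m::finite"
  assumes "holomorphic_map_on F S"
  shows "several_holomorphic_on (\<lambda>x. F x $ i) S"
proof -
  have "(\<lambda>x. F x $ i) differentiable at x \<and>
        (\<forall>a v. frechet_derivative (\<lambda>x. F x $ i) (at x) (a *s v) = a * frechet_derivative (\<lambda>x. F x $ i) (at x) v)"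
    if x: "x \<in> S" for x
  proof -
    obtain F' where F': "(F has_derivative F') (at x)" "\<And>a v. F' (a *s v) = a *s F' v"
      using assms x unfolding holomorphic_map_on_def by blast
    have d: "((\<lambda>x. F x $ i) has_derivative (\<lambda>v. F' v $ i)) (at x)"
      by (rule bounded_linear.has_derivative[OF bounded_linear_vec_nth F'(1)])
    have eq: "frechet_derivative (\<lambda>x. F x $ i) (at x) = (\<lambda>v. F' v $ i)"
      using frechet_derivative_at[OF d] by simp
    show ?thesis unfolding eq using d F'(2) by (auto simp: differentiable_def)
  qed
  then show ?thesis unfolding several_holomorphic_on_def by blast
qed

text \<open>Cauchy's formula on the complex line through \<open>x\<close> in direction \<open>v\<close>. The right-hand side no longer differentiates \<open>f\<close>,
so its dependence on \<open>x\<close> can be studied under the integral sign.\<close>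

lemma directional_derivative_Cauchy_integral:
  fixes f :: "complex^'n::finite \<Rightarrow> complex"
  assumes hol: "several_holomorphic_on f S" and r: "0 < r"
    and inS: "\<And>\<zeta>. cmod \<zeta> \<le> r \<Longrightarrow> x + \<zeta> *s v \<in> S"
  shows "frechet_derivative f (at x) v =
    integral (cbox 0 1) (\<lambda>t. inverse (of_real r * exp (2 * of_real pi * \<i> * of_real t)) *
      f (x + (of_real r * exp (2 * of_real pi * \<i> * of_real t)) *s v))"
proof -
  define h where "h \<zeta> = f (x + \<zeta> *s v)" for \<zeta>
  have dh: "(h has_field_derivative frechet_derivative f (at (x + \<zeta> *s v)) v) (at \<zeta>)" if "cmod \<zeta> \<le> r" for \<zeta>
  proof -
    have f: "(f has_derivative frechet_derivative f (at (x + \<zeta> *s v))) (at (x + \<zeta> *s v))"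
      and lin: "\<And>a. frechet_derivative f (at (x + \<zeta> *s v)) (a *s v) = a * frechet_derivative f (at (x + \<zeta> *s v)) v"
      using hol inS[OF that] has_frechet_derivative unfolding several_holomorphic_on_def by blast+
    have "((\<lambda>\<zeta>. x + \<zeta> *s v) has_derivative (\<lambda>h. 0 + h *s v)) (at \<zeta>)"
      by (intro has_derivative_add has_derivative_const
          bounded_linear.has_derivative[OF bounded_linear_vector_scalar_mult_left has_derivative_ident])
    from has_derivative_compose[OF this f]
    show ?thesis unfolding h_def has_field_derivative_def by (simp add: lin mult_commute_abs)
  qed
  have cont: "continuous_on (cball 0 r) h"
    using dh by (intro continuous_at_imp_continuous_on ballI DERIV_isCont) auto
  have hol: "h holomorphic_on ball 0 r"
  proof (rule holomorphic_onI)
    fix z :: complex assume "z \<in> ball 0 r"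
    then have "cmod z \<le> r" by simp
    from dh[OF this] show "h field_differentiable at z within ball 0 r"
      by (meson field_differentiable_at_within field_differentiable_def)
  qed
  have "(h has_field_derivative 1 / (2 * of_real pi * \<i>) *
      contour_integral (circlepath 0 r) (\<lambda>u. h u / (u - 0)\<^sup>2)) (at 0)"
    by (rule Cauchy_derivative_integral_circlepath(2)[OF cont hol]) (use r in simp)
  moreover have "(h has_field_derivative frechet_derivative f (at x) v) (at 0)"
    using dh[of 0] r by simp
  ultimately have "frechet_derivative f (at x) v = 1 / (2 * of_real pi * \<i>) *
      contour_integral (circlepath 0 r) (\<lambda>u. h u / (u - 0)\<^sup>2)"
    using DERIV_unique by blast
  also have "\<dots> = integral {0..1} (\<lambda>t. 1 / (2 * of_real pi * \<i>) * (h (circlepath 0 r t) / (circlepath 0 r t)\<^sup>2 *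
      vector_derivative (circlepath 0 r) (at t)))"
    unfolding contour_integral_integral integral_mult_right by simp
  also have "\<dots> = integral {0..1} (\<lambda>t. inverse (of_real r * exp (2 * of_real pi * \<i> * of_real t)) *
      f (x + (of_real r * exp (2 * of_real pi * \<i> * of_real t)) *s v))"
    using r by (intro integral_cong)
      (simp add: vector_derivative_circlepath h_def, simp add: circlepath field_simps power2_eq_square)
  finally show ?thesis by (simp only: cbox_interval)
qed

text \<open>A radius that serves for all base points near \<open>x\<close>, as differentiation under the integral sign in \<open>x\<close> requires.\<close>

lemma several_holomorphic_neighbourhood:
  fixes x :: "complex^'n::finite"
  assumes "open S" "x \<in> S"
  obtains d r where "0 < d" "0 < r" "ball x d \<subseteq> S" "\<And>y \<zeta>. y \<in> ball x d \<Longrightarrow> cmod \<zeta> \<le> r \<Longrightarrow> y + \<zeta> *s v \<in> S"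
proof -
  obtain R where R: "0 < R" "ball x R \<subseteq> S" using assms open_contains_ball by blast
  define r where "r = R / 2 / (norm v + 1)"
  have nv: "norm v + 1 > 0" using norm_ge_zero[of v] by linarith
  have r0: "0 < r" unfolding r_def using R nv by simp
  have "y + \<zeta> *s v \<in> S" if "y \<in> ball x (R/2)" "cmod \<zeta> \<le> r" for y \<zeta>
  proof -
    have "norm (\<zeta> *s v) \<le> r * norm v"
      unfolding norm_vector_scalar_mult using that by (intro mult_right_mono) auto
    also have "\<dots> \<le> r * (norm v + 1)" using r0 by simp
    also have "\<dots> = R / 2" unfolding r_def using nv by (metis less_irrefl nonzero_eq_divide_eq)
    finally have "dist x (y + \<zeta> *s v) < R"
      using that dist_triangle[of x "y + \<zeta> *s v" y] by (simp add: dist_norm)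
    then show ?thesis using R by auto
  qed
  with R r0 show ?thesis by (intro that[of "R/2" r]) auto
qed

lemma several_holomorphic_imp_continuous_on: "several_holomorphic_on f S \<Longrightarrow> continuous_on S f"
  unfolding several_holomorphic_on_def
  by (auto intro!: continuous_at_imp_continuous_on differentiable_imp_continuous_within)

text \<open>The Cauchy integral depends continuously on its base point, because \<open>f\<close> is continuous.\<close>

lemma continuous_on_directional_derivative:
  fixes f :: "complex^'n::finite \<Rightarrow> complex"
  assumes hol: "several_holomorphic_on f S" and S: "open S"
  shows "continuous_on S (\<lambda>x. frechet_derivative f (at x) v)"
proof (rule continuous_at_imp_continuous_on, rule ballI)
  fix x0 assume "x0 \<in> S"
  from several_holomorphic_neighbourhood[OF S this]
  obtain d r where d: "0 < d" "0 < r" "ball x0 d \<subseteq> S" and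
    inS: "\<And>y \<zeta>. y \<in> ball x0 d \<Longrightarrow> cmod \<zeta> \<le> r \<Longrightarrow> y + \<zeta> *s v \<in> S" by metis
  let ?g = "\<lambda>t. of_real r * exp (2 * of_real pi * \<i> * of_real t) :: complex"
  have n: "cmod (?g t) = r" for t using d by (simp add: norm_mult)
  have "continuous_on (ball x0 d \<times> cbox 0 1) (\<lambda>(x, t). inverse (?g t) * f (x + ?g t *s v))"
    unfolding split_beta
  proof (intro continuous_intros continuous_on_compose2[OF several_holomorphic_imp_continuous_on[OF hol]]
      bounded_linear.continuous_on[OF bounded_linear_vector_scalar_mult_left])
    show "(\<lambda>z. fst z + ?g (snd z) *s v) ` (ball x0 d \<times> cbox 0 1) \<subseteq> S"
      using inS n by auto
  qed (use d in auto)
  then have "continuous_on (ball x0 d) (\<lambda>x. integral (cbox 0 1) (\<lambda>t. inverse (?g t) * f (x + ?g t *s v)))"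
    by (rule integral_continuous_on_param)
  then have "continuous_on (ball x0 d) (\<lambda>x. frechet_derivative f (at x) v)"
    by (rule continuous_on_eq)
      (rule directional_derivative_Cauchy_integral[OF hol d(2) inS, symmetric], auto)
  then show "isCont (\<lambda>x. frechet_derivative f (at x) v) x0"
    using d(1) by (simp add: continuous_on_eq_continuous_at)
qed

text \<open>Differentiating the Cauchy integral under the integral sign; the derivative of the integrand is complex homogeneous, and
integration preserves that. The Leibniz rule wants the derivative as a continuous function into bounded linear maps, whence the use of \<open>blinfun\<close>.\<close>

lemma several_holomorphic_directional_derivative:
  fixes f :: "complex^'n::finite \<Rightarrow> complex"
  assumes hol: "several_holomorphic_on f S" and S: "open S"
  shows "several_holomorphic_on (\<lambda>x. frechet_derivative f (at x) v) S"
  unfolding several_holomorphic_on_def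
proof
  fix x0 assume "x0 \<in> S"
  from several_holomorphic_neighbourhood[OF S this]
  obtain d r where d: "0 < d" "0 < r" "ball x0 d \<subseteq> S" and
    inS: "\<And>y \<zeta>. y \<in> ball x0 d \<Longrightarrow> cmod \<zeta> \<le> r \<Longrightarrow> y + \<zeta> *s v \<in> S" by metis
  let ?g = "\<lambda>t. of_real r * exp (2 * of_real pi * \<i> * of_real t) :: complex"
  have n: "cmod (?g t) = r" for t using d by (simp add: norm_mult)
  have g0: "?g t \<noteq> 0" for t using d by simp
  have x0: "x0 \<in> ball x0 d" using d by simp
  define D where "D y = Blinfun (frechet_derivative f (at y))" for y
  have fD: "(f has_derivative blinfun_apply (D y)) (at y)" "blinfun_apply (D y) = frechet_derivative f (at y)"
    and lin: "blinfun_apply (D y) (a *s w) = a * blinfun_apply (D y) w" if "y \<in> S" for y a w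
  proof -
    have 1: "(f has_derivative frechet_derivative f (at y)) (at y)"
      "frechet_derivative f (at y) (a *s w) = a * frechet_derivative f (at y) w"
      using hol that has_frechet_derivative unfolding several_holomorphic_on_def by blast+
    then show 2: "blinfun_apply (D y) = frechet_derivative f (at y)"
      unfolding D_def by (intro bounded_linear_Blinfun_apply has_derivative_bounded_linear)
    show "(f has_derivative blinfun_apply (D y)) (at y)"
      "blinfun_apply (D y) (a *s w) = a * blinfun_apply (D y) w" unfolding 2 by (fact 1)+
  qed
  have contD: "continuous_on S D"
  proof (rule continuous_on_blinfun_componentwise)
    show "continuous_on S (\<lambda>x. blinfun_apply (D x) i)" for i
      by (rule continuous_on_eq[OF continuous_on_directional_derivative[OF hol S, of i]]) (simp add: fD(2))
  qed
  define fx where "fx x t = blinfun_mult_right (inverse (?g t)) o\<^sub>L D (x + ?g t *s v)" for x t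
  have der: "((\<lambda>x. inverse (?g t) * f (x + ?g t *s v)) has_derivative blinfun_apply (fx x t)) (at x within ball x0 d)"
    if "x \<in> ball x0 d" for x t
  proof -
    have yS: "x + ?g t *s v \<in> S" using inS[OF that] n by simp
    have "((\<lambda>x. x + ?g t *s v) has_derivative (\<lambda>h. h)) (at x)"
      by (auto intro!: derivative_eq_intros)
    from has_derivative_compose[OF this fD(1)[OF yS]]
    have "((\<lambda>x. inverse (?g t) * f (x + ?g t *s v)) has_derivative (\<lambda>h. inverse (?g t) * blinfun_apply (D (x + ?g t *s v)) h)) (at x)"
      by (rule has_derivative_mult_right)
    moreover have "(\<lambda>h. inverse (?g t) * blinfun_apply (D (x + ?g t *s v)) h) = blinfun_apply (fx x t)"
      by (simp add: fx_def fun_eq_iff)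
    ultimately show ?thesis using has_derivative_at_withinI by metis
  qed
  have inner: "continuous_on (ball x0 d \<times> cbox 0 1) (\<lambda>z. fst z + ?g (snd z) *s v)"
    by (intro continuous_intros bounded_linear.continuous_on[OF bounded_linear_vector_scalar_mult_left])
  have img: "(\<lambda>z. fst z + ?g (snd z) *s v) ` (ball x0 d \<times> cbox 0 1) \<subseteq> S" using inS n by auto
  have cfx: "continuous_on (ball x0 d \<times> cbox 0 1) (\<lambda>(x, t). fx x t)"
    unfolding split_beta fx_def
    by (intro bounded_bilinear.continuous_on[OF bounded_bilinear_blinfun_compose]
        bounded_linear.continuous_on[OF bounded_linear_blinfun_mult_right]
        continuous_on_compose2[OF contD inner img] continuous_on_inverse continuous_intros)
      (use d in auto)
  have cf: "continuous_on (cbox 0 1) (\<lambda>t. inverse (?g t) * f (x + ?g t *s v))" if "x \<in> ball x0 d" for x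
  proof (intro continuous_intros continuous_on_compose2[OF several_holomorphic_imp_continuous_on[OF hol]]
      bounded_linear.continuous_on[OF bounded_linear_vector_scalar_mult_left])
    show "(\<lambda>t. x + ?g t *s v) ` cbox 0 1 \<subseteq> S" using inS[OF that] n by auto
  qed (use d in auto)
  have "((\<lambda>x. integral (cbox 0 1) (\<lambda>t. inverse (?g t) * f (x + ?g t *s v))) has_derivative
      blinfun_apply (integral (cbox 0 1) (fx x0))) (at x0 within ball x0 d)"
    by (rule leibniz_rule[OF der integrable_continuous[OF cf] cfx x0 convex_ball])
  then have "((\<lambda>x. integral (cbox 0 1) (\<lambda>t. inverse (?g t) * f (x + ?g t *s v))) has_derivative
      blinfun_apply (integral (cbox 0 1) (fx x0))) (at x0)"
    using d(1) by (simp add: at_within_open[of x0 "ball x0 d"])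
  then have fin: "((\<lambda>x. frechet_derivative f (at x) v) has_derivative
      blinfun_apply (integral (cbox 0 1) (fx x0))) (at x0)"
  proof (rule has_derivative_transform_within_open[where s="ball x0 d"])
    show "integral (cbox 0 1) (\<lambda>t. inverse (?g t) * f (x + ?g t *s v)) = frechet_derivative f (at x) v"
      if "x \<in> ball x0 d" for x
      by (rule directional_derivative_Cauchy_integral[OF hol d(2) inS[OF that], symmetric])
  qed (use d in auto)
  have int: "fx x0 integrable_on cbox 0 1"
    by (intro integrable_continuous continuous_on_compose2[OF cfx, of _ "\<lambda>t. (x0, t)", simplified split_beta fst_conv snd_conv])
      (use x0 in \<open>auto intro!: continuous_intros\<close>)
  have app: "blinfun_apply (integral (cbox 0 1) (fx x0)) w = integral (cbox 0 1) (\<lambda>t. blinfun_apply (fx x0 t) w)" for w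
    using integral_linear[OF int, of "\<lambda>B. blinfun_apply B w"] by (simp add: o_def blinfun.bounded_linear_left)
  have "blinfun_apply (integral (cbox 0 1) (fx x0)) (a *s w) = a * blinfun_apply (integral (cbox 0 1) (fx x0)) w" for a w
  proof -
    have "blinfun_apply (fx x0 t) (a *s w) = a * blinfun_apply (fx x0 t) w" for t
      using lin[of "x0 + ?g t *s v" a w] inS[OF x0] n by (simp add: fx_def)
    then show ?thesis unfolding app by simp
  qed
  then show "(\<lambda>x. frechet_derivative f (at x) v) differentiable at x0 \<and>
    (\<forall>a w. frechet_derivative (\<lambda>x. frechet_derivative f (at x) v) (at x0) (a *s w) =
           a * frechet_derivative (\<lambda>x. frechet_derivative f (at x) v) (at x0) w)"
    using fin frechet_derivative_at[OF fin] by (auto simp: differentiable_def)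
qed

text \<open>Directional derivatives of a holomorphic function are holomorphic, so the process can be iterated.\<close>

lemma several_holomorphic_imp_smooth_on:
  fixes f :: "complex^'n::finite \<Rightarrow> complex"
  assumes "several_holomorphic_on f S" and S: "open S"
  shows "smooth_on f S"
proof -
  have "Ck_on k f S" for k
    using assms(1)
  proof (induction k arbitrary: f)
    case 0
    then show ?case by (simp add: several_holomorphic_imp_continuous_on)
  next
    case (Suc k)
    then have "Ck_on k (\<lambda>x. frechet_derivative f (at x) v) S" for v
      using several_holomorphic_directional_derivative S by blast
    then show ?case using Suc.prems by (auto simp: several_holomorphic_on_def)
  qed
  then show ?thesis by (simp add: smooth_on_def)
qed

lemma holomorphic_map_imp_smooth_on:
  fixes F :: "complex^'n::finite \<Rightarrow> complex^'m::finite"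
  assumes "holomorphic_map_on F S" "open S"
  shows "smooth_on F S"
  by (intro smooth_on_vec assms(2) several_holomorphic_imp_smooth_on holomorphic_map_on_component[OF assms(1)])

section \<open>Wirtinger derivatives\<close>

lemma vec_eq_sum_real_axes:
  "(v :: complex^'n::finite) = (\<Sum>i\<in>UNIV. Re (v $ i) *\<^sub>R axis i 1 + Im (v $ i) *\<^sub>R axis i \<i>)"
proof -
  have "(\<Sum>i\<in>UNIV. Re (v $ i) *\<^sub>R axis i 1 + Im (v $ i) *\<^sub>R axis i \<i>) $ k = v $ k" for k
  proof -
    have "(\<Sum>i\<in>UNIV. Re (v $ i) *\<^sub>R axis i 1 + Im (v $ i) *\<^sub>R axis i \<i>) $ k =
        (\<Sum>i\<in>UNIV. if i = k then of_real (Re (v $ k)) + of_real (Im (v $ k)) * \<i> else 0)"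
      unfolding sum_component by (intro sum.cong) (auto simp: axis_def complex_eq_iff)
    then show ?thesis by (simp add: complex_eq_iff)
  qed
  then show ?thesis by (simp add: vec_eq_iff)
qed

text \<open>The coordinate vectors \<open>e\<^sub>i\<close> and \<open>\<i> e\<^sub>i\<close> span the space over the reals; on the two of them the sum and the difference
of the complex linear and the antilinear part can be read off.\<close>

lemma frechet_derivative_eq_wirtinger:
  fixes F :: "complex^'n::finite \<Rightarrow> complex"
  assumes "F differentiable at x"
  shows "frechet_derivative F (at x) v = (\<Sum>i\<in>UNIV. wirt i F x * v $ i + wirt_bar i F x * cnj (v $ i))"
proof -
  have lin: "linear (frechet_derivative F (at x))"
    using has_derivative_linear[OF has_frechet_derivative[OF assms]] .
  have "frechet_derivative F (at x) v = frechet_derivative F (at x)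
      (\<Sum>i\<in>UNIV. Re (v $ i) *\<^sub>R axis i 1 + Im (v $ i) *\<^sub>R axis i \<i>)"
    using vec_eq_sum_real_axes[of v] by simp
  also have "\<dots> = (\<Sum>i\<in>UNIV. of_real (Re (v $ i)) * frechet_derivative F (at x) (axis i 1)
      + of_real (Im (v $ i)) * frechet_derivative F (at x) (axis i \<i>))"
    by (simp only: linear_sum[OF lin] linear_add[OF lin] linear_scale[OF lin]) (simp add: scaleR_conv_of_real)
  also have "\<dots> = (\<Sum>i\<in>UNIV. wirt i F x * v $ i + wirt_bar i F x * cnj (v $ i))"
  proof (rule sum.cong)
    fix i :: 'n
    have "a * r + b * s = (a - \<i> * b) / 2 * (r + \<i> * s) + (a + \<i> * b) / 2 * (r - \<i> * s)" for a b r s :: complex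
      by (simp add: field_simps)
    moreover have "of_real (Re z) + \<i> * of_real (Im z) = z" "of_real (Re z) - \<i> * of_real (Im z) = cnj z" for z
      by (simp_all add: complex_eq_iff)
    ultimately have "a * of_real (Re z) + b * of_real (Im z) = (a - \<i> * b) / 2 * z + (a + \<i> * b) / 2 * cnj z" for a b z
      by metis
    from this[of "frechet_derivative F (at x) (axis i 1)" "v $ i"
        "frechet_derivative F (at x) (axis i \<i>)"]
    show "of_real (Re (v $ i)) * frechet_derivative F (at x) (axis i 1)
      + of_real (Im (v $ i)) * frechet_derivative F (at x) (axis i \<i>) =
      wirt i F x * v $ i + wirt_bar i F x * cnj (v $ i)"
      unfolding wirt_def wirt_bar_def by (simp only: mult.commute[of "of_real _" "frechet_derivative _ _ _"])
  qed simp
  finally show ?thesis .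
qed

text \<open>All computation rules below are read off from this: differentiate by the real rules, then compare coefficients.\<close>

lemma wirtinger_unique:
  fixes F :: "complex^'n::finite \<Rightarrow> complex"
  assumes "(F has_derivative (\<lambda>v. \<Sum>i\<in>UNIV. a i * v $ i + b i * cnj (v $ i))) (at x)"
  shows "wirt i F x = a i" "wirt_bar i F x = b i"
proof -
  have *: "frechet_derivative F (at x) = (\<lambda>v. \<Sum>i\<in>UNIV. a i * v $ i + b i * cnj (v $ i))"
    using frechet_derivative_at[OF assms] by simp
  have "frechet_derivative F (at x) (axis i c) = a i * c + b i * cnj c" for c
  proof -
    have "frechet_derivative F (at x) (axis i c) = (\<Sum>j\<in>UNIV. if j = i then a i * c + b i * cnj c else 0)"
      unfolding * by (rule sum.cong) (auto simp: axis_def)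
    then show ?thesis by simp
  qed
  then show "wirt i F x = a i" "wirt_bar i F x = b i"
    unfolding wirt_def wirt_bar_def by (simp_all add: algebra_simps)
qed

lemma has_derivative_wirtinger:
  fixes F :: "complex^'n::finite \<Rightarrow> complex"
  assumes "F differentiable at x"
  shows "(F has_derivative (\<lambda>v. \<Sum>i\<in>UNIV. wirt i F x * v $ i + wirt_bar i F x * cnj (v $ i))) (at x)"
  using has_frechet_derivative[OF assms] frechet_derivative_eq_wirtinger[OF assms] by (metis (no_types, lifting) ext)

context
  fixes F G :: "complex^'n::finite \<Rightarrow> complex" and x
  assumes F: "F differentiable at x" and G: "G differentiable at x"
begin

lemma wirt_add: "wirt i (\<lambda>y. F y + G y) x = wirt i F x + wirt i G x"
  and wirt_bar_add: "wirt_bar i (\<lambda>y. F y + G y) x = wirt_bar i F x + wirt_bar i G x"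
proof -
  have "((\<lambda>y. F y + G y) has_derivative (\<lambda>v. \<Sum>i\<in>UNIV. (wirt i F x + wirt i G x) * v $ i +
      (wirt_bar i F x + wirt_bar i G x) * cnj (v $ i))) (at x)"
    by (rule has_derivative_eq_rhs[OF has_derivative_add[OF has_derivative_wirtinger[OF F] has_derivative_wirtinger[OF G]]])
      (simp add: sum.distrib algebra_simps)
  from wirtinger_unique[OF this]
  show "wirt i (\<lambda>y. F y + G y) x = wirt i F x + wirt i G x"
    "wirt_bar i (\<lambda>y. F y + G y) x = wirt_bar i F x + wirt_bar i G x" by auto
qed

lemma wirt_mult: "wirt i (\<lambda>y. F y * G y) x = wirt i F x * G x + F x * wirt i G x"
  and wirt_bar_mult: "wirt_bar i (\<lambda>y. F y * G y) x = wirt_bar i F x * G x + F x * wirt_bar i G x"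
proof -
  have "((\<lambda>y. F y * G y) has_derivative (\<lambda>v. \<Sum>i\<in>UNIV. (wirt i F x * G x + F x * wirt i G x) * v $ i +
      (wirt_bar i F x * G x + F x * wirt_bar i G x) * cnj (v $ i))) (at x)"
    by (rule has_derivative_eq_rhs[OF has_derivative_mult[OF has_derivative_wirtinger[OF F] has_derivative_wirtinger[OF G]]])
      (simp add: sum.distrib algebra_simps sum_distrib_left sum_distrib_right)
  from wirtinger_unique[OF this]
  show "wirt i (\<lambda>y. F y * G y) x = wirt i F x * G x + F x * wirt i G x"
    "wirt_bar i (\<lambda>y. F y * G y) x = wirt_bar i F x * G x + F x * wirt_bar i G x" by auto
qed

lemma wirt_cnj: "wirt i (\<lambda>y. cnj (F y)) x = cnj (wirt_bar i F x)"
  and wirt_bar_cnj: "wirt_bar i (\<lambda>y. cnj (F y)) x = cnj (wirt i F x)"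
proof -
  have "((\<lambda>y. cnj (F y)) has_derivative (\<lambda>v. \<Sum>i\<in>UNIV. cnj (wirt_bar i F x) * v $ i +
      cnj (wirt i F x) * cnj (v $ i))) (at x)"
    by (rule has_derivative_eq_rhs[OF bounded_linear.has_derivative[OF bounded_linear_cnj has_derivative_wirtinger[OF F]]])
      (simp add: fun_eq_iff add.commute)
  from wirtinger_unique[OF this]
  show "wirt i (\<lambda>y. cnj (F y)) x = cnj (wirt_bar i F x)" "wirt_bar i (\<lambda>y. cnj (F y)) x = cnj (wirt i F x)" by auto
qed

end

lemma wirt_const: "wirt i (\<lambda>y. c) x = 0" and wirt_bar_const: "wirt_bar i (\<lambda>y. c) x = 0"
  by (simp_all add: wirt_def wirt_bar_def frechet_derivative_const)

lemma
  assumes "open S" "x \<in> S" "\<And>y. y \<in> S \<Longrightarrow> F y = G y" "F differentiable at x"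
  shows wirt_cong_open: "wirt i F x = wirt i G x" and wirt_bar_cong_open: "wirt_bar i F x = wirt_bar i G x"
  using frechet_derivative_transform_within_open[OF assms(4,1,2,3)] by (simp_all add: wirt_def wirt_bar_def)

lemma
  assumes "open S" "smooth_on F S"
  shows smooth_on_wirt: "smooth_on (wirt i F) S" and smooth_on_wirt_bar: "smooth_on (wirt_bar i F) S"
proof -
  note fr = smooth_on_frechet_derivative[OF assms(2)]
  have "smooth_on (\<lambda>x. (frechet_derivative F (at x) (axis i 1) - \<i> * frechet_derivative F (at x) (axis i \<i>)) * (1/2)) S"
    "smooth_on (\<lambda>x. (frechet_derivative F (at x) (axis i 1) + \<i> * frechet_derivative F (at x) (axis i \<i>)) * (1/2)) S"
    by (intro smooth_on_mult smooth_on_diff smooth_on_add smooth_on_const fr assms(1))+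
  then show "smooth_on (wirt i F) S" "smooth_on (wirt_bar i F) S"
    by (simp_all add: wirt_def[abs_def] wirt_bar_def[abs_def])
qed

lemma
  assumes S: "open S" "x \<in> S" and sm: "smooth_on F S"
  shows wirt_commute: "wirt i (wirt j F) x = wirt j (wirt i F) x"
    and wirt_wirt_bar_commute: "wirt i (wirt_bar j F) x = wirt_bar j (wirt i F) x"
proof -
  let ?D = "\<lambda>u v. frechet_derivative (\<lambda>y. frechet_derivative F (at y) u) (at x) v"
  have dd: "(\<lambda>y. frechet_derivative F (at y) u) differentiable at x" for u
    using smooth_on_imp_differentiable[OF smooth_on_frechet_derivative[OF sm] S(2)] .
  have d1: "frechet_derivative (wirt j F) (at x) v = (?D (axis j 1) v - \<i> * ?D (axis j \<i>) v) / 2"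
    "frechet_derivative (wirt_bar j F) (at x) v = (?D (axis j 1) v + \<i> * ?D (axis j \<i>) v) / 2" for v j
  proof -
    note h = has_frechet_derivative[OF dd]
    have "((wirt j F) has_derivative (\<lambda>v. (?D (axis j 1) v - \<i> * ?D (axis j \<i>) v) / 2)) (at x)"
      unfolding wirt_def[abs_def]
      by (rule bounded_linear.has_derivative[OF bounded_linear_divide]
          has_derivative_diff h has_derivative_mult_right)+
    from fun_cong[OF frechet_derivative_at[OF this], of v]
    show "frechet_derivative (wirt j F) (at x) v = (?D (axis j 1) v - \<i> * ?D (axis j \<i>) v) / 2" by (rule sym)
    have "((wirt_bar j F) has_derivative (\<lambda>v. (?D (axis j 1) v + \<i> * ?D (axis j \<i>) v) / 2)) (at x)"
      unfolding wirt_bar_def[abs_def]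
      by (rule bounded_linear.has_derivative[OF bounded_linear_divide]
          has_derivative_add h has_derivative_mult_right)+
    from fun_cong[OF frechet_derivative_at[OF this], of v]
    show "frechet_derivative (wirt_bar j F) (at x) v = (?D (axis j 1) v + \<i> * ?D (axis j \<i>) v) / 2" by (rule sym)
  qed
  note c = frechet_derivative_commute[OF sm S]
  have mixed1: "((a - \<i> * b) / 2 - \<i> * ((c - \<i> * d) / 2)) / 2 = ((a - \<i> * c) / 2 - \<i> * ((b - \<i> * d) / 2)) / 2"
    and mixed2: "((a + \<i> * b) / 2 - \<i> * ((c + \<i> * d) / 2)) / 2 = ((a - \<i> * c) / 2 + \<i> * ((b - \<i> * d) / 2)) / 2"
    for a b c d by (simp_all add: field_simps)
  show "wirt i (wirt j F) x = wirt j (wirt i F) x"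
    unfolding wirt_def[of i "wirt j F"] wirt_def[of j "wirt i F"] d1
    unfolding c[of "axis i 1" "axis j 1"] c[of "axis i \<i>" "axis j 1"] c[of "axis i 1" "axis j \<i>"] c[of "axis i \<i>" "axis j \<i>"]
    by (rule mixed1)
  show "wirt i (wirt_bar j F) x = wirt_bar j (wirt i F) x"
    unfolding wirt_def[of i "wirt_bar j F"] wirt_bar_def[of j "wirt i F"] d1
    unfolding c[of "axis i 1" "axis j 1"] c[of "axis i \<i>" "axis j 1"] c[of "axis i 1" "axis j \<i>"] c[of "axis i \<i>" "axis j \<i>"]
    by (rule mixed2)
qed

lemma wirt_bar_holomorphic:
  assumes "several_holomorphic_on f S" "x \<in> S"
  shows "wirt_bar i f x = 0"
proof -
  have "axis i \<i> = \<i> *s axis i 1" by (simp add: axis_def vec_eq_iff)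
  then have "frechet_derivative f (at x) (axis i \<i>) = \<i> * frechet_derivative f (at x) (axis i 1)"
    using assms by (simp add: several_holomorphic_on_def)
  then show ?thesis by (simp add: wirt_bar_def)
qed

lemma several_holomorphic_has_derivative:
  fixes P :: "complex^'n::finite \<Rightarrow> complex^'m::finite"
  assumes hol: "\<And>k. several_holomorphic_on (\<lambda>y. P y $ k) S" and x: "x \<in> S"
  shows "(P has_derivative (\<lambda>v. \<chi> k. \<Sum>i\<in>UNIV. wirt i (\<lambda>y. P y $ k) x * v $ i)) (at x)"
  unfolding has_derivative_componentwise_within[of P]
proof
  have d: "(\<lambda>y. P y $ k) differentiable at x" for k using hol x by (auto simp: several_holomorphic_on_def)
  have dk: "((\<lambda>y. P y $ k) has_derivative (\<lambda>v. \<Sum>i\<in>UNIV. wirt i (\<lambda>y. P y $ k) x * v $ i)) (at x)" for k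
    using has_derivative_wirtinger[OF d, of k] by (simp add: wirt_bar_holomorphic[OF hol x])
  fix b :: "complex^'m" assume "b \<in> Basis"
  then obtain k c where b: "b = axis k c" by (auto simp: Basis_vec_def)
  show "((\<lambda>x. P x \<bullet> b) has_derivative (\<lambda>v. (\<chi> k. \<Sum>i\<in>UNIV. wirt i (\<lambda>y. P y $ k) x * v $ i) \<bullet> b)) (at x)"
    unfolding b inner_axis by (simp add: bounded_linear.has_derivative[OF bounded_linear_inner_left dk])
qed

lemma
  fixes F :: "complex^'m::finite \<Rightarrow> complex" and P :: "complex^'n::finite \<Rightarrow> complex^'m"
  assumes hol: "\<And>k. several_holomorphic_on (\<lambda>y. P y $ k) S" and x: "x \<in> S" and F: "F differentiable at (P x)"
  shows wirt_holomorphic_compose: "wirt i (\<lambda>y. F (P y)) x = (\<Sum>k\<in>UNIV. wirt i (\<lambda>y. P y $ k) x * wirt k F (P x))"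
    and wirt_bar_holomorphic_compose:
      "wirt_bar i (\<lambda>y. F (P y)) x = (\<Sum>k\<in>UNIV. cnj (wirt i (\<lambda>y. P y $ k) x) * wirt_bar k F (P x))"
proof -
  note P = several_holomorphic_has_derivative[OF hol x]
  have "((\<lambda>y. F (P y)) has_derivative (\<lambda>v. \<Sum>i\<in>UNIV.
      (\<Sum>k\<in>UNIV. wirt i (\<lambda>y. P y $ k) x * wirt k F (P x)) * v $ i +
      (\<Sum>k\<in>UNIV. cnj (wirt i (\<lambda>y. P y $ k) x) * wirt_bar k F (P x)) * cnj (v $ i))) (at x)"
  proof (rule has_derivative_eq_rhs[OF has_derivative_compose[OF P has_derivative_wirtinger[OF F]]], rule ext)
    fix v
    show "(\<Sum>k\<in>UNIV. wirt k F (P x) * (\<chi> k. \<Sum>i\<in>UNIV. wirt i (\<lambda>y. P y $ k) x * v $ i) $ k +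
        wirt_bar k F (P x) * cnj ((\<chi> k. \<Sum>i\<in>UNIV. wirt i (\<lambda>y. P y $ k) x * v $ i) $ k)) =
      (\<Sum>i\<in>UNIV. (\<Sum>k\<in>UNIV. wirt i (\<lambda>y. P y $ k) x * wirt k F (P x)) * v $ i +
      (\<Sum>k\<in>UNIV. cnj (wirt i (\<lambda>y. P y $ k) x) * wirt_bar k F (P x)) * cnj (v $ i))"
      unfolding sum.distrib vec_lambda_beta sum_distrib_right cnj_sum sum_distrib_left
      by (subst (1 2) sum.swap) (simp add: ac_simps)
  qed
  from wirtinger_unique[OF this]
  show "wirt i (\<lambda>y. F (P y)) x = (\<Sum>k\<in>UNIV. wirt i (\<lambda>y. P y $ k) x * wirt k F (P x))"
    "wirt_bar i (\<lambda>y. F (P y)) x = (\<Sum>k\<in>UNIV. cnj (wirt i (\<lambda>y. P y $ k) x) * wirt_bar k F (P x))" by auto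
qed

section \<open>The volume density as a Pfaffian\<close>

text \<open>Up to the factor \<open>2\<^sup>n n!\<close> this is the Pfaffian of \<open>W\<close> when \<open>W\<close> is alternating. The sum makes sense for every \<open>W\<close>,
and \<open>volume_density\<close> is such a sum.\<close>

definition pfaffian_sum :: "('n::finite \<times> bool \<Rightarrow> 'n \<times> bool \<Rightarrow> 'a::comm_ring_1) \<Rightarrow> 'a" where
  "pfaffian_sum W = (\<Sum>\<sigma> | \<sigma> permutes (UNIV :: ('n \<times> bool) set). of_int (sign \<sigma>) *
     (\<Prod>i\<in>UNIV. W (\<sigma> (i, False)) (\<sigma> (i, True))))"

lemma prod_UNIV_times_bool:
  fixes f :: "'n::finite \<times> bool \<Rightarrow> 'a::comm_monoid_mult"
  shows "(\<Prod>x\<in>UNIV. f x) = (\<Prod>i\<in>UNIV. f (i, False) * f (i, True))"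
proof -
  have "(\<Prod>x\<in>UNIV. f x) = (\<Prod>i\<in>UNIV. \<Prod>b\<in>UNIV. f (i, b))"
    unfolding UNIV_Times_UNIV[symmetric] by (simp add: prod.cartesian_product)
  then show ?thesis by (simp add: UNIV_bool mult.commute)
qed

lemma sum_UNIV_times_bool:
  fixes f :: "'n::finite \<times> bool \<Rightarrow> 'a::comm_monoid_add"
  shows "(\<Sum>x\<in>UNIV. f x) = (\<Sum>i\<in>UNIV. f (i, False) + f (i, True))"
proof -
  have "(\<Sum>x\<in>UNIV. f x) = (\<Sum>i\<in>UNIV. \<Sum>b\<in>UNIV. f (i, b))"
    unfolding UNIV_Times_UNIV[symmetric] by (simp add: sum.cartesian_product)
  then show ?thesis by (simp add: UNIV_bool add.commute)
qed

text \<open>A repeated row kills the determinant, so only permutations survive when a product of row sums is expanded.\<close>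

lemma det_rows_selection:
  fixes L :: "'a::comm_ring_1^'m::finite^'m"
  shows "det (\<chi> x. L $ \<tau> x) = (if \<tau> permutes UNIV then of_int (sign \<tau>) * det L else 0)"
proof (cases "\<tau> permutes UNIV")
  case True
  then show ?thesis using det_permute_rows[OF True, of L] by simp
next
  case False
  have "\<not> inj \<tau>"
  proof
    assume "inj \<tau>"
    then have "bij \<tau>" using finite_UNIV_inj_surj[OF finite \<open>inj \<tau>\<close>] by (simp add: bij_def)
    with False show False using bij_imp_permutes[of \<tau> UNIV] by auto
  qed
  then obtain a b where "a \<noteq> b" "\<tau> a = \<tau> b" by (auto simp: inj_def)
  then have "det (\<chi> x. L $ \<tau> x) = 0"
    by (intro det_identical_rows[of a b]) (auto simp: row_def)
  with False show ?thesis by simp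
qed

text \<open>The rule \<open>Pf(L\<^sup>T W L) = det L Pf W\<close>. Expanding the product of double sums gives a sum over all selections of rows of \<open>L\<close>; summing
over \<open>\<sigma>\<close> first turns the coefficient of each selection into a determinant, which vanishes unless the selection is a permutation.\<close>

lemma pfaffian_sum_congruence:
  fixes L :: "'a::comm_ring_1^('n::finite \<times> bool)^('n \<times> bool)"
  shows "pfaffian_sum (\<lambda>x y. \<Sum>z\<in>UNIV. \<Sum>w\<in>UNIV. L $ z $ x * L $ w $ y * W z w) = det L * pfaffian_sum W"
proof -
  \<comment> \<open>One pair of rows is chosen for every factor; \<open>\<tau>\<close> rearranges these choices into one selection of rows for all \<open>2n\<close> indices.\<close>
  define \<tau> :: "('n \<Rightarrow> ('n \<times> bool) \<times> ('n \<times> bool)) \<Rightarrow> 'n \<times> bool \<Rightarrow> 'n \<times> bool"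
    where "\<tau> g x = (if snd x then snd (g (fst x)) else fst (g (fst x)))" for g x
  have expand: "(\<Prod>i\<in>UNIV. \<Sum>z\<in>UNIV. \<Sum>w\<in>UNIV. L $ z $ \<sigma> (i, False) * L $ w $ \<sigma> (i, True) * W z w) =
      (\<Sum>g\<in>UNIV. (\<Prod>i\<in>UNIV. W (\<tau> g (i, False)) (\<tau> g (i, True))) * (\<Prod>x\<in>UNIV. L $ \<tau> g x $ \<sigma> x))" for \<sigma>
  proof -
    have "(\<Prod>i\<in>UNIV. \<Sum>z\<in>UNIV. \<Sum>w\<in>UNIV. L $ z $ \<sigma> (i, False) * L $ w $ \<sigma> (i, True) * W z w) =
       (\<Prod>i\<in>UNIV. \<Sum>p\<in>UNIV. L $ fst p $ \<sigma> (i, False) * L $ snd p $ \<sigma> (i, True) * W (fst p) (snd p))"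
      unfolding UNIV_Times_UNIV[symmetric] sum.cartesian_product by (simp add: case_prod_unfold)
    also have "\<dots> = (\<Sum>g\<in>UNIV. \<Prod>i\<in>UNIV. L $ fst (g i) $ \<sigma> (i, False) * L $ snd (g i) $ \<sigma> (i, True) * W (fst (g i)) (snd (g i)))"
      by (subst prod_sum_PiE) auto
    also have "\<dots> = (\<Sum>g\<in>UNIV. (\<Prod>i\<in>UNIV. W (\<tau> g (i, False)) (\<tau> g (i, True))) * (\<Prod>x\<in>UNIV. L $ \<tau> g x $ \<sigma> x))"
      unfolding prod_UNIV_times_bool \<tau>_def by (simp add: prod.distrib ac_simps)
    finally show ?thesis .
  qed
  have "pfaffian_sum (\<lambda>x y. \<Sum>z\<in>UNIV. \<Sum>w\<in>UNIV. L $ z $ x * L $ w $ y * W z w) =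
     (\<Sum>g\<in>UNIV. (\<Prod>i\<in>UNIV. W (\<tau> g (i, False)) (\<tau> g (i, True))) * det (\<chi> x. L $ \<tau> g x))"
    unfolding pfaffian_sum_def expand det_def sum_distrib_left
    by (subst sum.swap) (simp add: ac_simps)
  also have "\<dots> = (\<Sum>t\<in>UNIV. (\<Prod>i\<in>UNIV. W (t (i, False)) (t (i, True))) * det (\<chi> x. L $ t x))"
    by (rule sum.reindex_bij_witness[of _ "\<lambda>t i. (t (i, False), t (i, True))" \<tau>])
      (auto simp: \<tau>_def fun_eq_iff)
  also have "\<dots> = (\<Sum>t | t permutes UNIV. (\<Prod>i\<in>UNIV. W (t (i, False)) (t (i, True))) * (of_int (sign t) * det L))"
    unfolding det_rows_selection by (rule sum.mono_neutral_cong_right) auto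
  also have "\<dots> = det L * pfaffian_sum W"
    unfolding pfaffian_sum_def sum_distrib_left by (simp add: ac_simps)
  finally show ?thesis .
qed

lemma permutation_finite_bij: "bij (f :: 'm::finite \<Rightarrow> 'm) \<Longrightarrow> permutation f"
  by (simp add: permutation)

text \<open>A permutation of the pairs acts on first and on second members alike, hence is a product of two copies of \<open>p\<close>.\<close>

lemma sign_lift:
  fixes p :: "'n::finite \<Rightarrow> 'n"
  assumes "p permutes UNIV"
  shows "sign (\<lambda>x :: 'n \<times> bool. (p (fst x), snd x)) = 1"
proof -
  define l where "l b = map_permutation UNIV (\<lambda>i. (i, b :: bool)) p" for b
  have inj: "inj (\<lambda>i::'n. (i, b :: bool))" for b by (auto simp: inj_def)
  have perm: "l b permutes range (\<lambda>i. (i, b))" for b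
    unfolding l_def by (rule map_permutation_permutes) (use assms inj in \<open>auto simp: bij_betw_def\<close>)
  have l: "l b (i, c) = (if b = c then (p i, c) else (i, c))" for b i c
    using inv_f_f[OF inj[of True], of i] inv_f_f[OF inj[of False], of i]
    unfolding l_def map_permutation_def by (cases b; cases c) (auto simp: restrict_id_def)
  have "(\<lambda>x :: 'n \<times> bool. (p (fst x), snd x)) = l False \<circ> l True"
    by (auto simp: fun_eq_iff l)
  moreover have "sign (l b) = sign p" for b
    unfolding l_def by (rule sign_map_permutation) (use assms inj in auto)
  moreover have "permutation (l b)" for b
    using perm permutation_permutes by (metis finite)
  ultimately show ?thesis by (simp only: sign_compose sign_idempotent)
qed

definition swap_pairs :: "'n set \<Rightarrow> 'n \<times> bool \<Rightarrow> 'n \<times> bool" where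
  "swap_pairs T x = (fst x, if fst x \<in> T then \<not> snd x else snd x)"

lemma bij_swap_pairs: "bij (swap_pairs T)"
  by (rule o_bij[of "swap_pairs T"]) (auto simp: swap_pairs_def fun_eq_iff)

lemma sign_swap_pairs:
  fixes T :: "'n::finite set"
  shows "sign (swap_pairs T) = (-1) ^ card T"
  using finite[of T]
proof (induction T rule: finite_induct)
  case empty
  have "swap_pairs {} = (id :: 'n \<times> bool \<Rightarrow> _)" by (auto simp: swap_pairs_def fun_eq_iff)
  then show ?case by simp
next
  case (insert i T)
  have eq: "swap_pairs (insert i T) = Transposition.transpose (i, False) (i, True) \<circ> swap_pairs T"
    using insert(2) by (auto simp: swap_pairs_def fun_eq_iff Transposition.transpose_def)
  show ?case
    unfolding eq sign_compose[OF permutation_swap_id permutation_finite_bij[OF bij_swap_pairs]]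
    using insert by (simp add: sign_swap_id)
qed

text \<open>The form \<open>\<Sum> dx\<^sub>i \<and> dy\<^sub>i\<close> on the real coordinate frame.\<close>

definition standard_form :: "'n \<times> bool \<Rightarrow> 'n \<times> bool \<Rightarrow> int" where
  "standard_form x y = (if fst x = fst y \<and> snd x \<noteq> snd y then if snd y then 1 else -1 else 0)"

text \<open>A permutation with nonzero contribution maps pairs to pairs: it permutes the pairs, an even permutation, after swapping the members of
those in some set \<open>T\<close>. Both its sign and the product are then \<open>(-1)\<^bsup>|T|\<^esup>\<close>.\<close>

lemma pfaffian_term_nonneg:
  fixes \<sigma> :: "'n::finite \<times> bool \<Rightarrow> 'n \<times> bool"
  assumes "\<sigma> permutes UNIV"
  shows "sign \<sigma> * (\<Prod>i\<in>UNIV. standard_form (\<sigma> (i, False)) (\<sigma> (i, True))) \<ge> 0"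
proof (cases "\<forall>i. fst (\<sigma> (i, False)) = fst (\<sigma> (i, True))")
  case False
  then obtain i where "fst (\<sigma> (i, False)) \<noteq> fst (\<sigma> (i, True))" by blast
  then have "(\<Prod>i\<in>UNIV. standard_form (\<sigma> (i, False)) (\<sigma> (i, True))) = 0"
    by (intro prod_zero) (auto simp: standard_form_def intro!: bexI[of _ i])
  then show ?thesis by (simp only: mult_zero_right)
next
  case True
  have bij: "bij \<sigma>" using assms by (rule permutes_bij)
  have ne: "snd (\<sigma> (i, False)) \<noteq> snd (\<sigma> (i, True))" for i
  proof
    assume "snd (\<sigma> (i, False)) = snd (\<sigma> (i, True))"
    with True have "\<sigma> (i, False) = \<sigma> (i, True)" by (simp add: prod_eq_iff)
    then show False using bij by (auto simp: bij_def inj_def)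
  qed
  define p where "p i = fst (\<sigma> (i, False))" for i
  define T where "T = {i. snd (\<sigma> (i, False))}"
  have s: "\<sigma> = (\<lambda>x. (p (fst x), snd x)) \<circ> swap_pairs T"
  proof
    fix x :: "'n \<times> bool"
    obtain i b where x: "x = (i, b)" by (cases x)
    show "\<sigma> x = ((\<lambda>x. (p (fst x), snd x)) \<circ> swap_pairs T) x"
      using True[rule_format, of i] ne[of i] unfolding x p_def T_def swap_pairs_def
      by (cases b) (auto simp: prod_eq_iff)
  qed
  have "inj p"
  proof (rule injI)
    fix i j assume "p i = p j"
    then have "\<sigma> (swap_pairs T (i, False)) = \<sigma> (swap_pairs T (j, False))"
      unfolding s by (auto simp: swap_pairs_def)
    then have "swap_pairs T (i, False) = swap_pairs T (j, False)"
      by (rule injD[OF bij_is_inj[OF bij]])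
    then show "i = j" by (simp add: swap_pairs_def)
  qed
  then have "bij p" using finite_UNIV_inj_surj[OF finite \<open>inj p\<close>] by (simp add: bij_def)
  then have p: "p permutes UNIV" by (intro bij_imp_permutes) auto
  have l: "bij (\<lambda>x :: 'n \<times> bool. (p (fst x), snd x))"
    using \<open>bij p\<close> by (auto simp: bij_def inj_def surj_def)
  have "sign \<sigma> = (-1) ^ card T"
    unfolding s sign_compose[OF permutation_finite_bij[OF l] permutation_finite_bij[OF bij_swap_pairs]]
    by (simp add: sign_lift[OF p] sign_swap_pairs)
  moreover have "(\<Prod>i\<in>UNIV. standard_form (\<sigma> (i, False)) (\<sigma> (i, True))) = (\<Prod>i\<in>UNIV. if i \<in> T then -1 else 1)"
    using True ne by (intro prod.cong) (auto simp: standard_form_def T_def)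
  moreover have "\<dots> = (-1) ^ card T"
    by (simp add: prod.If_cases)
  ultimately show ?thesis by (simp only: flip: power_mult_distrib) simp
qed

lemma pfaffian_standard_form_pos: "pfaffian_sum (standard_form :: 'n::finite \<times> bool \<Rightarrow> _) > 0"
proof -
  have "(\<Sum>\<sigma>\<in>{id :: 'n \<times> bool \<Rightarrow> _}. sign \<sigma> * (\<Prod>i\<in>UNIV. standard_form (\<sigma> (i, False)) (\<sigma> (i, True))))
     \<le> pfaffian_sum (standard_form :: 'n \<times> bool \<Rightarrow> _)"
    unfolding pfaffian_sum_def of_int_eq_id id_apply[of "sign _"]
    by (rule sum_mono2) (auto simp: permutes_id pfaffian_term_nonneg intro: finite_permutations)
  then show ?thesis by (simp add: standard_form_def)
qed

lemma kaehler_form_mat_1: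
  fixes x y :: "'n::finite \<times> bool"
  shows "kaehler_form (mat 1) (real_frame x) (real_frame y) = 2 * of_int (standard_form x y)"
proof -
  let ?u = "real_frame x :: complex^'n" and ?v = "real_frame y :: complex^'n"
  have "(\<Sum>i\<in>UNIV. \<Sum>j\<in>UNIV. mat 1 $ i $ j * (?u $ i * cnj (?v $ j) - ?v $ i * cnj (?u $ j))) =
     (\<Sum>i\<in>UNIV. \<Sum>j\<in>UNIV. if i = j then ?u $ j * cnj (?v $ j) - ?v $ j * cnj (?u $ j) else 0)"
    by (intro sum.cong) (auto simp: mat_def)
  also have "\<dots> = (\<Sum>i\<in>UNIV. ?u $ i * cnj (?v $ i) - ?v $ i * cnj (?u $ i))"
    by simp
  also have "\<dots> = (\<Sum>i\<in>UNIV. if i = fst x then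
      (if fst x = fst y then ?u $ fst x * cnj (?v $ fst x) - ?v $ fst x * cnj (?u $ fst x) else 0) else 0)"
    by (intro sum.cong) (auto simp: real_frame_def axis_def)
  finally show ?thesis
    unfolding kaehler_form_def
    by (cases "fst x = fst y"; cases "snd x"; cases "snd y")
      (simp_all add: standard_form_def real_frame_def axis_def algebra_simps)
qed

lemma pfaffian_sum_scale:
  fixes W :: "'n::finite \<times> bool \<Rightarrow> 'n \<times> bool \<Rightarrow> int"
  shows "pfaffian_sum (\<lambda>x y. c * of_int (W x y)) = (c :: 'a::comm_ring_1) ^ CARD('n) * of_int (pfaffian_sum W)"
  unfolding pfaffian_sum_def by (simp add: prod.distrib sum_distrib_left ac_simps)

lemma volume_density_eq_pfaffian:
  "volume_density (G :: complex^'n::finite^'n) =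
    Re (pfaffian_sum (\<lambda>x y. kaehler_form G (real_frame x) (real_frame y))) / (2 ^ CARD('n) * fact CARD('n))"
  by (simp add: volume_density_def pfaffian_sum_def)

lemma det_of_real: "det (\<chi> i j. complex_of_real (A $ i $ j)) = of_real (det A)"
  by (simp add: det_def)

text \<open>The matrix, in the real frame, of the complex linear map \<open>u \<mapsto> J\<^sup>T u\<close>.\<close>

definition real_matrix :: "complex^'m::finite^'n::finite \<Rightarrow> real^('n \<times> bool)^('m \<times> bool)" where
  "real_matrix J = (\<chi> z x. (if snd z then Im else Re) ((real_frame x v* J) $ fst z))"

lemma real_frame_expansion: "(u :: complex^'n::finite) = (\<Sum>z\<in>UNIV. (if snd z then Im else Re) (u $ fst z) *\<^sub>R real_frame z)"
  unfolding sum_UNIV_times_bool real_frame_def using vec_eq_sum_real_axes[of u] by simp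

lemma kaehler_form_bilinear: "bounded_bilinear (kaehler_form (G :: complex^'n::finite^'n))"
  unfolding bilinear_conv_bounded_bilinear[symmetric] bilinear_def
  by (auto intro!: linearI simp: kaehler_form_def sum.distrib sum_subtractf algebra_simps scaleR_conv_of_real[where 'a=complex] sum_distrib_left)

lemma kaehler_form_congruence:
  fixes J :: "complex^'m::finite^'n::finite"
  assumes "\<And>i j. G $ i $ j = (\<Sum>k\<in>UNIV. \<Sum>l\<in>UNIV. J $ i $ k * cnj (J $ j $ l) * H $ k $ l)"
  shows "kaehler_form G u v = kaehler_form H (u v* J) (v v* J)"
proof -
  have *: "(\<Sum>i\<in>UNIV. \<Sum>j\<in>UNIV. G $ i $ j * (u $ i * cnj (v $ j))) =
     (\<Sum>k\<in>UNIV. \<Sum>l\<in>UNIV. H $ k $ l * ((u v* J) $ k * cnj ((v v* J) $ l)))" for u v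
  proof -
    have "(\<Sum>i\<in>UNIV. \<Sum>j\<in>UNIV. G $ i $ j * (u $ i * cnj (v $ j))) =
      (\<Sum>i\<in>UNIV. \<Sum>j\<in>UNIV. \<Sum>k\<in>UNIV. \<Sum>l\<in>UNIV. J $ i $ k * cnj (J $ j $ l) * H $ k $ l * (u $ i * cnj (v $ j)))"
      unfolding assms sum_distrib_right ..
    also have "\<dots> = (\<Sum>k\<in>UNIV. \<Sum>l\<in>UNIV. \<Sum>i\<in>UNIV. \<Sum>j\<in>UNIV. J $ i $ k * cnj (J $ j $ l) * H $ k $ l * (u $ i * cnj (v $ j)))"
      by (simp add: sum.swap[of _ "UNIV :: 'm set" "UNIV :: 'n set"])
    also have "\<dots> = (\<Sum>k\<in>UNIV. \<Sum>l\<in>UNIV. H $ k $ l * ((u v* J) $ k * cnj ((v v* J) $ l)))"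
      unfolding vector_matrix_mult_def vec_lambda_beta cnj_sum complex_cnj_mult sum_product
      unfolding sum_distrib_left by (simp add: ac_simps)
    finally show ?thesis .
  qed
  show ?thesis
    unfolding kaehler_form_def right_diff_distrib sum_subtractf *
    using *[of u v] *[of v u] by (simp add: right_diff_distrib)
qed

text \<open>The density of \<open>\<omega>\<^sup>n/n!\<close> transforms by the real Jacobian determinant. Writing the images of the
frame vectors in the frame again displays the new values of the form as a congruence by \<open>real_matrix J\<close>.\<close>

lemma volume_density_congruence:
  fixes G H :: "complex^'n::finite^'n"
  assumes "\<And>i j. G $ i $ j = (\<Sum>k\<in>UNIV. \<Sum>l\<in>UNIV. J $ i $ k * cnj (J $ j $ l) * H $ k $ l)"
  shows "volume_density G = det (real_matrix J) * volume_density H"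
proof -
  let ?R = "\<chi> i j. complex_of_real (real_matrix J $ i $ j)"
  interpret b: bounded_bilinear "kaehler_form H" by (rule kaehler_form_bilinear)
  have "kaehler_form G (real_frame x) (real_frame y) =
      (\<Sum>z\<in>UNIV. \<Sum>w\<in>UNIV. ?R $ z $ x * ?R $ w $ y * kaehler_form H (real_frame z) (real_frame w))" for x y
  proof -
    have "kaehler_form G (real_frame x) (real_frame y) = kaehler_form H
        (\<Sum>z\<in>UNIV. real_matrix J $ z $ x *\<^sub>R real_frame z) (\<Sum>w\<in>UNIV. real_matrix J $ w $ y *\<^sub>R real_frame w)"
      unfolding kaehler_form_congruence[OF assms]
      using real_frame_expansion[of "real_frame x v* J"] real_frame_expansion[of "real_frame y v* J"]
      by (simp add: real_matrix_def)
    then show ?thesis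
      by (simp add: b.sum_left b.sum_right b.scaleR_left b.scaleR_right scaleR_conv_of_real[where 'a=complex] sum_distrib_left ac_simps)
        (subst sum.swap, simp add: ac_simps)
  qed
  then have "pfaffian_sum (\<lambda>x y. kaehler_form G (real_frame x) (real_frame y)) =
      det ?R * pfaffian_sum (\<lambda>x y. kaehler_form H (real_frame x) (real_frame y))"
    by (simp only: pfaffian_sum_congruence)
  then show ?thesis unfolding volume_density_eq_pfaffian det_of_real by simp
qed

text \<open>The block matrix with blocks \<open>G\<^sup>T\<close> and the identity. Its determinant is \<open>det G\<close>, but its index type is that of the
real frame, so that the congruence rule for Pfaffians applies to it.\<close>

definition pad_matrix :: "complex^'n::finite^'n \<Rightarrow> complex^('n \<times> bool)^('n \<times> bool)" where
  "pad_matrix G = (\<chi> z x. if snd z = snd x then if snd z then if fst z = fst x then 1 else 0 else G $ fst x $ fst z else 0)"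

lemma pad_matrix_nth:
  "pad_matrix G $ (i, False) $ (j, False) = G $ j $ i"
  "pad_matrix G $ (i, True) $ (j, True) = (if i = j then 1 else 0)"
  "pad_matrix G $ (i, False) $ (j, True) = 0"
  "pad_matrix G $ (i, True) $ (j, False) = 0"
  by (simp_all add: pad_matrix_def)

lemma pad_matrix_mult: "pad_matrix G ** pad_matrix H = pad_matrix (H ** G)"
proof -
  have "(pad_matrix G ** pad_matrix H) $ (i, b) $ (j, c) = pad_matrix (H ** G) $ (i, b) $ (j, c)" for i b j c
    by (cases b; cases c)
      (simp_all add: matrix_matrix_mult_def sum_UNIV_times_bool pad_matrix_nth mult_delta_left mult.commute)
  then show ?thesis by (simp add: vec_eq_iff)
qed

lemma pad_matrix_1: "pad_matrix (mat 1) = mat 1"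
  by (auto simp: pad_matrix_def mat_def vec_eq_iff prod_eq_iff)

text \<open>The form \<open>\<i> g\<^bsub>i\<bar>j\<^esub> dz\<^sup>i \<and> d\<bar>z\<^sup>j\<close> on the frame of the \<open>\<partial>/\<partial>z\<^sup>i\<close> (\<open>False\<close>) and \<open>\<partial>/\<partial>\<bar>z\<^sup>i\<close> (\<open>True\<close>).\<close>

definition mixed_form :: "complex^'n::finite^'n \<Rightarrow> 'n \<times> bool \<Rightarrow> 'n \<times> bool \<Rightarrow> complex" where
  "mixed_form G z w = (if snd z = snd w then 0 else if snd w then \<i> * G $ fst z $ fst w else - \<i> * G $ fst w $ fst z)"

text \<open>Acting on the \<open>\<partial>/\<partial>z\<^sup>i\<close> alone by \<open>G\<close> turns the standard form into the form of \<open>G\<close>: this congruence is complex linear in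
\<open>G\<close> and so brings in \<open>det G\<close> itself, without an absolute value or a square.\<close>

lemma mixed_form_congruence:
  "mixed_form G x y = (\<Sum>z\<in>UNIV. \<Sum>w\<in>UNIV. pad_matrix G $ z $ x * pad_matrix G $ w $ y * mixed_form (mat 1) z w)"
proof (cases x, cases y)
  fix i b j c assume "x = (i, b)" "y = (j, c)"
  then show ?thesis
    by (cases b; cases c)
      (simp_all add: mixed_form_def sum_UNIV_times_bool pad_matrix_nth mat_def mult_delta_left mult_delta_right
        sum_negf sum.distrib algebra_simps)
qed

text \<open>The passage from the real frame to the frame of the \<open>\<partial>/\<partial>z\<^sup>i\<close> and \<open>\<partial>/\<partial>\<bar>z\<^sup>i\<close>.\<close>

definition frame_matrix :: "complex^('n::finite \<times> bool)^('n \<times> bool)" where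
  "frame_matrix = (\<chi> z x. if snd z then cnj (real_frame x $ fst z) else real_frame x $ fst z)"

lemma kaehler_form_eq_mixed_form:
  "kaehler_form G (real_frame x) (real_frame y) =
    (\<Sum>z\<in>UNIV. \<Sum>w\<in>UNIV. frame_matrix $ z $ x * frame_matrix $ w $ y * mixed_form G z w)"
proof -
  have "(\<Sum>z\<in>UNIV. \<Sum>w\<in>UNIV. frame_matrix $ z $ x * frame_matrix $ w $ y * mixed_form G z w) =
    (\<Sum>i\<in>UNIV. \<Sum>j\<in>UNIV. real_frame x $ i * cnj (real_frame y $ j) * (\<i> * G $ i $ j)) +
    (\<Sum>i\<in>UNIV. \<Sum>j\<in>UNIV. cnj (real_frame x $ i) * real_frame y $ j * (- \<i> * G $ j $ i))"
    unfolding sum_UNIV_times_bool frame_matrix_def mixed_form_def by (simp add: sum.distrib)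
  also have "(\<Sum>i\<in>UNIV. \<Sum>j\<in>UNIV. cnj (real_frame x $ i) * real_frame y $ j * (- \<i> * G $ j $ i)) =
    (\<Sum>i\<in>UNIV. \<Sum>j\<in>UNIV. cnj (real_frame x $ j) * real_frame y $ i * (- \<i> * G $ i $ j))"
    by (rule sum.swap)
  finally show ?thesis
    unfolding kaehler_form_def sum_distrib_left by (simp add: sum.distrib[symmetric] algebra_simps)
qed

text \<open>Two congruences lead from the form of \<open>G\<close> to that of the identity matrix. The constant they leave behind does not depend on \<open>G\<close>,
so it can be found by taking \<open>G = 1\<close>.\<close>

lemma pfaffian_kaehler_form:
  fixes G :: "complex^'n::finite^'n"
  shows "pfaffian_sum (\<lambda>x y. kaehler_form G (real_frame x) (real_frame y)) =
    det (pad_matrix G) * of_real (2 ^ CARD('n) * of_int (pfaffian_sum (standard_form :: 'n \<times> bool \<Rightarrow> _)))"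
proof -
  let ?c = "det (frame_matrix :: complex^('n \<times> bool)^('n \<times> bool)) * pfaffian_sum (mixed_form (mat 1 :: complex^'n^'n))"
  have 1: "pfaffian_sum (\<lambda>x y. kaehler_form G (real_frame x) (real_frame y)) = det (pad_matrix G) * ?c"
    for G :: "complex^'n^'n"
  proof -
    have "pfaffian_sum (\<lambda>x y. kaehler_form G (real_frame x) (real_frame y)) =
        det (frame_matrix :: complex^('n \<times> bool)^('n \<times> bool)) * pfaffian_sum (mixed_form G)"
      unfolding kaehler_form_eq_mixed_form pfaffian_sum_congruence by (rule refl)
    also have "mixed_form G = (\<lambda>x y. \<Sum>z\<in>UNIV. \<Sum>w\<in>UNIV. pad_matrix G $ z $ x * pad_matrix G $ w $ y * mixed_form (mat 1) z w)"
      by (intro ext mixed_form_congruence)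
    finally show ?thesis unfolding pfaffian_sum_congruence by simp
  qed
  have "?c = of_real (2 ^ CARD('n) * of_int (pfaffian_sum (standard_form :: 'n \<times> bool \<Rightarrow> _)))"
    using 1[of "mat 1"] unfolding pad_matrix_1 kaehler_form_mat_1 pfaffian_sum_scale by simp
  then show ?thesis using 1 by simp
qed

text \<open>The density of the identity matrix, that is, \<open>2\<^sup>n\<close>.\<close>

definition unit_volume :: "'n::finite itself \<Rightarrow> real" where
  "unit_volume _ = of_int (pfaffian_sum (standard_form :: 'n \<times> bool \<Rightarrow> _)) / fact CARD('n)"

lemma unit_volume_pos: "unit_volume TYPE('n::finite) > 0"
  unfolding unit_volume_def using pfaffian_standard_form_pos[where 'n='n] by simp

lemma volume_density_eq_det:
  "volume_density (G :: complex^'n::finite^'n) = unit_volume TYPE('n) * Re (det (pad_matrix G))"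
  unfolding volume_density_eq_pfaffian pfaffian_kaehler_form unit_volume_def
  by (simp del: of_real_mult)

definition hermitian_posdef :: "complex^'n::finite^'n \<Rightarrow> bool" where
  "hermitian_posdef G \<longleftrightarrow> (\<forall>i j. G $ i $ j = cnj (G $ j $ i)) \<and>
     (\<forall>v. v \<noteq> 0 \<longrightarrow> Re (\<Sum>i\<in>UNIV. \<Sum>j\<in>UNIV. G $ i $ j * v $ i * cnj (v $ j)) > 0)"

text \<open>For Hermitian \<open>G\<close> the form takes real values on real vectors, hence so does its Pfaffian.\<close>

lemma det_pad_matrix_real:
  assumes "\<And>i j. G $ i $ j = cnj (G $ j $ i)"
  shows "Im (det (pad_matrix (G :: complex^'n::finite^'n))) = 0"
proof -
  let ?d = "2 ^ CARD('n) * of_int (pfaffian_sum (standard_form :: 'n \<times> bool \<Rightarrow> _)) :: real"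
  have "cnj (kaehler_form G u v) = kaehler_form G u v" for u v
  proof -
    have "cnj (kaehler_form G u v) = - \<i> * (\<Sum>i\<in>UNIV. \<Sum>j\<in>UNIV. G $ j $ i * (cnj (u $ i) * v $ j - cnj (v $ i) * u $ j))"
      unfolding kaehler_form_def by (simp add: assms[symmetric])
    also have "\<dots> = - \<i> * (\<Sum>i\<in>UNIV. \<Sum>j\<in>UNIV. G $ i $ j * (cnj (u $ j) * v $ i - cnj (v $ j) * u $ i))"
      by (subst sum.swap) simp
    also have "\<dots> = kaehler_form G u v"
      unfolding kaehler_form_def sum_distrib_left by (intro sum.cong refl) (simp add: algebra_simps)
    finally show ?thesis .
  qed
  then have "cnj (pfaffian_sum (\<lambda>x y. kaehler_form G (real_frame x) (real_frame y))) =
     pfaffian_sum (\<lambda>x y. kaehler_form G (real_frame x) (real_frame y))"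
    unfolding pfaffian_sum_def by simp
  then have "cnj (det (pad_matrix G)) * of_real ?d = det (pad_matrix G) * of_real ?d"
    unfolding pfaffian_kaehler_form by simp
  moreover have "complex_of_real ?d \<noteq> 0" using pfaffian_standard_form_pos[where 'n='n] by simp
  ultimately have "cnj (det (pad_matrix G)) = det (pad_matrix G)" using mult_right_cancel by blast
  then show ?thesis by (simp add: complex_eq_iff)
qed

lemma hermitian_posdef_invertible:
  fixes G :: "complex^'n::finite^'n"
  assumes "hermitian_posdef G"
  shows "invertible G"
proof -
  have "v = 0" if "v v* G = 0" for v
  proof (rule ccontr)
    assume "v \<noteq> 0"
    then have "Re (\<Sum>i\<in>UNIV. \<Sum>j\<in>UNIV. G $ i $ j * v $ i * cnj (v $ j)) > 0"
      using assms unfolding hermitian_posdef_def by blast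
    also have "(\<Sum>i\<in>UNIV. \<Sum>j\<in>UNIV. G $ i $ j * v $ i * cnj (v $ j)) = (\<Sum>j\<in>UNIV. (v v* G) $ j * cnj (v $ j))"
      unfolding vector_matrix_mult_def by (subst sum.swap) (simp add: sum_distrib_left ac_simps)
    finally show False using that by simp
  qed
  then obtain B where "B ** transpose G = mat 1"
    using matrix_left_invertible_ker[of "transpose G"] by (auto simp: transpose_matrix_vector)
  then have "G ** transpose B = mat 1"
    by (metis matrix_transpose_mul transpose_mat transpose_transpose)
  then show ?thesis by (simp add: invertible_right_inverse) blast
qed

lemma
  assumes "invertible A"
  shows matrix_inv_right: "A ** matrix_inv A = mat 1" and matrix_inv_left: "matrix_inv A ** A = mat 1"
  using someI_ex[OF assms[unfolded invertible_def]] unfolding matrix_inv_def by auto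

lemma det_pad_matrix_nonzero: "invertible G \<Longrightarrow> det (pad_matrix G) \<noteq> 0"
proof -
  assume "invertible G"
  then obtain B where "G ** B = mat 1" "B ** G = mat 1" by (auto simp: invertible_def)
  then have "pad_matrix G ** pad_matrix B = mat 1" by (simp add: pad_matrix_mult pad_matrix_1)
  then have "det (pad_matrix G) * det (pad_matrix B) = 1" by (metis det_I det_mul)
  then show ?thesis by auto
qed

lemma hermitian_posdef_mat_1: "hermitian_posdef (mat 1)"
proof -
  have "Re (\<Sum>i\<in>UNIV. \<Sum>j\<in>UNIV. mat 1 $ i $ j * v $ i * cnj (v $ j)) > 0" if v: "v \<noteq> 0" for v :: "complex^'n"
  proof -
    obtain k where k: "v $ k \<noteq> 0" using v by (auto simp: vec_eq_iff)
    have "(\<Sum>i\<in>UNIV. \<Sum>j\<in>UNIV. mat 1 $ i $ j * v $ i * cnj (v $ j)) = (\<Sum>i\<in>UNIV. \<Sum>j\<in>UNIV. if i = j then of_real ((cmod (v $ j))\<^sup>2) else 0)"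
      by (intro sum.cong) (auto simp: mat_def complex_norm_square simp del: of_real_power)
    also have "Re \<dots> = (\<Sum>i\<in>UNIV. (cmod (v $ i))\<^sup>2)" by simp
    also have "\<dots> > 0" using k by (intro sum_pos2[of _ k]) auto
    finally show ?thesis .
  qed
  then show ?thesis by (auto simp: hermitian_posdef_def mat_def)
qed

lemma hermitian_posdef_combination:
  assumes "hermitian_posdef G" "hermitian_posdef H" "0 \<le> t" "t \<le> 1"
  shows "hermitian_posdef ((1 - t) *\<^sub>R G + t *\<^sub>R H)"
proof -
  have "Re (\<Sum>i\<in>UNIV. \<Sum>j\<in>UNIV. ((1 - t) *\<^sub>R G + t *\<^sub>R H) $ i $ j * v $ i * cnj (v $ j)) > 0" if v: "v \<noteq> 0" for v
  proof -
    have "(\<Sum>i\<in>UNIV. \<Sum>j\<in>UNIV. ((1 - t) *\<^sub>R G + t *\<^sub>R H) $ i $ j * v $ i * cnj (v $ j)) =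
      (1 - t) *\<^sub>R (\<Sum>i\<in>UNIV. \<Sum>j\<in>UNIV. G $ i $ j * v $ i * cnj (v $ j)) + t *\<^sub>R (\<Sum>i\<in>UNIV. \<Sum>j\<in>UNIV. H $ i $ j * v $ i * cnj (v $ j))"
      by (simp add: scaleR_sum_right sum.distrib[symmetric] distrib_right)
    moreover have "Re (\<Sum>i\<in>UNIV. \<Sum>j\<in>UNIV. G $ i $ j * v $ i * cnj (v $ j)) > 0"
      "Re (\<Sum>i\<in>UNIV. \<Sum>j\<in>UNIV. H $ i $ j * v $ i * cnj (v $ j)) > 0"
      using assms v unfolding hermitian_posdef_def by blast+
    moreover have "(1 - t) * a + t * b > 0" if "a > 0" "b > 0" for a b :: real
      using that assms(3,4) by (cases "t = 0") (auto intro!: add_nonneg_pos)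
    ultimately show ?thesis by simp
  qed
  moreover have "((1 - t) *\<^sub>R G + t *\<^sub>R H) $ i $ j = cnj (((1 - t) *\<^sub>R G + t *\<^sub>R H) $ j $ i)" for i j
  proof -
    have "G $ i $ j = cnj (G $ j $ i)" "H $ i $ j = cnj (H $ j $ i)"
      using assms(1,2) unfolding hermitian_posdef_def by blast+
    then have "(1 - t) *\<^sub>R G $ i $ j + t *\<^sub>R H $ i $ j = cnj ((1 - t) *\<^sub>R G $ j $ i + t *\<^sub>R H $ j $ i)"
      by (simp only: complex_cnj_add complex_cnj_scaleR)
    then show ?thesis by simp
  qed
  ultimately show ?thesis unfolding hermitian_posdef_def by blast
qed

lemma continuous_on_det_pad_matrix:
  fixes G :: "'v::topological_space \<Rightarrow> complex^'n::finite^'n"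
  assumes "continuous_on S G"
  shows "continuous_on S (\<lambda>x. det (pad_matrix (G x)))"
proof -
  have "continuous_on S (\<lambda>x. pad_matrix (G x) $ i $ j)" for i j
    by (cases i; cases j; cases "snd i"; cases "snd j") (auto simp: pad_matrix_nth intro!: continuous_intros assms)
  then show ?thesis unfolding det_def
    by (intro continuous_on_sum continuous_on_mult continuous_on_prod continuous_on_const)
qed

text \<open>The determinant is real and nonzero along the segment from the identity to \<open>G\<close>, which stays in the positive definite matrices.\<close>

lemma det_pad_matrix_pos:
  assumes "hermitian_posdef G"
  shows "Re (det (pad_matrix G)) > 0"
proof (rule ccontr)
  assume neg: "\<not> Re (det (pad_matrix G)) > 0"
  let ?h = "\<lambda>t. Re (det (pad_matrix ((1 - t) *\<^sub>R mat 1 + t *\<^sub>R G)))"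
  have "continuous_on {0..1} ?h"
    by (intro continuous_on_Re continuous_on_det_pad_matrix continuous_intros)
  then obtain t where t: "0 \<le> t" "t \<le> 1" "?h t = 0"
    using IVT2'[of ?h 1 0 0] neg by (auto simp: pad_matrix_1)
  have hp: "hermitian_posdef ((1 - t) *\<^sub>R mat 1 + t *\<^sub>R G)"
    by (rule hermitian_posdef_combination[OF hermitian_posdef_mat_1 assms t(1,2)])
  then have "Im (det (pad_matrix ((1 - t) *\<^sub>R mat 1 + t *\<^sub>R G))) = 0"
    unfolding hermitian_posdef_def by (intro det_pad_matrix_real) blast
  with t(3) have "det (pad_matrix ((1 - t) *\<^sub>R mat 1 + t *\<^sub>R G)) = 0" by (simp add: complex_eq_iff)
  then show False using det_pad_matrix_nonzero[OF hermitian_posdef_invertible[OF hp]] by simp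
qed

lemma volume_density_pos: "hermitian_posdef G \<Longrightarrow> volume_density G > 0"
  unfolding volume_density_eq_det by (intro mult_pos_pos unit_volume_pos det_pad_matrix_pos)

lemma of_real_volume_density:
  assumes "hermitian_posdef (G :: complex^'n::finite^'n)"
  shows "complex_of_real (volume_density G) = of_real (unit_volume TYPE('n)) * det (pad_matrix G)"
proof -
  have "Im (det (pad_matrix G)) = 0"
    using assms unfolding hermitian_posdef_def by (intro det_pad_matrix_real) blast
  then show ?thesis unfolding volume_density_eq_det by (simp add: complex_eq_iff)
qed

lemma has_derivative_det:
  fixes A :: "'v::real_normed_vector \<Rightarrow> complex^'m::finite^'m"
  assumes "\<And>r c. ((\<lambda>y. A y $ r $ c) has_derivative A' r c) (at x)"
  shows "((\<lambda>y. det (A y)) has_derivative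
    (\<lambda>v. \<Sum>r\<in>UNIV. det (\<chi> k. if k = r then (\<chi> c. A' r c v) else A x $ k))) (at x)"
proof -
  have "((\<lambda>y. det (A y)) has_derivative (\<lambda>v. \<Sum>p | p permutes UNIV. of_int (sign p) *
     (\<Sum>r\<in>UNIV. A' r (p r) v * (\<Prod>k\<in>UNIV - {r}. A x $ k $ p k)))) (at x)"
    unfolding det_def
    by (intro has_derivative_sum has_derivative_mult_right has_derivative_prod assms)
  moreover have "(\<Sum>p | p permutes UNIV. of_int (sign p) * (\<Sum>r\<in>UNIV. A' r (p r) v * (\<Prod>k\<in>UNIV - {r}. A x $ k $ p k))) =
    (\<Sum>r\<in>UNIV. det (\<chi> k. if k = r then (\<chi> c. A' r c v) else A x $ k))" for v
  proof -
    have "(\<Prod>k\<in>UNIV. (\<chi> k. if k = r then (\<chi> c. A' r c v) else A x $ k) $ k $ p k) =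
        A' r (p r) v * (\<Prod>k\<in>UNIV - {r}. A x $ k $ p k)" for r :: 'm and p
      by (subst prod.remove[of _ r]) (auto intro!: prod.cong)
    then show ?thesis
      unfolding det_def sum_distrib_left by (subst sum.swap) simp
  qed
  ultimately show ?thesis by simp
qed

text \<open>Expressing the differentiated row as a combination of the rows of \<open>A x\<close>, with coefficients given by the inverse, reduces each summand
of the row-wise derivative to Cramer's rule.\<close>

lemma Jacobi_formula:
  fixes A :: "'v::real_normed_vector \<Rightarrow> complex^'m::finite^'m"
  assumes "\<And>r c. ((\<lambda>y. A y $ r $ c) has_derivative A' r c) (at x)" and inv: "B ** A x = mat 1"
  shows "((\<lambda>y. det (A y)) has_derivative (\<lambda>v. det (A x) * (\<Sum>r\<in>UNIV. \<Sum>c\<in>UNIV. A' r c v * B $ c $ r))) (at x)"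
proof -
  have "det (\<chi> k. if k = r then (\<chi> c. A' r c v) else A x $ k) = (\<Sum>c\<in>UNIV. A' r c v * B $ c $ r) * det (A x)" for r v
  proof -
    let ?M = "\<chi> r c. A' r c v"
    let ?x = "(?M ** B) $ r"
    have "(\<Sum>s\<in>UNIV. ?x $ s *s row s (A x)) = ((?M ** B) ** A x) $ r"
      by (simp add: vec_eq_iff matrix_matrix_mult_def row_def sum_component)
    also have "\<dots> = ?M $ r" by (simp add: matrix_mul_assoc[symmetric] inv)
    finally have e: "(\<Sum>s\<in>UNIV. ?x $ s *s row s (A x)) = (\<chi> c. A' r c v)" by simp
    have "(\<chi> k. if k = r then \<Sum>s\<in>UNIV. ?x $ s *s row s (A x) else row k (A x)) =
       (\<chi> k. if k = r then (\<chi> c. A' r c v) else A x $ k)"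
      unfolding e by (simp add: vec_eq_iff row_def)
    with cramer_lemma_transpose[of r ?x "A x"] show ?thesis
      by (simp add: matrix_matrix_mult_def)
  qed
  then show ?thesis
    using has_derivative_det[OF assms(1)] by (simp add: sum_distrib_left sum_distrib_right mult.commute)
qed

lemma det_pad_matrix_has_derivative:
  fixes G :: "'v::real_normed_vector \<Rightarrow> complex^'n::finite^'n"
  assumes der: "\<And>j k. ((\<lambda>y. G y $ j $ k) has_derivative G' j k) (at x)" and inv: "invertible (G x)"
  shows "((\<lambda>y. det (pad_matrix (G y))) has_derivative (\<lambda>v. det (pad_matrix (G x)) *
    (\<Sum>j\<in>UNIV. \<Sum>k\<in>UNIV. matrix_inv (G x) $ k $ j * G' j k v))) (at x)"
proof -
  \<comment> \<open>The identity block of the padded matrix is constant.\<close>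
  define A' where "A' r c = (if \<not> snd r \<and> \<not> snd c then G' (fst c) (fst r) else (\<lambda>v. 0))" for r c
  have "((\<lambda>y. pad_matrix (G y) $ r $ c) has_derivative A' r c) (at x)" for r c
    unfolding A'_def using der
    by (cases r; cases c; cases "snd r"; cases "snd c") (auto simp: pad_matrix_nth)
  moreover have "pad_matrix (matrix_inv (G x)) ** pad_matrix (G x) = mat 1"
    unfolding pad_matrix_mult using inv by (simp add: matrix_inv_right pad_matrix_1)
  ultimately have "((\<lambda>y. det (pad_matrix (G y))) has_derivative (\<lambda>v. det (pad_matrix (G x)) *
     (\<Sum>r\<in>UNIV. \<Sum>c\<in>UNIV. A' r c v * pad_matrix (matrix_inv (G x)) $ c $ r))) (at x)"
    by (rule Jacobi_formula)
  moreover have "(\<Sum>r\<in>UNIV. \<Sum>c\<in>UNIV. A' r c v * pad_matrix (matrix_inv (G x)) $ c $ r) =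
     (\<Sum>j\<in>UNIV. \<Sum>k\<in>UNIV. matrix_inv (G x) $ k $ j * G' j k v)" for v
  proof -
    have "(\<Sum>r\<in>UNIV. \<Sum>c\<in>UNIV. A' r c v * pad_matrix (matrix_inv (G x)) $ c $ r) =
      (\<Sum>k\<in>UNIV. \<Sum>j\<in>UNIV. G' j k v * matrix_inv (G x) $ k $ j)"
      unfolding sum_UNIV_times_bool A'_def pad_matrix_def by simp
    then show ?thesis by (subst sum.swap) (simp add: mult.commute)
  qed
  ultimately show ?thesis by simp
qed

lemma smooth_on_det_pad_matrix:
  fixes G :: "'v::real_normed_vector \<Rightarrow> complex^'n::finite^'n"
  assumes "open S" "smooth_on G S"
  shows "smooth_on (\<lambda>x. det (pad_matrix (G x))) S"
proof -
  have "smooth_on (\<lambda>x. pad_matrix (G x) $ i $ j) S" for i j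
    using assms by (cases i; cases j; cases "snd i"; cases "snd j") (auto simp: pad_matrix_nth intro!: smooth_on_const smooth_on_vec_nth)
  then show ?thesis unfolding det_def
    by (intro smooth_on_sum smooth_on_mult smooth_on_prod smooth_on_const assms(1))
qed

section \<open>Integrals of derivatives of compactly supported functions\<close>

lemma integrable_compact_support:
  fixes h :: "'v::euclidean_space \<Rightarrow> 'w::{banach, second_countable_topology}"
  assumes "compact K" "continuous_on K h" "\<And>x. x \<notin> K \<Longrightarrow> h x = 0"
  shows "integrable lborel h"
proof -
  have "(\<lambda>x. indicator K x *\<^sub>R h x) = h" using assms(3) by (auto simp: fun_eq_iff indicator_def)
  with borel_integrable_compact[OF assms(1,2)] show ?thesis by simp
qed

text \<open>Difference quotients have integral zero by translation invariance. They converge to the derivative pointwise and are dominated, by the mean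
value theorem, by a constant on a compact set that contains all the translated supports.\<close>

lemma integral_directional_derivative_real:
  fixes h :: "'v::euclidean_space \<Rightarrow> real"
  assumes sm: "smooth_on h UNIV" and K: "compact K" "\<And>x. x \<notin> K \<Longrightarrow> h x = 0"
  shows "integral\<^sup>L lborel (\<lambda>x. frechet_derivative h (at x) v) = 0"
proof -
  let ?D = "\<lambda>x. frechet_derivative h (at x) v"
  have conth: "continuous_on UNIV h" and contD: "continuous_on UNIV ?D"
    using smooth_on_imp_continuous_on sm smooth_on_frechet_derivative[OF sm] by blast+
  have D0: "?D x = 0" if "x \<notin> K" for x
  proof -
    have "?D x = frechet_derivative (\<lambda>x. 0) (at x) v"
      by (rule fun_cong[OF frechet_derivative_transform_within_open[of _ _ "- K"]])
        (use K that sm in \<open>auto simp: compact_imp_closed open_Compl intro: smooth_on_imp_differentiable\<close>)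
    then show ?thesis by simp
  qed
  obtain B where B: "\<And>x. \<bar>?D x\<bar> \<le> B" "0 \<le> B"
  proof -
    have "bounded (?D ` K)"
      by (intro compact_imp_bounded compact_continuous_image continuous_on_subset[OF contD] K(1)) auto
    then obtain B where "\<And>x. x \<in> K \<Longrightarrow> \<bar>?D x\<bar> \<le> B" by (auto simp: bounded_iff)
    then have "\<bar>?D x\<bar> \<le> max B 0" for x using D0[of x] by (cases "x \<in> K") (auto simp: max.coboundedI1)
    then show ?thesis using that by fastforce
  qed
  \<comment> \<open>Swept out by the support under the translations by \<open>- t v\<close>, it supports all the difference quotients.\<close>
  define K' where "K' = (\<lambda>(x, t). x - t *\<^sub>R v) ` (K \<times> {0..1})"
  have K': "compact K'"
    unfolding K'_def split_beta by (intro compact_continuous_image continuous_intros compact_Times K(1)) auto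
  define q where "q n x = real (Suc n) * (h (inverse (real (Suc n)) *\<^sub>R v + x) - h x)" for n x
  have hint: "integrable lborel h"
    by (rule integrable_compact_support[OF K(1) continuous_on_subset[OF conth] K(2)]) auto
  have shift: "integrable lborel (\<lambda>x. h (c + x))" "integral\<^sup>L lborel (\<lambda>x. h (c + x)) = integral\<^sup>L lborel h" for c
  proof -
    have m: "h \<in> borel_measurable borel" using conth by (rule borel_measurable_continuous_onI)
    show "integrable lborel (\<lambda>x. h (c + x))"
      using hint m by (subst integrable_distr_eq[of "(+) c" lborel borel h, symmetric]) (auto simp: lborel_distr_plus)
    show "integral\<^sup>L lborel (\<lambda>x. h (c + x)) = integral\<^sup>L lborel h"
      using m by (subst integral_distr[of "(+) c" lborel borel h, symmetric]) (auto simp: lborel_distr_plus)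
  qed
  have q0: "integral\<^sup>L lborel (q n) = 0" for n
    unfolding q_def using shift hint by simp
  have line: "((\<lambda>t. h (t *\<^sub>R v + x)) has_real_derivative ?D (t *\<^sub>R v + x)) (at t)" for t x
  proof -
    have d: "(h has_derivative frechet_derivative h (at (t *\<^sub>R v + x))) (at (t *\<^sub>R v + x))"
      using smooth_on_has_derivative[OF sm] by blast
    have "((\<lambda>t. h (t *\<^sub>R v + x)) has_derivative (\<lambda>s. frechet_derivative h (at (t *\<^sub>R v + x)) (s *\<^sub>R v))) (at t)"
      by (rule has_derivative_compose[of "\<lambda>t. t *\<^sub>R v + x" "\<lambda>s. s *\<^sub>R v", OF _ d]) (auto intro!: derivative_eq_intros)
    then show ?thesis
      by (simp add: has_field_derivative_def linear_scale[OF has_derivative_linear[OF d]] mult_commute_abs)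
  qed
  have qB: "\<bar>q n x\<bar> \<le> indicator K' x *\<^sub>R B" for n x
  proof -
    let ?s = "inverse (real (Suc n))"
    have s: "0 < ?s" "?s \<le> 1" by (auto simp: divide_simps)
    show ?thesis
    proof (cases "x \<in> K'")
      case True
      obtain t where "h (?s *\<^sub>R v + x) - h (0 *\<^sub>R v + x) = (?s - 0) * ?D (t *\<^sub>R v + x)"
        using MVT2[OF s(1), of "\<lambda>t. h (t *\<^sub>R v + x)" "\<lambda>t. ?D (t *\<^sub>R v + x)"] line by auto
      then have "q n x = ?D (t *\<^sub>R v + x)" by (simp add: q_def)
      then show ?thesis using B True by simp
    next
      case False
      have "x \<notin> K"
      proof
        assume "x \<in> K"
        then have "x - 0 *\<^sub>R v \<in> K'" unfolding K'_def by (intro image_eqI[of _ _ "(x, 0)"]) auto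
        with False show False by simp
      qed
      moreover have "?s *\<^sub>R v + x \<notin> K"
      proof
        assume "?s *\<^sub>R v + x \<in> K"
        then have "(?s *\<^sub>R v + x) - ?s *\<^sub>R v \<in> K'"
          unfolding K'_def using s by (intro image_eqI[of _ _ "(?s *\<^sub>R v + x, ?s)"]) auto
        with False show False by simp
      qed
      ultimately show ?thesis using K(2) B(2) by (simp add: q_def indicator_def)
    qed
  qed
  have lim: "(\<lambda>n. q n x) \<longlonglongrightarrow> ?D x" for x
  proof -
    have "((\<lambda>t. (h (t *\<^sub>R v + x) - h (0 *\<^sub>R v + x)) / (t - 0)) \<longlongrightarrow> ?D (0 *\<^sub>R v + x)) (at 0)"
      using line[of x 0] unfolding has_field_derivative_iff by simp
    moreover have "filterlim (\<lambda>n. inverse (real (Suc n))) (at 0) sequentially"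
      unfolding filterlim_at using LIMSEQ_inverse_real_of_nat by auto
    ultimately have "(\<lambda>n. (h (inverse (real (Suc n)) *\<^sub>R v + x) - h (0 *\<^sub>R v + x)) / (inverse (real (Suc n)) - 0)) \<longlonglongrightarrow> ?D (0 *\<^sub>R v + x)"
      by (rule filterlim_compose)
    moreover have "(h (inverse (real (Suc n)) *\<^sub>R v + x) - h (0 *\<^sub>R v + x)) / (inverse (real (Suc n)) - 0) = q n x" for n
      unfolding q_def by (simp add: divide_inverse)
    ultimately show ?thesis by simp
  qed
  have "(\<lambda>n. integral\<^sup>L lborel (q n)) \<longlonglongrightarrow> integral\<^sup>L lborel ?D"
  proof (rule integral_dominated_convergence[where w="\<lambda>x. indicator K' x *\<^sub>R B"])
    show "?D \<in> borel_measurable lborel"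
      using borel_measurable_continuous_onI[OF contD] by simp
    show "q n \<in> borel_measurable lborel" for n
    proof -
      have "continuous_on UNIV (q n)"
        unfolding q_def by (intro continuous_intros continuous_on_compose2[OF conth]) auto
      then show ?thesis using borel_measurable_continuous_onI by simp
    qed
    show "integrable lborel (\<lambda>x. indicator K' x *\<^sub>R B)"
      by (rule borel_integrable_compact[OF K' continuous_on_const])
  qed (use qB lim in auto)
  then have "(\<lambda>n. 0) \<longlonglongrightarrow> integral\<^sup>L lborel ?D" by (simp add: q0)
  then show ?thesis using LIMSEQ_const_iff by metis
qed

lemma integral_directional_derivative:
  fixes h :: "'v::euclidean_space \<Rightarrow> complex"
  assumes sm: "smooth_on h UNIV" and K: "compact K" "\<And>x. x \<notin> K \<Longrightarrow> h x = 0"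
  shows "integral\<^sup>L lborel (\<lambda>x. frechet_derivative h (at x) v) = 0"
    and "integrable lborel (\<lambda>x. frechet_derivative h (at x) v)"
proof -
  let ?D = "\<lambda>x. frechet_derivative h (at x) v"
  have D0: "?D x = 0" if "x \<notin> K" for x
  proof -
    have "?D x = frechet_derivative (\<lambda>x. 0) (at x) v"
      by (rule fun_cong[OF frechet_derivative_transform_within_open[of _ _ "- K"]])
        (use K that sm in \<open>auto simp: compact_imp_closed open_Compl intro: smooth_on_imp_differentiable\<close>)
    then show ?thesis by simp
  qed
  show int: "integrable lborel ?D"
    by (rule integrable_compact_support[OF K(1) continuous_on_subset[OF smooth_on_imp_continuous_on[OF
        smooth_on_frechet_derivative[OF sm]]] D0]) auto
  have "L (integral\<^sup>L lborel ?D) = 0" if L: "bounded_linear L" for L :: "complex \<Rightarrow> real"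
  proof -
    have "integral\<^sup>L lborel (\<lambda>x. frechet_derivative (\<lambda>x. L (h x)) (at x) v) = 0"
      by (rule integral_directional_derivative_real[OF smooth_on_linear_compose[OF _ L sm] K(1)])
        (use K(2) bounded_linear.linear[OF L] in \<open>auto simp: linear_0\<close>)
    then show ?thesis
      using integral_bounded_linear[OF L int]
      by (simp add: frechet_derivative_linear_compose[OF L smooth_on_imp_differentiable[OF sm]])
  qed
  from this[OF bounded_linear_Re] this[OF bounded_linear_Im]
  show "integral\<^sup>L lborel ?D = 0" by (simp add: complex_eq_iff)
qed

lemma integral_wirt:
  fixes h :: "complex^'n::finite \<Rightarrow> complex"
  assumes "smooth_on h UNIV" "compact K" "\<And>x. x \<notin> K \<Longrightarrow> h x = 0"
  shows "integral\<^sup>L lborel (wirt i h) = 0" "integrable lborel (wirt i h)"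
  unfolding wirt_def[abs_def] using integral_directional_derivative[OF assms] by simp_all

section \<open>Change of variables in complex coordinate space\<close>

definition real_coord :: "complex^'n \<Rightarrow> 'n \<times> bool \<Rightarrow> real" where
  "real_coord u z = (if snd z then Im else Re) (u $ fst z)"

lemma real_coord_linear: "bounded_linear (\<lambda>u :: complex^'n::finite. real_coord u z)"
  unfolding real_coord_def
  by (cases "snd z") (auto intro!: bounded_linear_compose[OF bounded_linear_Re bounded_linear_vec_nth]
      bounded_linear_compose[OF bounded_linear_Im bounded_linear_vec_nth])

lemma real_coord_real_frame: "real_coord (real_frame x) z = (if x = z then 1 else 0)"
  by (auto simp: real_coord_def real_frame_def axis_def prod_eq_iff)

lemma inner_real_frame: "u \<bullet> real_frame z = real_coord (u :: complex^'n::finite) z"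
  by (simp add: real_frame_def inner_axis real_coord_def inner_complex_def)

lemma Basis_eq_range_real_frame: "(Basis :: (complex^'n::finite) set) = range real_frame"
proof -
  have "axis i 1 = real_frame (i, False)" "axis i \<i> = real_frame (i, True)" for i :: 'n
    by (simp_all add: real_frame_def)
  then have "Basis \<subseteq> range (real_frame :: 'n \<times> bool \<Rightarrow> _)" by (auto simp: Basis_vec_def Basis_complex_def)
  moreover have "range real_frame \<subseteq> (Basis :: (complex^'n) set)"
    by (auto simp: Basis_vec_def Basis_complex_def real_frame_def)
  ultimately show ?thesis by (rule equalityI)
qed

lemma inj_real_frame: "inj (real_frame :: 'n::finite \<times> bool \<Rightarrow> _)"
proof (rule injI)
  fix x y :: "'n \<times> bool" assume "real_frame x = real_frame y"
  then have "real_coord (real_frame x) y = 1" by (simp add: real_coord_real_frame)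
  then show "x = y" by (simp add: real_coord_real_frame split: if_splits)
qed

text \<open>The change of variables theorem concerns \<open>real ^ 'm\<close> for a well-ordered index type. The type \<open>'n bit0\<close> is one of
cardinality \<open>2n\<close>, and any bijection will do: reindexing rows and columns alike does not change a determinant.\<close>

definition frame_index :: "'n::finite bit0 \<Rightarrow> 'n \<times> bool" where
  "frame_index = (SOME f. bij f)"

lemma bij_frame_index: "bij (frame_index :: 'n::finite bit0 \<Rightarrow> _)"
proof -
  have "card (UNIV :: 'n bit0 set) = card (UNIV :: ('n \<times> bool) set)" by simp
  then have "\<exists>f :: 'n bit0 \<Rightarrow> 'n \<times> bool. bij f"
    using finite_same_card_bij[of "UNIV :: 'n bit0 set" "UNIV :: ('n \<times> bool) set"] by auto
  then show ?thesis unfolding frame_index_def by (rule someI_ex)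
qed

definition of_real_coords :: "real^('n::finite bit0) \<Rightarrow> complex^'n" where
  "of_real_coords y = (\<Sum>m\<in>UNIV. y $ m *\<^sub>R real_frame (frame_index m))"

definition to_real_coords :: "complex^'n::finite \<Rightarrow> real^('n bit0)" where
  "to_real_coords u = (\<chi> m. real_coord u (frame_index m))"

lemma of_to_real_coords: "of_real_coords (to_real_coords u) = u"
proof -
  have "of_real_coords (to_real_coords u) = (\<Sum>z\<in>UNIV. real_coord u z *\<^sub>R real_frame z)"
    unfolding of_real_coords_def to_real_coords_def
    by (simp add: sum.reindex_bij_betw[OF bij_frame_index, of "\<lambda>z. real_coord u z *\<^sub>R real_frame z"])
  then show ?thesis using real_frame_expansion[of u] by (simp add: real_coord_def)
qed

lemma to_of_real_coords: "to_real_coords (of_real_coords y) = y"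
proof -
  have "real_coord (of_real_coords y) (frame_index k) = y $ k" for k
  proof -
    interpret L: bounded_linear "\<lambda>u. real_coord u (frame_index k)" by (rule real_coord_linear)
    have inj: "frame_index m = frame_index k \<longleftrightarrow> m = k" for m
      using bij_is_inj[OF bij_frame_index] by (auto simp: inj_def)
    show ?thesis
      unfolding of_real_coords_def by (simp add: L.sum L.scaleR real_coord_real_frame inj mult_delta_right)
  qed
  then show ?thesis by (simp add: to_real_coords_def vec_eq_iff)
qed

lemma linear_of_real_coords: "linear (of_real_coords :: real^('n::finite bit0) \<Rightarrow> _)"
  by (rule linearI) (simp_all add: of_real_coords_def scaleR_left_distrib sum.distrib scaleR_sum_right)

lemma linear_to_real_coords: "linear (to_real_coords :: complex^'n::finite \<Rightarrow> _)"
  by (intro linearI) (simp_all add: to_real_coords_def vec_eq_iff real_coord_def)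

lemma of_real_coords_axis: "of_real_coords (axis m 1) = real_frame (frame_index m)"
  unfolding of_real_coords_def axis_def by (simp add: if_distrib[of "\<lambda>c. c *\<^sub>R _"] cong: if_cong)

text \<open>The map sends the standard orthonormal basis to the standard orthonormal basis, hence boxes to boxes of the same volume.\<close>

lemma lborel_eq_distr_of_real_coords:
  "(lborel :: (complex^'n::finite) measure) = distr lborel borel of_real_coords"
proof (rule lborel_eqI)
  fix l u :: "complex^'n" assume le: "\<And>b. b \<in> Basis \<Longrightarrow> l \<bullet> b \<le> u \<bullet> b"
  have m: "of_real_coords \<in> borel_measurable (borel :: (real^('n bit0)) measure)"
    by (intro borel_measurable_continuous_onI linear_continuous_on linear_of_real_coords linear_conv_bounded_linear[THEN iffD1])
  have "of_real_coords -` box l u = box (to_real_coords l) (to_real_coords u)"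
  proof -
    have "of_real_coords y \<in> box l u \<longleftrightarrow> y \<in> box (to_real_coords l) (to_real_coords u)" for y
    proof -
      have "of_real_coords y \<in> box l u \<longleftrightarrow> (\<forall>z. real_coord l z < real_coord (of_real_coords y) z \<and>
          real_coord (of_real_coords y) z < real_coord u z)"
        unfolding mem_box Basis_eq_range_real_frame by (simp add: inner_real_frame)
      also have "\<dots> \<longleftrightarrow> (\<forall>m. real_coord l (frame_index m) < real_coord (of_real_coords y) (frame_index m) \<and>
          real_coord (of_real_coords y) (frame_index m) < real_coord u (frame_index m))"
        using bij_is_surj[OF bij_frame_index] by (metis surjD)
      also have "\<dots> \<longleftrightarrow> (\<forall>m. to_real_coords l $ m < to_real_coords (of_real_coords y) $ m \<and>
          to_real_coords (of_real_coords y) $ m < to_real_coords u $ m)"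
        by (simp add: to_real_coords_def)
      finally show ?thesis unfolding to_of_real_coords mem_box_cart .
    qed
    then show ?thesis by auto
  qed
  then have "emeasure (distr lborel borel of_real_coords) (box l u) = emeasure lborel (box (to_real_coords l) (to_real_coords u))"
    using m by (simp add: emeasure_distr)
  also have "\<dots> = (\<Prod>b\<in>Basis. (to_real_coords u - to_real_coords l) \<bullet> b)"
  proof (rule emeasure_lborel_box)
    fix b :: "real^('n bit0)" assume "b \<in> Basis"
    then obtain m where b: "b = axis m 1" by (auto simp: Basis_vec_def)
    show "to_real_coords l \<bullet> b \<le> to_real_coords u \<bullet> b"
      using le[of "real_frame (frame_index m)"] unfolding b
      by (simp add: inner_axis to_real_coords_def inner_real_frame Basis_eq_range_real_frame)
  qed
  also have "(\<Prod>b\<in>Basis. (to_real_coords u - to_real_coords l) \<bullet> b) = (\<Prod>m\<in>UNIV. (to_real_coords u - to_real_coords l) $ m)"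
  proof -
    have B: "(Basis :: (real^('n bit0)) set) = range (\<lambda>m. axis m 1)" by (auto simp: Basis_vec_def)
    have "inj (\<lambda>m. axis m 1 :: real^('n bit0))" by (auto simp: inj_def axis_eq_axis)
    then show ?thesis unfolding B by (simp add: prod.reindex inner_axis)
  qed
  also have "\<dots> = (\<Prod>m\<in>UNIV. real_coord (u - l) (frame_index m))"
    using linear_diff[OF linear_to_real_coords, of u l] by (metis (no_types, lifting) to_real_coords_def vec_lambda_beta)
  also have "\<dots> = (\<Prod>z\<in>UNIV. real_coord (u - l) z)"
    by (rule prod.reindex_bij_betw[OF bij_frame_index])
  also have "\<dots> = (\<Prod>b\<in>Basis. (u - l) \<bullet> b)"
    unfolding Basis_eq_range_real_frame by (simp add: prod.reindex[OF inj_real_frame] inner_real_frame)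
  finally show "emeasure (distr lborel borel of_real_coords) (box l u) = (\<Prod>b\<in>Basis. (u - l) \<bullet> b)" .
qed simp

text \<open>Conjugation by a bijection preserves signs of permutations.\<close>

lemma det_reindex:
  fixes A :: "'b::finite \<Rightarrow> 'b \<Rightarrow> 'c::comm_ring_1" and f :: "'a::finite \<Rightarrow> 'b"
  assumes f: "bij f"
  shows "det (\<chi> m l. A (f m) (f l)) = det (\<chi> z x. A z x)"
proof -
  have inj: "inj f" and inj': "inj (inv f)" using f by (auto simp: bij_is_inj bij_imp_bij_inv)
  have [simp]: "inv f (f m) = m" "f (inv f z) = z" for m z
    using f by (auto simp: bij_is_inj bij_is_surj surj_f_inv_f)
  have bij: "bij p" if "p permutes UNIV" for p :: "'x \<Rightarrow> 'x" using permutes_bij that by blast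
  have "det (\<chi> m l. A (f m) (f l)) = (\<Sum>p | p permutes UNIV. of_int (sign p) * (\<Prod>m\<in>UNIV. A (f m) (f (p m))))"
    by (simp add: det_def)
  also have "\<dots> = (\<Sum>p | p permutes UNIV. of_int (sign p) * (\<Prod>z\<in>UNIV. A z (p z)))"
  proof (rule sum.reindex_bij_witness[where i="\<lambda>q. inv f \<circ> q \<circ> f" and j="\<lambda>p. f \<circ> p \<circ> inv f"])
    fix p :: "'a \<Rightarrow> 'a" assume "p \<in> {p. p permutes UNIV}"
    then have p: "p permutes UNIV" by simp
    have "f \<circ> p \<circ> inv f = map_permutation UNIV f p"
      using bij_is_surj[OF f] by (auto simp: map_permutation_def fun_eq_iff restrict_id_def)
    then have "sign (f \<circ> p \<circ> inv f) = sign p"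
      using sign_map_permutation[OF inj p] by simp
    moreover have "(\<Prod>z\<in>UNIV. A z ((f \<circ> p \<circ> inv f) z)) = (\<Prod>m\<in>UNIV. A (f m) (f (p m)))"
      by (subst prod.reindex_bij_betw[OF f, symmetric]) simp
    ultimately show "of_int (sign (f \<circ> p \<circ> inv f)) * (\<Prod>z\<in>UNIV. A z ((f \<circ> p \<circ> inv f) z)) =
        of_int (sign p) * (\<Prod>m\<in>UNIV. A (f m) (f (p m)))" by simp
    show "f \<circ> p \<circ> inv f \<in> {p. p permutes UNIV}"
      using f bij[OF p] by (auto intro!: bij_imp_permutes bij_comp bij_imp_bij_inv)
    show "inv f \<circ> (f \<circ> p \<circ> inv f) \<circ> f = p" by (auto simp: fun_eq_iff)
  next
    fix q :: "'b \<Rightarrow> 'b" assume "q \<in> {p. p permutes UNIV}"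
    then have q: "q permutes UNIV" by simp
    show "inv f \<circ> q \<circ> f \<in> {p. p permutes UNIV}"
      using f bij[OF q] by (auto intro!: bij_imp_permutes bij_comp bij_imp_bij_inv)
    show "f \<circ> (inv f \<circ> q \<circ> f) \<circ> inv f = q" by (auto simp: fun_eq_iff)
  qed
  finally show ?thesis by (simp add: det_def)
qed

lemma set_integrable_lborel_imp_absolutely_integrable:
  fixes f :: "'v::euclidean_space \<Rightarrow> real"
  assumes "set_integrable lborel S f"
  shows "f absolutely_integrable_on S"
  unfolding absolutely_integrable_on_def
  using set_borel_integral_eq_integral(1)[OF assms] set_borel_integral_eq_integral(1)[OF set_integrable_norm[OF assms]] by simp

lemma set_integral_of_real_coords:
  fixes f :: "complex^'n::finite \<Rightarrow> real"
  assumes f: "set_integrable lborel S f"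
  shows "set_integrable lborel (of_real_coords -` S) (\<lambda>y. f (of_real_coords y))"
    and "(LINT u:S|lborel. f u) = integral (of_real_coords -` S) (\<lambda>y. f (of_real_coords y))"
proof -
  let ?g = "\<lambda>u. indicator S u *\<^sub>R f u"
  have g: "integrable lborel ?g" using f by (simp add: set_integrable_def)
  then have gm: "?g \<in> borel_measurable borel" by auto
  have m: "of_real_coords \<in> borel_measurable (borel :: (real^('n bit0)) measure)"
    by (intro borel_measurable_continuous_onI linear_continuous_on linear_conv_bounded_linear[THEN iffD1] linear_of_real_coords)
  have "integrable (distr lborel borel of_real_coords) ?g"
    using g by (subst (asm) lborel_eq_distr_of_real_coords)
  then have "integrable lborel (\<lambda>y. ?g (of_real_coords y))"
    by (subst (asm) integrable_distr_eq) (use m gm in auto)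
  then show 1: "set_integrable lborel (of_real_coords -` S) (\<lambda>y. f (of_real_coords y))"
    by (simp add: set_integrable_def indicator_def)
  have "(LINT u:S|lborel. f u) = integral\<^sup>L (distr lborel borel of_real_coords) ?g"
    unfolding set_lebesgue_integral_def by (subst lborel_eq_distr_of_real_coords) (rule refl)
  also have "\<dots> = integral\<^sup>L lborel (\<lambda>y. ?g (of_real_coords y))"
    by (rule integral_distr) (use m gm in auto)
  also have "\<dots> = (LINT y:of_real_coords -` S|lborel. f (of_real_coords y))"
    unfolding set_lebesgue_integral_def by (simp add: indicator_def)
  also have "\<dots> = integral (of_real_coords -` S) (\<lambda>y. f (of_real_coords y))"
    by (rule set_borel_integral_eq_integral(2)[OF 1])
  finally show "(LINT u:S|lborel. f u) = integral (of_real_coords -` S) (\<lambda>y. f (of_real_coords y))" .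
qed

text \<open>The change of variables theorem of real coordinate space, transported along \<open>of_real_coords\<close>.\<close>

lemma change_of_variables_real:
  fixes f :: "complex^'n::finite \<Rightarrow> real" and P :: "complex^'n \<Rightarrow> complex^'n"
  assumes S: "open S" and der: "\<And>x. x \<in> S \<Longrightarrow> (P has_derivative P' x) (at x)" and inj: "inj_on P S"
    and f: "set_integrable lborel (P ` S) f"
    and f': "set_integrable lborel S (\<lambda>x. \<bar>det (\<chi> z k. real_coord (P' x (real_frame k)) z)\<bar> * f (P x))"
  shows "(LINT u:P ` S|lborel. f u) = (LINT x:S|lborel. \<bar>det (\<chi> z k. real_coord (P' x (real_frame k)) z)\<bar> * f (P x))"
proof -
  define S' where "S' = (of_real_coords :: _ \<Rightarrow> complex^'n) -` S"
  define Q where "Q y = to_real_coords (P (of_real_coords y))" for y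
  define Q' where "Q' y v = to_real_coords (P' (of_real_coords y) (of_real_coords v))" for y v
  have contof: "continuous_on UNIV (of_real_coords :: _ \<Rightarrow> complex^'n)"
    by (intro linear_continuous_on linear_conv_bounded_linear[THEN iffD1] linear_of_real_coords)
  have oS': "open S'" unfolding S'_def using S contof by (metis open_vimage)
  have QS: "Q ` S' = of_real_coords -` (P ` S)"
  proof -
    have "y \<in> Q ` S' \<longleftrightarrow> of_real_coords y \<in> P ` S" for y
    proof
      assume "y \<in> Q ` S'"
      then show "of_real_coords y \<in> P ` S" by (auto simp: Q_def S'_def of_to_real_coords)
    next
      assume "of_real_coords y \<in> P ` S"
      then obtain x where x: "x \<in> S" "of_real_coords y = P x" by auto
      have "y = Q (to_real_coords x)" using x(2) by (metis Q_def of_to_real_coords to_of_real_coords)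
      moreover have "to_real_coords x \<in> S'" using x(1) by (simp add: S'_def of_to_real_coords)
      ultimately show "y \<in> Q ` S'" by blast
    qed
    then show ?thesis by (intro set_eqI) simp
  qed
  have derQ: "(Q has_derivative Q' y) (at y within S')" if "y \<in> S'" for y
  proof -
    have 1: "(of_real_coords has_derivative of_real_coords) (at y)"
      by (intro bounded_linear_imp_has_derivative linear_conv_bounded_linear[THEN iffD1] linear_of_real_coords)
    have "((\<lambda>y. P (of_real_coords y)) has_derivative (\<lambda>v. P' (of_real_coords y) (of_real_coords v))) (at y)"
      by (rule has_derivative_compose[OF 1 der]) (use that in \<open>simp add: S'_def\<close>)
    then have "((\<lambda>y. to_real_coords (P (of_real_coords y))) has_derivative Q' y) (at y)"
      unfolding Q'_def by (rule bounded_linear.has_derivative[OF linear_conv_bounded_linear[THEN iffD1, OF linear_to_real_coords]])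
    then show ?thesis unfolding Q_def by (rule has_derivative_at_withinI)
  qed
  have injQ: "inj_on Q S'"
  proof (rule inj_onI)
    fix x y assume "x \<in> S'" "y \<in> S'" "Q x = Q y"
    then have "P (of_real_coords x) = P (of_real_coords y)" by (metis Q_def of_to_real_coords)
    then have "of_real_coords x = (of_real_coords y :: complex^'n)"
      using inj \<open>x \<in> S'\<close> \<open>y \<in> S'\<close> by (auto simp: S'_def inj_on_def)
    then show "x = y" by (metis to_of_real_coords)
  qed
  have det: "det (matrix (Q' y)) = det (\<chi> z k. real_coord (P' (of_real_coords y) (real_frame k)) z)" for y
  proof -
    have "matrix (Q' y) = (\<chi> m l. real_coord (P' (of_real_coords y) (real_frame (frame_index l))) (frame_index m))"
      by (simp add: matrix_def Q'_def to_real_coords_def of_real_coords_axis)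
    then show ?thesis
      using det_reindex[OF bij_frame_index, of "\<lambda>z k. real_coord (P' (of_real_coords y) (real_frame k)) z"] by simp
  qed
  define F :: "real^('n bit0) \<Rightarrow> real^1" where "F y = vec (f (of_real_coords y))" for y
  have absF: "F absolutely_integrable_on (Q ` S')"
    unfolding absolutely_integrable_on_1_iff QS F_def
    using set_integrable_lborel_imp_absolutely_integrable[OF set_integral_of_real_coords(1)[OF f]] by simp
  have "integral (Q ` S') F = integral S' (\<lambda>y. \<bar>det (matrix (Q' y))\<bar> *\<^sub>R F (Q y))"
    by (rule integral_change_of_variables[OF _ derQ injQ]) (use absF oS' in auto)
  then have "integral (Q ` S') (\<lambda>y. F y $ 1) = integral S' (\<lambda>y. (\<bar>det (matrix (Q' y))\<bar> *\<^sub>R F (Q y)) $ 1)"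
    unfolding integral_on_1_eq[of "Q ` S'" F] integral_on_1_eq[of S' "\<lambda>y. \<bar>det (matrix (Q' y))\<bar> *\<^sub>R F (Q y)"]
    by (simp only: vec_eq_iff vec_component simp_thms)
  then have "integral (of_real_coords -` (P ` S)) (\<lambda>y. f (of_real_coords y)) =
      integral S' (\<lambda>y. \<bar>det (\<chi> z k. real_coord (P' (of_real_coords y) (real_frame k)) z)\<bar> * f (P (of_real_coords y)))"
    unfolding QS F_def det by (simp add: Q_def of_to_real_coords)
  then show ?thesis
    unfolding set_integral_of_real_coords(2)[OF f] set_integral_of_real_coords(2)[OF f'] S'_def .
qed

lemma change_of_variables_complex:
  fixes f :: "complex^'n::finite \<Rightarrow> complex" and P :: "complex^'n \<Rightarrow> complex^'n"
  assumes S: "open S" and der: "\<And>x. x \<in> S \<Longrightarrow> (P has_derivative P' x) (at x)" and inj: "inj_on P S"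
    and f: "set_integrable lborel (P ` S) f"
    and f': "set_integrable lborel S (\<lambda>x. \<bar>det (\<chi> z k. real_coord (P' x (real_frame k)) z)\<bar> *\<^sub>R f (P x))"
  shows "(LINT u:P ` S|lborel. f u) = (LINT x:S|lborel. \<bar>det (\<chi> z k. real_coord (P' x (real_frame k)) z)\<bar> *\<^sub>R f (P x))"
proof -
  let ?d = "\<lambda>x. \<bar>det (\<chi> z k. real_coord (P' x (real_frame k)) z)\<bar>"
  have "L (LINT u:P ` S|lborel. f u) = L (LINT x:S|lborel. ?d x *\<^sub>R f (P x))"
    if L: "bounded_linear L" for L :: "complex \<Rightarrow> real"
  proof -
    interpret L: bounded_linear L by (rule L)
    have i: "integrable lborel (\<lambda>u. indicator (P ` S) u *\<^sub>R f u)"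
      "integrable lborel (\<lambda>x. indicator S x *\<^sub>R (?d x *\<^sub>R f (P x)))"
      using f f' by (simp_all add: set_integrable_def)
    have eq: "(LINT u:P ` S|lborel. L (f u)) = L (LINT u:P ` S|lborel. f u)"
      "(LINT x:S|lborel. ?d x * L (f (P x))) = L (LINT x:S|lborel. ?d x *\<^sub>R f (P x))"
      unfolding set_lebesgue_integral_def
      using integral_bounded_linear[OF L i(1)] integral_bounded_linear[OF L i(2)] by (simp_all add: L.scaleR mult.assoc)
    have "set_integrable lborel (P ` S) (\<lambda>u. L (f u))" "set_integrable lborel S (\<lambda>x. ?d x * L (f (P x)))"
      unfolding set_integrable_def
      using integrable_bounded_linear[OF L i(1)] integrable_bounded_linear[OF L i(2)] by (simp_all add: L.scaleR mult.assoc)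
    from change_of_variables_real[OF S der inj this] show ?thesis unfolding eq .
  qed
  from this[OF bounded_linear_Re] this[OF bounded_linear_Im] show ?thesis by (simp add: complex_eq_iff)
qed

section \<open>Charts\<close>

definition chart_smooth :: "('a, 'n::finite) chart \<Rightarrow> ('a \<Rightarrow> 'w::real_normed_vector) \<Rightarrow> bool" where
  "chart_smooth c h \<longleftrightarrow> smooth_on (h \<circ> chart_inv c) (snd c ` fst c)"

locale compact_manifold =
  fixes M :: "'a topology" and A :: "('a, 'n::finite) chart set"
  assumes compact_complex_manifold: "compact_complex_manifold M A"
begin

lemma compact_M: "compact_space M" and Hausdorff_M: "Hausdorff_space M"
  and openin_chart: "\<And>c. c \<in> A \<Longrightarrow> openin M (fst c)"
  and open_chart_image: "\<And>c. c \<in> A \<Longrightarrow> open (snd c ` fst c)"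
  and homeomorphic_chart:
    "\<And>c. c \<in> A \<Longrightarrow> homeomorphic_map (subtopology M (fst c)) (top_of_set (snd c ` fst c)) (snd c)"
  and Union_charts: "(\<Union>c\<in>A. fst c) = topspace M"
  and holomorphic_transition: "\<And>c d. c \<in> A \<Longrightarrow> d \<in> A \<Longrightarrow>
    holomorphic_map_on (snd d \<circ> chart_inv c) (snd c ` (fst c \<inter> fst d))"
  using compact_complex_manifold unfolding compact_complex_manifold_def by blast+

lemma chart_subset: "c \<in> A \<Longrightarrow> fst c \<subseteq> topspace M"
  using openin_chart openin_subset by blast

lemma inj_on_chart: "c \<in> A \<Longrightarrow> inj_on (snd c) (fst c)"
  using homeomorphic_imp_injective_map[OF homeomorphic_chart] chart_subset
  by (simp add: inf.absorb2)

lemma chart_inv_chart: "c \<in> A \<Longrightarrow> p \<in> fst c \<Longrightarrow> chart_inv c (snd c p) = p"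
  unfolding chart_inv_def using inj_on_chart by simp

lemma chart_inv_in: "x \<in> snd c ` fst c \<Longrightarrow> chart_inv c x \<in> fst c"
  unfolding chart_inv_def by (rule inv_into_into)

lemma chart_chart_inv: "x \<in> snd c ` fst c \<Longrightarrow> snd c (chart_inv c x) = x"
  unfolding chart_inv_def by (rule f_inv_into_f)

lemma open_chart_image_of_open:
  assumes c: "c \<in> A" and U: "openin M U" "U \<subseteq> fst c"
  shows "open (snd c ` U)"
proof -
  have "openin (subtopology M (fst c)) U"
    using U by (auto simp: openin_subtopology)
  then have "openin (top_of_set (snd c ` fst c)) (snd c ` U)"
    using homeomorphic_imp_open_map[OF homeomorphic_chart[OF c]] by (simp add: open_map_def)
  then show ?thesis using openin_open_trans open_chart_image[OF c] by blast
qed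

lemma open_overlap: "c \<in> A \<Longrightarrow> d \<in> A \<Longrightarrow> open (snd c ` (fst c \<inter> fst d))"
  by (intro open_chart_image_of_open openin_Int openin_chart) auto

lemma openin_chart_preimage:
  assumes c: "c \<in> A" and V: "open V"
  shows "openin M {p \<in> fst c. snd c p \<in> V}"
proof -
  have "continuous_map (subtopology M (fst c)) euclidean (snd c)"
    using homeomorphic_imp_continuous_map[OF homeomorphic_chart[OF c]] continuous_map_in_subtopology by blast
  then have "openin (subtopology M (fst c)) {p \<in> topspace (subtopology M (fst c)). snd c p \<in> V}"
    using V by (auto simp: continuous_map_def)
  moreover have "topspace (subtopology M (fst c)) = fst c"
    using chart_subset[OF c] by auto
  ultimately have "openin (subtopology M (fst c)) {p \<in> fst c. snd c p \<in> V}" by (simp only:)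
  then show ?thesis using openin_chart[OF c] openin_open_subtopology by blast
qed

lemma compact_chart_image:
  assumes c: "c \<in> A" and K: "closedin M K" "K \<subseteq> fst c"
  shows "compact (snd c ` K)"
proof -
  have "compactin M K" using compact_M K(1) closedin_compact_space by blast
  then have "compactin (subtopology M (fst c)) K" using K(2) by (simp add: compactin_subtopology)
  then have "compactin (top_of_set (snd c ` fst c)) (snd c ` K)"
    using image_compactin homeomorphic_imp_continuous_map[OF homeomorphic_chart[OF c]] by blast
  then show ?thesis by (simp add: compactin_subtopology)
qed

text \<open>This is where the Hausdorff property enters: the compact image is closed in the whole manifold, so that a bump function supported in
it extends by zero.\<close>

lemma closedin_chart_inv_image:
  assumes c: "c \<in> A" and K: "compact K" "K \<subseteq> snd c ` fst c"
  shows "closedin M (chart_inv c ` K)"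
proof -
  obtain g where g: "homeomorphic_maps (subtopology M (fst c)) (top_of_set (snd c ` fst c)) (snd c) g"
    using homeomorphic_chart[OF c] homeomorphic_map_maps by blast
  have "chart_inv c x = g x" if x: "x \<in> K" for x
  proof -
    have "x \<in> snd c ` fst c" using K x by blast
    then obtain p where p: "p \<in> fst c" "x = snd c p" by blast
    have "p \<in> topspace (subtopology M (fst c))" using p chart_subset[OF c] by auto
    then have "g x = p" using g p unfolding homeomorphic_maps_def by blast
    then show ?thesis using p chart_inv_chart[OF c] by simp
  qed
  then have "chart_inv c ` K = g ` K" by (intro image_cong) auto
  moreover have "compactin (top_of_set (snd c ` fst c)) K"
    using K by (simp add: compactin_subtopology)
  then have "compactin (subtopology M (fst c)) (g ` K)"
    using g image_compactin unfolding homeomorphic_maps_def by blast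
  ultimately have "compactin M (chart_inv c ` K)" by (simp add: compactin_subtopology)
  then show ?thesis using Hausdorff_M compactin_imp_closedin by blast
qed

lemma smooth_transition:
  "c \<in> A \<Longrightarrow> d \<in> A \<Longrightarrow> smooth_on (snd d \<circ> chart_inv c) (snd c ` (fst c \<inter> fst d))"
  by (intro holomorphic_map_imp_smooth_on holomorphic_transition open_overlap)

lemma smooth_function_iff: "smooth_function A h \<longleftrightarrow> (\<forall>c\<in>A. chart_smooth c h)"
  by (simp add: smooth_function_def chart_smooth_def)

end

section \<open>Existence of partitions of unity\<close>

text \<open>The powers of \<open>1/t\<close> are there to make the family closed under differentiation; \<open>flat 0\<close> is the usual flat function.\<close>

definition flat :: "nat \<Rightarrow> real \<Rightarrow> real" where
  "flat k t = (if t > 0 then inverse t ^ k * exp (- inverse t) else 0)"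

lemma flat_tendsto_0: "(flat k \<longlongrightarrow> 0) (at 0)"
proof -
  have "((\<lambda>x::real. x ^ k / exp x) \<longlongrightarrow> 0) at_top" by (rule tendsto_power_div_exp_0)
  then have "((\<lambda>t::real. inverse t ^ k / exp (inverse t)) \<longlongrightarrow> 0) (at_right 0)"
    by (rule filterlim_compose[OF _ filterlim_inverse_at_top_right])
  moreover have ev: "\<forall>\<^sub>F t in at_right 0. inverse t ^ k / exp (inverse t) = flat k t"
    unfolding eventually_at_filter by (rule always_eventually) (auto simp: flat_def exp_minus field_simps)
  ultimately have "(flat k \<longlongrightarrow> 0) (at_right 0)" using tendsto_cong[OF ev, of 0] by (simp only:)
  moreover have "(flat k \<longlongrightarrow> 0) (at_left 0)"
  proof (rule tendsto_eventually)
    show "\<forall>\<^sub>F t in at_left 0. flat k t = 0"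
      unfolding eventually_at_filter by (rule always_eventually) (auto simp: flat_def)
  qed
  ultimately show ?thesis using filterlim_split_at by blast
qed

lemma flat_has_derivative: "(flat k has_real_derivative flat (k + 2) t - real k * flat (k + 1) t) (at t)"
proof (cases t "0 :: real" rule: linorder_cases)
  case less
  have "((\<lambda>t. 0) has_real_derivative 0) (at t)" by simp
  then have "(flat k has_real_derivative 0) (at t)"
    by (rule has_field_derivative_transform_within_open[of _ _ _ "{..<0}"]) (use less in \<open>auto simp: flat_def\<close>)
  then show ?thesis using less by (simp add: flat_def)
next
  case equal
  have "((\<lambda>h. flat k h / h) \<longlongrightarrow> 0) (at 0)"
  proof (rule tendsto_cong[THEN iffD1, OF _ flat_tendsto_0[of "Suc k"]])
    show "\<forall>\<^sub>F x in at 0. flat (Suc k) x = flat k x / x"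
      unfolding eventually_at_filter by (rule always_eventually) (auto simp: flat_def divide_inverse)
  qed
  then show ?thesis using equal by (simp add: has_field_derivative_iff flat_def)
next
  case greater
  have "((\<lambda>t. inverse t ^ k * exp (- inverse t)) has_real_derivative flat (k + 2) t - real k * flat (k + 1) t) (at t)"
  proof -
    have e: "((\<lambda>t. exp (- inverse t)) has_real_derivative exp (- inverse t) * inverse t ^ 2) (at t)"
      using greater by (auto intro!: derivative_eq_intros simp: power2_eq_square)
    have i: "((\<lambda>t. inverse t) has_real_derivative - (inverse t ^ Suc (Suc 0))) (at t)"
      using greater by (intro DERIV_inverse) auto
    show ?thesis
      by (rule DERIV_cong[OF DERIV_mult[OF DERIV_power[OF i, of k] e]])
        (cases k; use greater in \<open>simp add: flat_def power2_eq_square algebra_simps\<close>)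
  qed
  then show ?thesis
    by (rule has_field_derivative_transform_within_open[of _ _ _ "{0<..}"]) (use greater in \<open>auto simp: flat_def\<close>)
qed

text \<open>The derivative of a member of the family is a linear combination of two others, so smoothness of all of them follows at once by induction.\<close>

lemma smooth_on_flat: "smooth_on (flat m) UNIV"
proof -
  have "Ck_on k (flat m) UNIV" for k
  proof (induction k arbitrary: m)
    case 0
    then show ?case
      using DERIV_isCont[OF flat_has_derivative[of m]] by (simp add: continuous_at_imp_continuous_on)
  next
    case (Suc k)
    show ?case
    proof (rule Ck_on_SucI[where F'="\<lambda>t v. (flat (m + 2) t + - real m * flat (m + 1) t) * v"])
      show "(flat m has_derivative (\<lambda>v. (flat (m + 2) t + - real m * flat (m + 1) t) * v)) (at t)" for t
        using flat_has_derivative[of m t] by (simp add: has_field_derivative_def)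
      show "Ck_on k (\<lambda>t. (flat (m + 2) t + - real m * flat (m + 1) t) * v) UNIV" for v
        by (intro Ck_on_bilinear[OF _ bounded_bilinear_mult] Ck_on_add Ck_on_const Suc.IH) auto
    qed simp
  qed
  then show ?thesis by (simp add: smooth_on_def)
qed

context compact_manifold
begin

lemma bump_function:
  assumes c: "c \<in> A" and p: "p \<in> fst c"
  shows "\<exists>b :: 'a \<Rightarrow> real. smooth_function A b \<and> (\<forall>q. 0 \<le> b q) \<and> b p > 0 \<and>
    openin M {q \<in> topspace M. b q \<noteq> 0} \<and> M closure_of {q \<in> topspace M. b q \<noteq> 0} \<subseteq> fst c"
proof -
  define x0 where "x0 = snd c p"
  obtain r where r: "0 < r" "cball x0 r \<subseteq> snd c ` fst c"
    using open_chart_image[OF c] p by (metis open_contains_cball imageI x0_def)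
  \<comment> \<open>The squared distance is used because it is smooth at the centre as well.\<close>
  define w where "w x = flat 0 (r\<^sup>2 - (x - x0) \<bullet> (x - x0))" for x
  define b where "b q = (if q \<in> fst c then w (snd c q) else 0)" for q
  have w: "smooth_on w UNIV"
    unfolding w_def
    by (intro smooth_on_compose[OF _ _ _ smooth_on_flat] smooth_on_diff smooth_on_const
        smooth_on_bilinear[OF _ bounded_bilinear_inner] smooth_on_bounded_linear bounded_linear_ident) auto
  have wpos: "w x \<noteq> 0 \<longleftrightarrow> x \<in> ball x0 r" for x
  proof -
    have "(x - x0) \<bullet> (x - x0) = (dist x0 x)\<^sup>2" by (metis dist_norm norm_minus_commute power2_norm_eq_inner)
    moreover have "(dist x0 x)\<^sup>2 < r\<^sup>2 \<longleftrightarrow> dist x0 x < r"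
      using r(1) power_strict_mono[of "dist x0 x" r 2] power2_less_imp_less[of "dist x0 x" r] by auto
    ultimately show ?thesis by (simp add: w_def flat_def)
  qed
  have w0: "0 \<le> w x" for x by (simp add: w_def flat_def)
  define C where "C = chart_inv c ` cball x0 r"
  have C: "closedin M C" unfolding C_def by (rule closedin_chart_inv_image[OF c compact_cball r(2)])
  have supp: "{q \<in> topspace M. b q \<noteq> 0} = {q \<in> fst c. snd c q \<in> ball x0 r}"
    using chart_subset[OF c] wpos by (auto simp: b_def)
  have suppC: "{q \<in> topspace M. b q \<noteq> 0} \<subseteq> C"
  proof
    fix q assume "q \<in> {q \<in> topspace M. b q \<noteq> 0}"
    then have q: "q \<in> fst c" "snd c q \<in> ball x0 r" unfolding supp by auto
    show "q \<in> C" unfolding C_def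
      by (rule image_eqI[of _ _ "snd c q"]) (use q chart_inv_chart[OF c q(1)] in auto)
  qed
  have Cc: "C \<subseteq> fst c" unfolding C_def using r(2) chart_inv_in[of _ c] by blast
  have "chart_smooth d b" if d: "d \<in> A" for d
  proof -
    let ?O1 = "snd d ` (fst d \<inter> fst c)" and ?O2 = "snd d ` (fst d - C)"
    have o1: "open ?O1" by (rule open_overlap[OF d c])
    have o2: "open ?O2"
    proof (rule open_chart_image_of_open[OF d])
      have "fst d - C = fst d \<inter> (topspace M - C)" using chart_subset[OF d] by auto
      then show "openin M (fst d - C)" using openin_chart[OF d] C by (simp add: closedin_def openin_Int)
    qed auto
    have "smooth_on (\<lambda>x. w ((snd c \<circ> chart_inv d) x)) ?O1"
      by (rule smooth_on_compose[OF o1 open_UNIV smooth_transition[OF d c] w]) auto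
    then have 1: "smooth_on (b \<circ> chart_inv d) ?O1"
      by (rule smooth_on_cong[OF o1, rotated]) (auto simp: b_def chart_inv_chart[OF d])
    have 2: "smooth_on (b \<circ> chart_inv d) ?O2"
      by (rule smooth_on_cong[OF o2 _ smooth_on_const[of 0]])
        (use suppC chart_subset[OF d] in \<open>auto simp: chart_inv_chart[OF d]\<close>)
    have "snd d ` fst d = ?O1 \<union> ?O2" using Cc by auto
    then show ?thesis unfolding chart_smooth_def using smooth_on_Un[OF o1 o2 1 2] by simp
  qed
  moreover have "b p > 0" using wpos[of x0] w0[of x0] p r by (simp add: b_def x0_def less_le)
  moreover have "M closure_of {q \<in> topspace M. b q \<noteq> 0} \<subseteq> fst c"
    using closure_of_minimal[OF suppC C] Cc by blast
  moreover have "openin M {q \<in> topspace M. b q \<noteq> 0}"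
    unfolding supp by (rule openin_chart_preimage[OF c open_ball])
  moreover have "0 \<le> b q" for q using w0 by (simp add: b_def)
  ultimately show ?thesis unfolding smooth_function_iff by blast
qed

text \<open>Finitely many bump functions cover the manifold by compactness. Grouping them by the chart they belong to and dividing by the total makes
a family indexed by charts, which is the form in which \<open>integral_M\<close> wants it.\<close>

lemma partition_of_unity_exists: "\<exists>\<rho>. partition_of_unity M A \<rho>"
proof -
  have "\<forall>p\<in>topspace M. \<exists>c. \<exists>b :: 'a \<Rightarrow> real. c \<in> A \<and> smooth_function A b \<and> (\<forall>q. 0 \<le> b q) \<and> b p > 0 \<and>
    openin M {q \<in> topspace M. b q \<noteq> 0} \<and> M closure_of {q \<in> topspace M. b q \<noteq> 0} \<subseteq> fst c"
  proof
    fix p assume "p \<in> topspace M"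
    then obtain c where "c \<in> A" "p \<in> fst c" using Union_charts by blast
    with bump_function[OF this] show "\<exists>c. \<exists>b :: 'a \<Rightarrow> real. c \<in> A \<and> smooth_function A b \<and> (\<forall>q. 0 \<le> b q) \<and> b p > 0 \<and>
      openin M {q \<in> topspace M. b q \<noteq> 0} \<and> M closure_of {q \<in> topspace M. b q \<noteq> 0} \<subseteq> fst c" by blast
  qed
  then obtain C where "\<forall>p\<in>topspace M. \<exists>b :: 'a \<Rightarrow> real. C p \<in> A \<and> smooth_function A b \<and> (\<forall>q. 0 \<le> b q) \<and> b p > 0 \<and>
      openin M {q \<in> topspace M. b q \<noteq> 0} \<and> M closure_of {q \<in> topspace M. b q \<noteq> 0} \<subseteq> fst (C p)"
    unfolding bchoice_iff by blast
  then obtain B :: "'a \<Rightarrow> 'a \<Rightarrow> real" where CB: "\<And>p. p \<in> topspace M \<Longrightarrow> C p \<in> A \<and> smooth_function A (B p) \<and> (\<forall>q. 0 \<le> B p q) \<and> B p p > 0 \<and>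
      openin M {q \<in> topspace M. B p q \<noteq> 0} \<and> M closure_of {q \<in> topspace M. B p q \<noteq> 0} \<subseteq> fst (C p)"
    unfolding bchoice_iff by blast
  let ?U = "\<lambda>p. {q \<in> topspace M. B p q \<noteq> 0}"
  have "\<exists>\<F>. finite \<F> \<and> \<F> \<subseteq> ?U ` topspace M \<and> topspace M \<subseteq> \<Union>\<F>"
  proof (rule compactinD[OF compact_M[unfolded compact_space_def]])
    show "topspace M \<subseteq> \<Union>(?U ` topspace M)" using CB by (force simp: less_le)
  qed (use CB in auto)
  then obtain \<F> where \<F>: "finite \<F>" "\<F> \<subseteq> ?U ` topspace M" "topspace M \<subseteq> \<Union>\<F>" by blast
  obtain F where F0: "F \<subseteq> topspace M" "finite F" "\<F> = ?U ` F"
    using finite_subset_image[OF \<F>(1,2)] by blast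
  have F: "finite F" "F \<subseteq> topspace M" "topspace M \<subseteq> (\<Union>p\<in>F. ?U p)"
    using F0 \<F>(3) by (simp_all only:)
  define s where "s q = (\<Sum>p\<in>F. B p q)" for q
  have spos: "s q > 0" if q: "q \<in> topspace M" for q
  proof -
    obtain p where "p \<in> F" "B p q \<noteq> 0" using F q by blast
    then show ?thesis unfolding s_def using CB F by (intro sum_pos2[OF F(1)]) (auto simp: less_le)
  qed
  \<comment> \<open>Several of the chosen points may share a chart.\<close>
  define \<rho> where "\<rho> c q = (\<Sum>p | p \<in> F \<and> C p = c. B p q) * inverse (s q)" for c q
  have active: "active_charts M A \<rho> \<subseteq> C ` F"
  proof
    fix c assume "c \<in> active_charts M A \<rho>"
    then obtain q where q: "\<rho> c q \<noteq> 0" by (auto simp: active_charts_def)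
    have "{p. p \<in> F \<and> C p = c} \<noteq> {}"
    proof
      assume e: "{p. p \<in> F \<and> C p = c} = {}"
      have "\<rho> c q = 0" unfolding \<rho>_def e by simp
      with q show False by simp
    qed
    then show "c \<in> C ` F" by blast
  qed
  have "partition_of_unity M A \<rho>"
    unfolding partition_of_unity_def
  proof (intro conjI ballI)
    show "finite (active_charts M A \<rho>)" using active F(1) finite_surj by blast
  next
    fix c assume c: "c \<in> A"
    have "smooth_on (\<rho> c \<circ> chart_inv d) (snd d ` fst d)" if d: "d \<in> A" for d
    proof -
      note od = open_chart_image[OF d]
      have sB: "smooth_on (\<lambda>x. B p (chart_inv d x)) (snd d ` fst d)" if "p \<in> F" for p
        using CB[of p] F that d by (auto simp: smooth_function_def o_def)
      have "s (chart_inv d x) \<noteq> 0" if "x \<in> snd d ` fst d" for x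
        using spos[of "chart_inv d x"] chart_inv_in[OF that] chart_subset[OF d] by auto
      then show ?thesis
        unfolding \<rho>_def o_def s_def
        by (intro smooth_on_mult smooth_on_inverse smooth_on_sum od sB) auto
    qed
    then show "smooth_function A (\<rho> c)" by (simp add: smooth_function_def)
    show "0 \<le> \<rho> c p" if "p \<in> topspace M" for p
      unfolding \<rho>_def using spos[OF that] CB F by (intro mult_nonneg_nonneg sum_nonneg) (auto simp: less_imp_le)
    have "{p \<in> topspace M. \<rho> c p \<noteq> 0} \<subseteq> \<Union>(?U ` {p. p \<in> F \<and> C p = c})"
    proof
      fix q assume q: "q \<in> {p \<in> topspace M. \<rho> c p \<noteq> 0}"
      then have ne: "(\<Sum>p | p \<in> F \<and> C p = c. B p q) \<noteq> 0" by (auto simp: \<rho>_def)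
      have "\<exists>p. p \<in> F \<and> C p = c \<and> B p q \<noteq> 0"
      proof (rule ccontr)
        assume "\<not> ?thesis"
        then have "(\<Sum>p | p \<in> F \<and> C p = c. B p q) = 0" by (intro sum.neutral) auto
        with ne show False by simp
      qed
      then obtain p where "p \<in> F" "C p = c" "B p q \<noteq> 0" by blast
      with q show "q \<in> \<Union>(?U ` {p. p \<in> F \<and> C p = c})" by blast
    qed
    then have "M closure_of {p \<in> topspace M. \<rho> c p \<noteq> 0} \<subseteq> M closure_of \<Union>(?U ` {p. p \<in> F \<and> C p = c})"
      by (rule closure_of_mono)
    also have "\<dots> = \<Union>((\<lambda>S. M closure_of S) ` ?U ` {p. p \<in> F \<and> C p = c})"
      using F(1) by (subst closure_of_Union) auto
    also have "\<dots> \<subseteq> fst c" using CB F(2) by blast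
    finally show "M closure_of {p \<in> topspace M. \<rho> c p \<noteq> 0} \<subseteq> fst c" .
  next
    fix q assume q: "q \<in> topspace M"
    have "(\<Sum>c\<in>active_charts M A \<rho>. \<rho> c q) = (\<Sum>c\<in>C ` F. \<rho> c q)"
      using active F CB q by (intro sum.mono_neutral_left) (auto simp: active_charts_def)
    also have "\<dots> = (\<Sum>c\<in>C ` F. \<Sum>p | p \<in> F \<and> C p = c. B p q) * inverse (s q)"
      unfolding \<rho>_def by (simp add: sum_distrib_right)
    also have "(\<Sum>c\<in>C ` F. \<Sum>p | p \<in> F \<and> C p = c. B p q) = s q"
      unfolding s_def by (rule sum.image_gen[OF F(1), symmetric])
    finally show "(\<Sum>c\<in>active_charts M A \<rho>. \<rho> c q) = 1" using spos[OF q] by simp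
  qed
  then show ?thesis by blast
qed

end

section \<open>Calculus in charts\<close>

context compact_manifold
begin

text \<open>The domains on which functions are differentiated: open sets contained in a chart domain.\<close>

definition region :: "('a, 'n) chart \<Rightarrow> 'a set \<Rightarrow> bool" where
  "region c U \<longleftrightarrow> c \<in> A \<and> openin M U \<and> U \<subseteq> fst c"

definition smooth_in :: "('a, 'n) chart \<Rightarrow> 'a set \<Rightarrow> ('a \<Rightarrow> 'w::real_normed_vector) \<Rightarrow> bool" where
  "smooth_in c U h \<longleftrightarrow> region c U \<and> smooth_on (\<lambda>x. h (chart_inv c x)) (snd c ` U)"

lemma region_chart: "c \<in> A \<Longrightarrow> region c (fst c)"
  and region_Int: "region c U \<Longrightarrow> openin M V \<Longrightarrow> region c (U \<inter> V)"
  and region_overlap: "c \<in> A \<Longrightarrow> d \<in> A \<Longrightarrow> region c (fst c \<inter> fst d)"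
  unfolding region_def by (auto intro: openin_chart)

lemma region_open: "region c U \<Longrightarrow> open (snd c ` U)"
  unfolding region_def using open_chart_image_of_open by blast

lemma smooth_in_region: "smooth_in c U h \<Longrightarrow> region c U"
  by (simp add: smooth_in_def)

lemma region_chart_inv: "region c U \<Longrightarrow> p \<in> U \<Longrightarrow> chart_inv c (snd c p) = p"
  unfolding region_def using chart_inv_chart by blast

lemma smooth_function_imp_smooth_in: "smooth_function A h \<Longrightarrow> c \<in> A \<Longrightarrow> smooth_in c (fst c) h"
  by (auto simp: smooth_function_def smooth_in_def region_chart o_def)

lemma smooth_in_subset: "smooth_in c U h \<Longrightarrow> region c V \<Longrightarrow> V \<subseteq> U \<Longrightarrow> smooth_in c V h"
  unfolding smooth_in_def by (auto intro: smooth_on_subset)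

lemma smooth_in_cong:
  assumes "\<And>q. q \<in> U \<Longrightarrow> h q = k q" "smooth_in c U h"
  shows "smooth_in c U k"
proof -
  have r: "region c U" using assms(2) by (rule smooth_in_region)
  have eq: "h (chart_inv c x) = k (chart_inv c x)" if "x \<in> snd c ` U" for x
    using that assms(1) by (auto simp: region_chart_inv[OF r])
  have sh: "smooth_on (\<lambda>x. h (chart_inv c x)) (snd c ` U)" using assms(2) by (simp add: smooth_in_def)
  have "smooth_on (\<lambda>x. k (chart_inv c x)) (snd c ` U)"
    by (rule smooth_on_cong[where F="\<lambda>x. h (chart_inv c x)" and G="\<lambda>x. k (chart_inv c x)", OF region_open[OF r]], erule eq, rule sh)
  with r show ?thesis by (simp add: smooth_in_def)
qed

lemma smooth_in_const: "region c U \<Longrightarrow> smooth_in c U (\<lambda>q. a)"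
  by (simp add: smooth_in_def smooth_on_const)

lemma smooth_in_add: "smooth_in c U h \<Longrightarrow> smooth_in c U k \<Longrightarrow> smooth_in c U (\<lambda>q. h q + k q)"
  unfolding smooth_in_def using smooth_on_add region_open by blast

lemma smooth_in_diff: "smooth_in c U h \<Longrightarrow> smooth_in c U k \<Longrightarrow> smooth_in c U (\<lambda>q. h q - k q)"
  unfolding smooth_in_def using smooth_on_diff region_open by blast

lemma smooth_in_mult:
  fixes h k :: "'a \<Rightarrow> 'w::real_normed_field"
  shows "smooth_in c U h \<Longrightarrow> smooth_in c U k \<Longrightarrow> smooth_in c U (\<lambda>q. h q * k q)"
  unfolding smooth_in_def using smooth_on_mult region_open by blast

lemma smooth_in_cnj: "smooth_in c U h \<Longrightarrow> smooth_in c U (\<lambda>q. cnj (h q))"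
  unfolding smooth_in_def using smooth_on_cnj region_open by blast

lemma smooth_in_of_real: "smooth_in c U h \<Longrightarrow> smooth_in c U (\<lambda>q. complex_of_real (h q))"
  unfolding smooth_in_def using smooth_on_of_real region_open by blast

lemma smooth_in_sum:
  "region c U \<Longrightarrow> (\<And>i. i \<in> I \<Longrightarrow> smooth_in c U (h i)) \<Longrightarrow> smooth_in c U (\<lambda>q. \<Sum>i\<in>I. h i q)"
  unfolding smooth_in_def using smooth_on_sum[of "snd c ` U" I "\<lambda>i x. h i (chart_inv c x)"] region_open by blast

lemma smooth_in_differentiable:
  "smooth_in c U h \<Longrightarrow> p \<in> U \<Longrightarrow> (\<lambda>x. h (chart_inv c x)) differentiable at (snd c p)"
  unfolding smooth_in_def using smooth_on_imp_differentiable by blast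

lemma smooth_in_pd: "smooth_in c U h \<Longrightarrow> smooth_in c U (pd c i h)"
  and smooth_in_pd_bar: "smooth_in c U h \<Longrightarrow> smooth_in c U (pd_bar c i h)"
proof -
  assume h: "smooth_in c U h"
  then have r: "region c U" by (rule smooth_in_region)
  have 1: "smooth_on (wirt i (\<lambda>x. h (chart_inv c x))) (snd c ` U)"
    "smooth_on (wirt_bar i (\<lambda>x. h (chart_inv c x))) (snd c ` U)"
    using h region_open[OF r] by (auto simp: smooth_in_def intro: smooth_on_wirt smooth_on_wirt_bar)
  have 2: "snd c (chart_inv c x) = x" if "x \<in> snd c ` U" for x
    using that r by (auto simp: region_chart_inv)
  show "smooth_in c U (pd c i h)" "smooth_in c U (pd_bar c i h)"
    unfolding smooth_in_def pd_def pd_bar_def o_def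
    using smooth_on_cong[OF region_open[OF r] _ 1(1)] smooth_on_cong[OF region_open[OF r] _ 1(2)] r 2 by auto
qed

context
  fixes c U h k p
  assumes h: "smooth_in c U (h :: 'a \<Rightarrow> complex)" and k: "smooth_in c U (k :: 'a \<Rightarrow> complex)" and p: "p \<in> U"
begin

lemma pd_add: "pd c i (\<lambda>q. h q + k q) p = pd c i h p + pd c i k p"
  and pd_bar_add: "pd_bar c i (\<lambda>q. h q + k q) p = pd_bar c i h p + pd_bar c i k p"
  unfolding pd_def pd_bar_def o_def
  by (rule wirt_add wirt_bar_add smooth_in_differentiable[OF h p] smooth_in_differentiable[OF k p])+

lemma pd_mult: "pd c i (\<lambda>q. h q * k q) p = pd c i h p * k p + h p * pd c i k p"
  and pd_bar_mult: "pd_bar c i (\<lambda>q. h q * k q) p = pd_bar c i h p * k p + h p * pd_bar c i k p"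
  using wirt_mult[OF smooth_in_differentiable[OF h p] smooth_in_differentiable[OF k p], of i]
    wirt_bar_mult[OF smooth_in_differentiable[OF h p] smooth_in_differentiable[OF k p], of i]
    region_chart_inv[OF smooth_in_region[OF h] p]
  by (simp_all add: pd_def pd_bar_def o_def)

lemma pd_cnj: "pd c i (\<lambda>q. cnj (h q)) p = cnj (pd_bar c i h p)"
  and pd_bar_cnj: "pd_bar c i (\<lambda>q. cnj (h q)) p = cnj (pd c i h p)"
  unfolding pd_def pd_bar_def o_def
  by (rule wirt_cnj wirt_bar_cnj smooth_in_differentiable[OF h p])+

lemma
  assumes "\<And>q. q \<in> U \<Longrightarrow> h q = k' q"
  shows pd_cong: "pd c i h p = pd c i k' p" and pd_bar_cong: "pd_bar c i h p = pd_bar c i k' p"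
proof -
  have r: "region c U" using h by (rule smooth_in_region)
  have "h (chart_inv c x) = k' (chart_inv c x)" if "x \<in> snd c ` U" for x
    using that assms by (auto simp: region_chart_inv[OF r])
  then show "pd c i h p = pd c i k' p" "pd_bar c i h p = pd_bar c i k' p"
    unfolding pd_def pd_bar_def o_def
    using wirt_cong_open[OF region_open[OF r] _ _ smooth_in_differentiable[OF h p]]
      wirt_bar_cong_open[OF region_open[OF r] _ _ smooth_in_differentiable[OF h p]] p by auto
qed

lemma pd_commute: "pd c i (pd c j h) p = pd c j (pd c i h) p"
  and pd_pd_bar_commute: "pd c i (pd_bar c j h) p = pd_bar c j (pd c i h) p"
proof -
  have r: "region c U" using h by (rule smooth_in_region)
  let ?h = "\<lambda>x. h (chart_inv c x)"
  have s: "smooth_on ?h (snd c ` U)" using h by (simp add: smooth_in_def)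
  note o = region_open[OF r]
  have inv: "snd c (chart_inv c x) = x" if "x \<in> snd c ` U" for x
    using that r by (auto simp: region_chart_inv)
  have px: "snd c p \<in> snd c ` U" using p by blast
  have e: "wirt i (\<lambda>x. W j ?h (snd c (chart_inv c x))) (snd c p) = wirt i (W j ?h) (snd c p)"
    "wirt_bar i (\<lambda>x. W j ?h (snd c (chart_inv c x))) (snd c p) = wirt_bar i (W j ?h) (snd c p)"
    if W: "smooth_on (W j ?h) (snd c ` U)" for W :: "'n \<Rightarrow> _" and i j
    using wirt_cong_open[OF o px _ smooth_on_imp_differentiable[OF W px], of "\<lambda>x. W j ?h (snd c (chart_inv c x))" i]
      wirt_bar_cong_open[OF o px _ smooth_on_imp_differentiable[OF W px], of "\<lambda>x. W j ?h (snd c (chart_inv c x))" i]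
    by (simp_all add: inv)
  note w = smooth_on_wirt[OF o s] smooth_on_wirt_bar[OF o s]
  show "pd c i (pd c j h) p = pd c j (pd c i h) p"
    unfolding pd_def o_def e(1)[of wirt, OF w(1)] by (rule wirt_commute[OF o px s])
  show "pd c i (pd_bar c j h) p = pd_bar c j (pd c i h) p"
    unfolding pd_def pd_bar_def o_def e(1)[of wirt_bar, OF w(2)] e(2)[of wirt, OF w(1)]
    by (rule wirt_wirt_bar_commute[OF o px s])
qed

end

lemma pd_const: "pd c i (\<lambda>q. a) p = 0" and pd_bar_const: "pd_bar c i (\<lambda>q. a) p = 0"
  by (simp_all add: pd_def pd_bar_def o_def wirt_const wirt_bar_const)

lemma pd_sum:
  assumes "region c U" "\<And>j. j \<in> I \<Longrightarrow> smooth_in c U (h j)" "p \<in> U"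
  shows "pd c i (\<lambda>q. \<Sum>j\<in>I. h j q) p = (\<Sum>j\<in>I. pd c i (h j) p)"
  using assms(2)
  by (induction I rule: infinite_finite_induct)
    (auto simp: pd_const intro!: pd_add[where U=U, THEN trans] smooth_in_sum assms(1,3))

lemma pd_bar_sum:
  assumes "region c U" "\<And>j. j \<in> I \<Longrightarrow> smooth_in c U (h j)" "p \<in> U"
  shows "pd_bar c i (\<lambda>q. \<Sum>j\<in>I. h j q) p = (\<Sum>j\<in>I. pd_bar c i (h j) p)"
  using assms(2)
  by (induction I rule: infinite_finite_induct)
    (auto simp: pd_bar_const intro!: pd_bar_add[where U=U, THEN trans] smooth_in_sum assms(1,3))

text \<open>The Jacobian matrix \<open>\<partial>w\<^sup>k/\<partial>z\<^sup>i\<close> of the transition from the coordinates \<open>z\<close> of \<open>c\<close> to the coordinates \<open>w\<close> of \<open>d\<close>.\<close>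

definition jac :: "('a, 'n) chart \<Rightarrow> ('a, 'n) chart \<Rightarrow> 'n \<Rightarrow> 'n \<Rightarrow> 'a \<Rightarrow> complex" where
  "jac c d i k = pd c i (\<lambda>q. snd d q $ k)"

lemma transition_component_holomorphic:
  assumes "c \<in> A" "d \<in> A"
  shows "several_holomorphic_on (\<lambda>x. snd d (chart_inv c x) $ k) (snd c ` (fst c \<inter> fst d))"
  using holomorphic_map_on_component[OF holomorphic_transition[OF assms]] by (simp add: o_def)

lemma several_holomorphic_on_subset: "several_holomorphic_on f S \<Longrightarrow> T \<subseteq> S \<Longrightarrow> several_holomorphic_on f T"
  by (auto simp: several_holomorphic_on_def)

lemma
  assumes c: "c \<in> A" and d: "d \<in> A"
  shows smooth_in_jac: "smooth_in c (fst c \<inter> fst d) (jac c d i k)"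
    and pd_bar_jac: "p \<in> fst c \<inter> fst d \<Longrightarrow> pd_bar c j (jac c d i k) p = 0"
proof -
  let ?O = "snd c ` (fst c \<inter> fst d)" and ?f = "\<lambda>x. snd d (chart_inv c x) $ k"
  have r: "region c (fst c \<inter> fst d)" by (rule region_overlap[OF c d])
  note o = region_open[OF r]
  have hol: "several_holomorphic_on ?f ?O" by (rule transition_component_holomorphic[OF c d])
  have inv: "snd c (chart_inv c x) = x" if "x \<in> ?O" for x
    using that r by (auto simp: region_chart_inv)
  have "smooth_on ?f ?O" by (rule several_holomorphic_imp_smooth_on[OF hol o])
  then have "smooth_in c (fst c \<inter> fst d) (\<lambda>q. snd d q $ k)" using r by (simp add: smooth_in_def)
  then show "smooth_in c (fst c \<inter> fst d) (jac c d i k)" unfolding jac_def by (rule smooth_in_pd)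
  have hD: "several_holomorphic_on (\<lambda>x. frechet_derivative ?f (at x) (axis i 1)) ?O"
    by (rule several_holomorphic_directional_derivative[OF hol o])
  have e: "jac c d i k (chart_inv c x) = frechet_derivative ?f (at x) (axis i 1)" if x: "x \<in> ?O" for x
  proof -
    have "axis i \<i> = \<i> *s axis i 1" by (simp add: axis_def vec_eq_iff)
    then have "frechet_derivative ?f (at x) (axis i \<i>) = \<i> * frechet_derivative ?f (at x) (axis i 1)"
      using bspec[OF hol[unfolded several_holomorphic_on_def] x] by simp
    then show ?thesis by (simp add: jac_def pd_def o_def inv[OF x] wirt_def)
  qed
  show "pd_bar c j (jac c d i k) p = 0" if p: "p \<in> fst c \<inter> fst d"
  proof -
    have px: "snd c p \<in> ?O" using p by blast
    have "(\<lambda>x. frechet_derivative ?f (at x) (axis i 1)) differentiable at (snd c p)"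
      using bspec[OF hD[unfolded several_holomorphic_on_def] px] by blast
    then have "wirt_bar j (\<lambda>x. frechet_derivative ?f (at x) (axis i 1)) (snd c p) = wirt_bar j (\<lambda>x. jac c d i k (chart_inv c x)) (snd c p)"
      by (intro wirt_bar_cong_open[OF o px]) (simp add: e)
    then show ?thesis using wirt_bar_holomorphic[OF hD px] by (simp add: pd_bar_def o_def)
  qed
qed

lemma
  assumes c: "c \<in> A" and h: "smooth_in d U (h :: 'a \<Rightarrow> complex)"
  shows smooth_in_change: "smooth_in c (fst c \<inter> U) h"
    and pd_change: "p \<in> fst c \<Longrightarrow> p \<in> U \<Longrightarrow> pd c i h p = (\<Sum>k\<in>UNIV. jac c d i k p * pd d k h p)"
    and pd_bar_change: "p \<in> fst c \<Longrightarrow> p \<in> U \<Longrightarrow> pd_bar c i h p = (\<Sum>k\<in>UNIV. cnj (jac c d i k p) * pd_bar d k h p)"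
proof -
  have rd: "region d U" using h by (rule smooth_in_region)
  then have d: "d \<in> A" and U: "openin M U" "U \<subseteq> fst d" by (auto simp: region_def)
  have r: "region c (fst c \<inter> U)" using region_Int[OF region_chart[OF c] U(1)] .
  let ?O = "snd c ` (fst c \<inter> U)" and ?P = "\<lambda>x. snd d (chart_inv c x)"
  note o = region_open[OF r]
  have sub: "?O \<subseteq> snd c ` (fst c \<inter> fst d)" using U(2) by blast
  have sP: "smooth_on ?P ?O" using smooth_on_subset[OF smooth_transition[OF c d] sub] by (simp add: o_def)
  have sh: "smooth_on (\<lambda>x. h (chart_inv d x)) (snd d ` U)" using h by (simp add: smooth_in_def)
  have PO: "?P x \<in> snd d ` U" if "x \<in> ?O" for x using that r by (auto simp: region_chart_inv)
  have eq: "h (chart_inv d (?P x)) = h (chart_inv c x)" if "x \<in> ?O" for x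
    using that r rd by (auto simp: region_chart_inv)
  have comp: "smooth_on (\<lambda>x. h (chart_inv d (?P x))) ?O"
    by (rule smooth_on_compose[OF o region_open[OF rd] sP sh PO])
  have "smooth_on (\<lambda>x. h (chart_inv c x)) ?O"
    by (rule smooth_on_cong[where F="\<lambda>x. h (chart_inv d (?P x))" and G="\<lambda>x. h (chart_inv c x)", OF o], erule eq, rule comp)
  then show "smooth_in c (fst c \<inter> U) h" using r by (simp add: smooth_in_def)
  assume p: "p \<in> fst c" "p \<in> U"
  then have px: "snd c p \<in> ?O" by blast
  have Pp: "?P (snd c p) = snd d p" using p by (simp add: chart_inv_chart[OF c])
  have hol: "several_holomorphic_on (\<lambda>x. ?P x $ k) ?O" for k
    by (rule several_holomorphic_on_subset[OF transition_component_holomorphic[OF c d] sub])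
  have df: "(\<lambda>x. h (chart_inv d x)) differentiable at (?P (snd c p))"
    unfolding Pp by (rule smooth_in_differentiable[OF h p(2)])
  have j: "jac c d i k p = wirt i (\<lambda>x. ?P x $ k) (snd c p)" for i k by (simp add: jac_def pd_def o_def)
  have "wirt i (\<lambda>x. h (chart_inv c x)) (snd c p) = wirt i (\<lambda>x. h (chart_inv d (?P x))) (snd c p)"
    by (rule wirt_cong_open[OF o px eq smooth_on_imp_differentiable[OF comp px], symmetric])
  then show "pd c i h p = (\<Sum>k\<in>UNIV. jac c d i k p * pd d k h p)"
    using wirt_holomorphic_compose[OF hol px df, of i] unfolding Pp j[symmetric] by (simp add: pd_def o_def)
  have "wirt_bar i (\<lambda>x. h (chart_inv c x)) (snd c p) = wirt_bar i (\<lambda>x. h (chart_inv d (?P x))) (snd c p)"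
    by (rule wirt_bar_cong_open[OF o px eq smooth_on_imp_differentiable[OF comp px], symmetric])
  then show "pd_bar c i h p = (\<Sum>k\<in>UNIV. cnj (jac c d i k p) * pd_bar d k h p)"
    using wirt_bar_holomorphic_compose[OF hol px df, of i] unfolding Pp j[symmetric] by (simp add: pd_bar_def o_def)
qed

lemma transition_has_derivative:
  assumes c: "c \<in> A" and d: "d \<in> A" and p: "p \<in> fst c" "p \<in> fst d"
  shows "((\<lambda>x. snd d (chart_inv c x)) has_derivative (\<lambda>v. v v* (\<chi> i k. jac c d i k p))) (at (snd c p))"
proof -
  have px: "snd c p \<in> snd c ` (fst c \<inter> fst d)" using p by blast
  show ?thesis
    using several_holomorphic_has_derivative[OF transition_component_holomorphic[OF c d] px]
    by (simp add: jac_def pd_def o_def vector_matrix_mult_def mult.commute)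
qed

lemma scalar_eq:
  assumes "\<And>c d. c \<in> A \<Longrightarrow> d \<in> A \<Longrightarrow> p \<in> fst c \<Longrightarrow> p \<in> fst d \<Longrightarrow> h c p = h d p" "c \<in> A" "p \<in> fst c"
  shows "scalar A h p = h c p"
  unfolding scalar_def
proof (rule the_equality)
  show "\<forall>d\<in>A. p \<in> fst d \<longrightarrow> h d p = h c p"
    by (intro ballI impI assms(1)[OF _ assms(2) _ assms(3)])
  show "v = h c p" if "\<forall>d\<in>A. p \<in> fst d \<longrightarrow> h d p = v" for v
    using bspec[OF that assms(2)] assms(3) by simp
qed

end

section \<open>The divergence theorem\<close>

locale hermitian_manifold = compact_manifold M A
  for M :: "'a topology" and A :: "('a, 'n::finite) chart set" +
  fixes g :: "('a, 'n) metric"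
  assumes hermitian_metric: "hermitian_metric A g"
begin

lemma metric_posdef: "c \<in> A \<Longrightarrow> p \<in> fst c \<Longrightarrow> hermitian_posdef (g c p)"
  using hermitian_metric unfolding hermitian_metric_def hermitian_posdef_def by blast

lemma metric_change:
  "c \<in> A \<Longrightarrow> d \<in> A \<Longrightarrow> p \<in> fst c \<Longrightarrow> p \<in> fst d \<Longrightarrow>
    g c p $ i $ j = (\<Sum>k\<in>UNIV. \<Sum>l\<in>UNIV. jac c d i k p * cnj (jac c d j l p) * g d p $ k $ l)"
  using hermitian_metric unfolding hermitian_metric_def jac_def by blast

lemma metric_smooth: "c \<in> A \<Longrightarrow> smooth_on (\<lambda>x. g c (chart_inv c x)) (snd c ` fst c)"
  using hermitian_metric unfolding hermitian_metric_def by (auto simp: o_def)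

lemma smooth_in_metric: "c \<in> A \<Longrightarrow> smooth_in c (fst c) (\<lambda>q. g c q $ i $ j)"
  unfolding smooth_in_def
  by (auto intro!: region_chart smooth_on_vec_nth metric_smooth open_chart_image)

definition vol :: "('a, 'n) chart \<Rightarrow> 'a \<Rightarrow> real" where
  "vol c p = volume_density (g c p)"

lemma vol_pos: "c \<in> A \<Longrightarrow> p \<in> fst c \<Longrightarrow> vol c p > 0"
  unfolding vol_def by (rule volume_density_pos[OF metric_posdef])

lemma smooth_in_vol: "c \<in> A \<Longrightarrow> smooth_in c (fst c) (vol c)"
proof -
  assume c: "c \<in> A"
  have "smooth_on (\<lambda>x. unit_volume TYPE('n) * Re (det (pad_matrix (g c (chart_inv c x))))) (snd c ` fst c)"
    by (intro smooth_on_mult smooth_on_Re smooth_on_const smooth_on_det_pad_matrix metric_smooth c open_chart_image)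
  then show ?thesis unfolding smooth_in_def vol_def volume_density_eq_det using c region_chart by blast
qed

text \<open>The expression \<open>tr (G\<^sup>-\<^sup>1 \<partial>\<^sub>i G)\<close>, which is \<open>\<partial>\<^sub>i log (det G)\<close> by Jacobi's formula.\<close>

definition dlog_vol :: "('a, 'n) chart \<Rightarrow> 'n \<Rightarrow> 'a \<Rightarrow> complex" where
  "dlog_vol c i p = (\<Sum>j\<in>UNIV. \<Sum>k\<in>UNIV. matrix_inv (g c p) $ k $ j * pd c i (\<lambda>q. g c q $ j $ k) p)"

lemma pd_vol:
  assumes c: "c \<in> A" and p: "p \<in> fst c"
  shows "pd c i (\<lambda>q. of_real (vol c q)) p = of_real (vol c p) * dlog_vol c i p"
proof -
  let ?G = "\<lambda>x. g c (chart_inv c x)" and ?u = "complex_of_real (unit_volume TYPE('n))"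
  let ?B = "matrix_inv (g c p)"
  have inv: "chart_inv c (snd c p) = p" by (rule chart_inv_chart[OF c p])
  define G' where "G' j k = frechet_derivative (\<lambda>x. ?G x $ j $ k) (at (snd c p))" for j k
  have dG: "((\<lambda>x. ?G x $ j $ k) has_derivative G' j k) (at (snd c p))" for j k
    unfolding G'_def by (rule has_frechet_derivative[OF smooth_in_differentiable[OF smooth_in_metric[OF c] p]])
  have invG: "invertible (?G (snd c p))" unfolding inv by (rule hermitian_posdef_invertible[OF metric_posdef[OF c p]])
  have "((\<lambda>x. ?u * det (pad_matrix (?G x))) has_derivative (\<lambda>v. ?u * (det (pad_matrix (g c p)) *
     (\<Sum>j\<in>UNIV. \<Sum>k\<in>UNIV. ?B $ k $ j * G' j k v)))) (at (snd c p))"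
    by (rule has_derivative_mult_right[OF det_pad_matrix_has_derivative[OF dG invG, unfolded inv]])
  then have "((\<lambda>x. complex_of_real (vol c (chart_inv c x))) has_derivative (\<lambda>v. ?u * (det (pad_matrix (g c p)) *
     (\<Sum>j\<in>UNIV. \<Sum>k\<in>UNIV. ?B $ k $ j * G' j k v)))) (at (snd c p))"
  proof (rule has_derivative_transform_within_open[OF _ open_chart_image[OF c]])
    show "snd c p \<in> snd c ` fst c" using p by blast
    show "?u * det (pad_matrix (?G x)) = complex_of_real (vol c (chart_inv c x))" if "x \<in> snd c ` fst c" for x
      using of_real_volume_density[OF metric_posdef[OF c chart_inv_in[OF that]]] by (simp add: vol_def)
  qed
  then have fr: "frechet_derivative (\<lambda>x. complex_of_real (vol c (chart_inv c x))) (at (snd c p)) v =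
     of_real (vol c p) * (\<Sum>j\<in>UNIV. \<Sum>k\<in>UNIV. ?B $ k $ j * G' j k v)" for v
    unfolding vol_def of_real_volume_density[OF metric_posdef[OF c p]] mult.assoc
    by (rule fun_cong[OF frechet_derivative_at, symmetric])
  have e: "pd c i (\<lambda>q. g c q $ j $ k) p = (G' j k (axis i 1) - \<i> * G' j k (axis i \<i>)) / 2" for j k
    by (simp add: pd_def wirt_def G'_def o_def)
  show ?thesis
    unfolding dlog_vol_def e pd_def[of c i "\<lambda>q. of_real (vol c q)"] wirt_def o_def fr
    by (simp add: sum_subtractf sum_distrib_left sum_divide_distrib algebra_simps diff_divide_distrib)
qed

text \<open>Both densities are positive, hence so is the determinant: transition maps preserve the orientation, and the absolute value demanded by the
change of variables formula does no harm.\<close>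

lemma vol_change:
  assumes "c \<in> A" "d \<in> A" "p \<in> fst c" "p \<in> fst d"
  shows "vol c p = \<bar>det (real_matrix (\<chi> i k. jac c d i k p))\<bar> * vol d p"
proof -
  have "vol c p = det (real_matrix (\<chi> i k. jac c d i k p)) * vol d p"
    unfolding vol_def by (rule volume_density_congruence) (simp add: metric_change[OF assms])
  moreover have "vol c p > 0" "vol d p > 0" using vol_pos assms by blast+
  ultimately show ?thesis by (metis abs_of_pos abs_mult)
qed

definition chart_integrand :: "('a, 'n) chart \<Rightarrow> ('a \<Rightarrow> complex) \<Rightarrow> complex^'n \<Rightarrow> complex" where
  "chart_integrand c k x = indicator (snd c ` fst c) x *\<^sub>R (vol c (chart_inv c x) *\<^sub>R k (chart_inv c x))"

text \<open>Functions that can be integrated in the chart \<open>c\<close>. The support \<open>K\<close> is closed in the manifold, hence compact.\<close>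

definition supported :: "('a, 'n) chart \<Rightarrow> 'a set \<Rightarrow> ('a \<Rightarrow> complex) \<Rightarrow> bool" where
  "supported c K k \<longleftrightarrow> c \<in> A \<and> closedin M K \<and> K \<subseteq> fst c \<and> (\<forall>q\<in>fst c - K. k q = 0) \<and>
     continuous_on (snd c ` fst c) (\<lambda>x. k (chart_inv c x))"

lemma chart_integrand_zero:
  assumes "supported c K k" "x \<notin> snd c ` K"
  shows "chart_integrand c k x = 0"
proof (cases "x \<in> snd c ` fst c")
  case True
  then obtain q where q: "q \<in> fst c" "x = snd c q" by blast
  then have "q \<notin> K" using assms(2) by blast
  then have "k (chart_inv c x) = 0" using q assms(1) chart_inv_chart[of c q] by (auto simp: supported_def)
  then show ?thesis by (simp add: chart_integrand_def)
qed (simp add: chart_integrand_def)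

lemma continuous_on_vol: "c \<in> A \<Longrightarrow> continuous_on (snd c ` fst c) (\<lambda>x. vol c (chart_inv c x))"
  using smooth_in_vol smooth_on_imp_continuous_on unfolding smooth_in_def by blast

lemma integrable_chart_integrand:
  assumes "supported c K k"
  shows "integrable lborel (chart_integrand c k)"
proof (rule integrable_compact_support)
  have c: "c \<in> A" using assms by (simp add: supported_def)
  show "compact (snd c ` K)" using compact_chart_image[OF c] assms by (simp add: supported_def)
  have "continuous_on (snd c ` fst c) (\<lambda>x. vol c (chart_inv c x) *\<^sub>R k (chart_inv c x))"
    using assms by (intro continuous_intros continuous_on_vol c) (simp add: supported_def)
  then have "continuous_on (snd c ` fst c) (chart_integrand c k)"
    by (rule continuous_on_eq) (simp add: chart_integrand_def)
  then show "continuous_on (snd c ` K) (chart_integrand c k)"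
    by (rule continuous_on_subset) (use assms in \<open>auto simp: supported_def\<close>)
qed (rule chart_integrand_zero[OF assms])

lemma chart_integrand_restrict:
  assumes s: "supported c K k" and U: "region c U" "K \<subseteq> U"
  shows "(LINT x:snd c ` U|lborel. vol c (chart_inv c x) *\<^sub>R k (chart_inv c x)) = integral\<^sup>L lborel (chart_integrand c k)"
    and "set_integrable lborel (snd c ` U) (\<lambda>x. vol c (chart_inv c x) *\<^sub>R k (chart_inv c x))"
proof -
  have "indicator (snd c ` U) x *\<^sub>R (vol c (chart_inv c x) *\<^sub>R k (chart_inv c x)) = chart_integrand c k x" for x
  proof (cases "x \<in> snd c ` U")
    case True
    then have "x \<in> snd c ` fst c" using U by (auto simp: region_def)
    with True show ?thesis by (simp add: chart_integrand_def)
  next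
    case False
    then have "x \<notin> snd c ` K" using U by blast
    with False show ?thesis by (simp add: chart_integrand_zero[OF s])
  qed
  then show "(LINT x:snd c ` U|lborel. vol c (chart_inv c x) *\<^sub>R k (chart_inv c x)) = integral\<^sup>L lborel (chart_integrand c k)"
    "set_integrable lborel (snd c ` U) (\<lambda>x. vol c (chart_inv c x) *\<^sub>R k (chart_inv c x))"
    unfolding set_lebesgue_integral_def set_integrable_def using integrable_chart_integrand[OF s] by simp_all
qed

text \<open>For a function supported in both charts, both integrals live on the overlap, where the Jacobian determinant of the transition map cancels
the change of the density.\<close>

lemma chart_integral_independent:
  assumes sc: "supported c K k" and sd: "supported d K k"
  shows "integral\<^sup>L lborel (chart_integrand c k) = integral\<^sup>L lborel (chart_integrand d k)"
proof -
  have c: "c \<in> A" and d: "d \<in> A" and K: "K \<subseteq> fst c \<inter> fst d" using sc sd by (auto simp: supported_def)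
  let ?U = "fst c \<inter> fst d" and ?P = "\<lambda>x. snd d (chart_inv c x)"
  have rc: "region c ?U" by (rule region_overlap[OF c d])
  have rd: "region d ?U" using region_overlap[OF d c] by (simp add: Int_commute)
  let ?f = "\<lambda>u. vol d (chart_inv d u) *\<^sub>R k (chart_inv d u)"
  let ?P' = "\<lambda>x v. v v* (\<chi> i l. jac c d i l (chart_inv c x))"
  let ?D = "\<lambda>x. \<bar>det (\<chi> z l. real_coord (?P' x (real_frame l)) z)\<bar>"
  have img: "?P ` snd c ` ?U = snd d ` ?U"
    unfolding image_image by (rule image_cong) (auto simp: chart_inv_chart[OF c])
  have D: "?D x *\<^sub>R ?f (?P x) = vol c (chart_inv c x) *\<^sub>R k (chart_inv c x)" if x: "x \<in> snd c ` ?U" for x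
  proof -
    obtain p where p: "p \<in> fst c" "p \<in> fst d" "x = snd c p" using x by blast
    have "?D x = \<bar>det (real_matrix (\<chi> i l. jac c d i l p))\<bar>"
      by (simp add: p chart_inv_chart[OF c] real_matrix_def real_coord_def)
    then show ?thesis
      using vol_change[OF c d p(1,2)] by (simp add: p chart_inv_chart[OF c] chart_inv_chart[OF d])
  qed
  have der: "(?P has_derivative ?P' x) (at x)" if x: "x \<in> snd c ` ?U" for x
  proof -
    obtain p where p: "p \<in> fst c" "p \<in> fst d" "x = snd c p" using x by blast
    show ?thesis using transition_has_derivative[OF c d p(1,2)] by (simp add: p chart_inv_chart[OF c])
  qed
  have inj: "inj_on ?P (snd c ` ?U)"
  proof (rule inj_onI)
    fix x y assume x: "x \<in> snd c ` ?U" and y: "y \<in> snd c ` ?U" and e: "?P x = ?P y"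
    obtain p q where "p \<in> ?U" "x = snd c p" "q \<in> ?U" "y = snd c q" using x y by blast
    then show "x = y" using e inj_on_chart[OF d] by (auto simp: chart_inv_chart[OF c] inj_on_def)
  qed
  have "integral\<^sup>L lborel (chart_integrand d k) = (LINT u:?P ` snd c ` ?U|lborel. ?f u)"
    unfolding img by (rule chart_integrand_restrict(1)[OF sd rd K, symmetric])
  also have "\<dots> = (LINT x:snd c ` ?U|lborel. ?D x *\<^sub>R ?f (?P x))"
  proof (rule change_of_variables_complex[OF region_open[OF rc] der inj])
    show "set_integrable lborel (?P ` snd c ` ?U) ?f" unfolding img by (rule chart_integrand_restrict(2)[OF sd rd K])
    show "set_integrable lborel (snd c ` ?U) (\<lambda>x. ?D x *\<^sub>R ?f (?P x))"
      using chart_integrand_restrict(2)[OF sc rc K] D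
      by (subst set_integrable_cong[where f'="\<lambda>x. vol c (chart_inv c x) *\<^sub>R k (chart_inv c x)"]) auto
  qed
  also have "\<dots> = (LINT x:snd c ` ?U|lborel. vol c (chart_inv c x) *\<^sub>R k (chart_inv c x))"
    by (rule set_lebesgue_integral_cong) (use D region_open[OF rc] in auto)
  also have "\<dots> = integral\<^sup>L lborel (chart_integrand c k)"
    by (rule chart_integrand_restrict(1)[OF sc rc K])
  finally show ?thesis ..
qed

definition smooth_scalar :: "('a \<Rightarrow> complex) \<Rightarrow> bool" where
  "smooth_scalar h \<longleftrightarrow> (\<forall>c\<in>A. smooth_in c (fst c) h)"

definition pou :: "('a, 'n) chart \<Rightarrow> 'a \<Rightarrow> real" where
  "pou = (SOME \<rho>. partition_of_unity M A \<rho>)"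

definition act :: "('a, 'n) chart set" where
  "act = active_charts M A pou"

definition supp :: "('a, 'n) chart \<Rightarrow> 'a set" where
  "supp c = M closure_of {p \<in> topspace M. pou c p \<noteq> 0}"

lemma partition_of_unity_pou: "partition_of_unity M A pou"
  unfolding pou_def using partition_of_unity_exists by (rule someI_ex)

lemma finite_act: "finite act" and act_subset: "act \<subseteq> A"
  and sum_pou: "p \<in> topspace M \<Longrightarrow> (\<Sum>c\<in>act. pou c p) = 1"
  and pou_nonneg: "c \<in> A \<Longrightarrow> p \<in> topspace M \<Longrightarrow> 0 \<le> pou c p"
  and smooth_pou: "c \<in> A \<Longrightarrow> smooth_function A (pou c)"
  and supp_subset: "c \<in> A \<Longrightarrow> supp c \<subseteq> fst c"
  using partition_of_unity_pou unfolding partition_of_unity_def act_def supp_def by (auto simp: active_charts_def)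

lemma closedin_supp: "closedin M (supp c)" by (simp add: supp_def)

lemma pou_zero: "q \<in> topspace M \<Longrightarrow> q \<notin> supp c \<Longrightarrow> pou c q = 0"
  using closure_of_subset[of "{p \<in> topspace M. pou c p \<noteq> 0}" M] unfolding supp_def by auto

lemma smooth_scalar_pou: "c \<in> A \<Longrightarrow> smooth_scalar (\<lambda>q. of_real (pou c q))"
  unfolding smooth_scalar_def using smooth_function_imp_smooth_in[OF smooth_pou] smooth_in_of_real by blast

lemma smooth_scalar_continuous:
  "smooth_scalar h \<Longrightarrow> c \<in> A \<Longrightarrow> continuous_on (snd c ` fst c) (\<lambda>x. h (chart_inv c x))"
  unfolding smooth_scalar_def smooth_in_def using smooth_on_imp_continuous_on by blast

lemma smooth_scalar_add: "smooth_scalar h \<Longrightarrow> smooth_scalar k \<Longrightarrow> smooth_scalar (\<lambda>q. h q + k q)"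
  and smooth_scalar_mult: "smooth_scalar h \<Longrightarrow> smooth_scalar k \<Longrightarrow> smooth_scalar (\<lambda>q. h q * k q)"
  and smooth_scalar_diff: "smooth_scalar h \<Longrightarrow> smooth_scalar k \<Longrightarrow> smooth_scalar (\<lambda>q. h q - k q)"
  and smooth_scalar_const: "smooth_scalar (\<lambda>q. a)"
  and smooth_scalar_cnj: "smooth_scalar h \<Longrightarrow> smooth_scalar (\<lambda>q. cnj (h q))"
  unfolding smooth_scalar_def
  by (simp_all add: smooth_in_add smooth_in_mult smooth_in_diff smooth_in_const smooth_in_cnj region_chart)

lemma supported_pou_mult:
  assumes "c \<in> A" "smooth_scalar h"
  shows "supported c (supp c) (\<lambda>p. of_real (pou c p) * h p)"
  unfolding supported_def
  using assms closedin_supp[of c] supp_subset[OF assms(1)] pou_zero[of _ c] chart_subset[OF assms(1)]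
  by (auto intro!: smooth_scalar_continuous smooth_scalar_mult smooth_scalar_pou)

lemma integral_M_eq:
  "integral_M M A g h = (\<Sum>c\<in>act. integral\<^sup>L lborel (chart_integrand c (\<lambda>p. of_real (pou c p) * h p)))"
  unfolding integral_M_def pou_def[symmetric] act_def[symmetric] Let_def set_lebesgue_integral_def
    chart_integrand_def[abs_def] vol_def
  by (simp add: scaleR_conv_of_real mult.assoc mult.left_commute mult.commute)

lemma integral_M_cong:
  assumes "\<And>p. p \<in> topspace M \<Longrightarrow> h p = k p"
  shows "integral_M M A g h = integral_M M A g k"
proof -
  have e: "indicator (snd c ` fst c) x *\<^sub>R (a *\<^sub>R h (chart_inv c x)) = indicator (snd c ` fst c) x *\<^sub>R (a *\<^sub>R k (chart_inv c x))"
    if "c \<in> act" for c x a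
    using assms[of "chart_inv c x"] chart_inv_in[of x c] chart_subset[of c] act_subset that by (auto simp: indicator_def)
  show ?thesis
    unfolding integral_M_def pou_def[symmetric] act_def[symmetric] Let_def set_lebesgue_integral_def
    by (intro sum.cong refl arg_cong[where f="integral\<^sup>L lborel"] ext e)
qed

lemma integral_M_of_real: "integral_M M A g (\<lambda>p. complex_of_real (h p)) = of_real (integral_M M A g h)"
  unfolding integral_M_def Let_def set_lebesgue_integral_def
  by (simp add: scaleR_conv_of_real flip: of_real_mult)

lemma integral_M_nonneg:
  fixes h :: "'a \<Rightarrow> real"
  assumes "\<And>p. p \<in> topspace M \<Longrightarrow> 0 \<le> h p"
  shows "0 \<le> integral_M M A g h"
  unfolding integral_M_def pou_def[symmetric] act_def[symmetric] Let_def set_lebesgue_integral_def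
proof (intro sum_nonneg integral_nonneg_AE always_eventually allI)
  fix c x assume c: "c \<in> act"
  show "0 \<le> indicator (snd c ` fst c) x *\<^sub>R ((pou c (chart_inv c x) * volume_density (g c (chart_inv c x))) *\<^sub>R h (chart_inv c x))"
  proof (cases "x \<in> snd c ` fst c")
    case True
    have cA: "c \<in> A" using c act_subset by blast
    have p: "chart_inv c x \<in> fst c" by (rule chart_inv_in[OF True])
    have "chart_inv c x \<in> topspace M" using p chart_subset[OF cA] by blast
    then show ?thesis
      using assms[of "chart_inv c x"] pou_nonneg[OF cA, of "chart_inv c x"] vol_pos[OF cA p]
      by (simp add: vol_def)
  qed simp
qed

lemma integrable_pou_mult:
  "c \<in> act \<Longrightarrow> smooth_scalar h \<Longrightarrow> integrable lborel (chart_integrand c (\<lambda>p. of_real (pou c p) * h p))"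
  using integrable_chart_integrand[OF supported_pou_mult] act_subset by blast

lemma integral_M_add:
  assumes "smooth_scalar h" "smooth_scalar k"
  shows "integral_M M A g (\<lambda>p. h p + k p) = integral_M M A g h + integral_M M A g k"
proof -
  have "chart_integrand c (\<lambda>p. of_real (pou c p) * (h p + k p)) =
     (\<lambda>x. chart_integrand c (\<lambda>p. of_real (pou c p) * h p) x + chart_integrand c (\<lambda>p. of_real (pou c p) * k p) x)" for c
    by (simp add: chart_integrand_def fun_eq_iff algebra_simps)
  then show ?thesis
    unfolding integral_M_eq using integrable_pou_mult assms by (simp add: sum.distrib[symmetric])
qed

lemma integral_M_mult_left: "integral_M M A g (\<lambda>p. a * h p) = a * integral_M M A g h" for h :: "'a \<Rightarrow> complex"
proof -
  have "chart_integrand c (\<lambda>p. of_real (pou c p) * (a * h p)) = (\<lambda>x. a * chart_integrand c (\<lambda>p. of_real (pou c p) * h p) x)" for c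
    by (simp add: chart_integrand_def fun_eq_iff scaleR_conv_of_real algebra_simps)
  then show ?thesis unfolding integral_M_eq by (simp add: sum_distrib_left)
qed

lemma integral_M_cnj: "integral_M M A g (\<lambda>p. cnj (h p)) = cnj (integral_M M A g h)"
proof -
  have "chart_integrand c (\<lambda>p. of_real (pou c p) * cnj (h p)) = (\<lambda>x. cnj (chart_integrand c (\<lambda>p. of_real (pou c p) * h p) x))" for c
    by (simp add: chart_integrand_def fun_eq_iff scaleR_conv_of_real)
  then show ?thesis unfolding integral_M_eq by simp
qed

text \<open>The divergence \<open>v\<^sup>-\<^sup>1 \<partial>\<^sub>i (v X\<^sup>i)\<close> with respect to the density \<open>v\<close>, in a form that needs no division.\<close>

definition divergence :: "('a, 'n) chart \<Rightarrow> ('a, 'n) field10 \<Rightarrow> 'a \<Rightarrow> complex" where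
  "divergence c X p = (\<Sum>i\<in>UNIV. pd c i (\<lambda>q. X c q $ i) p + X c p $ i * dlog_vol c i p)"

definition vector_field :: "('a, 'n) field10 \<Rightarrow> bool" where
  "vector_field X \<longleftrightarrow> (\<forall>c\<in>A. \<forall>i. smooth_in c (fst c) (\<lambda>q. X c q $ i)) \<and>
     (\<forall>c\<in>A. \<forall>d\<in>A. \<forall>p\<in>fst c \<inter> fst d. \<forall>k. X d p $ k = (\<Sum>i\<in>UNIV. X c p $ i * jac c d i k p))"

definition directional :: "('a, 'n) field10 \<Rightarrow> ('a \<Rightarrow> complex) \<Rightarrow> 'a \<Rightarrow> complex" where
  "directional X h = scalar A (\<lambda>c p. \<Sum>i\<in>UNIV. X c p $ i * pd c i h p)"

lemma directional_eq:
  assumes X: "vector_field X" and h: "smooth_scalar h" and c: "c \<in> A" "p \<in> fst c"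
  shows "directional X h p = (\<Sum>i\<in>UNIV. X c p $ i * pd c i h p)"
  unfolding directional_def
proof (rule scalar_eq[OF _ c])
  fix c d assume cd: "c \<in> A" "d \<in> A" "p \<in> fst c" "p \<in> fst d"
  have hd: "smooth_in d (fst d) h" using h cd by (simp add: smooth_scalar_def)
  have "(\<Sum>i\<in>UNIV. X c p $ i * pd c i h p) = (\<Sum>i\<in>UNIV. \<Sum>k\<in>UNIV. X c p $ i * jac c d i k p * pd d k h p)"
    unfolding pd_change[OF cd(1) hd cd(3,4)] by (simp add: sum_distrib_left mult.assoc)
  also have "\<dots> = (\<Sum>k\<in>UNIV. (\<Sum>i\<in>UNIV. X c p $ i * jac c d i k p) * pd d k h p)"
    by (subst sum.swap) (simp add: sum_distrib_right)
  also have "\<dots> = (\<Sum>k\<in>UNIV. X d p $ k * pd d k h p)"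
    using X cd by (simp add: vector_field_def)
  finally show "(\<Sum>i\<in>UNIV. X c p $ i * pd c i h p) = (\<Sum>i\<in>UNIV. X d p $ i * pd d i h p)" .
qed

lemma smooth_scalarI:
  assumes "\<And>c. c \<in> A \<Longrightarrow> smooth_in c (fst c) (k c)" "\<And>c p. c \<in> A \<Longrightarrow> p \<in> fst c \<Longrightarrow> h p = k c p"
  shows "smooth_scalar h"
  unfolding smooth_scalar_def
proof
  fix c assume c: "c \<in> A"
  show "smooth_in c (fst c) h"
    by (rule smooth_in_cong[OF _ assms(1)[OF c]]) (simp add: assms(2)[OF c])
qed

lemma smooth_scalar_directional:
  assumes X: "vector_field X" and h: "smooth_scalar h"
  shows "smooth_scalar (directional X h)"
proof (rule smooth_scalarI[of "\<lambda>c p. \<Sum>i\<in>UNIV. X c p $ i * pd c i h p"])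
  fix c assume c: "c \<in> A"
  have hc: "smooth_in c (fst c) h" using h c by (simp add: smooth_scalar_def)
  have Xc: "smooth_in c (fst c) (\<lambda>q. X c q $ i)" for i using X c by (simp add: vector_field_def)
  show "smooth_in c (fst c) (\<lambda>p. \<Sum>i\<in>UNIV. X c p $ i * pd c i h p)"
    by (intro smooth_in_sum smooth_in_mult smooth_in_pd region_chart c hc Xc)
qed (rule directional_eq[OF X h])

text \<open>Extended by zero, \<open>H\<close> is smooth on the whole coordinate space, where derivatives integrate to zero.\<close>

lemma integral_pd_zero:
  assumes c: "c \<in> A" and H: "smooth_in c (fst c) H" and K: "closedin M K" "K \<subseteq> fst c"
    and H0: "\<And>q. q \<in> fst c - K \<Longrightarrow> H q = 0"
  shows "integral\<^sup>L lborel (\<lambda>x. indicator (snd c ` fst c) x *\<^sub>R pd c i H (chart_inv c x)) = 0"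
    and "integrable lborel (\<lambda>x. indicator (snd c ` fst c) x *\<^sub>R pd c i H (chart_inv c x))"
proof -
  let ?S = "snd c ` fst c" and ?K = "snd c ` K"
  define h where "h x = (if x \<in> ?S then H (chart_inv c x) else 0)" for x
  have oS: "open ?S" by (rule open_chart_image[OF c])
  have K': "compact ?K" by (rule compact_chart_image[OF c K])
  have oK: "open (- ?K)" using compact_imp_closed[OF K'] by (rule open_Compl)
  have KS: "?K \<subseteq> ?S" using K by blast
  have h0: "h x = 0" if "x \<notin> ?K" for x
  proof (cases "x \<in> ?S")
    case True
    then obtain q where q: "q \<in> fst c" "x = snd c q" by blast
    with that have "q \<notin> K" by blast
    with q show ?thesis using H0 by (simp add: h_def chart_inv_chart[OF c])
  qed (simp add: h_def)
  have sH: "smooth_on (\<lambda>x. H (chart_inv c x)) ?S" using H by (simp add: smooth_in_def)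
  have s1: "smooth_on h ?S"
    by (rule smooth_on_cong[where F="\<lambda>x. H (chart_inv c x)", OF oS _ sH]) (simp add: h_def)
  have s2: "smooth_on h (- ?K)"
    by (rule smooth_on_cong[where F="\<lambda>x. 0", OF oK _ smooth_on_const]) (simp add: h0)
  have "?S \<union> - ?K = UNIV" using KS by blast
  with smooth_on_Un[OF oS oK s1 s2] have sm: "smooth_on h UNIV" by simp
  have eq: "indicator ?S x *\<^sub>R pd c i H (chart_inv c x) = wirt i h x" for x
  proof (cases "x \<in> ?S")
    case True
    have "wirt i (\<lambda>x. H (chart_inv c x)) x = wirt i h x"
      by (rule wirt_cong_open[OF oS True _ smooth_on_imp_differentiable[OF sH True]]) (simp add: h_def)
    with True show ?thesis by (simp add: pd_def o_def chart_chart_inv)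
  next
    case False
    then have "x \<in> - ?K" using KS by blast
    then have "wirt i (\<lambda>x. 0) x = wirt i h x"
      by (intro wirt_cong_open[OF oK]) (auto simp: h0)
    with False show ?thesis by (simp add: wirt_const)
  qed
  show "integral\<^sup>L lborel (\<lambda>x. indicator ?S x *\<^sub>R pd c i H (chart_inv c x)) = 0"
    "integrable lborel (\<lambda>x. indicator ?S x *\<^sub>R pd c i H (chart_inv c x))"
    unfolding eq using integral_wirt[OF sm K' h0] by simp_all
qed

lemma pd_zero_outside:
  assumes c: "c \<in> A" and K: "closedin M K" and h0: "\<And>q. q \<in> fst c - K \<Longrightarrow> h q = 0" and p: "p \<in> fst c - K"
  shows "pd c i h p = 0"
proof -
  have "fst c - K = fst c \<inter> (topspace M - K)" using chart_subset[OF c] by auto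
  then have r: "region c (fst c - K)"
    using region_Int[OF region_chart[OF c], of "topspace M - K"] K by (simp add: closedin_def)
  have "pd c i (\<lambda>q. 0) p = pd c i h p"
    by (rule pd_cong[OF smooth_in_const[OF r] smooth_in_const[OF r] p]) (simp add: h0)
  then show ?thesis by (simp add: pd_const)
qed

lemma integration_by_parts:
  assumes c: "c \<in> A" and X: "\<And>i. smooth_in c (fst c) (\<lambda>q. X c q $ i)"
    and \<rho>: "smooth_in c (fst c) (\<rho> :: 'a \<Rightarrow> complex)"
    and K: "closedin M K" "K \<subseteq> fst c" and \<rho>0: "\<And>q. q \<in> fst c - K \<Longrightarrow> \<rho> q = 0"
  shows "integral\<^sup>L lborel (chart_integrand c (\<lambda>q. \<rho> q * divergence c X q)) =
    - integral\<^sup>L lborel (chart_integrand c (\<lambda>q. \<Sum>i\<in>UNIV. X c q $ i * pd c i \<rho> q))"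
proof -
  have v: "smooth_in c (fst c) (\<lambda>q. complex_of_real (vol c q))" by (rule smooth_in_of_real[OF smooth_in_vol[OF c]])
  let ?H = "\<lambda>i q. \<rho> q * (of_real (vol c q) * X c q $ i)"
  have H: "smooth_in c (fst c) (?H i)" for i by (intro smooth_in_mult \<rho> v X)
  have H0: "?H i q = 0" if "q \<in> fst c - K" for i q using \<rho>0[OF that] by simp
  note zero = integral_pd_zero[OF c H K H0]
  have pdH: "(\<Sum>i\<in>UNIV. pd c i (?H i) q) = of_real (vol c q) * (\<rho> q * divergence c X q) +
      of_real (vol c q) * (\<Sum>i\<in>UNIV. X c q $ i * pd c i \<rho> q)" if q: "q \<in> fst c" for q
    unfolding pd_mult[OF \<rho> smooth_in_mult[OF v X] q] pd_mult[OF v X q] pd_vol[OF c q] divergence_def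
    by (simp add: sum_distrib_left sum.distrib algebra_simps)
  have 1: "integrable lborel (chart_integrand c (\<lambda>q. \<Sum>i\<in>UNIV. X c q $ i * pd c i \<rho> q))"
  proof (rule integrable_chart_integrand[of _ K])
    have "smooth_in c (fst c) (\<lambda>q. \<Sum>i\<in>UNIV. X c q $ i * pd c i \<rho> q)"
      by (intro smooth_in_sum smooth_in_mult smooth_in_pd region_chart c \<rho> X)
    then show "supported c K (\<lambda>q. \<Sum>i\<in>UNIV. X c q $ i * pd c i \<rho> q)"
      unfolding supported_def using c K pd_zero_outside[OF c K(1) \<rho>0]
      by (auto simp: smooth_in_def intro: smooth_on_imp_continuous_on)
  qed
  have eq: "(\<Sum>i\<in>UNIV. indicator (snd c ` fst c) x *\<^sub>R pd c i (?H i) (chart_inv c x)) =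
      chart_integrand c (\<lambda>q. \<rho> q * divergence c X q) x + chart_integrand c (\<lambda>q. \<Sum>i\<in>UNIV. X c q $ i * pd c i \<rho> q) x" for x
  proof (cases "x \<in> snd c ` fst c")
    case True
    then show ?thesis using pdH[OF chart_inv_in[OF True]] by (simp add: chart_integrand_def scaleR_conv_of_real)
  qed (simp add: chart_integrand_def)
  have int: "integrable lborel (\<lambda>x. \<Sum>i\<in>UNIV. indicator (snd c ` fst c) x *\<^sub>R pd c i (?H i) (chart_inv c x))"
    by (rule Bochner_Integration.integrable_sum) (rule zero(2))
  then have 2: "integrable lborel (chart_integrand c (\<lambda>q. \<rho> q * divergence c X q))"
    using Bochner_Integration.integrable_diff[OF int 1] unfolding eq by simp
  have "integral\<^sup>L lborel (\<lambda>x. \<Sum>i\<in>UNIV. indicator (snd c ` fst c) x *\<^sub>R pd c i (?H i) (chart_inv c x)) = 0"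
  proof -
    have "integral\<^sup>L lborel (\<lambda>x. \<Sum>i\<in>UNIV. indicator (snd c ` fst c) x *\<^sub>R pd c i (?H i) (chart_inv c x)) =
      (\<Sum>i\<in>UNIV. integral\<^sup>L lborel (\<lambda>x. indicator (snd c ` fst c) x *\<^sub>R pd c i (?H i) (chart_inv c x)))"
      by (rule Bochner_Integration.integral_sum) (rule zero(2))
    also have "\<dots> = 0" by (intro sum.neutral ballI zero(1))
    finally show ?thesis .
  qed
  then show ?thesis unfolding eq using 1 2 by (simp add: eq_neg_iff_add_eq_0)
qed

text \<open>Integration by parts in the chart \<open>c\<close> turns \<open>\<integral> \<rho>\<^sub>c div X\<close> into \<open>- \<integral> X \<rho>\<^sub>c\<close>. Inserting \<open>1 = \<Sum>\<^sub>d \<rho>\<^sub>d\<close> makes the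
integrands \<open>\<rho>\<^sub>d X \<rho>\<^sub>c\<close> supported in both charts, so each may be moved to the chart \<open>d\<close>, where the sum over \<open>c\<close> is \<open>X 1 = 0\<close>.\<close>

theorem divergence_theorem:
  assumes X: "vector_field X" and h: "\<And>c p. c \<in> A \<Longrightarrow> p \<in> fst c \<Longrightarrow> h p = divergence c X p"
  shows "integral_M M A g h = 0"
proof -
  let ?r = "\<lambda>c q. complex_of_real (pou c q)"
  define D where "D c = directional X (?r c)" for c
  let ?I = "\<lambda>c k. integral\<^sup>L lborel (chart_integrand c k)"
  have actA: "c \<in> A" if "c \<in> act" for c using act_subset that by blast
  have sD: "smooth_scalar (D c)" if "c \<in> act" for c
    unfolding D_def by (rule smooth_scalar_directional[OF X smooth_scalar_pou[OF actA[OF that]]])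
  have Deq: "D c q = (\<Sum>i\<in>UNIV. X d q $ i * pd d i (?r c) q)" if "c \<in> act" "d \<in> A" "q \<in> fst d" for c d q
    unfolding D_def by (rule directional_eq[OF X smooth_scalar_pou[OF actA[OF that(1)]] that(2,3)])
  have D0: "D c q = 0" if c: "c \<in> act" and d: "d \<in> A" and q: "q \<in> fst d - supp c" for c d q
  proof -
    have "pd d i (?r c) q = 0" for i
      by (rule pd_zero_outside[OF d closedin_supp[of c] _ q]) (use pou_zero[of _ c] chart_subset[OF d] in auto)
    then show ?thesis using Deq[OF c d] q by simp
  qed
  have cg: "chart_integrand c k = chart_integrand c k'" if "\<And>q. q \<in> fst c \<Longrightarrow> k q = k' q" for c k k'
    using that chart_inv_in[of _ c] by (auto simp: chart_integrand_def fun_eq_iff indicator_def)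
  have step: "?I c (\<lambda>p. ?r c p * h p) = - (\<Sum>d\<in>act. ?I d (\<lambda>q. ?r d q * D c q))" if c: "c \<in> act" for c
  proof -
    have cA: "c \<in> A" using actA[OF c] .
    have sm: "smooth_in c (fst c) (?r c)" using smooth_scalar_pou[OF cA] cA by (simp add: smooth_scalar_def)
    have Xc: "smooth_in c (fst c) (\<lambda>q. X c q $ i)" for i using X cA by (simp add: vector_field_def)
    have "?I c (\<lambda>p. ?r c p * h p) = ?I c (\<lambda>p. ?r c p * divergence c X p)"
      by (rule arg_cong[where f="integral\<^sup>L lborel"], rule cg) (simp add: h[OF cA])
    also have "?I c (\<lambda>p. ?r c p * divergence c X p) = - ?I c (\<lambda>q. \<Sum>i\<in>UNIV. X c q $ i * pd c i (?r c) q)"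
      by (rule integration_by_parts[where X=X and \<rho>="?r c" and K="supp c", OF cA Xc sm closedin_supp supp_subset[OF cA]])
        (use pou_zero[of _ c] chart_subset[OF cA] in auto)
    also have "?I c (\<lambda>q. \<Sum>i\<in>UNIV. X c q $ i * pd c i (?r c) q) = ?I c (\<lambda>q. \<Sum>d\<in>act. ?r d q * D c q)"
    proof (rule arg_cong[where f="integral\<^sup>L lborel"], rule cg)
      fix q assume q: "q \<in> fst c"
      then have "(\<Sum>d\<in>act. pou d q) = 1" using sum_pou chart_subset[OF cA] by blast
      then have "(\<Sum>d\<in>act. ?r d q) = 1" by (metis of_real_1 of_real_sum)
      then show "(\<Sum>i\<in>UNIV. X c q $ i * pd c i (?r c) q) = (\<Sum>d\<in>act. ?r d q * D c q)"
        using Deq[OF c cA q] by (simp flip: sum_distrib_right)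
    qed
    also have "?I c (\<lambda>q. \<Sum>d\<in>act. ?r d q * D c q) = (\<Sum>d\<in>act. ?I d (\<lambda>q. ?r d q * D c q))"
    proof -
      \<comment> \<open>The factor \<open>\<rho>\<^sub>d\<close> vanishes off the support of \<open>\<rho>\<^sub>d\<close>, and \<open>X \<rho>\<^sub>c\<close> off that of \<open>\<rho>\<^sub>c\<close>.\<close>
      have s: "supported e (supp c \<inter> supp d) (\<lambda>q. ?r d q * D c q)" if d: "d \<in> act" and e: "e = c \<or> e = d" for d e
      proof -
        have eA: "e \<in> A" using e actA c d by blast
        have sm: "smooth_scalar (\<lambda>q. ?r d q * D c q)"
          by (intro smooth_scalar_mult smooth_scalar_pou actA d sD c)
        show ?thesis
          unfolding supported_def
        proof (intro conjI ballI eA smooth_scalar_continuous[OF sm eA] closedin_Int closedin_supp)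
          show "supp c \<inter> supp d \<subseteq> fst e"
            using e supp_subset[OF actA[OF c]] supp_subset[OF actA[OF d]] by blast
          fix q assume q: "q \<in> fst e - supp c \<inter> supp d"
          show "?r d q * D c q = 0"
          proof (cases "q \<in> supp c")
            case True
            then have "pou d q = 0" using q chart_subset[OF eA] by (intro pou_zero) auto
            then show ?thesis by simp
          next
            case False
            then have "D c q = 0" using q by (intro D0[OF c eA]) auto
            then show ?thesis by simp
          qed
        qed
      qed
      have "chart_integrand c (\<lambda>q. \<Sum>d\<in>act. ?r d q * D c q) = (\<lambda>x. \<Sum>d\<in>act. chart_integrand c (\<lambda>q. ?r d q * D c q) x)"
        by (simp add: chart_integrand_def scaleR_sum_right fun_eq_iff)
      then have "?I c (\<lambda>q. \<Sum>d\<in>act. ?r d q * D c q) = (\<Sum>d\<in>act. ?I c (\<lambda>q. ?r d q * D c q))"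
        using integrable_chart_integrand[OF s] by simp
      also have "\<dots> = (\<Sum>d\<in>act. ?I d (\<lambda>q. ?r d q * D c q))"
        by (rule sum.cong[OF refl], rule chart_integral_independent[OF s s]) auto
      finally show ?thesis .
    qed
    finally show ?thesis .
  qed
  have "integral_M M A g h = - (\<Sum>c\<in>act. \<Sum>d\<in>act. ?I d (\<lambda>q. ?r d q * D c q))"
    unfolding integral_M_eq by (simp add: step sum_negf)
  also have "(\<Sum>c\<in>act. \<Sum>d\<in>act. ?I d (\<lambda>q. ?r d q * D c q)) = (\<Sum>d\<in>act. \<Sum>c\<in>act. ?I d (\<lambda>q. ?r d q * D c q))"
    by (rule sum.swap)
  also have "\<dots> = 0"
  proof (rule sum.neutral, rule ballI)
    fix d assume d: "d \<in> act"
    have dA: "d \<in> A" by (rule actA[OF d])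
    have "(\<Sum>c\<in>act. ?I d (\<lambda>q. ?r d q * D c q)) = integral\<^sup>L lborel (\<lambda>x. \<Sum>c\<in>act. chart_integrand d (\<lambda>q. ?r d q * D c q) x)"
      using integrable_pou_mult[OF d sD] by simp
    also have "(\<lambda>x. \<Sum>c\<in>act. chart_integrand d (\<lambda>q. ?r d q * D c q) x) = chart_integrand d (\<lambda>q. \<Sum>c\<in>act. ?r d q * D c q)"
      by (simp add: chart_integrand_def scaleR_sum_right fun_eq_iff)
    also have "integral\<^sup>L lborel (chart_integrand d (\<lambda>q. \<Sum>c\<in>act. ?r d q * D c q)) = ?I d (\<lambda>q. 0)"
    proof (rule arg_cong[where f="integral\<^sup>L lborel"], rule cg)
      fix q assume q: "q \<in> fst d"
      have rc: "smooth_in d (fst d) (?r c)" if "c \<in> act" for c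
        using smooth_scalar_pou[OF actA[OF that]] dA by (simp add: smooth_scalar_def)
      have one: "(\<Sum>c\<in>act. ?r c q) = 1" if "q \<in> fst d" for q
      proof -
        have "(\<Sum>c\<in>act. pou c q) = 1" using that sum_pou chart_subset[OF dA] by blast
        then show ?thesis by (metis of_real_1 of_real_sum)
      qed
      have p0: "pd d i (\<lambda>q. \<Sum>c\<in>act. ?r c q) q = 0" for i
      proof -
        have s: "smooth_in d (fst d) (\<lambda>q. \<Sum>c\<in>act. ?r c q)" by (intro smooth_in_sum region_chart dA rc)
        have "pd d i (\<lambda>q. \<Sum>c\<in>act. ?r c q) q = pd d i (\<lambda>q. 1) q" by (rule pd_cong[OF s s q one])
        then show ?thesis by (simp add: pd_const)
      qed
      have "(\<Sum>c\<in>act. pd d i (?r c) q) = 0" for i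
      proof -
        have "pd d i (\<lambda>q. \<Sum>c\<in>act. ?r c q) q = (\<Sum>c\<in>act. pd d i (?r c) q)"
          by (rule pd_sum[OF region_chart[OF dA] _ q]) (rule rc)
        with p0[of i] show ?thesis by simp
      qed
      then have "(\<Sum>i\<in>UNIV. X d q $ i * (\<Sum>c\<in>act. pd d i (?r c) q)) = 0" by simp
      then have "(\<Sum>c\<in>act. D c q) = 0"
        by (simp add: Deq[OF _ dA q] sum_distrib_left sum.swap[of _ act UNIV])
      then show "(\<Sum>c\<in>act. ?r d q * D c q) = 0" by (simp flip: sum_distrib_left)
    qed
    also have "?I d (\<lambda>q. 0) = 0" by (simp add: chart_integrand_def[abs_def])
    finally show "(\<Sum>c\<in>act. ?I d (\<lambda>q. ?r d q * D c q)) = 0" .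
  qed
  finally show ?thesis by simp
qed

end

section \<open>The inverse metric and Christoffel symbols\<close>

text \<open>Cramer's rule exhibits the entries of the inverse as smooth functions of the entries of the matrix.\<close>

lemma matrix_inv_nth_cramer:
  fixes B :: "complex^'n::finite^'n"
  assumes "invertible B"
  shows "matrix_inv B $ k $ i = det (\<chi> a b. if b = k then (if a = i then 1 else 0) else B $ a $ b) * inverse (det B)"
proof -
  have d: "det B \<noteq> 0" using assms by (simp add: invertible_det_nz)
  have "B *v (\<chi> k. matrix_inv B $ k $ i) = (\<chi> a. if a = i then 1 else 0)"
    using matrix_inv_right[OF assms]
    by (simp add: vec_eq_iff matrix_vector_mult_def matrix_matrix_mult_def mat_def)
  then have "(\<chi> k. matrix_inv B $ k $ i) =
      (\<chi> k. det (\<chi> a b. if b = k then (if a = i then 1 else 0) else B $ a $ b) / det B)"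
    unfolding cramer[OF d] vec_lambda_beta .
  then show ?thesis by (simp add: vec_eq_iff divide_inverse)
qed

context hermitian_manifold
begin

lemma metric_invertible: "c \<in> A \<Longrightarrow> p \<in> fst c \<Longrightarrow> invertible (g c p)"
  by (rule hermitian_posdef_invertible[OF metric_posdef])

lemma smooth_in_det:
  assumes "region c U" "\<And>i j. smooth_in c U (\<lambda>q. B q $ i $ j :: complex)"
  shows "smooth_in c U (\<lambda>q. det (B q :: complex^'m::finite^'m))"
  unfolding smooth_in_def det_def
  using assms region_open[OF assms(1)]
  by (auto intro!: smooth_on_sum smooth_on_mult smooth_on_const smooth_on_prod simp: smooth_in_def)

lemma smooth_in_ginv:
  assumes c: "c \<in> A"
  shows "smooth_in c (fst c) (ginv g c i k)"
proof -
  have r: "region c (fst c)" by (rule region_chart[OF c])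
  have "smooth_in c (fst c) (\<lambda>q. det (\<chi> a b. if b = k then (if a = i then 1 else 0) else g c q $ a $ b))"
  proof (rule smooth_in_det[OF r])
    show "smooth_in c (fst c) (\<lambda>q. (\<chi> a b. if b = k then (if a = i then 1 else 0) else g c q $ a $ b) $ a $ b)" for a b
      by (cases "b = k"; cases "a = i") (simp_all add: smooth_in_const[OF r] smooth_in_metric[OF c])
  qed
  moreover have "smooth_in c (fst c) (\<lambda>q. inverse (det (g c q)))"
  proof -
    have "smooth_in c (fst c) (\<lambda>q. det (g c q))" by (rule smooth_in_det[OF r smooth_in_metric[OF c]])
    moreover have "det (g c (chart_inv c x)) \<noteq> 0" if "x \<in> snd c ` fst c" for x
      using metric_invertible[OF c chart_inv_in[OF that]] by (simp add: invertible_det_nz)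
    ultimately show ?thesis unfolding smooth_in_def using smooth_on_inverse region_open[OF r] by blast
  qed
  ultimately have "smooth_in c (fst c) (\<lambda>q. det (\<chi> a b. if b = k then (if a = i then 1 else 0) else g c q $ a $ b) * inverse (det (g c q)))"
    by (rule smooth_in_mult)
  then show ?thesis
    by (rule smooth_in_cong[rotated]) (simp add: ginv_def matrix_inv_nth_cramer[OF metric_invertible[OF c]])
qed

lemma ginv_metric:
  assumes "c \<in> A" "q \<in> fst c"
  shows ginv_metric1: "(\<Sum>k\<in>UNIV. ginv g c i k q * g c q $ j $ k) = (if i = j then 1 else 0)"
    and ginv_metric2: "(\<Sum>i\<in>UNIV. ginv g c i k q * g c q $ i $ l) = (if k = l then 1 else 0)"
proof -
  note i = metric_invertible[OF assms]
  have "(g c q ** matrix_inv (g c q)) $ j $ i = (if i = j then 1 else 0)"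
    unfolding matrix_inv_right[OF i] by (simp add: mat_def eq_commute)
  then show "(\<Sum>k\<in>UNIV. ginv g c i k q * g c q $ j $ k) = (if i = j then 1 else 0)"
    by (simp add: matrix_matrix_mult_def ginv_def mult.commute)
  have "(matrix_inv (g c q) ** g c q) $ k $ l = (if k = l then 1 else 0)"
    unfolding matrix_inv_left[OF i] by (simp add: mat_def)
  then show "(\<Sum>i\<in>UNIV. ginv g c i k q * g c q $ i $ l) = (if k = l then 1 else 0)"
    by (simp add: matrix_matrix_mult_def ginv_def)
qed

lemma metric_hermitian: "c \<in> A \<Longrightarrow> q \<in> fst c \<Longrightarrow> cnj (g c q $ i $ j) = g c q $ j $ i"
  using metric_posdef[of c q] unfolding hermitian_posdef_def by (metis complex_cnj_cnj)

lemma ginv_hermitian: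
  assumes c: "c \<in> A" "q \<in> fst c"
  shows "cnj (ginv g c i j q) = ginv g c j i q"
proof -
  have "ginv g c j i q = (\<Sum>k\<in>UNIV. ginv g c j k q * (if i = k then 1 else 0))"
    by (simp add: mult_delta_right)
  also have "\<dots> = (\<Sum>k\<in>UNIV. ginv g c j k q * (\<Sum>l\<in>UNIV. cnj (ginv g c i l q) * g c q $ l $ k))"
  proof -
    have "(\<Sum>l\<in>UNIV. cnj (ginv g c i l q) * g c q $ l $ k) = cnj (\<Sum>l\<in>UNIV. ginv g c i l q * g c q $ k $ l)" for k
      using metric_hermitian[OF c] by simp
    then show ?thesis unfolding ginv_metric1[OF c] by (simp add: mult_delta_right if_distrib[of cnj] cong: if_cong)
  qed
  also have "\<dots> = (\<Sum>l\<in>UNIV. cnj (ginv g c i l q) * (\<Sum>k\<in>UNIV. ginv g c j k q * g c q $ l $ k))"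
    unfolding sum_distrib_left by (subst sum.swap) (simp add: ac_simps)
  also have "\<dots> = cnj (ginv g c i j q)" unfolding ginv_metric1[OF c] by (simp add: mult_delta_right)
  finally show ?thesis ..
qed

text \<open>Obtained by differentiating the relation \<open>g\<^bsup>i\<bar>k\<^esup> g\<^bsub>j\<bar>k\<^esub> = \<delta>\<^sup>i\<^sub>j\<close> and raising an index.\<close>

lemma pd_ginv:
  assumes c: "c \<in> A" and q: "q \<in> fst c"
  shows "pd c m (ginv g c i l) q =
    - (\<Sum>j\<in>UNIV. \<Sum>k\<in>UNIV. ginv g c i k q * pd c m (\<lambda>q. g c q $ j $ k) q * ginv g c j l q)"
proof -
  note r = region_chart[OF c] and sK = smooth_in_ginv[OF c] and sg = smooth_in_metric[OF c]
  have z: "(\<Sum>k\<in>UNIV. pd c m (ginv g c i k) q * g c q $ j $ k) = - (\<Sum>k\<in>UNIV. ginv g c i k q * pd c m (\<lambda>q. g c q $ j $ k) q)" for j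
  proof -
    have s: "smooth_in c (fst c) (\<lambda>q. \<Sum>k\<in>UNIV. ginv g c i k q * g c q $ j $ k)"
      by (intro smooth_in_sum smooth_in_mult r sK sg)
    have "pd c m (\<lambda>q. \<Sum>k\<in>UNIV. ginv g c i k q * g c q $ j $ k) q = pd c m (\<lambda>q. if i = j then 1 else 0) q"
      by (rule pd_cong[OF s s q]) (rule ginv_metric1[OF c])
    moreover have "pd c m (\<lambda>q. \<Sum>k\<in>UNIV. ginv g c i k q * g c q $ j $ k) q =
        (\<Sum>k\<in>UNIV. pd c m (ginv g c i k) q * g c q $ j $ k + ginv g c i k q * pd c m (\<lambda>q. g c q $ j $ k) q)"
      by (subst pd_sum[OF r _ q]) (intro smooth_in_mult sK sg sum.cong refl pd_mult[OF sK sg q])+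
    ultimately show ?thesis by (simp add: pd_const sum.distrib add_eq_0_iff)
  qed
  have "pd c m (ginv g c i l) q = (\<Sum>k\<in>UNIV. pd c m (ginv g c i k) q * (\<Sum>j\<in>UNIV. ginv g c j l q * g c q $ j $ k))"
    unfolding ginv_metric2[OF c q] by (simp add: mult_delta_right)
  also have "\<dots> = (\<Sum>j\<in>UNIV. ginv g c j l q * (\<Sum>k\<in>UNIV. pd c m (ginv g c i k) q * g c q $ j $ k))"
    unfolding sum_distrib_left by (subst sum.swap) (simp add: ac_simps)
  also have "\<dots> = - (\<Sum>j\<in>UNIV. \<Sum>k\<in>UNIV. ginv g c i k q * pd c m (\<lambda>q. g c q $ j $ k) q * ginv g c j l q)"
    unfolding z by (simp add: sum_negf sum_distrib_left ac_simps)
  finally show ?thesis .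
qed

lemma pd_bar_metric:
  assumes c: "c \<in> A" and q: "q \<in> fst c"
  shows "pd_bar c m (\<lambda>q. g c q $ i $ j) q = cnj (pd c m (\<lambda>q. g c q $ j $ i) q)"
proof -
  note sg = smooth_in_metric[OF c]
  have "pd_bar c m (\<lambda>q. g c q $ i $ j) q = pd_bar c m (\<lambda>q. cnj (g c q $ j $ i)) q"
    by (rule pd_bar_cong[OF sg sg q]) (simp add: metric_hermitian[OF c])
  also have "\<dots> = cnj (pd c m (\<lambda>q. g c q $ j $ i) q)" by (rule pd_bar_cnj[OF sg sg q])
  finally show ?thesis .
qed

lemma pd_bar_ginv:
  assumes c: "c \<in> A" and q: "q \<in> fst c"
  shows "pd_bar c m (ginv g c i l) q =
    - (\<Sum>j\<in>UNIV. \<Sum>k\<in>UNIV. ginv g c i k q * pd_bar c m (\<lambda>q. g c q $ j $ k) q * ginv g c j l q)"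
proof -
  note sK = smooth_in_ginv[OF c]
  have "pd_bar c m (ginv g c i l) q = pd_bar c m (\<lambda>q. cnj (ginv g c l i q)) q"
    by (rule pd_bar_cong[OF sK sK q]) (simp add: ginv_hermitian[OF c])
  also have "\<dots> = cnj (pd c m (ginv g c l i) q)" by (rule pd_bar_cnj[OF sK sK q])
  also have "\<dots> = - (\<Sum>j\<in>UNIV. \<Sum>k\<in>UNIV. ginv g c k l q * pd_bar c m (\<lambda>q. g c q $ k $ j) q * ginv g c i j q)"
    unfolding pd_ginv[OF c q] pd_bar_metric[OF c q] by (simp add: ginv_hermitian[OF c q])
  also have "\<dots> = - (\<Sum>j\<in>UNIV. \<Sum>k\<in>UNIV. ginv g c i k q * pd_bar c m (\<lambda>q. g c q $ j $ k) q * ginv g c j l q)"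
    by (subst sum.swap) (simp add: ac_simps)
  finally show ?thesis .
qed

end

locale kaehler_manifold = hermitian_manifold M A g
  for M :: "'a topology" and A :: "('a, 'n::finite) chart set" and g +
  assumes kaehler_closed: "\<And>c x u v w. c \<in> A \<Longrightarrow> x \<in> snd c ` fst c \<Longrightarrow>
    ext_deriv2 (\<lambda>y. kaehler_form (g c (chart_inv c y))) x u v w = 0"
begin

lemma kaehler_form_axis: "kaehler_form G (axis j a) (axis k b) = \<i> * (G $ j $ k * (a * cnj b) - G $ k $ j * (b * cnj a))"
proof -
  have 1: "(\<Sum>i\<in>UNIV. \<Sum>l\<in>UNIV. G $ i $ l * (axis j a $ i * cnj (axis k b $ l))) = G $ j $ k * (a * cnj b)" for j k a b
  proof -
    have "(\<Sum>l\<in>UNIV. G $ i $ l * (axis j a $ i * cnj (axis k b $ l))) = (if i = j then G $ j $ k * (a * cnj b) else 0)" for i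
    proof -
      have "(\<Sum>l\<in>UNIV. G $ i $ l * (axis j a $ i * cnj (axis k b $ l))) =
          (\<Sum>l\<in>UNIV. if l = k then G $ i $ k * (axis j a $ i * cnj b) else 0)"
        by (intro sum.cong refl) (auto simp: axis_def)
      then show ?thesis by (simp add: axis_def)
    qed
    then show ?thesis by simp
  qed
  show ?thesis unfolding kaehler_form_def right_diff_distrib sum_subtractf 1 ..
qed

text \<open>Closedness of \<open>\<omega>\<close> tested on the real coordinate vectors of the directions \<open>i\<close>, \<open>j\<close>, \<open>k\<close>. The symmetry of \<open>\<partial>\<^sub>i g\<^bsub>j\<bar>k\<^esub>\<close> is the component of
type (2,1), which is picked out by a linear combination of the eight evaluations.\<close>

lemma metric_kaehler:
  assumes c: "c \<in> A" and q: "q \<in> fst c"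
  shows "pd c i (\<lambda>q. g c q $ j $ k) q = pd c j (\<lambda>q. g c q $ i $ k) q"
proof -
  let ?x = "snd c q" and ?G = "\<lambda>j k x. g c (chart_inv c x) $ j $ k"
  define d where "d j k u = frechet_derivative (?G j k) (at ?x) u" for j k u
  have df: "?G j k differentiable at ?x" for j k
    by (rule smooth_in_differentiable[OF smooth_in_metric[OF c] q])
  have fr: "frechet_derivative (\<lambda>y. kaehler_form (g c (chart_inv c y)) (axis j a) (axis k b)) (at ?x) u =
      \<i> * (d j k u * (a * cnj b) - d k j u * (b * cnj a))" for j k a b u
  proof -
    have "((\<lambda>y. \<i> * (?G j k y * (a * cnj b) - ?G k j y * (b * cnj a))) has_derivative
       (\<lambda>u. \<i> * (d j k u * (a * cnj b) - d k j u * (b * cnj a)))) (at ?x)"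
      unfolding d_def
      by (intro has_derivative_mult_right has_derivative_diff has_derivative_mult_left has_frechet_derivative df)
    from fun_cong[OF frechet_derivative_at[OF this], of u] show ?thesis unfolding kaehler_form_axis by simp
  qed
  \<comment> \<open>The value of \<open>d\<omega>\<close>, up to a factor \<open>\<i>\<close>, on the vectors \<open>\<alpha> e\<^sub>i\<close>, \<open>a e\<^sub>j\<close>, \<open>b e\<^sub>k\<close>.\<close>
  define e where "e \<alpha> a b = (d j k (axis i \<alpha>) * (a * cnj b) - d k j (axis i \<alpha>) * (b * cnj a))
      - (d i k (axis j a) * (\<alpha> * cnj b) - d k i (axis j a) * (b * cnj \<alpha>))
      + (d i j (axis k b) * (\<alpha> * cnj a) - d j i (axis k b) * (a * cnj \<alpha>))" for \<alpha> a b
  have E: "e \<alpha> a b = 0" for \<alpha> a b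
  proof -
    have "?x \<in> snd c ` fst c" using q by blast
    from kaehler_closed[OF c this, of "axis i \<alpha>" "axis j a" "axis k b"]
    have "\<i> * e \<alpha> a b = 0"
      unfolding ext_deriv2_def fr e_def by (simp add: algebra_simps)
    then show ?thesis by simp
  qed
  have e1: "pd c i (\<lambda>q. g c q $ j $ k) q = (d j k (axis i 1) - \<i> * d j k (axis i \<i>)) / 2"
    and e2: "pd c j (\<lambda>q. g c q $ i $ k) q = (d i k (axis j 1) - \<i> * d i k (axis j \<i>)) / 2"
    by (simp_all add: pd_def wirt_def d_def o_def)
  show ?thesis
  proof -
    have "4 * ((d j k (axis i 1) - \<i> * d j k (axis i \<i>)) - (d i k (axis j 1) - \<i> * d i k (axis j \<i>))) =
      e 1 1 1 + \<i> * e 1 1 \<i> - \<i> * e 1 \<i> 1 + e 1 \<i> \<i> - \<i> * e \<i> 1 1 + e \<i> 1 \<i> - e \<i> \<i> 1 - \<i> * e \<i> \<i> \<i>"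
      unfolding e_def by (simp add: algebra_simps)
    also have "\<dots> = 0" unfolding E by simp
    finally have "d j k (axis i 1) - \<i> * d j k (axis i \<i>) = d i k (axis j 1) - \<i> * d i k (axis j \<i>)"
      unfolding mult_eq_0_iff right_minus_eq by (elim disjE) simp_all
    then show ?thesis unfolding e1 e2 by (simp only:)
  qed
qed

end

section \<open>A Bochner identity in a chart\<close>

locale kaehler_function = kaehler_manifold M A g
  for M :: "'a topology" and A :: "('a, 'n::finite) chart set" and g +
  fixes f :: "'a \<Rightarrow> real"
  assumes smooth_f: "smooth_function A f"
begin

abbreviation fc :: "'a \<Rightarrow> complex" where
  "fc \<equiv> \<lambda>q. of_real (f q)"

definition \<phi> :: "('a, 'n) field10" where
  "\<phi> = del fc"

definition hess :: "('a, 'n) chart \<Rightarrow> 'n \<Rightarrow> 'n \<Rightarrow> 'a \<Rightarrow> complex" where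
  "hess c i j = pd c i (pd_bar c j fc)"

definition V :: "('a, 'n) field10" where
  "V = dual_vec g \<phi>"

definition christoffel :: "('a, 'n) chart \<Rightarrow> 'n \<Rightarrow> 'n \<Rightarrow> 'n \<Rightarrow> 'a \<Rightarrow> complex" where
  "christoffel c i j k q = (\<Sum>l\<in>UNIV. ginv g c k l q * pd c i (\<lambda>q. g c q $ j $ l) q)"

text \<open>The tensor \<open>t\<^sub>i\<^sub>j\<close>, the (2,0) part of the covariant Hessian of \<open>f\<close>.\<close>

definition cov_hess :: "('a, 'n) chart \<Rightarrow> 'n \<Rightarrow> 'n \<Rightarrow> 'a \<Rightarrow> complex" where
  "cov_hess c i j q = pd c i (\<lambda>q. \<phi> c q $ j) q - (\<Sum>k\<in>UNIV. christoffel c i j k q * \<phi> c q $ k)"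

definition \<omega>1 :: "('a, 'n) field10" where
  "\<omega>1 c q = (\<chi> j. \<Sum>i\<in>UNIV. cov_hess c j i q * V c q $ i)"

text \<open>The part of \<open>\<partial>|\<phi>|\<^sup>2\<close> that comes from differentiating the conjugate of \<open>\<phi>\<close>; see \<open>pd_norm\<close>.\<close>

definition \<omega>2 :: "('a, 'n) field10" where
  "\<omega>2 c q = (\<chi> j. \<Sum>k\<in>UNIV. hess c j k q * cnj (V c q $ k))"

definition W1 :: "('a, 'n) field10" where
  "W1 = dual_vec g \<omega>1"

definition W2 :: "('a, 'n) field10" where
  "W2 = dual_vec g \<omega>2"

context
  fixes c :: "('a, 'n) chart"
  assumes c: "c \<in> A"
begin

lemma smooth_fc: "smooth_in c (fst c) fc"
  by (rule smooth_in_of_real[OF smooth_function_imp_smooth_in[OF smooth_f c]])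

lemma phi_nth: "\<phi> c q $ i = pd c i fc q"
  by (simp add: \<phi>_def del_def)

lemma smooth_phi: "smooth_in c (fst c) (\<lambda>q. \<phi> c q $ i)"
  unfolding phi_nth by (rule smooth_in_pd[OF smooth_fc])

lemma cnj_phi: "q \<in> fst c \<Longrightarrow> cnj (\<phi> c q $ i) = pd_bar c i fc q"
  unfolding phi_nth using pd_bar_cnj[OF smooth_fc smooth_fc, of q i] by simp

lemma smooth_cnj_phi: "smooth_in c (fst c) (\<lambda>q. cnj (\<phi> c q $ i))"
  by (rule smooth_in_cnj[OF smooth_phi])

lemma smooth_hess: "smooth_in c (fst c) (hess c i j)"
  unfolding hess_def by (intro smooth_in_pd smooth_in_pd_bar smooth_fc)

lemma V_nth: "V c q $ i = (\<Sum>k\<in>UNIV. ginv g c i k q * cnj (\<phi> c q $ k))"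
  by (simp add: V_def dual_vec_def)

lemma smooth_V: "smooth_in c (fst c) (\<lambda>q. V c q $ i)"
  unfolding V_nth by (intro smooth_in_sum smooth_in_mult smooth_in_ginv smooth_cnj_phi region_chart c)

lemma smooth_cnj_V: "smooth_in c (fst c) (\<lambda>q. cnj (V c q $ i))"
  by (rule smooth_in_cnj[OF smooth_V])

lemma cnj_V: "q \<in> fst c \<Longrightarrow> cnj (V c q $ l) = (\<Sum>k\<in>UNIV. \<phi> c q $ k * ginv g c k l q)"
  unfolding V_nth by (simp add: ginv_hermitian[OF c] mult.commute)

lemma smooth_christoffel: "smooth_in c (fst c) (christoffel c i j k)"
  unfolding christoffel_def by (intro smooth_in_sum smooth_in_mult smooth_in_ginv smooth_in_pd smooth_in_metric region_chart c)

lemma smooth_cov_hess: "smooth_in c (fst c) (cov_hess c i j)"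
  unfolding cov_hess_def
  by (intro smooth_in_diff smooth_in_sum smooth_in_mult smooth_in_pd smooth_phi smooth_christoffel region_chart c)

lemma \<omega>1_nth: "\<omega>1 c q $ j = (\<Sum>i\<in>UNIV. cov_hess c j i q * V c q $ i)"
  and \<omega>2_nth: "\<omega>2 c q $ j = (\<Sum>k\<in>UNIV. hess c j k q * cnj (V c q $ k))"
  and W1_nth: "W1 c q $ j = (\<Sum>k\<in>UNIV. ginv g c j k q * cnj (\<omega>1 c q $ k))"
  and W2_nth: "W2 c q $ j = (\<Sum>k\<in>UNIV. ginv g c j k q * cnj (\<omega>2 c q $ k))"
  by (simp_all add: \<omega>1_def \<omega>2_def W1_def W2_def dual_vec_def)

lemma smooth_\<omega>1: "smooth_in c (fst c) (\<lambda>q. \<omega>1 c q $ j)"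
  and smooth_\<omega>2: "smooth_in c (fst c) (\<lambda>q. \<omega>2 c q $ j)"
  unfolding \<omega>1_nth \<omega>2_nth
  by (intro smooth_in_sum smooth_in_mult smooth_cov_hess smooth_hess smooth_V smooth_cnj_V region_chart c)+

context
  fixes q :: 'a
  assumes q: "q \<in> fst c"
begin

lemma hess_hermitian: "cnj (hess c i j q) = hess c j i q"
proof -
  have "cnj (hess c i j q) = pd_bar c i (\<lambda>q. cnj (pd_bar c j fc q)) q"
    unfolding hess_def by (rule pd_bar_cnj[OF smooth_in_pd_bar[OF smooth_fc] smooth_in_pd_bar[OF smooth_fc] q, symmetric])
  also have "\<dots> = pd_bar c i (pd c j fc) q"
    by (rule pd_bar_cong[OF smooth_in_cnj[OF smooth_in_pd_bar[OF smooth_fc]] smooth_in_cnj[OF smooth_in_pd_bar[OF smooth_fc]] q])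
      (simp add: cnj_phi[symmetric] phi_nth)
  also have "\<dots> = hess c j i q"
    unfolding hess_def by (rule pd_pd_bar_commute[OF smooth_fc smooth_fc q, symmetric])
  finally show ?thesis .
qed

lemma pd_bar_phi: "pd_bar c k (\<lambda>q. \<phi> c q $ j) q = hess c j k q"
  unfolding phi_nth hess_def by (rule pd_pd_bar_commute[OF smooth_fc smooth_fc q, symmetric])

lemma pd_cnj_phi: "pd c i (\<lambda>q. cnj (\<phi> c q $ l)) q = hess c i l q"
  using pd_cnj[OF smooth_phi smooth_phi q] pd_bar_phi hess_hermitian by simp

lemma christoffel_symmetric: "christoffel c i j k q = christoffel c j i k q"
  unfolding christoffel_def metric_kaehler[OF c q, of i j] ..

lemma cov_hess_symmetric: "cov_hess c i j q = cov_hess c j i q"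
  unfolding cov_hess_def christoffel_symmetric[of i j]
  using pd_commute[OF smooth_fc smooth_fc q, of i j] by (simp add: phi_nth)

lemma \<omega>1_eq: "(\<Sum>i\<in>UNIV. cov_hess c i j q * V c q $ i) = \<omega>1 c q $ j"
  unfolding \<omega>1_nth cov_hess_symmetric[of _ j] ..

lemma cnj_\<omega>2: "cnj (\<omega>2 c q $ k) = (\<Sum>p\<in>UNIV. hess c p k q * V c q $ p)"
  unfolding \<omega>2_nth by (simp add: hess_hermitian)

text \<open>The derivative of the inverse metric is minus a Christoffel symbol, so raising an index commutes with covariant differentiation in
holomorphic directions. The lower index of \<open>\<eta>\<close> is a conjugate one, for which no correction arises.\<close>

lemma pd_dual:
  assumes \<eta>: "\<And>k. smooth_in c (fst c) (\<eta> k)"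
  shows "pd c i (\<lambda>q. \<Sum>k\<in>UNIV. ginv g c j k q * \<eta> k q) q =
    (\<Sum>k\<in>UNIV. ginv g c j k q * pd c i (\<eta> k) q)
    - (\<Sum>a\<in>UNIV. christoffel c i a j q * (\<Sum>k\<in>UNIV. ginv g c a k q * \<eta> k q))"
proof -
  note K = smooth_in_ginv[OF c]
  have "pd c i (\<lambda>q. \<Sum>k\<in>UNIV. ginv g c j k q * \<eta> k q) q =
      (\<Sum>k\<in>UNIV. pd c i (ginv g c j k) q * \<eta> k q + ginv g c j k q * pd c i (\<eta> k) q)"
    by (subst pd_sum[OF region_chart[OF c] _ q]) (intro smooth_in_mult K \<eta> sum.cong refl pd_mult[OF K \<eta> q])+
  moreover have "(\<Sum>k\<in>UNIV. pd c i (ginv g c j k) q * \<eta> k q) =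
      - (\<Sum>a\<in>UNIV. christoffel c i a j q * (\<Sum>k\<in>UNIV. ginv g c a k q * \<eta> k q))"
  proof -
    have "(\<Sum>k\<in>UNIV. pd c i (ginv g c j k) q * \<eta> k q) =
        - (\<Sum>k\<in>UNIV. \<Sum>a\<in>UNIV. christoffel c i a j q * (ginv g c a k q * \<eta> k q))"
      unfolding pd_ginv[OF c q] christoffel_def by (simp add: sum_negf sum_distrib_left sum_distrib_right ac_simps)
    also have "\<dots> = - (\<Sum>a\<in>UNIV. christoffel c i a j q * (\<Sum>k\<in>UNIV. ginv g c a k q * \<eta> k q))"
      by (subst sum.swap) (simp add: sum_distrib_left)
    finally show ?thesis .
  qed
  ultimately show ?thesis by (simp add: sum.distrib)
qed

lemma pd_V: "pd c i (\<lambda>q. V c q $ j) q =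
    (\<Sum>k\<in>UNIV. ginv g c j k q * hess c i k q) - (\<Sum>a\<in>UNIV. christoffel c i a j q * V c q $ a)"
  unfolding V_nth pd_dual[of "\<lambda>k q. cnj (\<phi> c q $ k)", OF smooth_cnj_phi] pd_cnj_phi ..

text \<open>In contrast to \<open>pd_V\<close>, no Christoffel symbols are left over: \<open>\<bar>\<partial>\<close> of a vector field is tensorial.\<close>

lemma pd_bar_V: "pd_bar c i (\<lambda>q. V c q $ j) q = (\<Sum>l\<in>UNIV. ginv g c j l q * cnj (cov_hess c i l q))"
proof -
  note K = smooth_in_ginv[OF c]
  have "pd_bar c i (\<lambda>q. V c q $ j) q =
      (\<Sum>l\<in>UNIV. pd_bar c i (ginv g c j l) q * cnj (\<phi> c q $ l) + ginv g c j l q * pd_bar c i (\<lambda>q. cnj (\<phi> c q $ l)) q)"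
    unfolding V_nth
    by (subst pd_bar_sum[OF region_chart[OF c] _ q])
      (intro smooth_in_mult K smooth_cnj_phi sum.cong refl pd_bar_mult[OF K smooth_cnj_phi q])+
  also have "\<dots> = (\<Sum>l\<in>UNIV. pd_bar c i (ginv g c j l) q * cnj (\<phi> c q $ l)) +
      (\<Sum>l\<in>UNIV. ginv g c j l q * cnj (pd c i (\<lambda>q. \<phi> c q $ l) q))"
    by (simp add: sum.distrib pd_bar_cnj[OF smooth_phi smooth_phi q])
  also have "(\<Sum>l\<in>UNIV. pd_bar c i (ginv g c j l) q * cnj (\<phi> c q $ l)) =
      - (\<Sum>l\<in>UNIV. ginv g c j l q * cnj (\<Sum>k\<in>UNIV. christoffel c i l k q * \<phi> c q $ k))"
  proof -
    have "(\<Sum>l\<in>UNIV. pd_bar c i (ginv g c j l) q * cnj (\<phi> c q $ l)) =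
       - (\<Sum>l\<in>UNIV. \<Sum>a\<in>UNIV. \<Sum>b\<in>UNIV. ginv g c j b q * pd_bar c i (\<lambda>q. g c q $ a $ b) q * ginv g c a l q * cnj (\<phi> c q $ l))"
      unfolding pd_bar_ginv[OF c q] by (simp add: sum_negf sum_distrib_left sum_distrib_right ac_simps)
    also have "(\<Sum>l\<in>UNIV. \<Sum>a\<in>UNIV. \<Sum>b\<in>UNIV. ginv g c j b q * pd_bar c i (\<lambda>q. g c q $ a $ b) q * ginv g c a l q * cnj (\<phi> c q $ l)) =
       (\<Sum>l\<in>UNIV. \<Sum>b\<in>UNIV. \<Sum>a\<in>UNIV. ginv g c j b q * pd_bar c i (\<lambda>q. g c q $ a $ b) q * ginv g c a l q * cnj (\<phi> c q $ l))"
      by (intro sum.cong refl sum.swap)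
    also have "\<dots> = (\<Sum>b\<in>UNIV. \<Sum>l\<in>UNIV. \<Sum>a\<in>UNIV. ginv g c j b q * pd_bar c i (\<lambda>q. g c q $ a $ b) q * ginv g c a l q * cnj (\<phi> c q $ l))"
      by (rule sum.swap)
    also have "\<dots> = (\<Sum>b\<in>UNIV. ginv g c j b q * cnj (\<Sum>k\<in>UNIV. christoffel c i b k q * \<phi> c q $ k))"
      unfolding christoffel_def
      by (simp add: pd_bar_metric[OF c q] ginv_hermitian[OF c q] sum_distrib_left sum_distrib_right ac_simps)
    finally show ?thesis .
  qed
  also have "- (\<Sum>l\<in>UNIV. ginv g c j l q * cnj (\<Sum>k\<in>UNIV. christoffel c i l k q * \<phi> c q $ k)) +
      (\<Sum>l\<in>UNIV. ginv g c j l q * cnj (pd c i (\<lambda>q. \<phi> c q $ l) q)) =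
      (\<Sum>l\<in>UNIV. ginv g c j l q * cnj (cov_hess c i l q))"
    unfolding cov_hess_def by (simp add: right_diff_distrib sum_subtractf)
  finally show ?thesis .
qed

definition DV :: "('a \<Rightarrow> complex) \<Rightarrow> complex" where
  "DV h = (\<Sum>i\<in>UNIV. V c q $ i * pd c i h q)"

definition DV_bar :: "('a \<Rightarrow> complex) \<Rightarrow> complex" where
  "DV_bar h = (\<Sum>i\<in>UNIV. cnj (V c q $ i) * pd_bar c i h q)"

lemma DV_mult: "smooth_in c (fst c) h \<Longrightarrow> smooth_in c (fst c) k \<Longrightarrow> DV (\<lambda>q. h q * k q) = DV h * k q + h q * DV k"
  and DV_bar_mult: "smooth_in c (fst c) h \<Longrightarrow> smooth_in c (fst c) k \<Longrightarrow> DV_bar (\<lambda>q. h q * k q) = DV_bar h * k q + h q * DV_bar k"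
  unfolding DV_def DV_bar_def
  by (simp_all add: pd_mult[OF _ _ q] pd_bar_mult[OF _ _ q] sum.distrib sum_distrib_left sum_distrib_right algebra_simps)

lemma DV_sum:
  fixes h :: "'n \<Rightarrow> 'a \<Rightarrow> complex"
  assumes h: "\<And>j. smooth_in c (fst c) (h j)"
  shows "DV (\<lambda>q. \<Sum>j\<in>UNIV. h j q) = (\<Sum>j\<in>UNIV. DV (h j))"
proof -
  have "pd c i (\<lambda>q. \<Sum>j\<in>UNIV. h j q) q = (\<Sum>j\<in>UNIV. pd c i (h j) q)" for i
    by (rule pd_sum[OF region_chart[OF c] h q])
  then show ?thesis unfolding DV_def by (simp add: sum_distrib_left) (rule sum.swap)
qed

lemma DV_bar_sum:
  fixes h :: "'n \<Rightarrow> 'a \<Rightarrow> complex"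
  assumes h: "\<And>j. smooth_in c (fst c) (h j)"
  shows "DV_bar (\<lambda>q. \<Sum>j\<in>UNIV. h j q) = (\<Sum>j\<in>UNIV. DV_bar (h j))"
proof -
  have "pd_bar c i (\<lambda>q. \<Sum>j\<in>UNIV. h j q) q = (\<Sum>j\<in>UNIV. pd_bar c i (h j) q)" for i
    by (rule pd_bar_sum[OF region_chart[OF c] h q])
  then show ?thesis unfolding DV_bar_def by (simp add: sum_distrib_left) (rule sum.swap)
qed

lemma DV_cnj: "smooth_in c (fst c) h \<Longrightarrow> DV (\<lambda>q. cnj (h q)) = cnj (DV_bar h)"
  unfolding DV_def DV_bar_def by (simp add: pd_cnj[OF _ _ q])

definition \<Gamma>V :: "'n \<Rightarrow> complex" where
  "\<Gamma>V j = (\<Sum>i\<in>UNIV. \<Sum>a\<in>UNIV. V c q $ i * V c q $ a * christoffel c i a j q)"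

lemma DV_V: "DV (\<lambda>q. V c q $ j) = W2 c q $ j - \<Gamma>V j"
proof -
  have "DV (\<lambda>q. V c q $ j) = (\<Sum>i\<in>UNIV. \<Sum>k\<in>UNIV. V c q $ i * (ginv g c j k q * hess c i k q)) -
      (\<Sum>i\<in>UNIV. \<Sum>a\<in>UNIV. V c q $ i * (christoffel c i a j q * V c q $ a))"
    unfolding DV_def pd_V by (simp add: right_diff_distrib sum_subtractf sum_distrib_left)
  also have "(\<Sum>i\<in>UNIV. \<Sum>k\<in>UNIV. V c q $ i * (ginv g c j k q * hess c i k q)) = W2 c q $ j"
    unfolding W2_nth cnj_\<omega>2 sum_distrib_left by (subst sum.swap) (simp add: ac_simps)
  also have "(\<Sum>i\<in>UNIV. \<Sum>a\<in>UNIV. V c q $ i * (christoffel c i a j q * V c q $ a)) = \<Gamma>V j"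
    unfolding \<Gamma>V_def by (simp add: ac_simps)
  finally show ?thesis .
qed

lemma DV_bar_V: "DV_bar (\<lambda>q. V c q $ j) = W1 c q $ j"
proof -
  have "DV_bar (\<lambda>q. V c q $ j) = (\<Sum>k\<in>UNIV. \<Sum>l\<in>UNIV. ginv g c j l q * cnj (cov_hess c k l q * V c q $ k))"
    unfolding DV_bar_def pd_bar_V by (simp add: sum_distrib_left ac_simps)
  also have "\<dots> = (\<Sum>l\<in>UNIV. ginv g c j l q * cnj (\<Sum>k\<in>UNIV. cov_hess c k l q * V c q $ k))"
    by (subst sum.swap) (simp add: sum_distrib_left)
  finally show ?thesis unfolding \<omega>1_eq W1_nth .
qed

lemma DV_cnj_V: "DV (\<lambda>q. cnj (V c q $ j)) = cnj (W1 c q $ j)"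
  unfolding DV_cnj[OF smooth_V] DV_bar_V ..

lemma cnj_W1: "cnj (W1 c q $ k) = (\<Sum>l\<in>UNIV. ginv g c l k q * \<omega>1 c q $ l)"
  unfolding W1_nth by (simp add: ginv_hermitian[OF c q])

text \<open>The derivative of \<open>g\<^bsup>i\<bar>k\<^esup> \<phi>\<^sub>i \<bar>\<phi>\<^sub>k\<close> splits according to the factor that is differentiated; the derivative of the inverse metric supplies the Christoffel
symbols that complete \<open>\<partial>\<phi>\<close> to a covariant derivative.\<close>

lemma pd_norm: "pd c j (\<lambda>q. \<Sum>i\<in>UNIV. \<phi> c q $ i * V c q $ i) q = \<omega>1 c q $ j + \<omega>2 c q $ j"
proof -
  have "pd c j (\<lambda>q. \<Sum>i\<in>UNIV. \<phi> c q $ i * V c q $ i) q =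
     (\<Sum>i\<in>UNIV. pd c j (\<lambda>q. \<phi> c q $ i) q * V c q $ i + \<phi> c q $ i * pd c j (\<lambda>q. V c q $ i) q)"
    by (subst pd_sum[OF region_chart[OF c] _ q]) (intro smooth_in_mult smooth_phi smooth_V sum.cong refl pd_mult[OF smooth_phi smooth_V q])+
  also have "\<dots> = (\<Sum>i\<in>UNIV. pd c j (\<lambda>q. \<phi> c q $ i) q * V c q $ i)
     + (\<Sum>i\<in>UNIV. \<Sum>k\<in>UNIV. hess c j k q * (\<phi> c q $ i * ginv g c i k q))
     - (\<Sum>i\<in>UNIV. \<Sum>a\<in>UNIV. christoffel c j a i q * \<phi> c q $ i * V c q $ a)"
    unfolding pd_V by (simp add: right_diff_distrib sum_subtractf sum.distrib sum_distrib_left ac_simps)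
  also have "(\<Sum>i\<in>UNIV. \<Sum>k\<in>UNIV. hess c j k q * (\<phi> c q $ i * ginv g c i k q)) = \<omega>2 c q $ j"
    unfolding \<omega>2_nth cnj_V[OF q] sum_distrib_left by (rule sum.swap)
  also have "(\<Sum>i\<in>UNIV. \<Sum>a\<in>UNIV. christoffel c j a i q * \<phi> c q $ i * V c q $ a) =
      (\<Sum>a\<in>UNIV. (\<Sum>i\<in>UNIV. christoffel c j a i q * \<phi> c q $ i) * V c q $ a)"
    unfolding sum_distrib_right by (rule sum.swap)
  also have "(\<Sum>i\<in>UNIV. pd c j (\<lambda>q. \<phi> c q $ i) q * V c q $ i) + \<omega>2 c q $ j -
      (\<Sum>a\<in>UNIV. (\<Sum>i\<in>UNIV. christoffel c j a i q * \<phi> c q $ i) * V c q $ a) = \<omega>1 c q $ j + \<omega>2 c q $ j"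
    unfolding \<omega>1_nth cov_hess_def by (simp add: left_diff_distrib sum_subtractf)
  finally show ?thesis .
qed

text \<open>The contraction of the third derivatives \<open>\<partial>\<^sub>i \<partial>\<^sub>j \<partial>\<^bsub>\<bar>k\<^esub> f\<close>. It occurs both in \<open>DV_\<omega>2\<close> and in \<open>DV_bar_\<omega>1\<close> and cancels from their
difference.\<close>

definition hess_third_order :: complex where
  "hess_third_order = (\<Sum>j\<in>UNIV. \<Sum>k\<in>UNIV. DV (hess c j k) * (V c q $ j * cnj (V c q $ k)))"

text \<open>The curvature in disguise: \<open>R\<close> is \<open>-\<bar>\<partial>\<close> of the Christoffel symbols, as \<open>curv_sum_eq\<close> makes precise.\<close>

definition curvature_term :: complex where
  "curvature_term = (\<Sum>i\<in>UNIV. \<Sum>j\<in>UNIV. \<Sum>p\<in>UNIV. DV_bar (christoffel c i j p) * \<phi> c q $ p * V c q $ i * V c q $ j)"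

lemma DV_\<omega>2: "DV (\<lambda>q. \<Sum>j\<in>UNIV. \<omega>2 c q $ j * V c q $ j) =
    hess_third_order + (\<Sum>j\<in>UNIV. \<omega>2 c q $ j * (W2 c q $ j - \<Gamma>V j)) + (\<Sum>j\<in>UNIV. W2 c q $ j * \<omega>1 c q $ j)"
proof -
  have 1: "DV (\<lambda>q. \<omega>2 c q $ j) = (\<Sum>k\<in>UNIV. DV (hess c j k) * cnj (V c q $ k) + hess c j k q * cnj (W1 c q $ k))" for j
    unfolding \<omega>2_nth
    by (subst DV_sum) (simp_all add: smooth_in_mult smooth_hess smooth_cnj_V DV_mult DV_cnj_V)
  have "DV (\<lambda>q. \<Sum>j\<in>UNIV. \<omega>2 c q $ j * V c q $ j) = (\<Sum>j\<in>UNIV. DV (\<lambda>q. \<omega>2 c q $ j) * V c q $ j + \<omega>2 c q $ j * DV (\<lambda>q. V c q $ j))"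
    by (subst DV_sum) (simp_all add: smooth_in_mult smooth_\<omega>2 smooth_V DV_mult)
  also have "\<dots> = hess_third_order + (\<Sum>j\<in>UNIV. \<Sum>k\<in>UNIV. hess c j k q * cnj (W1 c q $ k) * V c q $ j) + (\<Sum>j\<in>UNIV. \<omega>2 c q $ j * (W2 c q $ j - \<Gamma>V j))"
    unfolding 1 DV_V hess_third_order_def by (simp add: sum.distrib sum_distrib_left sum_distrib_right distrib_left ac_simps)
  also have "(\<Sum>j\<in>UNIV. \<Sum>k\<in>UNIV. hess c j k q * cnj (W1 c q $ k) * V c q $ j) = (\<Sum>k\<in>UNIV. cnj (\<omega>2 c q $ k) * cnj (W1 c q $ k))"
    unfolding cnj_\<omega>2 by (subst sum.swap) (simp add: sum_distrib_left ac_simps)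
  also have "\<dots> = (\<Sum>j\<in>UNIV. W2 c q $ j * \<omega>1 c q $ j)"
    unfolding cnj_W1 W2_nth sum_distrib_left sum_distrib_right by (subst sum.swap) (simp add: ac_simps)
  finally show ?thesis by simp
qed

lemma DV_bar_cov_hess: "DV_bar (cov_hess c j i) = DV_bar (pd c j (\<lambda>q. \<phi> c q $ i))
    - (\<Sum>p\<in>UNIV. DV_bar (christoffel c j i p) * \<phi> c q $ p) - (\<Sum>p\<in>UNIV. christoffel c j i p q * \<omega>2 c q $ p)"
proof -
  have e: "pd_bar c k (cov_hess c j i) q = pd_bar c k (pd c j (\<lambda>q. \<phi> c q $ i)) q -
      (\<Sum>p\<in>UNIV. pd_bar c k (christoffel c j i p) q * \<phi> c q $ p + christoffel c j i p q * hess c p k q)" for k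
  proof -
    have s: "smooth_in c (fst c) (\<lambda>q. \<Sum>p\<in>UNIV. christoffel c j i p q * \<phi> c q $ p)"
      by (intro smooth_in_sum smooth_in_mult smooth_christoffel smooth_phi region_chart c)
    have "pd_bar c k (\<lambda>q. pd c j (\<lambda>q. \<phi> c q $ i) q + (-1) * (\<Sum>p\<in>UNIV. christoffel c j i p q * \<phi> c q $ p)) q =
       pd_bar c k (pd c j (\<lambda>q. \<phi> c q $ i)) q + (-1) * pd_bar c k (\<lambda>q. \<Sum>p\<in>UNIV. christoffel c j i p q * \<phi> c q $ p) q"
      using pd_bar_add[OF smooth_in_pd[OF smooth_phi] smooth_in_mult[OF smooth_in_const[OF region_chart[OF c], of "-1"] s] q, of k j i]
        pd_bar_mult[OF smooth_in_const[OF region_chart[OF c], of "-1"] s q, of k] by (simp add: pd_bar_const)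
    also have "pd_bar c k (\<lambda>q. \<Sum>p\<in>UNIV. christoffel c j i p q * \<phi> c q $ p) q =
       (\<Sum>p\<in>UNIV. pd_bar c k (christoffel c j i p) q * \<phi> c q $ p + christoffel c j i p q * pd_bar c k (\<lambda>q. \<phi> c q $ p) q)"
      by (subst pd_bar_sum[OF region_chart[OF c] _ q])
        (intro smooth_in_mult smooth_christoffel smooth_phi sum.cong refl pd_bar_mult[OF smooth_christoffel smooth_phi q])+
    finally show ?thesis unfolding cov_hess_def[abs_def] pd_bar_phi by simp
  qed
  have "DV_bar (cov_hess c j i) = DV_bar (pd c j (\<lambda>q. \<phi> c q $ i))
     - (\<Sum>k\<in>UNIV. \<Sum>p\<in>UNIV. cnj (V c q $ k) * pd_bar c k (christoffel c j i p) q * \<phi> c q $ p)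
     - (\<Sum>k\<in>UNIV. \<Sum>p\<in>UNIV. christoffel c j i p q * (hess c p k q * cnj (V c q $ k)))"
    unfolding DV_bar_def e by (simp add: sum_subtractf sum_distrib_left sum.distrib algebra_simps)
  also have "(\<Sum>k\<in>UNIV. \<Sum>p\<in>UNIV. cnj (V c q $ k) * pd_bar c k (christoffel c j i p) q * \<phi> c q $ p) =
     (\<Sum>p\<in>UNIV. DV_bar (christoffel c j i p) * \<phi> c q $ p)"
    unfolding DV_bar_def sum_distrib_right by (rule sum.swap)
  also have "(\<Sum>k\<in>UNIV. \<Sum>p\<in>UNIV. christoffel c j i p q * (hess c p k q * cnj (V c q $ k))) =
     (\<Sum>p\<in>UNIV. christoffel c j i p q * \<omega>2 c q $ p)"
    unfolding \<omega>2_nth sum_distrib_left by (rule sum.swap)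
  finally show ?thesis .
qed

text \<open>Partial derivatives commute, so \<open>\<bar>V\<close> applied to \<open>\<partial>\<partial> f\<close> is \<open>\<partial>\<close> applied to the complex Hessian.\<close>

lemma DV_bar_pd_phi: "(\<Sum>j\<in>UNIV. V c q $ j * DV_bar (pd c j (\<lambda>q. \<phi> c q $ i))) = (\<Sum>k\<in>UNIV. DV (hess c i k) * cnj (V c q $ k))"
proof -
  have "pd_bar c k (pd c j (\<lambda>q. \<phi> c q $ i)) q = pd c j (hess c i k) q" for j k
  proof -
    have "pd_bar c k (pd c j (\<lambda>q. \<phi> c q $ i)) q = pd c j (pd_bar c k (\<lambda>q. \<phi> c q $ i)) q"
      by (rule pd_pd_bar_commute[OF smooth_phi smooth_phi q, symmetric])
    also have "\<dots> = pd c j (hess c i k) q"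
    proof (rule pd_cong[OF smooth_in_pd_bar[OF smooth_phi] smooth_in_pd_bar[OF smooth_phi] q])
      fix q' assume "q' \<in> fst c"
      then show "pd_bar c k (\<lambda>q. \<phi> c q $ i) q' = hess c i k q'"
        unfolding phi_nth hess_def by (rule pd_pd_bar_commute[OF smooth_fc smooth_fc, symmetric])
    qed
    finally show ?thesis .
  qed
  then show ?thesis
    unfolding DV_def DV_bar_def sum_distrib_left sum_distrib_right
    by (subst sum.swap) (simp add: ac_simps)
qed

lemma DV_bar_\<omega>1: "DV_bar (\<lambda>q. \<Sum>j\<in>UNIV. \<omega>1 c q $ j * V c q $ j) =
    hess_third_order - curvature_term - (\<Sum>p\<in>UNIV. \<Gamma>V p * \<omega>2 c q $ p) + 2 * (\<Sum>j\<in>UNIV. \<omega>1 c q $ j * W1 c q $ j)"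
proof -
  have 1: "DV_bar (\<lambda>q. \<omega>1 c q $ j) = (\<Sum>i\<in>UNIV. DV_bar (cov_hess c j i) * V c q $ i + cov_hess c j i q * W1 c q $ i)" for j
    unfolding \<omega>1_nth
    by (subst DV_bar_sum) (simp_all add: smooth_in_mult smooth_cov_hess smooth_V DV_bar_mult DV_bar_V)
  have "DV_bar (\<lambda>q. \<Sum>j\<in>UNIV. \<omega>1 c q $ j * V c q $ j) = (\<Sum>j\<in>UNIV. DV_bar (\<lambda>q. \<omega>1 c q $ j) * V c q $ j + \<omega>1 c q $ j * W1 c q $ j)"
    by (subst DV_bar_sum) (simp_all add: smooth_in_mult smooth_\<omega>1 smooth_V DV_bar_mult DV_bar_V)
  also have "\<dots> = (\<Sum>j\<in>UNIV. \<Sum>i\<in>UNIV. DV_bar (cov_hess c j i) * V c q $ i * V c q $ j) +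
     (\<Sum>j\<in>UNIV. \<Sum>i\<in>UNIV. cov_hess c j i q * V c q $ j * W1 c q $ i) + (\<Sum>j\<in>UNIV. \<omega>1 c q $ j * W1 c q $ j)"
    unfolding 1 by (simp add: sum.distrib sum_distrib_left sum_distrib_right distrib_left ac_simps)
  also have "(\<Sum>j\<in>UNIV. \<Sum>i\<in>UNIV. cov_hess c j i q * V c q $ j * W1 c q $ i) = (\<Sum>i\<in>UNIV. \<omega>1 c q $ i * W1 c q $ i)"
    unfolding \<omega>1_eq[symmetric] sum_distrib_right by (rule sum.swap)
  also have "(\<Sum>j\<in>UNIV. \<Sum>i\<in>UNIV. DV_bar (cov_hess c j i) * V c q $ i * V c q $ j) =
     hess_third_order - curvature_term - (\<Sum>p\<in>UNIV. \<Gamma>V p * \<omega>2 c q $ p)"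
  proof -
    have "(\<Sum>j\<in>UNIV. \<Sum>i\<in>UNIV. DV_bar (cov_hess c j i) * V c q $ i * V c q $ j) =
       (\<Sum>j\<in>UNIV. \<Sum>i\<in>UNIV. DV_bar (pd c j (\<lambda>q. \<phi> c q $ i)) * V c q $ i * V c q $ j) - curvature_term
       - (\<Sum>j\<in>UNIV. \<Sum>i\<in>UNIV. \<Sum>p\<in>UNIV. V c q $ j * V c q $ i * christoffel c j i p q * \<omega>2 c q $ p)"
      unfolding DV_bar_cov_hess curvature_term_def
      by (simp add: sum_subtractf right_diff_distrib sum_distrib_left ac_simps)
    also have "(\<Sum>j\<in>UNIV. \<Sum>i\<in>UNIV. DV_bar (pd c j (\<lambda>q. \<phi> c q $ i)) * V c q $ i * V c q $ j) = hess_third_order"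
    proof -
      have "(\<Sum>j\<in>UNIV. \<Sum>i\<in>UNIV. DV_bar (pd c j (\<lambda>q. \<phi> c q $ i)) * V c q $ i * V c q $ j) =
         (\<Sum>i\<in>UNIV. (\<Sum>j\<in>UNIV. V c q $ j * DV_bar (pd c j (\<lambda>q. \<phi> c q $ i))) * V c q $ i)"
        by (subst sum.swap) (simp add: sum_distrib_left ac_simps)
      then show ?thesis unfolding DV_bar_pd_phi hess_third_order_def by (simp add: sum_distrib_left sum_distrib_right ac_simps)
    qed
    also have "(\<Sum>j\<in>UNIV. \<Sum>i\<in>UNIV. \<Sum>p\<in>UNIV. V c q $ j * V c q $ i * christoffel c j i p q * \<omega>2 c q $ p) =
       (\<Sum>p\<in>UNIV. \<Gamma>V p * \<omega>2 c q $ p)"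
    proof -
      have "(\<Sum>j\<in>UNIV. \<Sum>i\<in>UNIV. \<Sum>p\<in>UNIV. V c q $ j * V c q $ i * christoffel c j i p q * \<omega>2 c q $ p) =
        (\<Sum>j\<in>UNIV. \<Sum>p\<in>UNIV. \<Sum>i\<in>UNIV. V c q $ j * V c q $ i * christoffel c j i p q * \<omega>2 c q $ p)"
        by (intro sum.cong refl sum.swap)
      also have "\<dots> = (\<Sum>p\<in>UNIV. \<Sum>j\<in>UNIV. \<Sum>i\<in>UNIV. V c q $ j * V c q $ i * christoffel c j i p q * \<omega>2 c q $ p)"
        by (rule sum.swap)
      finally show ?thesis unfolding \<Gamma>V_def sum_distrib_right .
    qed
    finally show ?thesis .
  qed
  finally show ?thesis by simp
qed

definition curv_sum :: complex where
  "curv_sum = (\<Sum>i\<in>UNIV. \<Sum>j\<in>UNIV. \<Sum>k\<in>UNIV. \<Sum>l\<in>UNIV.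
     curv g c i j k l q * V c q $ i * cnj (V c q $ j) * V c q $ k * cnj (V c q $ l))"

text \<open>Differentiating \<open>\<Gamma> = g\<^sup>-\<^sup>1 \<partial>g\<close> along \<open>\<bar>V\<close> produces the two terms in the definition of the curvature: one from \<open>\<bar>\<partial>\<partial>g\<close>, one from the
derivative of the inverse metric.\<close>

lemma curv_contraction:
  "(\<Sum>j\<in>UNIV. \<Sum>l\<in>UNIV. curv g c i j k l q * cnj (V c q $ j) * cnj (V c q $ l)) =
    - (\<Sum>p\<in>UNIV. DV_bar (christoffel c i k p) * \<phi> c q $ p)"
proof -
  note K = smooth_in_ginv[OF c] and sg = smooth_in_metric[OF c]
  let ?dg = "\<lambda>l. pd c i (\<lambda>q. g c q $ k $ l)"
  let ?b = "\<lambda>a l. DV_bar (\<lambda>q. g c q $ a $ l)"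
  have chr: "DV_bar (christoffel c i k p) = (\<Sum>l\<in>UNIV. DV_bar (ginv g c p l) * ?dg l q + ginv g c p l q * DV_bar (?dg l))" for p
    unfolding christoffel_def[abs_def]
    by (subst DV_bar_sum) (simp_all add: smooth_in_mult K smooth_in_pd sg DV_bar_mult)
  have DK: "DV_bar (ginv g c p l) = - (\<Sum>a\<in>UNIV. \<Sum>b\<in>UNIV. ginv g c p b q * ?b a b * ginv g c a l q)" for p l
  proof -
    have "DV_bar (ginv g c p l) = - (\<Sum>m\<in>UNIV. \<Sum>a\<in>UNIV. \<Sum>b\<in>UNIV.
        cnj (V c q $ m) * (ginv g c p b q * pd_bar c m (\<lambda>q. g c q $ a $ b) q * ginv g c a l q))"
      unfolding DV_bar_def pd_bar_ginv[OF c q] by (simp add: sum_negf sum_distrib_left)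
    also have "(\<Sum>m\<in>UNIV. \<Sum>a\<in>UNIV. \<Sum>b\<in>UNIV. cnj (V c q $ m) * (ginv g c p b q * pd_bar c m (\<lambda>q. g c q $ a $ b) q * ginv g c a l q))
      = (\<Sum>a\<in>UNIV. \<Sum>m\<in>UNIV. \<Sum>b\<in>UNIV. cnj (V c q $ m) * (ginv g c p b q * pd_bar c m (\<lambda>q. g c q $ a $ b) q * ginv g c a l q))"
      by (rule sum.swap)
    also have "\<dots> = (\<Sum>a\<in>UNIV. \<Sum>b\<in>UNIV. \<Sum>m\<in>UNIV. cnj (V c q $ m) * (ginv g c p b q * pd_bar c m (\<lambda>q. g c q $ a $ b) q * ginv g c a l q))"
      by (intro sum.cong refl sum.swap)
    finally show ?thesis unfolding DV_bar_def by (simp add: sum_distrib_left sum_distrib_right ac_simps)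
  qed
  have first: "(\<Sum>p\<in>UNIV. DV_bar (ginv g c p l) * \<phi> c q $ p) = - (\<Sum>a\<in>UNIV. \<Sum>b\<in>UNIV. cnj (V c q $ b) * ?b a b * ginv g c a l q)" for l
  proof -
    have "(\<Sum>p\<in>UNIV. DV_bar (ginv g c p l) * \<phi> c q $ p) =
      - (\<Sum>p\<in>UNIV. \<Sum>a\<in>UNIV. \<Sum>b\<in>UNIV. \<phi> c q $ p * ginv g c p b q * (?b a b * ginv g c a l q))"
      unfolding DK by (simp add: sum_negf sum_distrib_left ac_simps)
    also have "(\<Sum>p\<in>UNIV. \<Sum>a\<in>UNIV. \<Sum>b\<in>UNIV. \<phi> c q $ p * ginv g c p b q * (?b a b * ginv g c a l q)) =
       (\<Sum>a\<in>UNIV. \<Sum>p\<in>UNIV. \<Sum>b\<in>UNIV. \<phi> c q $ p * ginv g c p b q * (?b a b * ginv g c a l q))"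
      by (rule sum.swap)
    also have "\<dots> = (\<Sum>a\<in>UNIV. \<Sum>b\<in>UNIV. \<Sum>p\<in>UNIV. \<phi> c q $ p * ginv g c p b q * (?b a b * ginv g c a l q))"
      by (intro sum.cong refl sum.swap)
    finally show ?thesis unfolding cnj_V[OF q] by (simp add: sum_distrib_left sum_distrib_right ac_simps)
  qed
  have "(\<Sum>p\<in>UNIV. DV_bar (christoffel c i k p) * \<phi> c q $ p) =
      (\<Sum>l\<in>UNIV. (\<Sum>p\<in>UNIV. DV_bar (ginv g c p l) * \<phi> c q $ p) * ?dg l q
        + (\<Sum>p\<in>UNIV. \<phi> c q $ p * ginv g c p l q) * DV_bar (?dg l))"
    unfolding chr sum_distrib_right
    by (subst sum.swap) (simp add: sum.distrib distrib_left distrib_right ac_simps)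
  then have lhs: "(\<Sum>p\<in>UNIV. DV_bar (christoffel c i k p) * \<phi> c q $ p) =
      (\<Sum>l\<in>UNIV. cnj (V c q $ l) * DV_bar (?dg l))
      - (\<Sum>s\<in>UNIV. \<Sum>r\<in>UNIV. \<Sum>l\<in>UNIV. ginv g c r s q * ?dg s q * (cnj (V c q $ l) * ?b r l))"
    unfolding first cnj_V[OF q, symmetric] by (simp add: sum_subtractf sum_distrib_left sum_distrib_right ac_simps)
  have comm: "pd c i (pd_bar c j (\<lambda>q. g c q $ k $ l)) q = pd_bar c j (?dg l) q" for j l
    by (rule pd_pd_bar_commute[OF sg sg q])
  have "(\<Sum>j\<in>UNIV. \<Sum>l\<in>UNIV. curv g c i j k l q * cnj (V c q $ j) * cnj (V c q $ l)) =
     (\<Sum>l\<in>UNIV. \<Sum>j\<in>UNIV. curv g c i j k l q * cnj (V c q $ j) * cnj (V c q $ l))"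
    by (rule sum.swap)
  also have "\<dots> = (\<Sum>l\<in>UNIV. - (cnj (V c q $ l) * DV_bar (?dg l)) +
     (\<Sum>j\<in>UNIV. \<Sum>r\<in>UNIV. \<Sum>s\<in>UNIV. ginv g c r s q * ?dg s q * cnj (V c q $ l) * (cnj (V c q $ j) * pd_bar c j (\<lambda>q. g c q $ r $ l) q)))"
    unfolding curv_def comm DV_bar_def
    by (simp add: distrib_right right_diff_distrib sum.distrib sum_subtractf sum_negf sum_distrib_left sum_distrib_right ac_simps)
  also have "\<dots> = - (\<Sum>l\<in>UNIV. cnj (V c q $ l) * DV_bar (?dg l)) +
     (\<Sum>l\<in>UNIV. \<Sum>j\<in>UNIV. \<Sum>r\<in>UNIV. \<Sum>s\<in>UNIV. ginv g c r s q * ?dg s q * cnj (V c q $ l) * (cnj (V c q $ j) * pd_bar c j (\<lambda>q. g c q $ r $ l) q))"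
    by (simp add: sum.distrib sum_subtractf sum_negf)
  also have "(\<Sum>l\<in>UNIV. \<Sum>j\<in>UNIV. \<Sum>r\<in>UNIV. \<Sum>s\<in>UNIV. ginv g c r s q * ?dg s q * cnj (V c q $ l) * (cnj (V c q $ j) * pd_bar c j (\<lambda>q. g c q $ r $ l) q)) =
     (\<Sum>l\<in>UNIV. \<Sum>r\<in>UNIV. \<Sum>s\<in>UNIV. \<Sum>j\<in>UNIV. ginv g c r s q * ?dg s q * cnj (V c q $ l) * (cnj (V c q $ j) * pd_bar c j (\<lambda>q. g c q $ r $ l) q))"
  proof (rule sum.cong[OF refl])
    fix l
    have "(\<Sum>j\<in>UNIV. \<Sum>r\<in>UNIV. \<Sum>s\<in>UNIV. ginv g c r s q * ?dg s q * cnj (V c q $ l) * (cnj (V c q $ j) * pd_bar c j (\<lambda>q. g c q $ r $ l) q)) =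
      (\<Sum>r\<in>UNIV. \<Sum>j\<in>UNIV. \<Sum>s\<in>UNIV. ginv g c r s q * ?dg s q * cnj (V c q $ l) * (cnj (V c q $ j) * pd_bar c j (\<lambda>q. g c q $ r $ l) q))"
      by (rule sum.swap)
    also have "\<dots> = (\<Sum>r\<in>UNIV. \<Sum>s\<in>UNIV. \<Sum>j\<in>UNIV. ginv g c r s q * ?dg s q * cnj (V c q $ l) * (cnj (V c q $ j) * pd_bar c j (\<lambda>q. g c q $ r $ l) q))"
      by (intro sum.cong refl sum.swap)
    finally show "(\<Sum>j\<in>UNIV. \<Sum>r\<in>UNIV. \<Sum>s\<in>UNIV. ginv g c r s q * ?dg s q * cnj (V c q $ l) * (cnj (V c q $ j) * pd_bar c j (\<lambda>q. g c q $ r $ l) q)) =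
      (\<Sum>r\<in>UNIV. \<Sum>s\<in>UNIV. \<Sum>j\<in>UNIV. ginv g c r s q * ?dg s q * cnj (V c q $ l) * (cnj (V c q $ j) * pd_bar c j (\<lambda>q. g c q $ r $ l) q))" .
  qed
  also have "\<dots> = (\<Sum>l\<in>UNIV. \<Sum>r\<in>UNIV. \<Sum>s\<in>UNIV. ginv g c r s q * ?dg s q * (cnj (V c q $ l) * ?b r l))"
    unfolding DV_bar_def by (simp add: sum_distrib_left ac_simps)
  also have "\<dots> = (\<Sum>l\<in>UNIV. \<Sum>s\<in>UNIV. \<Sum>r\<in>UNIV. ginv g c r s q * ?dg s q * (cnj (V c q $ l) * ?b r l))"
    by (intro sum.cong refl sum.swap)
  also have "\<dots> = (\<Sum>s\<in>UNIV. \<Sum>l\<in>UNIV. \<Sum>r\<in>UNIV. ginv g c r s q * ?dg s q * (cnj (V c q $ l) * ?b r l))"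
    by (rule sum.swap)
  also have "\<dots> = (\<Sum>s\<in>UNIV. \<Sum>r\<in>UNIV. \<Sum>l\<in>UNIV. ginv g c r s q * ?dg s q * (cnj (V c q $ l) * ?b r l))"
    by (intro sum.cong refl sum.swap)
  finally show ?thesis unfolding lhs by simp
qed

lemma curv_sum_eq: "curv_sum = - curvature_term"
proof -
  have "curv_sum = (\<Sum>i\<in>UNIV. \<Sum>k\<in>UNIV. (\<Sum>j\<in>UNIV. \<Sum>l\<in>UNIV. curv g c i j k l q * cnj (V c q $ j) * cnj (V c q $ l)) * V c q $ i * V c q $ k)"
  proof -
    have "curv_sum = (\<Sum>i\<in>UNIV. \<Sum>k\<in>UNIV. \<Sum>j\<in>UNIV. \<Sum>l\<in>UNIV.
       curv g c i j k l q * V c q $ i * cnj (V c q $ j) * V c q $ k * cnj (V c q $ l))"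
      unfolding curv_sum_def by (intro sum.cong refl sum.swap)
    then show ?thesis by (simp add: sum_distrib_left sum_distrib_right ac_simps)
  qed
  then show ?thesis
    unfolding curv_contraction curvature_term_def by (simp add: sum_negf sum_distrib_left sum_distrib_right ac_simps)
qed

text \<open>The antiholomorphic derivative of \<open>\<omega>1(V)\<close> and the holomorphic derivative of \<open>\<omega>2(V)\<close> both contain the third derivatives of \<open>f\<close>. In
their difference these cancel, and so do the Christoffel symbols; what remains is curvature and first-order terms.\<close>

lemma Bochner_identity:
  "curv_sum = DV_bar (\<lambda>q. \<Sum>j\<in>UNIV. \<omega>1 c q $ j * V c q $ j) - DV (\<lambda>q. \<Sum>j\<in>UNIV. \<omega>2 c q $ j * V c q $ j)
    - 2 * (\<Sum>j\<in>UNIV. \<omega>1 c q $ j * W1 c q $ j) + (\<Sum>j\<in>UNIV. W2 c q $ j * (\<omega>1 c q $ j + \<omega>2 c q $ j))"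
  unfolding DV_bar_\<omega>1 DV_\<omega>2 curv_sum_eq
  by (simp add: distrib_left right_diff_distrib sum.distrib sum_subtractf ac_simps)

end

section \<open>Divergences of the vector fields\<close>

definition lap :: "'a \<Rightarrow> complex" where
  "lap q = (\<Sum>j\<in>UNIV. \<Sum>k\<in>UNIV. ginv g c j k q * hess c j k q)"

definition hess_norm2 :: "'a \<Rightarrow> complex" where
  "hess_norm2 q = (\<Sum>i\<in>UNIV. \<Sum>j\<in>UNIV. \<Sum>k\<in>UNIV. \<Sum>l\<in>UNIV. ginv g c i k q * ginv g c l j q
     * hess c i j q * cnj (hess c k l q))"

lemma dlog_vol_eq:
  assumes q: "q \<in> fst c"
  shows "dlog_vol c i q = (\<Sum>j\<in>UNIV. christoffel c j i j q)"
  unfolding dlog_vol_def christoffel_def metric_kaehler[OF c q, of i] by (simp add: ginv_def)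

text \<open>The trace of the Christoffel symbols in \<open>pd_dual\<close> cancels the logarithmic derivative of the volume density. This is where the Kaehler
condition enters the divergence.\<close>

lemma divergence_dual:
  assumes \<eta>: "\<And>k. smooth_in c (fst c) (\<eta> k)" and q: "q \<in> fst c"
    and X: "\<And>q j. X c q $ j = (\<Sum>k\<in>UNIV. ginv g c j k q * \<eta> k q)"
  shows "divergence c X q = (\<Sum>j\<in>UNIV. \<Sum>k\<in>UNIV. ginv g c j k q * pd c j (\<eta> k) q)"
proof -
  have "(\<Sum>j\<in>UNIV. \<Sum>a\<in>UNIV. christoffel c j a j q * X c q $ a) = (\<Sum>a\<in>UNIV. X c q $ a * dlog_vol c a q)"
    unfolding dlog_vol_eq[OF q] sum_distrib_left by (subst sum.swap) (simp add: mult.commute)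
  then show ?thesis
    unfolding divergence_def X pd_dual[OF q \<eta>] by (simp add: sum.distrib sum_subtractf)
qed

lemma divergence_V: "q \<in> fst c \<Longrightarrow> divergence c V q = lap q"
  using divergence_dual[of "\<lambda>k q. cnj (\<phi> c q $ k)" q V, OF smooth_cnj_phi _ V_nth]
  by (simp add: pd_cnj_phi lap_def)

lemma smooth_lap: "smooth_in c (fst c) lap"
  unfolding lap_def by (intro smooth_in_sum smooth_in_mult smooth_in_ginv smooth_hess region_chart c)

text \<open>Partial derivatives commute, so in \<open>div W\<close> the derivative falling on the Hessian can be taken along \<open>V\<close>, where together with the derivative of the
inverse metric it forms \<open>V (tr Hess f)\<close>. The derivative falling on \<open>V\<close> contributes \<open>|\<partial>\<bar>\<partial> f|\<^sup>2\<close>.\<close>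

lemma divergence_W2:
  assumes q: "q \<in> fst c"
  shows "divergence c W2 q = (\<Sum>p\<in>UNIV. V c q $ p * pd c p lap q) + hess_norm2 q"
proof -
  note K = smooth_in_ginv[OF c]
  have hcomm: "pd c j (hess c p k) q = pd c p (hess c j k) q" for j p k
    unfolding hess_def by (rule pd_commute[OF smooth_in_pd_bar[OF smooth_fc] smooth_in_pd_bar[OF smooth_fc] q])
  have pdK: "pd c p (ginv g c j k) q = - (\<Sum>a\<in>UNIV. christoffel c p a j q * ginv g c a k q)" for p j k
    unfolding pd_ginv[OF c q] christoffel_def by (simp add: sum_distrib_right)
  have "pd c j (\<lambda>q. cnj (\<omega>2 c q $ k)) q = (\<Sum>p\<in>UNIV. pd c j (hess c p k) q * V c q $ p + hess c p k q * pd c j (\<lambda>q. V c q $ p) q)" for j k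
  proof -
    have s: "smooth_in c (fst c) (\<lambda>q. \<Sum>p\<in>UNIV. hess c p k q * V c q $ p)"
      by (intro smooth_in_sum smooth_in_mult smooth_hess smooth_V region_chart c)
    have "pd c j (\<lambda>q. cnj (\<omega>2 c q $ k)) q = pd c j (\<lambda>q. \<Sum>p\<in>UNIV. hess c p k q * V c q $ p) q"
      by (rule pd_cong[OF smooth_in_cnj[OF smooth_\<omega>2] s q]) (rule cnj_\<omega>2)
    also have "\<dots> = (\<Sum>p\<in>UNIV. pd c j (hess c p k) q * V c q $ p + hess c p k q * pd c j (\<lambda>q. V c q $ p) q)"
      by (subst pd_sum[OF region_chart[OF c] _ q])
        (intro smooth_in_mult smooth_hess smooth_V sum.cong refl pd_mult[OF smooth_hess smooth_V q])+
    finally show ?thesis .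
  qed
  then have "divergence c W2 q = (\<Sum>j\<in>UNIV. \<Sum>k\<in>UNIV. ginv g c j k q *
      (\<Sum>p\<in>UNIV. pd c j (hess c p k) q * V c q $ p + hess c p k q * pd c j (\<lambda>q. V c q $ p) q))"
    using divergence_dual[of "\<lambda>k q. cnj (\<omega>2 c q $ k)" q W2, OF smooth_in_cnj[OF smooth_\<omega>2] q W2_nth] by simp
  also have "\<dots> = (\<Sum>j\<in>UNIV. \<Sum>k\<in>UNIV. \<Sum>p\<in>UNIV. V c q $ p * (ginv g c j k q * pd c p (hess c j k) q))
     + (\<Sum>j\<in>UNIV. \<Sum>k\<in>UNIV. \<Sum>p\<in>UNIV. \<Sum>l\<in>UNIV. ginv g c j k q * ginv g c p l q * hess c p k q * hess c j l q)
     - (\<Sum>j\<in>UNIV. \<Sum>k\<in>UNIV. \<Sum>p\<in>UNIV. \<Sum>a\<in>UNIV. ginv g c j k q * hess c p k q * christoffel c j a p q * V c q $ a)"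
    unfolding pd_V[OF q] hcomm[of _ _]
    by (simp add: sum.distrib sum_subtractf distrib_left right_diff_distrib sum_distrib_left ac_simps)
  also have "(\<Sum>j\<in>UNIV. \<Sum>k\<in>UNIV. \<Sum>p\<in>UNIV. \<Sum>l\<in>UNIV. ginv g c j k q * ginv g c p l q * hess c p k q * hess c j l q) = hess_norm2 q"
  proof -
    have "hess_norm2 q = (\<Sum>j\<in>UNIV. \<Sum>l\<in>UNIV. \<Sum>k\<in>UNIV. \<Sum>p\<in>UNIV. ginv g c j k q * ginv g c p l q * hess c j l q * hess c p k q)"
      unfolding hess_norm2_def by (simp add: hess_hermitian[OF q])
    also have "\<dots> = (\<Sum>j\<in>UNIV. \<Sum>k\<in>UNIV. \<Sum>l\<in>UNIV. \<Sum>p\<in>UNIV. ginv g c j k q * ginv g c p l q * hess c j l q * hess c p k q)"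
      by (intro sum.cong refl sum.swap)
    also have "\<dots> = (\<Sum>j\<in>UNIV. \<Sum>k\<in>UNIV. \<Sum>p\<in>UNIV. \<Sum>l\<in>UNIV. ginv g c j k q * ginv g c p l q * hess c j l q * hess c p k q)"
      by (intro sum.cong refl sum.swap)
    finally show ?thesis by (simp add: ac_simps)
  qed
  also have "(\<Sum>j\<in>UNIV. \<Sum>k\<in>UNIV. \<Sum>p\<in>UNIV. \<Sum>a\<in>UNIV. ginv g c j k q * hess c p k q * christoffel c j a p q * V c q $ a) =
     - (\<Sum>j\<in>UNIV. \<Sum>k\<in>UNIV. \<Sum>p\<in>UNIV. V c q $ p * (pd c p (ginv g c j k) q * hess c j k q))"
  proof -
    have "- (\<Sum>j\<in>UNIV. \<Sum>k\<in>UNIV. \<Sum>p\<in>UNIV. V c q $ p * (pd c p (ginv g c j k) q * hess c j k q)) =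
      (\<Sum>j\<in>UNIV. \<Sum>k\<in>UNIV. \<Sum>p\<in>UNIV. \<Sum>a\<in>UNIV. ginv g c a k q * hess c j k q * christoffel c a p j q * V c q $ p)"
      unfolding pdK christoffel_symmetric[OF q]
      by (simp add: sum_negf sum_distrib_left sum_distrib_right ac_simps christoffel_symmetric[OF q])
    also have "\<dots> = (\<Sum>j\<in>UNIV. \<Sum>k\<in>UNIV. \<Sum>a\<in>UNIV. \<Sum>p\<in>UNIV. ginv g c a k q * hess c j k q * christoffel c a p j q * V c q $ p)"
      by (intro sum.cong refl sum.swap)
    also have "\<dots> = (\<Sum>k\<in>UNIV. \<Sum>j\<in>UNIV. \<Sum>a\<in>UNIV. \<Sum>p\<in>UNIV. ginv g c a k q * hess c j k q * christoffel c a p j q * V c q $ p)"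
      by (rule sum.swap)
    also have "\<dots> = (\<Sum>k\<in>UNIV. \<Sum>a\<in>UNIV. \<Sum>j\<in>UNIV. \<Sum>p\<in>UNIV. ginv g c a k q * hess c j k q * christoffel c a p j q * V c q $ p)"
      by (intro sum.cong refl sum.swap)
    also have "\<dots> = (\<Sum>a\<in>UNIV. \<Sum>k\<in>UNIV. \<Sum>j\<in>UNIV. \<Sum>p\<in>UNIV. ginv g c a k q * hess c j k q * christoffel c a p j q * V c q $ p)"
      by (rule sum.swap)
    finally show ?thesis by simp
  qed
  also have "(\<Sum>j\<in>UNIV. \<Sum>k\<in>UNIV. \<Sum>p\<in>UNIV. V c q $ p * (ginv g c j k q * pd c p (hess c j k) q)) + hess_norm2 q -
     - (\<Sum>j\<in>UNIV. \<Sum>k\<in>UNIV. \<Sum>p\<in>UNIV. V c q $ p * (pd c p (ginv g c j k) q * hess c j k q)) =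
     (\<Sum>j\<in>UNIV. \<Sum>k\<in>UNIV. \<Sum>p\<in>UNIV. V c q $ p * (pd c p (ginv g c j k) q * hess c j k q + ginv g c j k q * pd c p (hess c j k) q)) + hess_norm2 q"
    by (simp add: sum.distrib distrib_left)
  also have "(\<Sum>j\<in>UNIV. \<Sum>k\<in>UNIV. \<Sum>p\<in>UNIV. V c q $ p * (pd c p (ginv g c j k) q * hess c j k q + ginv g c j k q * pd c p (hess c j k) q)) =
     (\<Sum>p\<in>UNIV. V c q $ p * pd c p lap q)"
  proof -
    have "pd c p lap q = (\<Sum>j\<in>UNIV. \<Sum>k\<in>UNIV. pd c p (ginv g c j k) q * hess c j k q + ginv g c j k q * pd c p (hess c j k) q)" for p
      unfolding lap_def[abs_def]
      by (subst pd_sum[OF region_chart[OF c] _ q], intro smooth_in_sum smooth_in_mult K smooth_hess region_chart c,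
          intro sum.cong refl, subst pd_sum[OF region_chart[OF c] _ q], intro smooth_in_mult K smooth_hess,
          intro sum.cong refl pd_mult[OF K smooth_hess q])
    then have "(\<Sum>p\<in>UNIV. V c q $ p * pd c p lap q) = (\<Sum>p\<in>UNIV. \<Sum>j\<in>UNIV. \<Sum>k\<in>UNIV.
       V c q $ p * (pd c p (ginv g c j k) q * hess c j k q + ginv g c j k q * pd c p (hess c j k) q))"
      by (simp add: sum_distrib_left)
    also have "\<dots> = (\<Sum>j\<in>UNIV. \<Sum>p\<in>UNIV. \<Sum>k\<in>UNIV.
       V c q $ p * (pd c p (ginv g c j k) q * hess c j k q + ginv g c j k q * pd c p (hess c j k) q))"
      by (rule sum.swap)
    also have "\<dots> = (\<Sum>j\<in>UNIV. \<Sum>k\<in>UNIV. \<Sum>p\<in>UNIV.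
       V c q $ p * (pd c p (ginv g c j k) q * hess c j k q + ginv g c j k q * pd c p (hess c j k) q))"
      by (intro sum.cong refl sum.swap)
    finally show ?thesis by simp
  qed
  finally show ?thesis .
qed

end
end

section \<open>Positive semidefinite Hermitian forms\<close>

definition psd_form :: "('n::finite \<Rightarrow> 'n \<Rightarrow> complex) \<Rightarrow> bool" where
  "psd_form K \<longleftrightarrow> (\<forall>i j. cnj (K i j) = K j i) \<and>
     (\<forall>x. 0 \<le> Re (\<Sum>i\<in>UNIV. \<Sum>j\<in>UNIV. K i j * x i * cnj (x j)))"

lemma psd_form_nonneg: "psd_form K \<Longrightarrow> 0 \<le> Re (\<Sum>i\<in>UNIV. \<Sum>j\<in>UNIV. K i j * x i * cnj (x j))"
  by (simp add: psd_form_def)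

text \<open>Completing the square in the single coordinate \<open>s\<close>.\<close>

lemma psd_form_translate:
  fixes K :: "'n::finite \<Rightarrow> 'n \<Rightarrow> complex"
  assumes herm: "\<And>i j. cnj (K i j) = K j i"
  defines "Q \<equiv> \<lambda>x. \<Sum>i\<in>UNIV. \<Sum>j\<in>UNIV. K i j * x i * cnj (x j)"
  shows "Q (\<lambda>i. x i - (if i = s then \<alpha> else 0)) =
    Q x - \<alpha> * cnj (\<Sum>i\<in>UNIV. K i s * x i) - cnj \<alpha> * (\<Sum>i\<in>UNIV. K i s * x i) + \<alpha> * cnj \<alpha> * K s s"
proof -
  have "Q (\<lambda>i. x i - (if i = s then \<alpha> else 0)) =
     (\<Sum>i\<in>UNIV. \<Sum>j\<in>UNIV. K i j * x i * cnj (x j) - (if j = s then cnj \<alpha> * (K i s * x i) else 0)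
       - (if i = s then \<alpha> * (K s j * cnj (x j)) else 0) + (if i = s then if j = s then \<alpha> * cnj \<alpha> * K s s else 0 else 0))"
    unfolding Q_def by (intro sum.cong refl) (auto simp: algebra_simps)
  also have "\<dots> = Q x - cnj \<alpha> * (\<Sum>i\<in>UNIV. K i s * x i) - \<alpha> * (\<Sum>j\<in>UNIV. K s j * cnj (x j)) + \<alpha> * cnj \<alpha> * K s s"
  proof -
    have 1: "(\<Sum>i\<in>UNIV. \<Sum>j\<in>UNIV. if i = s then h j else 0) = (\<Sum>j\<in>UNIV. h j)" for h :: "'n \<Rightarrow> complex"
      by (subst sum.swap) simp
    show ?thesis unfolding Q_def by (simp add: sum.distrib sum_subtractf 1 sum_distrib_left)
  qed
  also have "(\<Sum>j\<in>UNIV. K s j * cnj (x j)) = cnj (\<Sum>i\<in>UNIV. K i s * x i)"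
    by (simp add: herm)
  finally show ?thesis by simp
qed

lemma psd_form_diagonal:
  assumes "psd_form K"
  shows "0 \<le> Re (K s s)" "Im (K s s) = 0"
proof -
  have "(\<Sum>i\<in>UNIV. \<Sum>j\<in>UNIV. K i j * (if i = s then 1 else 0) * cnj (if j = s then 1 else 0)) =
      (\<Sum>i\<in>UNIV. if i = s then \<Sum>j\<in>UNIV. if j = s then K s s else 0 else 0)"
    by (intro sum.cong refl) (auto simp: if_distrib[of cnj] mult_delta_right cong: if_cong)
  also have "\<dots> = K s s" by simp
  finally have "(\<Sum>i\<in>UNIV. \<Sum>j\<in>UNIV. K i j * (if i = s then 1 else 0) * cnj (if j = s then 1 else 0)) = K s s" .
  moreover have "0 \<le> Re (\<Sum>i\<in>UNIV. \<Sum>j\<in>UNIV. K i j * (if i = s then 1 else 0) * cnj (if j = s then 1 else 0))"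
    by (rule psd_form_nonneg[OF assms])
  ultimately show "0 \<le> Re (K s s)" by simp
  have "cnj (K s s) = K s s" using assms by (simp add: psd_form_def)
  then show "Im (K s s) = 0" by (simp add: complex_eq_iff)
qed

text \<open>Otherwise moving far enough in the direction \<open>s\<close> would make the form negative: it is affine in that direction.\<close>

lemma psd_form_zero_diagonal:
  fixes K :: "'n::finite \<Rightarrow> 'n \<Rightarrow> complex"
  assumes psd: "psd_form K" and s: "K s s = 0"
  shows "K j s = 0"
proof (rule ccontr)
  assume ne: "K j s \<noteq> 0"
  have herm: "\<And>i j. cnj (K i j) = K j i" using psd by (simp add: psd_form_def)
  let ?x = "\<lambda>i. if i = j then 1 else 0 :: complex"
  let ?Q = "\<lambda>x. \<Sum>i\<in>UNIV. \<Sum>j\<in>UNIV. K i j * x i * cnj (x j)"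
  \<comment> \<open>Chosen such that the form takes the value \<open>-1\<close>.\<close>
  define r where "r = (Re (?Q ?x) + 1) / (2 * (cmod (K j s))\<^sup>2)"
  let ?a = "of_real r * K j s"
  have x: "(\<Sum>i\<in>UNIV. K i s * ?x i) = K j s" by (simp add: mult_delta_right)
  have "0 \<le> Re (?Q (\<lambda>i. ?x i - (if i = s then ?a else 0)))"
    by (rule psd_form_nonneg[OF psd])
  also have "?Q (\<lambda>i. ?x i - (if i = s then ?a else 0)) = ?Q ?x - of_real (2 * r * (cmod (K j s))\<^sup>2)"
    unfolding psd_form_translate[OF herm] x s
    by (simp add: complex_norm_square[symmetric] ac_simps del: of_real_power)
  finally have "0 \<le> Re (?Q ?x) - 2 * r * (cmod (K j s))\<^sup>2" by simp
  also have "2 * r * (cmod (K j s))\<^sup>2 = Re (?Q ?x) + 1" using ne by (simp add: r_def)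
  finally show False by simp
qed

text \<open>Lagrange's reduction: splitting off the square that belongs to one coordinate leaves a semidefinite form in the remaining ones. This
is how the nonnegativity of \<open>|\<partial>\<bar>\<partial> f|\<^sup>2\<close>, which involves two copies of the inverse metric, is reduced to that of one copy.\<close>

lemma psd_form_sum_of_squares:
  fixes K :: "'n::finite \<Rightarrow> 'n \<Rightarrow> complex"
  assumes "psd_form K"
  shows "\<exists>as :: ('n \<Rightarrow> complex) list. \<forall>i j. K i j = (\<Sum>a\<leftarrow>as. a i * cnj (a j))"
proof -
  have "\<exists>as :: ('n \<Rightarrow> complex) list. \<forall>i j. K i j = (\<Sum>a\<leftarrow>as. a i * cnj (a j))"
    if "finite S" "psd_form K" "\<And>i j. i \<notin> S \<or> j \<notin> S \<Longrightarrow> K i j = 0" for S and K :: "'n \<Rightarrow> 'n \<Rightarrow> complex"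
    using that
  proof (induction S arbitrary: K rule: finite_induct)
    case empty
    then show ?case by (intro exI[of _ "[]"]) simp
  next
    case (insert s S)
    have herm: "\<And>i j. cnj (K i j) = K j i" using insert.prems by (simp add: psd_form_def)
    define d where "d = Re (K s s)"
    have Kd: "K s s = of_real d" "0 \<le> d"
      using psd_form_diagonal[OF insert.prems(1), of s] by (simp_all add: d_def complex_eq_iff)
    define L where "L i j = K i j - K i s * K s j / of_real d" for i j
    have hL: "cnj (L i j) = L j i" for i j by (simp add: L_def herm mult.commute)
    have "0 \<le> Re (\<Sum>i\<in>UNIV. \<Sum>j\<in>UNIV. L i j * x i * cnj (x j))" for x
    proof -
      let ?b = "\<Sum>i\<in>UNIV. K i s * x i"
      have Lx: "(\<Sum>i\<in>UNIV. \<Sum>j\<in>UNIV. L i j * x i * cnj (x j)) =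
          (\<Sum>i\<in>UNIV. \<Sum>j\<in>UNIV. K i j * x i * cnj (x j)) - ?b * cnj ?b / of_real d"
        unfolding L_def
        by (simp add: left_diff_distrib right_diff_distrib sum_subtractf sum_product herm sum_divide_distrib ac_simps)
      show ?thesis
      proof (cases "d = 0")
        case True
        have "0 \<le> Re (\<Sum>i\<in>UNIV. \<Sum>j\<in>UNIV. K i j * x i * cnj (x j))"
          by (rule psd_form_nonneg[OF insert.prems(1)])
        then show ?thesis unfolding Lx using True by simp
      next
        case False
        \<comment> \<open>The minimiser of the form in the coordinate \<open>s\<close>.\<close>
    let ?a = "?b / of_real d"
        have "0 \<le> Re (\<Sum>i\<in>UNIV. \<Sum>j\<in>UNIV. K i j * (x i - (if i = s then ?a else 0)) * cnj (x j - (if j = s then ?a else 0)))"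
          by (rule psd_form_nonneg[OF insert.prems(1)])
        also have "(\<Sum>i\<in>UNIV. \<Sum>j\<in>UNIV. K i j * (x i - (if i = s then ?a else 0)) * cnj (x j - (if j = s then ?a else 0))) =
            (\<Sum>i\<in>UNIV. \<Sum>j\<in>UNIV. K i j * x i * cnj (x j)) - ?a * cnj ?b - cnj ?a * ?b + ?a * cnj ?a * of_real d"
          unfolding psd_form_translate[OF herm] Kd(1) ..
        also have "\<dots> = (\<Sum>i\<in>UNIV. \<Sum>j\<in>UNIV. L i j * x i * cnj (x j))"
          unfolding Lx using False by (simp add: ac_simps)
        finally show ?thesis .
      qed
    qed
    then have psdL: "psd_form L" unfolding psd_form_def using hL by blast
    have zero: "K i s = 0" if "d = 0" for i
      by (rule psd_form_zero_diagonal[OF insert.prems(1)]) (simp add: Kd that)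
    have "L i j = 0" if "i \<notin> S \<or> j \<notin> S" for i j
    proof (cases "i = s \<or> j = s")
      case True
      show ?thesis
      proof (cases "d = 0")
        case True
        then have "K i s = 0" "K j s = 0" "K s j = 0" "K i j = 0" if "i = s \<or> j = s"
          using zero[of i] zero[of j] herm[of j s] herm[of j i] that by auto
        then show ?thesis using \<open>i = s \<or> j = s\<close> by (auto simp: L_def)
      next
        case False
        then show ?thesis using \<open>i = s \<or> j = s\<close> by (auto simp: L_def Kd)
      qed
    next
      case False
      then have "K i j = 0" "K i s * K s j = 0" using that insert.prems(2) by auto
      then show ?thesis by (simp add: L_def)
    qed
    from insert.IH[OF psdL this] obtain as where as: "\<And>i j. L i j = (\<Sum>a\<leftarrow>as. a i * cnj (a j))" by blast
    have "K i j = (\<Sum>a\<leftarrow>(\<lambda>i. K i s / of_real (sqrt d)) # as. a i * cnj (a j))" for i j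
    proof -
      have "complex_of_real (sqrt d) * of_real (sqrt d) = of_real d"
        using Kd(2) by (simp flip: of_real_mult)
      then have "K i s / of_real (sqrt d) * cnj (K j s / of_real (sqrt d)) = K i s * K s j / of_real d"
        by (simp add: herm)
      then show ?thesis using as[of i j] unfolding L_def by (simp only: list.map sum_list.Cons) (simp add: algebra_simps)
    qed
    then show ?case by blast
  qed
  from this[of UNIV K] assms show ?thesis by simp
qed

section \<open>Change of chart\<close>

context compact_manifold
begin

lemma smooth_in_coordinate:
  assumes "c \<in> A" "d \<in> A"
  shows "smooth_in c (fst c \<inter> fst d) (\<lambda>q. snd d q $ k)"
  unfolding smooth_in_def
  using region_overlap[OF assms] several_holomorphic_imp_smooth_on[OF transition_component_holomorphic[OF assms] open_overlap[OF assms]]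
  by blast

lemma jac_self:
  assumes c: "c \<in> A" and p: "p \<in> fst c"
  shows "jac c c i l p = (if i = l then 1 else 0)"
proof -
  have x: "snd c p \<in> snd c ` fst c" using p by blast
  have d: "((\<lambda>x::complex^'n. x $ l) has_derivative (\<lambda>v. \<Sum>i\<in>UNIV. (if i = l then 1 else 0) * v $ i + 0 * cnj (v $ i))) (at (snd c p))"
    by (simp add: mult_delta_left bounded_linear_imp_has_derivative[OF bounded_linear_vec_nth])
  have "wirt i (\<lambda>x. x $ l) (snd c p) = wirt i (\<lambda>x. snd c (chart_inv c x) $ l) (snd c p)"
    by (rule wirt_cong_open[OF open_chart_image[OF c] x]) (use d in \<open>auto simp: chart_chart_inv differentiable_def\<close>)
  then show ?thesis using wirtinger_unique(1)[OF d, of i] by (simp add: jac_def pd_def o_def)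
qed

lemma jac_inverse:
  assumes c: "c \<in> A" and d: "d \<in> A" and p: "p \<in> fst c" "p \<in> fst d"
  shows "(\<Sum>k\<in>UNIV. jac c d i k p * jac d c k l p) = (if i = l then 1 else 0)"
proof -
  have "jac c c i l p = (\<Sum>k\<in>UNIV. jac c d i k p * pd d k (\<lambda>q. snd c q $ l) p)"
    unfolding jac_def[of c c] by (rule pd_change[OF c smooth_in_coordinate[OF d c]]) (use p in auto)
  then show ?thesis unfolding jac_self[OF c p(1)] jac_def[of d c] by (rule sym)
qed

definition covector :: "('a, 'n) field10 \<Rightarrow> bool" where
  "covector \<eta> \<longleftrightarrow> (\<forall>c\<in>A. \<forall>d\<in>A. \<forall>p\<in>fst c \<inter> fst d. \<forall>i. \<eta> c p $ i = (\<Sum>k\<in>UNIV. jac c d i k p * \<eta> d p $ k))"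

lemma covectorD:
  "covector \<eta> \<Longrightarrow> c \<in> A \<Longrightarrow> d \<in> A \<Longrightarrow> p \<in> fst c \<Longrightarrow> p \<in> fst d \<Longrightarrow>
    \<eta> c p $ i = (\<Sum>k\<in>UNIV. jac c d i k p * \<eta> d p $ k)"
  unfolding covector_def by blast

end

context hermitian_manifold
begin

lemma cov_inner_eq_dual: "cov_inner g c p (\<eta> c p) (\<xi> c p) = (\<Sum>i\<in>UNIV. \<eta> c p $ i * dual_vec g \<xi> c p $ i)"
  by (simp add: cov_inner_def dual_vec_def sum_distrib_left ac_simps)

lemma cov_inner_cnj:
  assumes "c \<in> A" "p \<in> fst c"
  shows "cnj (cov_inner g c p s t) = cov_inner g c p t s"
proof -
  have "cnj (cov_inner g c p s t) = (\<Sum>i\<in>UNIV. \<Sum>j\<in>UNIV. ginv g c j i p * cnj (s $ i) * t $ j)"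
    unfolding cov_inner_def by (simp add: ginv_hermitian[OF assms])
  also have "\<dots> = (\<Sum>j\<in>UNIV. \<Sum>i\<in>UNIV. ginv g c j i p * cnj (s $ i) * t $ j)"
    by (rule sum.swap)
  finally show ?thesis unfolding cov_inner_def by (simp add: ac_simps)
qed

lemma lower_dual:
  assumes c: "c \<in> A" and p: "p \<in> fst c"
  shows "(\<Sum>i\<in>UNIV. dual_vec g \<eta> c p $ i * g c p $ i $ l) = cnj (\<eta> c p $ l)"
proof -
  have "(\<Sum>i\<in>UNIV. dual_vec g \<eta> c p $ i * g c p $ i $ l) = (\<Sum>k\<in>UNIV. (\<Sum>i\<in>UNIV. ginv g c i k p * g c p $ i $ l) * cnj (\<eta> c p $ k))"
    unfolding dual_vec_def vec_lambda_beta sum_distrib_right by (subst sum.swap) (simp add: ac_simps)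
  then show ?thesis unfolding ginv_metric2[OF c p] by (simp add: mult_delta_left)
qed

lemma norm_dual_vec:
  assumes c: "c \<in> A" and p: "p \<in> fst c"
  shows "(\<Sum>i\<in>UNIV. \<Sum>j\<in>UNIV. g c p $ i $ j * dual_vec g \<eta> c p $ i * cnj (dual_vec g \<eta> c p $ j)) =
    cov_inner g c p (\<eta> c p) (\<eta> c p)"
proof -
  let ?v = "dual_vec g \<eta> c p"
  have "(\<Sum>i\<in>UNIV. \<Sum>j\<in>UNIV. g c p $ i $ j * ?v $ i * cnj (?v $ j)) = (\<Sum>j\<in>UNIV. (\<Sum>i\<in>UNIV. ?v $ i * g c p $ i $ j) * cnj (?v $ j))"
    unfolding sum_distrib_right by (subst sum.swap) (simp add: ac_simps)
  also have "\<dots> = cnj (cov_inner g c p (\<eta> c p) (\<eta> c p))"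
    unfolding lower_dual[OF c p] cov_inner_eq_dual[of c p \<eta> \<eta>] by simp
  finally show ?thesis unfolding cov_inner_cnj[OF c p] .
qed

lemma cov_inner_nonneg:
  assumes c: "c \<in> A" and p: "p \<in> fst c"
  shows "0 \<le> Re (cov_inner g c p s s)"
proof -
  have "0 \<le> Re (\<Sum>i\<in>UNIV. \<Sum>j\<in>UNIV. g c p $ i $ j * v $ i * cnj (v $ j))" for v
  proof (cases "v = 0")
    case False
    then show ?thesis using metric_posdef[OF c p] unfolding hermitian_posdef_def by (meson less_imp_le)
  qed simp
  from this[of "dual_vec g (\<lambda>c p. s) c p"] show ?thesis unfolding norm_dual_vec[OF c p] .
qed

text \<open>Both sides have the same image under the metric in the chart \<open>d\<close>, once the transition matrices are cancelled; raising the index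
again proves them equal.\<close>

lemma dual_vec_change:
  assumes \<eta>: "covector \<eta>" and c: "c \<in> A" and d: "d \<in> A" and p: "p \<in> fst c" "p \<in> fst d"
  shows "dual_vec g \<eta> d p $ k = (\<Sum>i\<in>UNIV. dual_vec g \<eta> c p $ i * jac c d i k p)"
proof -
  let ?X = "dual_vec g \<eta> c p"
  define Y where "Y a = (\<Sum>j\<in>UNIV. ?X $ j * jac c d j a p)" for a
  define Z where "Z b = (\<Sum>a\<in>UNIV. Y a * g d p $ a $ b)" for b
  have 1: "(\<Sum>b\<in>UNIV. cnj (jac c d l b p) * Z b) = (\<Sum>b\<in>UNIV. cnj (jac c d l b p) * cnj (\<eta> d p $ b))" for l
  proof -
    have "(\<Sum>b\<in>UNIV. cnj (jac c d l b p) * Z b) = (\<Sum>b\<in>UNIV. \<Sum>a\<in>UNIV. \<Sum>j\<in>UNIV. ?X $ j * (jac c d j a p * cnj (jac c d l b p) * g d p $ a $ b))"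
      unfolding Z_def Y_def by (simp add: sum_distrib_left sum_distrib_right ac_simps)
    also have "\<dots> = (\<Sum>a\<in>UNIV. \<Sum>b\<in>UNIV. \<Sum>j\<in>UNIV. ?X $ j * (jac c d j a p * cnj (jac c d l b p) * g d p $ a $ b))"
      by (rule sum.swap)
    also have "\<dots> = (\<Sum>a\<in>UNIV. \<Sum>j\<in>UNIV. \<Sum>b\<in>UNIV. ?X $ j * (jac c d j a p * cnj (jac c d l b p) * g d p $ a $ b))"
      by (intro sum.cong refl sum.swap)
    also have "\<dots> = (\<Sum>j\<in>UNIV. \<Sum>a\<in>UNIV. \<Sum>b\<in>UNIV. ?X $ j * (jac c d j a p * cnj (jac c d l b p) * g d p $ a $ b))"
      by (rule sum.swap)
    also have "\<dots> = (\<Sum>j\<in>UNIV. ?X $ j * g c p $ j $ l)"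
      unfolding metric_change[OF c d p] by (simp add: sum_distrib_left)
    also have "\<dots> = cnj (\<eta> c p $ l)" by (rule lower_dual[OF c p(1)])
    also have "\<dots> = (\<Sum>b\<in>UNIV. cnj (jac c d l b p) * cnj (\<eta> d p $ b))"
      unfolding covectorD[OF \<eta> c d p] by simp
    finally show ?thesis .
  qed
  have cancel: "(\<Sum>l\<in>UNIV. cnj (jac d c m l p) * (\<Sum>b\<in>UNIV. cnj (jac c d l b p) * z b)) = z m" for m z
  proof -
    have "(\<Sum>l\<in>UNIV. cnj (jac d c m l p) * (\<Sum>b\<in>UNIV. cnj (jac c d l b p) * z b)) =
      (\<Sum>b\<in>UNIV. cnj (\<Sum>l\<in>UNIV. jac d c m l p * jac c d l b p) * z b)"
      unfolding sum_distrib_left by (subst sum.swap) (simp add: sum_distrib_left sum_distrib_right ac_simps)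
    also have "\<dots> = (\<Sum>b\<in>UNIV. if b = m then z m else 0)"
      unfolding jac_inverse[OF d c p(2,1)] by (intro sum.cong) auto
    finally show ?thesis by simp
  qed
  have Zm: "Z m = cnj (\<eta> d p $ m)" for m
  proof -
    have "Z m = (\<Sum>l\<in>UNIV. cnj (jac d c m l p) * (\<Sum>b\<in>UNIV. cnj (jac c d l b p) * Z b))" by (rule cancel[symmetric])
    also have "\<dots> = cnj (\<eta> d p $ m)" unfolding 1 by (rule cancel)
    finally show ?thesis .
  qed
  have "dual_vec g \<eta> d p $ k = (\<Sum>b\<in>UNIV. ginv g d k b p * Z b)"
    by (simp add: dual_vec_def Zm)
  also have "\<dots> = (\<Sum>a\<in>UNIV. Y a * (\<Sum>b\<in>UNIV. ginv g d k b p * g d p $ a $ b))"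
    unfolding Z_def sum_distrib_left by (subst sum.swap) (simp add: ac_simps)
  also have "\<dots> = Y k" unfolding ginv_metric1[OF d p(2)] by (simp add: mult_delta_right)
  finally show ?thesis unfolding Y_def .
qed

lemma vector_field_dual:
  assumes "covector \<eta>" "\<And>c i. c \<in> A \<Longrightarrow> smooth_in c (fst c) (\<lambda>q. \<eta> c q $ i)"
  shows "vector_field (dual_vec g \<eta>)"
  unfolding vector_field_def
proof (intro conjI ballI allI)
  show "smooth_in c (fst c) (\<lambda>q. dual_vec g \<eta> c q $ i)" if "c \<in> A" for c i
    unfolding dual_vec_def vec_lambda_beta
    by (intro smooth_in_sum smooth_in_mult smooth_in_ginv smooth_in_cnj assms(2) region_chart that)
qed (use dual_vec_change[OF assms(1)] in auto)

lemma cov_inner_change: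
  assumes \<eta>: "covector \<eta>" and \<xi>: "covector \<xi>" and c: "c \<in> A" and d: "d \<in> A" and p: "p \<in> fst c" "p \<in> fst d"
  shows "cov_inner g c p (\<eta> c p) (\<xi> c p) = cov_inner g d p (\<eta> d p) (\<xi> d p)"
proof -
  have "cov_inner g c p (\<eta> c p) (\<xi> c p) = (\<Sum>i\<in>UNIV. \<Sum>k\<in>UNIV. jac c d i k p * \<eta> d p $ k * dual_vec g \<xi> c p $ i)"
    unfolding cov_inner_eq_dual unfolding covectorD[OF \<eta> c d p] sum_distrib_right ..
  also have "\<dots> = (\<Sum>k\<in>UNIV. \<eta> d p $ k * (\<Sum>i\<in>UNIV. dual_vec g \<xi> c p $ i * jac c d i k p))"
    unfolding sum_distrib_left by (subst sum.swap) (simp add: ac_simps)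
  also have "\<dots> = cov_inner g d p (\<eta> d p) (\<xi> d p)"
    unfolding cov_inner_eq_dual dual_vec_change[OF \<xi> c d p] ..
  finally show ?thesis .
qed

definition inner_scalar :: "('a, 'n) field10 \<Rightarrow> ('a, 'n) field10 \<Rightarrow> 'a \<Rightarrow> complex" where
  "inner_scalar \<eta> \<xi> = scalar A (\<lambda>c p. cov_inner g c p (\<eta> c p) (\<xi> c p))"

lemma inner_scalar_eq:
  "covector \<eta> \<Longrightarrow> covector \<xi> \<Longrightarrow> c \<in> A \<Longrightarrow> p \<in> fst c \<Longrightarrow> inner_scalar \<eta> \<xi> p = cov_inner g c p (\<eta> c p) (\<xi> c p)"
  unfolding inner_scalar_def by (rule scalar_eq) (rule cov_inner_change)

lemma smooth_inner_scalar:
  assumes \<eta>: "covector \<eta>" "\<And>c i. c \<in> A \<Longrightarrow> smooth_in c (fst c) (\<lambda>q. \<eta> c q $ i)"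
    and \<xi>: "covector \<xi>" "\<And>c i. c \<in> A \<Longrightarrow> smooth_in c (fst c) (\<lambda>q. \<xi> c q $ i)"
  shows "smooth_scalar (inner_scalar \<eta> \<xi>)"
proof (rule smooth_scalarI[of "\<lambda>c p. cov_inner g c p (\<eta> c p) (\<xi> c p)"])
  show "smooth_in c (fst c) (\<lambda>p. cov_inner g c p (\<eta> c p) (\<xi> c p))" if "c \<in> A" for c
    unfolding cov_inner_def
    by (intro smooth_in_sum smooth_in_mult smooth_in_ginv smooth_in_cnj \<eta>(2) \<xi>(2) region_chart that)
qed (rule inner_scalar_eq[OF \<eta>(1) \<xi>(1)])

lemma form_norm2_eq:
  "covector \<eta> \<Longrightarrow> c \<in> A \<Longrightarrow> p \<in> fst c \<Longrightarrow> complex_of_real (form_norm2 A g \<eta> p) = inner_scalar \<eta> \<eta> p"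
proof -
  assume \<eta>: "covector \<eta>" and c: "c \<in> A" "p \<in> fst c"
  have "form_norm2 A g \<eta> p = Re (cov_inner g c p (\<eta> c p) (\<eta> c p))"
    unfolding form_norm2_def by (rule scalar_eq[OF _ c]) (intro arg_cong[where f=Re] cov_inner_change[OF \<eta> \<eta>])
  moreover have "cnj (cov_inner g c p (\<eta> c p) (\<eta> c p)) = cov_inner g c p (\<eta> c p) (\<eta> c p)"
    by (rule cov_inner_cnj[OF c])
  ultimately show ?thesis using inner_scalar_eq[OF \<eta> \<eta> c] by (simp add: complex_eq_iff)
qed

lemma form_norm2_nonneg: "covector \<eta> \<Longrightarrow> p \<in> topspace M \<Longrightarrow> 0 \<le> form_norm2 A g \<eta> p"
proof -
  assume \<eta>: "covector \<eta>" and "p \<in> topspace M"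
  then obtain c where c: "c \<in> A" "p \<in> fst c" using Union_charts by blast
  have "form_norm2 A g \<eta> p = Re (cov_inner g c p (\<eta> c p) (\<eta> c p))"
    unfolding form_norm2_def by (rule scalar_eq[OF _ c]) (intro arg_cong[where f=Re] cov_inner_change[OF \<eta> \<eta>])
  then show ?thesis using cov_inner_nonneg[OF c] by simp
qed

definition scaled :: "('a \<Rightarrow> complex) \<Rightarrow> ('a, 'n) field10 \<Rightarrow> ('a, 'n) field10" where
  "scaled a X c p = (\<chi> i. a p * X c p $ i)"

lemma vector_fieldD:
  assumes "vector_field X"
  shows vector_field_smooth: "c \<in> A \<Longrightarrow> smooth_in c (fst c) (\<lambda>q. X c q $ i)"
    and vector_field_change: "c \<in> A \<Longrightarrow> d \<in> A \<Longrightarrow> p \<in> fst c \<Longrightarrow> p \<in> fst d \<Longrightarrow>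
      X d p $ k = (\<Sum>i\<in>UNIV. X c p $ i * jac c d i k p)"
  using assms unfolding vector_field_def by blast+

lemma vector_field_scaled:
  assumes a: "smooth_scalar a" and X: "vector_field X"
  shows "vector_field (scaled a X)"
  unfolding vector_field_def
proof (intro conjI ballI allI)
  show "smooth_in c (fst c) (\<lambda>q. scaled a X c q $ i)" if "c \<in> A" for c i
    unfolding scaled_def vec_lambda_beta using a that
    by (intro smooth_in_mult vector_field_smooth[OF X]) (simp_all add: smooth_scalar_def)
  show "scaled a X d p $ k = (\<Sum>i\<in>UNIV. scaled a X c p $ i * jac c d i k p)"
    if "c \<in> A" "d \<in> A" "p \<in> fst c \<inter> fst d" for c d p k
    using vector_field_change[OF X that(1,2), of p k] that(3) by (simp add: scaled_def sum_distrib_left mult.assoc)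
qed

lemma divergence_scaled:
  assumes a: "smooth_scalar a" and X: "vector_field X" and c: "c \<in> A" "p \<in> fst c"
  shows "divergence c (scaled a X) p = directional X a p + a p * divergence c X p"
proof -
  have sa: "smooth_in c (fst c) a" using a c by (simp add: smooth_scalar_def)
  have sX: "smooth_in c (fst c) (\<lambda>q. X c q $ i)" for i using X c by (simp add: vector_field_def)
  show ?thesis
    unfolding directional_eq[OF X a c] divergence_def scaled_def vec_lambda_beta pd_mult[OF sa sX c(2)]
    by (simp add: sum.distrib sum_distrib_left algebra_simps)
qed

lemma integral_divergence_scaled:
  assumes a: "smooth_scalar a" and X: "vector_field X"
    and h: "\<And>c p. c \<in> A \<Longrightarrow> p \<in> fst c \<Longrightarrow> h p = directional X a p + a p * divergence c X p"
  shows "integral_M M A g h = 0"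
  by (rule divergence_theorem[OF vector_field_scaled[OF a X]]) (simp add: divergence_scaled[OF a X] h)

end

section \<open>Global functions and the Bochner identity on the manifold\<close>

context compact_manifold
begin

lemma covectorI:
  assumes "\<And>c d p i. c \<in> A \<Longrightarrow> d \<in> A \<Longrightarrow> p \<in> fst c \<Longrightarrow> p \<in> fst d \<Longrightarrow>
    \<eta> c p $ i = (\<Sum>k\<in>UNIV. jac c d i k p * \<eta> d p $ k)"
  shows "covector \<eta>"
  unfolding covector_def
proof (intro ballI allI)
  fix c d p i
  assume "c \<in> A" "d \<in> A" "p \<in> fst c \<inter> fst d"
  then show "\<eta> c p $ i = (\<Sum>k\<in>UNIV. jac c d i k p * \<eta> d p $ k)"
    by (intro assms) simp_all
qed

lemma covector_del:
  assumes h: "\<And>c. c \<in> A \<Longrightarrow> smooth_in c (fst c) h"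
  shows "covector (del h)"
proof (rule covectorI)
  fix c d p i
  assume c: "c \<in> A" and d: "d \<in> A" and p: "p \<in> fst c" "p \<in> fst d"
  show "del h c p $ i = (\<Sum>k\<in>UNIV. jac c d i k p * del h d p $ k)"
    unfolding del_def vec_lambda_beta by (rule pd_change[OF c h[OF d] p])
qed

lemma covector_diff_scaled:
  assumes "covector \<eta>" "covector \<xi>"
  shows "covector (\<lambda>c p. \<eta> c p - a p *s \<xi> c p)"
proof (rule covectorI)
  fix c d p i
  assume cd: "c \<in> A" "d \<in> A" "p \<in> fst c" "p \<in> fst d"
  show "(\<eta> c p - a p *s \<xi> c p) $ i = (\<Sum>k\<in>UNIV. jac c d i k p * (\<eta> d p - a p *s \<xi> d p) $ k)"
    using covectorD[OF assms(1) cd, of i] covectorD[OF assms(2) cd, of i]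
    by (simp add: right_diff_distrib sum_subtractf sum_distrib_left mult.left_commute)
qed

definition jac_matrix :: "('a, 'n) chart \<Rightarrow> ('a, 'n) chart \<Rightarrow> 'a \<Rightarrow> complex^'n^'n" where
  "jac_matrix c d p = (\<chi> i k. jac c d i k p)"

definition jac_adjoint :: "('a, 'n) chart \<Rightarrow> ('a, 'n) chart \<Rightarrow> 'a \<Rightarrow> complex^'n^'n" where
  "jac_adjoint c d p = (\<chi> l j. cnj (jac c d j l p))"

lemma jac_congruence_nth:
  "(jac_matrix c d p ** X ** jac_adjoint c d p) $ i $ j =
    (\<Sum>k\<in>UNIV. \<Sum>l\<in>UNIV. jac c d i k p * cnj (jac c d j l p) * X $ k $ l)"
proof -
  have "(jac_matrix c d p ** X ** jac_adjoint c d p) $ i $ j =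
      (\<Sum>l\<in>UNIV. \<Sum>k\<in>UNIV. jac c d i k p * cnj (jac c d j l p) * X $ k $ l)"
    by (simp add: matrix_matrix_mult_def jac_matrix_def jac_adjoint_def sum_distrib_left sum_distrib_right ac_simps)
  then show ?thesis by (subst sum.swap)
qed

end

context hermitian_manifold
begin

lemma cov_inner_diff_scaled:
  assumes c: "c \<in> A" "p \<in> fst c"
  shows "cov_inner g c p (s - of_real a *s t) (s - of_real a *s t) =
    cov_inner g c p s s - of_real a * (cov_inner g c p s t + cnj (cov_inner g c p s t)) + of_real (a\<^sup>2) * cov_inner g c p t t"
proof -
  have "cov_inner g c p (s - of_real a *s t) (s - of_real a *s t) =
    cov_inner g c p s s - of_real a * (cov_inner g c p s t + cov_inner g c p t s) + of_real (a\<^sup>2) * cov_inner g c p t t"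
    unfolding cov_inner_def
    by (simp add: left_diff_distrib right_diff_distrib distrib_left sum.distrib sum_subtractf sum_distrib_left
        power2_eq_square ac_simps)
  then show ?thesis unfolding cov_inner_cnj[OF c, symmetric, of t s] .
qed

lemma form_norm2_cong:
  assumes "\<And>c. c \<in> A \<Longrightarrow> p \<in> fst c \<Longrightarrow> \<eta> c p = \<xi> c p"
  shows "form_norm2 A g \<eta> p = form_norm2 A g \<xi> p"
proof -
  have "(\<forall>c\<in>A. p \<in> fst c \<longrightarrow> Re (cov_inner g c p (\<eta> c p) (\<eta> c p)) = v) \<longleftrightarrow>
      (\<forall>c\<in>A. p \<in> fst c \<longrightarrow> Re (cov_inner g c p (\<xi> c p) (\<xi> c p)) = v)" for v
    by (intro ball_cong refl imp_cong) (simp add: assms)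
  then show ?thesis unfolding form_norm2_def scalar_def by simp
qed

text \<open>The Hermitian matrix \<open>H\<close> of a real (1,1)-form changes by the same congruence as the metric \<open>G\<close>, so that
  \<open>H G\<^sup>-\<^sup>1\<close> changes by conjugation: the traces of its powers are global functions.\<close>

lemma jac_adjoint_inverse_metric:
  assumes c: "c \<in> A" and d: "d \<in> A" and p: "p \<in> fst c" "p \<in> fst d"
  shows "jac_adjoint c d p ** matrix_inv (g c p) ** jac_matrix c d p = matrix_inv (g d p)"
proof -
  let ?J = "jac_matrix c d p" and ?K = "jac_adjoint c d p" and ?B = "matrix_inv (g c p)"
  have G: "g c p = ?J ** g d p ** ?K"
    by (simp add: vec_eq_iff jac_congruence_nth metric_change[OF c d p])
  have "?B ** ?J ** g d p ** ?K = mat 1"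
    using matrix_inv_left[OF metric_invertible[OF c p(1)]] by (subst (asm) (2) G) (simp add: matrix_mul_assoc)
  then have "?K ** (?B ** ?J ** g d p) = mat 1"
    using matrix_left_right_inverse by blast
  then have "(?K ** ?B ** ?J) ** g d p = mat 1" by (simp add: matrix_mul_assoc)
  then have "(?K ** ?B ** ?J) ** (g d p ** matrix_inv (g d p)) = matrix_inv (g d p)"
    by (simp add: matrix_mul_assoc)
  then show ?thesis
    by (simp add: matrix_inv_right[OF metric_invertible[OF d p(2)]])
qed

lemma trace_raised_change:
  assumes c: "c \<in> A" and d: "d \<in> A" and p: "p \<in> fst c" "p \<in> fst d"
    and H: "\<And>i j. H $ i $ j = (\<Sum>k\<in>UNIV. \<Sum>l\<in>UNIV. jac c d i k p * cnj (jac c d j l p) * H' $ k $ l)"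
  shows "trace (H ** matrix_inv (g c p)) = trace (H' ** matrix_inv (g d p))"
    and "trace (H ** matrix_inv (g c p) ** (H ** matrix_inv (g c p))) =
      trace (H' ** matrix_inv (g d p) ** (H' ** matrix_inv (g d p)))"
proof -
  let ?J = "jac_matrix c d p" and ?K = "jac_adjoint c d p" and ?B = "matrix_inv (g c p)"
  have B: "?K ** (?B ** ?J) = matrix_inv (g d p)"
    using jac_adjoint_inverse_metric[OF c d p] by (simp add: matrix_mul_assoc)
  have H': "H = ?J ** H' ** ?K"
    by (simp add: vec_eq_iff jac_congruence_nth H)
  have "trace (H ** ?B) = trace (?J ** (H' ** ?K ** ?B))" by (simp add: H' matrix_mul_assoc)
  also have "\<dots> = trace (H' ** ?K ** ?B ** ?J)" by (rule trace_mul_sym)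
  also have "\<dots> = trace (H' ** (?K ** (?B ** ?J)))" by (simp add: matrix_mul_assoc)
  finally show "trace (H ** ?B) = trace (H' ** matrix_inv (g d p))" unfolding B .
  have "trace (H ** ?B ** (H ** ?B)) = trace (?J ** (H' ** ?K ** ?B ** ?J ** H' ** ?K ** ?B))"
    by (simp add: H' matrix_mul_assoc)
  also have "\<dots> = trace (H' ** ?K ** ?B ** ?J ** H' ** ?K ** ?B ** ?J)" by (rule trace_mul_sym)
  also have "\<dots> = trace (H' ** (?K ** (?B ** ?J)) ** (H' ** (?K ** (?B ** ?J))))"
    by (simp add: matrix_mul_assoc)
  finally show "trace (H ** ?B ** (H ** ?B)) = trace (H' ** matrix_inv (g d p) ** (H' ** matrix_inv (g d p)))"
    unfolding B .
qed

end

context kaehler_function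
begin

lemma covector_phi: "covector \<phi>"
  unfolding \<phi>_def by (rule covector_del[OF smooth_fc])

text \<open>The Jacobian matrices are holomorphic, so the mixed second derivatives transform without a first-order term.\<close>

lemma hess_change:
  assumes c: "c \<in> A" and d: "d \<in> A" and p: "p \<in> fst c" "p \<in> fst d"
  shows "hess c i j p = (\<Sum>k\<in>UNIV. \<Sum>l\<in>UNIV. jac c d i k p * cnj (jac c d j l p) * hess d k l p)"
proof -
  let ?U = "fst c \<inter> fst d"
  have pU: "p \<in> ?U" using p by simp
  note r = region_overlap[OF c d]
  have sJ: "smooth_in c ?U (\<lambda>q. cnj (jac c d j l q))" for l by (rule smooth_in_cnj[OF smooth_in_jac[OF c d]])
  have sb: "smooth_in c ?U (pd_bar d l fc)" for l
    by (rule smooth_in_change[OF c smooth_in_pd_bar[OF smooth_fc[OF d]]])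
  have J0: "pd c i (\<lambda>q. cnj (jac c d j l q)) p = 0" for l
    using pd_cnj[OF smooth_in_jac[OF c d] smooth_in_jac[OF c d] pU] pd_bar_jac[OF c d pU] by simp
  have "hess c i j p = pd c i (\<lambda>q. \<Sum>l\<in>UNIV. cnj (jac c d j l q) * pd_bar d l fc q) p"
    unfolding hess_def
  proof (rule pd_cong)
    show "smooth_in c ?U (pd_bar c j fc)"
      by (rule smooth_in_subset[OF smooth_in_pd_bar[OF smooth_fc[OF c]] r Int_lower1])
    show "smooth_in c ?U (\<lambda>q. \<Sum>l\<in>UNIV. cnj (jac c d j l q) * pd_bar d l fc q)"
      by (intro smooth_in_sum smooth_in_mult sJ sb r)
    show "pd_bar c j fc q = (\<Sum>l\<in>UNIV. cnj (jac c d j l q) * pd_bar d l fc q)" if "q \<in> ?U" for q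
      using that by (intro pd_bar_change[OF c smooth_fc[OF d]]) simp_all
  qed (rule pU)
  also have "\<dots> = (\<Sum>l\<in>UNIV. cnj (jac c d j l p) * pd c i (pd_bar d l fc) p)"
    by (subst pd_sum[OF r _ pU], intro smooth_in_mult sJ sb, intro sum.cong refl,
        subst pd_mult[OF sJ sb pU]) (simp add: J0)
  also have "\<dots> = (\<Sum>l\<in>UNIV. cnj (jac c d j l p) * (\<Sum>k\<in>UNIV. jac c d i k p * hess d k l p))"
    unfolding hess_def pd_change[OF c smooth_in_pd_bar[OF smooth_fc[OF d]] p] ..
  also have "\<dots> = (\<Sum>l\<in>UNIV. \<Sum>k\<in>UNIV. jac c d i k p * cnj (jac c d j l p) * hess d k l p)"
    by (simp add: sum_distrib_left ac_simps)
  finally show ?thesis by (subst sum.swap)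
qed

lemma vector_field_V: "vector_field V"
  unfolding V_def by (rule vector_field_dual[OF covector_phi smooth_phi])

lemma covector_\<omega>2: "covector \<omega>2"
proof (rule covectorI)
  fix c d p j
  assume c: "c \<in> A" and d: "d \<in> A" and p: "p \<in> fst c" "p \<in> fst d"
  have "\<omega>2 c p $ j = (\<Sum>k\<in>UNIV. \<Sum>m\<in>UNIV. \<Sum>l\<in>UNIV.
      jac c d j m p * (hess d m l p * cnj (V c p $ k * jac c d k l p)))"
    unfolding \<omega>2_nth[OF c] hess_change[OF c d p] by (simp add: sum_distrib_left sum_distrib_right ac_simps)
  also have "\<dots> = (\<Sum>m\<in>UNIV. \<Sum>k\<in>UNIV. \<Sum>l\<in>UNIV.
      jac c d j m p * (hess d m l p * cnj (V c p $ k * jac c d k l p)))"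
    by (rule sum.swap)
  also have "\<dots> = (\<Sum>m\<in>UNIV. \<Sum>l\<in>UNIV. \<Sum>k\<in>UNIV.
      jac c d j m p * (hess d m l p * cnj (V c p $ k * jac c d k l p)))"
    by (intro sum.cong refl sum.swap)
  also have "\<dots> = (\<Sum>m\<in>UNIV. jac c d j m p * \<omega>2 d p $ m)"
    unfolding \<omega>2_nth[OF d] vector_field_change[OF vector_field_V c d p] by (simp add: sum_distrib_left)
  finally show "\<omega>2 c p $ j = (\<Sum>m\<in>UNIV. jac c d j m p * \<omega>2 d p $ m)" .
qed

lemma vector_field_W2: "vector_field W2"
  unfolding W2_def by (rule vector_field_dual[OF covector_\<omega>2 smooth_\<omega>2])

abbreviation phi_norm2 :: "'a \<Rightarrow> complex" where
  "phi_norm2 \<equiv> inner_scalar \<phi> \<phi>"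

lemma smooth_phi_norm2: "smooth_scalar phi_norm2"
  by (rule smooth_inner_scalar[OF covector_phi smooth_phi covector_phi smooth_phi])

lemma inner_scalar_phi:
  "covector \<eta> \<Longrightarrow> c \<in> A \<Longrightarrow> q \<in> fst c \<Longrightarrow> inner_scalar \<eta> \<phi> q = (\<Sum>i\<in>UNIV. \<eta> c q $ i * V c q $ i)"
  by (simp add: inner_scalar_eq[OF _ covector_phi] cov_inner_eq_dual V_def)

lemma smooth_scalarD: "smooth_scalar h \<Longrightarrow> c \<in> A \<Longrightarrow> smooth_in c (fst c) h"
  by (simp add: smooth_scalar_def)

lemma pd_phi_norm2:
  assumes c: "c \<in> A" and q: "q \<in> fst c"
  shows "pd c j phi_norm2 q = \<omega>1 c q $ j + \<omega>2 c q $ j"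
proof -
  have "pd c j phi_norm2 q = pd c j (\<lambda>q. \<Sum>i\<in>UNIV. \<phi> c q $ i * V c q $ i) q"
  proof (rule pd_cong[OF smooth_scalarD[OF smooth_phi_norm2 c] _ q])
    show "smooth_in c (fst c) (\<lambda>q. \<Sum>i\<in>UNIV. \<phi> c q $ i * V c q $ i)"
      by (intro smooth_in_sum smooth_in_mult smooth_phi smooth_V region_chart c)
  qed (rule inner_scalar_phi[OF covector_phi c])
  then show ?thesis unfolding pd_norm[OF c q] .
qed

text \<open>Direct verification would require the transformation of the Christoffel symbols. It is avoided by writing \<open>\<omega>1\<close> as the difference of
the covectors \<open>\<partial>|\<phi>|\<^sup>2\<close> and \<open>\<omega>2\<close>.\<close>

lemma covector_\<omega>1: "covector \<omega>1"
proof (rule covectorI)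
  fix c d p j
  assume c: "c \<in> A" and d: "d \<in> A" and p: "p \<in> fst c" "p \<in> fst d"
  have "pd c j phi_norm2 p = (\<Sum>k\<in>UNIV. jac c d j k p * pd d k phi_norm2 p)"
    by (rule pd_change[OF c smooth_scalarD[OF smooth_phi_norm2 d] p])
  then show "\<omega>1 c p $ j = (\<Sum>k\<in>UNIV. jac c d j k p * \<omega>1 d p $ k)"
    unfolding pd_phi_norm2[OF c p(1)] pd_phi_norm2[OF d p(2)]
    using covectorD[OF covector_\<omega>2 c d p, of j] by (simp add: distrib_left sum.distrib)
qed

lemma smooth_inner_\<omega>1: "smooth_scalar (inner_scalar \<omega>1 \<phi>)"
  and smooth_inner_\<omega>2: "smooth_scalar (inner_scalar \<omega>2 \<phi>)"
  and smooth_norm_\<omega>1: "smooth_scalar (inner_scalar \<omega>1 \<omega>1)"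
  by (intro smooth_inner_scalar covector_\<omega>1 covector_\<omega>2 covector_phi smooth_\<omega>1 smooth_\<omega>2 smooth_phi; assumption)+

lemma inner_\<omega>2_real:
  assumes c: "c \<in> A" and p: "p \<in> fst c"
  shows "cnj (inner_scalar \<omega>2 \<phi> p) = inner_scalar \<omega>2 \<phi> p"
proof -
  have e: "inner_scalar \<omega>2 \<phi> p = (\<Sum>j\<in>UNIV. \<Sum>k\<in>UNIV. hess c j k p * V c p $ j * cnj (V c p $ k))"
    unfolding inner_scalar_phi[OF covector_\<omega>2 c p] \<omega>2_nth[OF c] by (simp add: sum_distrib_left sum_distrib_right ac_simps)
  have "cnj (inner_scalar \<omega>2 \<phi> p) = (\<Sum>j\<in>UNIV. \<Sum>k\<in>UNIV. hess c k j p * V c p $ k * cnj (V c p $ j))"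
    unfolding e by (simp add: hess_hermitian[OF c p] ac_simps)
  also have "\<dots> = inner_scalar \<omega>2 \<phi> p" unfolding e by (rule sum.swap)
  finally show ?thesis .
qed

lemma directional_phi_norm2:
  assumes c: "c \<in> A" and p: "p \<in> fst c"
  shows "directional V phi_norm2 p = inner_scalar \<omega>1 \<phi> p + inner_scalar \<omega>2 \<phi> p"
  unfolding directional_eq[OF vector_field_V smooth_phi_norm2 c p] pd_phi_norm2[OF c p]
    inner_scalar_phi[OF covector_\<omega>1 c p] inner_scalar_phi[OF covector_\<omega>2 c p]
  by (simp add: distrib_left sum.distrib mult.commute)

lemma directional_mult:
  assumes X: "vector_field X" and h: "smooth_scalar h" and k: "smooth_scalar k" and c: "c \<in> A" "p \<in> fst c"
  shows "directional X (\<lambda>q. h q * k q) p = directional X h p * k p + h p * directional X k p"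
  unfolding directional_eq[OF X h c] directional_eq[OF X k c] directional_eq[OF X smooth_scalar_mult[OF h k] c]
    pd_mult[OF smooth_scalarD[OF h c(1)] smooth_scalarD[OF k c(1)] c(2)]
  by (simp add: distrib_left sum.distrib sum_distrib_left sum_distrib_right ac_simps)

text \<open>The curvature term expressed by global functions alone. Chart independence of \<open>R(V, \<bar>V, V, \<bar>V)\<close> is thereby a consequence of the Bochner
identity.\<close>

definition bochner_rhs :: "'a \<Rightarrow> complex" where
  "bochner_rhs p = cnj (directional V (\<lambda>q. cnj (inner_scalar \<omega>1 \<phi> q)) p) - directional V (inner_scalar \<omega>2 \<phi>) p
    - 2 * inner_scalar \<omega>1 \<omega>1 p + directional W2 phi_norm2 p"

lemma curv_sum_global:
  assumes c: "c \<in> A" and p: "p \<in> fst c"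
  shows "curv_sum c p = bochner_rhs p"
proof -
  let ?A = "inner_scalar \<omega>1 \<phi>" and ?B = "inner_scalar \<omega>2 \<phi>"
  have s: "smooth_in c (fst c) (\<lambda>q. \<Sum>j\<in>UNIV. \<omega>1 c q $ j * V c q $ j)"
    "smooth_in c (fst c) (\<lambda>q. \<Sum>j\<in>UNIV. \<omega>2 c q $ j * V c q $ j)"
    by (intro smooth_in_sum smooth_in_mult smooth_\<omega>1 smooth_\<omega>2 smooth_V region_chart c)+
  note sA = smooth_scalarD[OF smooth_inner_\<omega>1 c] and sB = smooth_scalarD[OF smooth_inner_\<omega>2 c]
  have "pd_bar c i (\<lambda>q. \<Sum>j\<in>UNIV. \<omega>1 c q $ j * V c q $ j) p = pd_bar c i ?A p" for i
    by (rule pd_bar_cong[OF s(1) sA p]) (rule inner_scalar_phi[OF covector_\<omega>1 c, symmetric])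
  then have "DV_bar c p (\<lambda>q. \<Sum>j\<in>UNIV. \<omega>1 c q $ j * V c q $ j) = (\<Sum>i\<in>UNIV. cnj (V c p $ i) * pd_bar c i ?A p)"
    by (simp add: DV_bar_def[OF c p])
  also have "\<dots> = cnj (directional V (\<lambda>q. cnj (?A q)) p)"
    unfolding directional_eq[OF vector_field_V smooth_scalar_cnj[OF smooth_inner_\<omega>1] c p] pd_cnj[OF sA sA p]
    by simp
  finally have 1: "DV_bar c p (\<lambda>q. \<Sum>j\<in>UNIV. \<omega>1 c q $ j * V c q $ j) = cnj (directional V (\<lambda>q. cnj (?A q)) p)" .
  have "pd c i (\<lambda>q. \<Sum>j\<in>UNIV. \<omega>2 c q $ j * V c q $ j) p = pd c i ?B p" for i
    by (rule pd_cong[OF s(2) sB p]) (rule inner_scalar_phi[OF covector_\<omega>2 c, symmetric])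
  then have 2: "DV c p (\<lambda>q. \<Sum>j\<in>UNIV. \<omega>2 c q $ j * V c q $ j) = directional V ?B p"
    unfolding directional_eq[OF vector_field_V smooth_inner_\<omega>2 c p] by (simp add: DV_def[OF c p])
  have 3: "(\<Sum>j\<in>UNIV. \<omega>1 c p $ j * W1 c p $ j) = inner_scalar \<omega>1 \<omega>1 p"
    unfolding inner_scalar_eq[OF covector_\<omega>1 covector_\<omega>1 c p] by (simp add: cov_inner_eq_dual W1_def)
  have 4: "(\<Sum>j\<in>UNIV. W2 c p $ j * (\<omega>1 c p $ j + \<omega>2 c p $ j)) = directional W2 phi_norm2 p"
    unfolding directional_eq[OF vector_field_W2 smooth_phi_norm2 c p] pd_phi_norm2[OF c p] ..
  show ?thesis
    unfolding Bochner_identity[OF c p] 1 2 3 4 bochner_rhs_def ..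
qed

lemma smooth_bochner_rhs: "smooth_scalar bochner_rhs"
  unfolding bochner_rhs_def[abs_def]
  by (intro smooth_scalar_add smooth_scalar_diff smooth_scalar_mult smooth_scalar_const smooth_scalar_cnj
      smooth_scalar_directional smooth_inner_\<omega>1 smooth_inner_\<omega>2 smooth_norm_\<omega>1 smooth_phi_norm2 vector_field_V vector_field_W2)

lemma curv_along_eq:
  assumes c: "c \<in> A" and p: "p \<in> fst c"
  shows "curv_along A g V p = bochner_rhs p"
proof -
  have "curv_along A g V p = curv_sum c p"
    unfolding curv_along_def
  proof (rule scalar_eq[OF _ c p, THEN trans])
    fix c d assume "c \<in> A" "d \<in> A" "p \<in> fst c" "p \<in> fst d"
    then show "(\<Sum>i\<in>UNIV. \<Sum>j\<in>UNIV. \<Sum>k\<in>UNIV. \<Sum>l\<in>UNIV. curv g c i j k l p * V c p $ i * cnj (V c p $ j) * V c p $ k * cnj (V c p $ l)) =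
        (\<Sum>i\<in>UNIV. \<Sum>j\<in>UNIV. \<Sum>k\<in>UNIV. \<Sum>l\<in>UNIV. curv g d i j k l p * V d p $ i * cnj (V d p $ j) * V d p $ k * cnj (V d p $ l))"
      using curv_sum_global[of c p] curv_sum_global[of d p] by (simp only: curv_sum_def)
  qed (simp only: curv_sum_def[OF c p])
  then show ?thesis using curv_sum_global[OF c p] by simp
qed

definition hess_matrix :: "('a, 'n) chart \<Rightarrow> 'a \<Rightarrow> complex^'n^'n" where
  "hess_matrix c p = (\<chi> i j. hess c i j p)"

lemma lap_eq_trace: "c \<in> A \<Longrightarrow> lap c p = trace (hess_matrix c p ** matrix_inv (g c p))"
  by (simp add: lap_def trace_def matrix_matrix_mult_def hess_matrix_def ginv_def mult.commute)

lemma hess_norm2_eq_trace: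
  assumes c: "c \<in> A" and p: "p \<in> fst c"
  shows "hess_norm2 c p = trace (hess_matrix c p ** matrix_inv (g c p) ** (hess_matrix c p ** matrix_inv (g c p)))"
proof -
  let ?t = "\<lambda>i j k l. ginv g c i k p * ginv g c l j p * hess c i j p * hess c l k p"
  have "hess_norm2 c p = (\<Sum>i\<in>UNIV. \<Sum>j\<in>UNIV. \<Sum>k\<in>UNIV. \<Sum>l\<in>UNIV. ?t i j k l)"
    by (simp add: hess_norm2_def[OF c] hess_hermitian[OF c p])
  also have "\<dots> = (\<Sum>i\<in>UNIV. \<Sum>j\<in>UNIV. \<Sum>l\<in>UNIV. \<Sum>k\<in>UNIV. ?t i j k l)"
    by (intro sum.cong refl sum.swap)
  also have "\<dots> = (\<Sum>i\<in>UNIV. \<Sum>l\<in>UNIV. \<Sum>j\<in>UNIV. \<Sum>k\<in>UNIV. ?t i j k l)"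
    by (intro sum.cong refl sum.swap)
  also have "\<dots> = trace (hess_matrix c p ** matrix_inv (g c p) ** (hess_matrix c p ** matrix_inv (g c p)))"
    by (simp add: trace_def matrix_matrix_mult_def hess_matrix_def ginv_def sum_product ac_simps)
  finally show ?thesis .
qed

lemma lap_change: "c \<in> A \<Longrightarrow> d \<in> A \<Longrightarrow> p \<in> fst c \<Longrightarrow> p \<in> fst d \<Longrightarrow> lap c p = lap d p"
  and hess_norm2_change: "c \<in> A \<Longrightarrow> d \<in> A \<Longrightarrow> p \<in> fst c \<Longrightarrow> p \<in> fst d \<Longrightarrow> hess_norm2 c p = hess_norm2 d p"
  using trace_raised_change[of c d p "hess_matrix c p" "hess_matrix d p"] hess_change[of c d p]
  by (simp_all only: lap_eq_trace hess_norm2_eq_trace) (simp_all add: hess_matrix_def)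

lemma dbar_laplacian_eq:
  assumes c: "c \<in> A" and p: "p \<in> fst c"
  shows "dbar_laplacian A g fc p = - lap c p"
  unfolding dbar_laplacian_def
proof (rule scalar_eq[OF _ c p, THEN trans])
  fix c d assume "c \<in> A" "d \<in> A" "p \<in> fst c" "p \<in> fst d"
  then show "- (\<Sum>i\<in>UNIV. \<Sum>j\<in>UNIV. ginv g c i j p * pd c i (pd_bar c j fc) p) =
      - (\<Sum>i\<in>UNIV. \<Sum>j\<in>UNIV. ginv g d i j p * pd d i (pd_bar d j fc) p)"
    using lap_change[of c d p] by (simp only: lap_def hess_def)
qed (simp only: lap_def[OF c] hess_def)

lemma del_delbar_norm2_eq:
  assumes c: "c \<in> A" and p: "p \<in> fst c"
  shows "del_delbar_norm2 A g fc p = Re (hess_norm2 c p)"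
  unfolding del_delbar_norm2_def
proof (rule scalar_eq[OF _ c p, THEN trans])
  fix c d assume "c \<in> A" "d \<in> A" "p \<in> fst c" "p \<in> fst d"
  then show "Re (\<Sum>i\<in>UNIV. \<Sum>j\<in>UNIV. \<Sum>k\<in>UNIV. \<Sum>l\<in>UNIV. ginv g c i k p * ginv g c l j p
           * pd c i (pd_bar c j fc) p * cnj (pd c k (pd_bar c l fc) p)) =
      Re (\<Sum>i\<in>UNIV. \<Sum>j\<in>UNIV. \<Sum>k\<in>UNIV. \<Sum>l\<in>UNIV. ginv g d i k p * ginv g d l j p
           * pd d i (pd_bar d j fc) p * cnj (pd d k (pd_bar d l fc) p))"
    using hess_norm2_change[of c d p] by (simp only: hess_norm2_def hess_def)
qed (simp only: hess_norm2_def[OF c] hess_def)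

text \<open>Writing one copy of the inverse metric as a sum of rank one forms displays the quadruple sum as a sum of norms of covectors.\<close>

lemma hess_norm2_real:
  assumes c: "c \<in> A" and p: "p \<in> fst c"
  shows "hess_norm2 c p = of_real (Re (hess_norm2 c p))" "0 \<le> Re (hess_norm2 c p)"
proof -
  have "psd_form (\<lambda>i j. ginv g c i j p)"
    unfolding psd_form_def
  proof (intro conjI allI)
    fix x :: "'n \<Rightarrow> complex"
    show "0 \<le> Re (\<Sum>i\<in>UNIV. \<Sum>j\<in>UNIV. ginv g c i j p * x i * cnj (x j))"
      using cov_inner_nonneg[OF c p, of "\<chi> i. x i"] by (simp add: cov_inner_def)
  qed (rule ginv_hermitian[OF c p])
  from psd_form_sum_of_squares[OF this] obtain as :: "('n \<Rightarrow> complex) list"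
    where as: "\<And>i j. ginv g c i j p = (\<Sum>a\<leftarrow>as. a i * cnj (a j))" by blast
  define s :: "nat \<Rightarrow> complex^'n" where "s m = (\<chi> i. \<Sum>j\<in>UNIV. cnj ((as ! m) j) * hess c i j p)" for m
  have Q: "(\<Sum>j\<in>UNIV. \<Sum>l\<in>UNIV. ginv g c l j p * hess c i j p * cnj (hess c k l p)) =
      (\<Sum>m<length as. s m $ i * cnj (s m $ k))" for i k
  proof -
    have "(\<Sum>j\<in>UNIV. \<Sum>l\<in>UNIV. ginv g c l j p * hess c i j p * cnj (hess c k l p)) =
        (\<Sum>j\<in>UNIV. \<Sum>l\<in>UNIV. \<Sum>m<length as. cnj ((as ! m) j) * hess c i j p * ((as ! m) l * cnj (hess c k l p)))"
      unfolding as by (simp add: sum_list_sum_nth atLeast0LessThan sum_distrib_left sum_distrib_right ac_simps)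
    also have "\<dots> = (\<Sum>j\<in>UNIV. \<Sum>m<length as. \<Sum>l\<in>UNIV. cnj ((as ! m) j) * hess c i j p * ((as ! m) l * cnj (hess c k l p)))"
      by (intro sum.cong refl sum.swap)
    also have "\<dots> = (\<Sum>m<length as. \<Sum>j\<in>UNIV. \<Sum>l\<in>UNIV. cnj ((as ! m) j) * hess c i j p * ((as ! m) l * cnj (hess c k l p)))"
      by (rule sum.swap)
    also have "\<dots> = (\<Sum>m<length as. s m $ i * cnj (s m $ k))"
      unfolding s_def by (simp add: sum_product)
    finally show ?thesis .
  qed
  have "hess_norm2 c p = (\<Sum>i\<in>UNIV. \<Sum>k\<in>UNIV. ginv g c i k p *
      (\<Sum>j\<in>UNIV. \<Sum>l\<in>UNIV. ginv g c l j p * hess c i j p * cnj (hess c k l p)))"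
    unfolding hess_norm2_def[OF c] sum_distrib_left mult.assoc[symmetric] by (intro sum.cong refl sum.swap)
  also have "\<dots> = (\<Sum>i\<in>UNIV. \<Sum>k\<in>UNIV. \<Sum>m<length as. ginv g c i k p * s m $ i * cnj (s m $ k))"
    unfolding Q by (simp add: sum_distrib_left mult.assoc)
  also have "\<dots> = (\<Sum>i\<in>UNIV. \<Sum>m<length as. \<Sum>k\<in>UNIV. ginv g c i k p * s m $ i * cnj (s m $ k))"
    by (intro sum.cong refl sum.swap)
  also have "\<dots> = (\<Sum>m<length as. cov_inner g c p (s m) (s m))"
    unfolding cov_inner_def by (rule sum.swap)
  finally have e: "hess_norm2 c p = (\<Sum>m<length as. cov_inner g c p (s m) (s m))" .
  have "cnj (hess_norm2 c p) = hess_norm2 c p"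
    unfolding e by (simp add: cov_inner_cnj[OF c p])
  then show "hess_norm2 c p = of_real (Re (hess_norm2 c p))" by (simp add: complex_eq_iff)
  show "0 \<le> Re (hess_norm2 c p)"
    unfolding e Re_sum by (intro sum_nonneg cov_inner_nonneg[OF c p])
qed

end

section \<open>The weighted Bochner formula\<close>

context kaehler_function
begin

lemma form_norm2_phi_eq: "c \<in> A \<Longrightarrow> p \<in> fst c \<Longrightarrow> phi_norm2 p = of_real (form_norm2 A g \<phi> p)"
  using form_norm2_eq[OF covector_phi] by simp

lemma vec_norm2_V:
  assumes c: "c \<in> A" and p: "p \<in> fst c"
  shows "vec_norm2 A g V p = form_norm2 A g \<phi> p"
proof -
  have e: "Re (\<Sum>i\<in>UNIV. \<Sum>j\<in>UNIV. g c p $ i $ j * V c p $ i * cnj (V c p $ j)) = form_norm2 A g \<phi> p"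
    if "c \<in> A" "p \<in> fst c" for c
    unfolding V_def norm_dual_vec[OF that] using form_norm2_phi_eq[OF that] inner_scalar_eq[OF covector_phi covector_phi that]
    by simp
  show ?thesis unfolding vec_norm2_def
    by (rule scalar_eq[OF _ c p, THEN trans]) (simp_all only: e[OF c p] e)
qed

text \<open>The matrix \<open>(g\<^sup>k\<^sup>\<bar>\<^sup>l)\<close> of the metric on the cotangent bundle is inverse to the transpose of \<open>(g\<^bsub>i\<bar>j\<^esub>)\<close>, so the Chern
  connection of the cotangent bundle is minus the transpose of that of the tangent bundle.\<close>

lemma chern_form_eq:
  assumes c: "c \<in> A" and p: "p \<in> fst c"
  shows "chern_form g c j p $ k $ i = - christoffel c j i k p"
proof -
  define P :: "complex^'n^'n" where "P = (\<chi> k l. ginv g c k l p)"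
  define Q :: "complex^'n^'n" where "Q = (\<chi> m i. g c p $ i $ m)"
  have PQ: "P ** Q = mat 1"
    by (simp add: P_def Q_def vec_eq_iff matrix_matrix_mult_def mat_def ginv_metric1[OF c p])
  then have "invertible P" unfolding invertible_def using matrix_left_right_inverse by blast
  then have "matrix_inv P ** P = mat 1" by (rule matrix_inv_left)
  then have "matrix_inv P = Q" by (metis PQ matrix_mul_assoc matrix_mul_lid matrix_mul_rid)
  then have "chern_form g c j p $ k $ i = (\<Sum>m\<in>UNIV. pd c j (ginv g c k m) p * g c p $ i $ m)"
    by (simp add: chern_form_def P_def[symmetric] matrix_matrix_mult_def Q_def)
  also have "\<dots> = - (\<Sum>m\<in>UNIV. \<Sum>a\<in>UNIV. \<Sum>b\<in>UNIV. ginv g c k b p * pd c j (\<lambda>q. g c q $ a $ b) p * (ginv g c a m p * g c p $ i $ m))"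
    unfolding pd_ginv[OF c p] by (simp add: sum_negf sum_distrib_left sum_distrib_right ac_simps)
  also have "(\<Sum>m\<in>UNIV. \<Sum>a\<in>UNIV. \<Sum>b\<in>UNIV. ginv g c k b p * pd c j (\<lambda>q. g c q $ a $ b) p * (ginv g c a m p * g c p $ i $ m)) =
      (\<Sum>a\<in>UNIV. \<Sum>m\<in>UNIV. \<Sum>b\<in>UNIV. ginv g c k b p * pd c j (\<lambda>q. g c q $ a $ b) p * (ginv g c a m p * g c p $ i $ m))"
    by (rule sum.swap)
  also have "\<dots> = (\<Sum>a\<in>UNIV. \<Sum>b\<in>UNIV. ginv g c k b p * pd c j (\<lambda>q. g c q $ a $ b) p * (\<Sum>m\<in>UNIV. ginv g c a m p * g c p $ i $ m))"
    unfolding sum_distrib_left by (intro sum.cong refl sum.swap)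
  also have "\<dots> = (\<Sum>a\<in>UNIV. if a = i then \<Sum>b\<in>UNIV. ginv g c k b p * pd c j (\<lambda>q. g c q $ i $ b) p else 0)"
    unfolding ginv_metric1[OF c p] by (intro sum.cong refl) simp
  also have "\<dots> = christoffel c j i k p" by (simp add: christoffel_def)
  finally show ?thesis .
qed

lemma E_pairing_eq:
  assumes c: "c \<in> A" and p: "p \<in> fst c"
  shows "E_pairing g (del_E g \<phi>) \<phi> c p = \<omega>1 c p"
proof -
  have "del_E g \<phi> j c p $ i = cov_hess c j i p" for i j
    by (simp add: del_E_def cov_hess_def chern_form_eq[OF c p] sum_negf mult.commute)
  then show ?thesis
    by (simp add: E_pairing_def vec_eq_iff cov_inner_eq_dual[of c p "del_E g \<phi> j" \<phi> for j] \<omega>1_nth[OF c] V_def)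
qed

context
  fixes lam :: real
  assumes eigenfunction: "\<forall>p\<in>topspace M. dbar_laplacian A g fc p = of_real (lam * f p)"
begin

lemma in_topspace: "c \<in> A \<Longrightarrow> p \<in> fst c \<Longrightarrow> p \<in> topspace M"
  using Union_charts by blast

lemma lap_eigen: "c \<in> A \<Longrightarrow> p \<in> fst c \<Longrightarrow> lap c p = of_real (- lam) * fc p"
  using dbar_laplacian_eq[of c p] bspec[OF eigenfunction in_topspace[of c p]] by (simp add: equation_minus_iff)

lemma pd_lap:
  assumes c: "c \<in> A" and p: "p \<in> fst c"
  shows "pd c j (lap c) p = of_real (- lam) * \<phi> c p $ j"
proof -
  note sc = smooth_in_const[OF region_chart[OF c], of "complex_of_real (- lam)"]
  have "pd c j (lap c) p = pd c j (\<lambda>q. of_real (- lam) * fc q) p"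
    by (rule pd_cong[OF smooth_lap[OF c] smooth_in_mult[OF sc smooth_fc[OF c]] p]) (rule lap_eigen[OF c])
  also have "\<dots> = of_real (- lam) * pd c j fc p"
    unfolding pd_mult[OF sc smooth_fc[OF c] p] pd_const by simp
  finally show ?thesis by (simp add: phi_nth[OF c])
qed

lemma divergence_V_eigen: "c \<in> A \<Longrightarrow> p \<in> fst c \<Longrightarrow> divergence c V p = of_real (- lam) * fc p"
  by (simp only: divergence_V lap_eigen)

lemma divergence_W2_eigen:
  assumes c: "c \<in> A" and p: "p \<in> fst c"
  shows "divergence c W2 p = of_real (- lam) * phi_norm2 p + of_real (del_delbar_norm2 A g fc p)"
  unfolding divergence_W2[OF c p] pd_lap[OF c p] inner_scalar_phi[OF covector_phi c p] del_delbar_norm2_eq[OF c p]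
    hess_norm2_real(1)[OF c p, symmetric]
  by (simp add: sum_distrib_left ac_simps)

lemma integral_divergence_cnj_\<omega>1_V: "integral_M M A g (\<lambda>p. directional V (\<lambda>q. cnj (inner_scalar \<omega>1 \<phi> q)) p
    + cnj (inner_scalar \<omega>1 \<phi> p) * (of_real (- lam) * fc p)) = 0"
  by (rule integral_divergence_scaled[OF smooth_scalar_cnj[OF smooth_inner_\<omega>1] vector_field_V])
    (simp only: divergence_V_eigen)

lemma integral_divergence_\<omega>2_V: "integral_M M A g (\<lambda>p. directional V (inner_scalar \<omega>2 \<phi>) p
    + inner_scalar \<omega>2 \<phi> p * (of_real (- lam) * fc p)) = 0"
  by (rule integral_divergence_scaled[OF smooth_inner_\<omega>2 vector_field_V]) (simp only: divergence_V_eigen)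

lemma integral_divergence_norm_W2: "integral_M M A g (\<lambda>p. directional W2 phi_norm2 p
    + phi_norm2 p * (of_real (- lam) * phi_norm2 p + of_real (del_delbar_norm2 A g fc p))) = 0"
  by (rule integral_divergence_scaled[OF smooth_phi_norm2 vector_field_W2]) (simp only: divergence_W2_eigen)

lemma smooth_scalar_fc: "smooth_scalar fc"
  unfolding smooth_scalar_def using smooth_fc by blast

lemma directional_fc:
  assumes c: "c \<in> A" and p: "p \<in> fst c"
  shows "directional V fc p = phi_norm2 p"
  unfolding directional_eq[OF vector_field_V smooth_scalar_fc c p] inner_scalar_phi[OF covector_phi c p] phi_nth[OF c]
  by (simp add: mult.commute)

lemma integral_divergence_norm_V: "integral_M M A g (\<lambda>p. phi_norm2 p * phi_norm2 p
    + fc p * (inner_scalar \<omega>1 \<phi> p + inner_scalar \<omega>2 \<phi> p) + fc p * phi_norm2 p * (of_real (- lam) * fc p)) = 0"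
  by (rule integral_divergence_scaled[OF smooth_scalar_mult[OF smooth_scalar_fc smooth_phi_norm2] vector_field_V])
    (simp only: divergence_V_eigen directional_mult[OF vector_field_V smooth_scalar_fc smooth_phi_norm2]
      directional_fc directional_phi_norm2)

abbreviation residual :: "('a, 'n) field10" where
  "residual \<equiv> \<lambda>c p. \<omega>1 c p - of_real (lam * f p) *s \<phi> c p"

lemma covector_residual: "covector residual"
  by (rule covector_diff_scaled[OF covector_\<omega>1 covector_phi])

lemma norm_residual:
  assumes c: "c \<in> A" and p: "p \<in> fst c"
  shows "complex_of_real (form_norm2 A g residual p) =
    inner_scalar \<omega>1 \<omega>1 p - of_real lam * fc p * (inner_scalar \<omega>1 \<phi> p + cnj (inner_scalar \<omega>1 \<phi> p))
      + of_real lam * of_real lam * fc p * fc p * phi_norm2 p"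
  unfolding form_norm2_eq[OF covector_residual c p] inner_scalar_eq[OF covector_residual covector_residual c p]
    cov_inner_diff_scaled[OF c p] inner_scalar_eq[OF covector_\<omega>1 covector_\<omega>1 c p]
    inner_scalar_eq[OF covector_\<omega>1 covector_phi c p] inner_scalar_eq[OF covector_phi covector_phi c p]
  by (simp add: power2_eq_square)

lemma smooth_hess_norm2: "c \<in> A \<Longrightarrow> smooth_in c (fst c) (hess_norm2 c)"
  by (rule smooth_in_cong[OF hess_norm2_def[symmetric]], assumption)
    (intro smooth_in_sum smooth_in_mult smooth_in_ginv smooth_in_cnj smooth_hess region_chart; assumption)

lemma smooth_del_delbar_norm2: "smooth_scalar (\<lambda>p. of_real (del_delbar_norm2 A g fc p))"
  by (rule smooth_scalarI[of "hess_norm2", OF smooth_hess_norm2])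
    (simp_all only: del_delbar_norm2_eq hess_norm2_real(1)[symmetric])

lemma smooth_curv_along: "smooth_scalar (curv_along A g V)"
  by (rule smooth_scalarI[of "\<lambda>_. bochner_rhs"])
    (use smooth_bochner_rhs curv_along_eq in \<open>simp_all add: smooth_scalar_def\<close>)

lemma smooth_form_norm2:
  assumes "covector \<eta>" "\<And>c i. c \<in> A \<Longrightarrow> smooth_in c (fst c) (\<lambda>q. \<eta> c q $ i)"
  shows "smooth_scalar (\<lambda>p. of_real (form_norm2 A g \<eta> p))"
  by (rule smooth_scalarI[of "\<lambda>_. inner_scalar \<eta> \<eta>"])
    (use smooth_inner_scalar[OF assms assms] form_norm2_eq[OF assms(1)] in \<open>simp_all add: smooth_scalar_def\<close>)

lemma smooth_residual: "c \<in> A \<Longrightarrow> smooth_in c (fst c) (\<lambda>q. residual c q $ i)"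
  unfolding vector_minus_component vector_smult_component of_real_mult
  by (intro smooth_in_diff smooth_in_mult smooth_\<omega>1 smooth_phi smooth_fc smooth_in_const region_chart)

text \<open>The functions \<open>h1\<close> to \<open>h4\<close> in the proof are the divergences of \<open>conj(a) V\<close>, \<open>b V\<close>, \<open>U W\<close> and \<open>f U V\<close>, where
\<open>a = \<omega>1(V)\<close>, \<open>b = \<omega>2(V)\<close> and \<open>U = |\<phi>|\<^sup>2\<close>. The weights of the combination are found by comparing coefficients: the first three remove the
derivatives from the Bochner identity, and the fourth exchanges the cross term \<open>\<lambda> f conj(a)\<close> for \<open>\<lambda> U\<^sup>2\<close>, thereby completing the
square \<open>|\<omega>1 - \<lambda> f \<phi>|\<^sup>2\<close>.\<close>

theorem weighted_bochner_formula:
  "complex_of_real (2 * lam * integral_M M A g (\<lambda>p. (form_norm2 A g \<phi> p)\<^sup>2)) =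
    integral_M M A g (\<lambda>p. curv_along A g V p + complex_of_real (form_norm2 A g \<phi> p * del_delbar_norm2 A g fc p))
    + complex_of_real (L2_norm2 M A g residual) + complex_of_real (L2_norm2 M A g \<omega>1)"
proof -
  let ?U = phi_norm2 and ?A = "inner_scalar \<omega>1 \<phi>" and ?B = "inner_scalar \<omega>2 \<phi>"
  let ?n = "\<lambda>p. complex_of_real (del_delbar_norm2 A g fc p)" and ?l = "complex_of_real (- lam)"
  define h1 where "h1 p = directional V (\<lambda>q. cnj (?A q)) p + cnj (?A p) * (?l * fc p)" for p
  define h2 where "h2 p = directional V ?B p + ?B p * (?l * fc p)" for p
  define h3 where "h3 p = directional W2 ?U p + ?U p * (?l * ?U p + ?n p)" for p
  define h4 where "h4 p = ?U p * ?U p + fc p * (?A p + ?B p) + fc p * ?U p * (?l * fc p)" for p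
  note S = smooth_scalar_add smooth_scalar_mult smooth_scalar_cnj smooth_scalar_const smooth_scalar_directional
    smooth_inner_\<omega>1 smooth_inner_\<omega>2 smooth_phi_norm2 smooth_scalar_fc smooth_del_delbar_norm2 vector_field_V vector_field_W2
  have s1: "smooth_scalar (\<lambda>p. cnj (h1 p))" unfolding h1_def by (intro S)
  have s2: "smooth_scalar (\<lambda>p. -1 * h2 p)" unfolding h2_def by (intro S)
  have s3: "smooth_scalar h3" unfolding h3_def[abs_def] by (intro S)
  have s4: "smooth_scalar (\<lambda>p. ?l * cnj (h4 p))" unfolding h4_def by (intro S)
  have s5: "smooth_scalar (\<lambda>p. of_real (2 * lam) * (?U p * ?U p))" by (intro S)
  let ?k1 = "\<lambda>p. curv_along A g V p + complex_of_real (form_norm2 A g \<phi> p * del_delbar_norm2 A g fc p)"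
  let ?k2 = "\<lambda>p. complex_of_real (form_norm2 A g residual p)" and ?k3 = "\<lambda>p. complex_of_real (form_norm2 A g \<omega>1 p)"
  have t1: "smooth_scalar ?k1"
    unfolding of_real_mult
    by (intro S smooth_curv_along smooth_form_norm2 covector_phi smooth_phi; assumption)
  have t2: "smooth_scalar ?k2" by (intro smooth_form_norm2 covector_residual smooth_residual; assumption)
  have t3: "smooth_scalar ?k3" by (intro smooth_form_norm2 covector_\<omega>1 smooth_\<omega>1; assumption)
  have pointwise: "(?k1 p + ?k2 p) + ?k3 p =
      (((of_real (2 * lam) * (?U p * ?U p) + cnj (h1 p)) + -1 * h2 p) + h3 p) + ?l * cnj (h4 p)"
    if pM: "p \<in> topspace M" for p
  proof -
    obtain c where c: "c \<in> A" "p \<in> fst c" using pM Union_charts by blast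
    have U: "cnj (?U p) = ?U p" by (simp add: form_norm2_phi_eq[OF c])
    show ?thesis
      unfolding norm_residual[OF c] form_norm2_eq[OF covector_\<omega>1 c] curv_along_eq[OF c] bochner_rhs_def
      unfolding of_real_mult form_norm2_phi_eq[OF c, symmetric] h1_def h2_def h3_def h4_def
      by (simp add: U inner_\<omega>2_real[OF c] algebra_simps)
  qed
  have "integral_M M A g ?k1 + integral_M M A g ?k2 + integral_M M A g ?k3 = integral_M M A g (\<lambda>p. (?k1 p + ?k2 p) + ?k3 p)"
    by (simp only: integral_M_add[OF smooth_scalar_add[OF t1 t2] t3] integral_M_add[OF t1 t2])
  also have "\<dots> = integral_M M A g (\<lambda>p. (((of_real (2 * lam) * (?U p * ?U p) + cnj (h1 p)) + -1 * h2 p) + h3 p) + ?l * cnj (h4 p))"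
    by (rule integral_M_cong) (rule pointwise)
  also have "\<dots> = of_real (2 * lam) * integral_M M A g (\<lambda>p. ?U p * ?U p) + cnj (integral_M M A g h1)
      + -1 * integral_M M A g h2 + integral_M M A g h3 + ?l * cnj (integral_M M A g h4)"
    by (simp only: integral_M_add[OF smooth_scalar_add[OF smooth_scalar_add[OF smooth_scalar_add[OF s5 s1] s2] s3] s4]
      integral_M_add[OF smooth_scalar_add[OF smooth_scalar_add[OF s5 s1] s2] s3]
      integral_M_add[OF smooth_scalar_add[OF s5 s1] s2] integral_M_add[OF s5 s1] integral_M_mult_left integral_M_cnj)
  also have "integral_M M A g h1 = 0" unfolding h1_def by (rule integral_divergence_cnj_\<omega>1_V)
  also have "integral_M M A g h2 = 0" unfolding h2_def by (rule integral_divergence_\<omega>2_V)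
  also have "integral_M M A g h3 = 0" unfolding h3_def by (rule integral_divergence_norm_W2)
  also have "integral_M M A g h4 = 0" unfolding h4_def by (rule integral_divergence_norm_V)
  also have "integral_M M A g (\<lambda>p. ?U p * ?U p) = integral_M M A g (\<lambda>p. complex_of_real ((form_norm2 A g \<phi> p)\<^sup>2))"
  proof (rule integral_M_cong)
    fix p assume "p \<in> topspace M"
    then obtain c where c: "c \<in> A" "p \<in> fst c" using Union_charts by blast
    show "?U p * ?U p = complex_of_real ((form_norm2 A g \<phi> p)\<^sup>2)"
      by (simp add: form_norm2_phi_eq[OF c] power2_eq_square)
  qed
  finally show ?thesis
    unfolding L2_norm2_def integral_M_of_real of_real_mult complex_cnj_zero mult_zero_right add_0_right by (rule sym)
qed

corollary curvature_integral_le: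
  "Re (integral_M M A g (curv_along A g V)) \<le> 2 * lam * integral_M M A g (\<lambda>p. (vec_norm2 A g V p)\<^sup>2)"
proof -
  let ?k = "\<lambda>p. form_norm2 A g \<phi> p * del_delbar_norm2 A g fc p"
  have "smooth_scalar (\<lambda>p. complex_of_real (?k p))"
    unfolding of_real_mult
    by (intro smooth_scalar_mult smooth_del_delbar_norm2 smooth_form_norm2 covector_phi smooth_phi; assumption)
  then have "integral_M M A g (\<lambda>p. curv_along A g V p + complex_of_real (?k p)) =
      integral_M M A g (curv_along A g V) + of_real (integral_M M A g ?k)"
    using integral_M_add[OF smooth_curv_along] integral_M_of_real by (simp del: of_real_mult)
  then have "complex_of_real (2 * lam * integral_M M A g (\<lambda>p. (form_norm2 A g \<phi> p)\<^sup>2)) =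
      integral_M M A g (curv_along A g V) + of_real (integral_M M A g ?k)
      + of_real (L2_norm2 M A g residual) + of_real (L2_norm2 M A g \<omega>1)"
    unfolding weighted_bochner_formula by simp
  then have "2 * lam * integral_M M A g (\<lambda>p. (form_norm2 A g \<phi> p)\<^sup>2) =
      Re (integral_M M A g (curv_along A g V)) + integral_M M A g ?k + L2_norm2 M A g residual + L2_norm2 M A g \<omega>1"
    by (drule_tac arg_cong[where f=Re]) (simp only: Re_complex_of_real plus_complex.sel)
  moreover have "0 \<le> L2_norm2 M A g residual" "0 \<le> L2_norm2 M A g \<omega>1"
    unfolding L2_norm2_def by (intro integral_M_nonneg form_norm2_nonneg covector_residual covector_\<omega>1; assumption)+
  moreover have "0 \<le> integral_M M A g ?k"
  proof (rule integral_M_nonneg)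
    fix p assume p: "p \<in> topspace M"
    then obtain c where c: "c \<in> A" "p \<in> fst c" using Union_charts by blast
    show "0 \<le> ?k p"
      unfolding del_delbar_norm2_eq[OF c]
      by (intro mult_nonneg_nonneg hess_norm2_real(2)[OF c] form_norm2_nonneg[OF covector_phi p])
  qed
  moreover have norms: "integral_M M A g (\<lambda>p. (vec_norm2 A g V p)\<^sup>2) = integral_M M A g (\<lambda>p. (form_norm2 A g \<phi> p)\<^sup>2)"
  proof (rule integral_M_cong)
    fix p assume "p \<in> topspace M"
    then obtain c where c: "c \<in> A" "p \<in> fst c" using Union_charts by blast
    show "(vec_norm2 A g V p)\<^sup>2 = (form_norm2 A g \<phi> p)\<^sup>2" unfolding vec_norm2_V[OF c] ..
  qed
  ultimately show ?thesis unfolding norms by linarith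
qed

lemma L2_norm2_E_pairing:
  "L2_norm2 M A g (E_pairing g (del_E g \<phi>) \<phi>) = L2_norm2 M A g \<omega>1"
  "L2_norm2 M A g (\<lambda>c p. E_pairing g (del_E g \<phi>) \<phi> c p - of_real (lam * f p) *s \<phi> c p) = L2_norm2 M A g residual"
  unfolding L2_norm2_def by (intro integral_M_cong form_norm2_cong; simp add: E_pairing_eq)+

end
end

theorem theorem1p5:
  fixes M :: "'a topology"
    and A :: "('a, 'n::finite) chart set"
    and g :: "('a, 'n) metric"
    and f :: "'a \<Rightarrow> real"
    and lam :: real
    and \<phi> V \<omega>\<^sub>1 :: "('a, 'n) field10"
  assumes "compact_kaehler_manifold M A g"
    and "smooth_function A f"
    and "\<forall>p\<in>topspace M. dbar_laplacian A g (\<lambda>q. of_real (f q)) p = of_real (lam * f p)"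
    and "\<phi> = del (\<lambda>q. of_real (f q))"
    and "V = dual_vec g \<phi>"
    and "\<omega>\<^sub>1 = E_pairing g (del_E g \<phi>) \<phi>"
  shows "complex_of_real (2 * lam * integral_M M A g (\<lambda>p. (form_norm2 A g \<phi> p)\<^sup>2)) =
           integral_M M A g (\<lambda>p. curv_along A g V p
             + complex_of_real (form_norm2 A g \<phi> p * del_delbar_norm2 A g (\<lambda>q. of_real (f q)) p))
           + complex_of_real (L2_norm2 M A g (\<lambda>c p. \<omega>\<^sub>1 c p - of_real (lam * f p) *s \<phi> c p))
           + complex_of_real (L2_norm2 M A g \<omega>\<^sub>1)
       \<and> 2 * lam * integral_M M A g (\<lambda>p. (vec_norm2 A g V p)\<^sup>2)
           \<ge> Re (integral_M M A g (curv_along A g V))"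
proof -
  interpret kaehler_function M A g f
    using assms(1,2) unfolding compact_kaehler_manifold_def by unfold_locales blast+
  have phi: "\<phi> = kaehler_function.\<phi> f" using assms(4) by (simp add: \<phi>_def)
  have V: "V = kaehler_function.V g f" using assms(5) by (simp add: V_def phi)
  show ?thesis
    unfolding assms(6) phi V
    unfolding L2_norm2_E_pairing[OF assms(3)]
    by (intro conjI weighted_bochner_formula[OF assms(3)] curvature_integral_le[OF assms(3)])
qed

end
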